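(* Fix $\lambda\in\mathbb{R}$. Let $G=G_n$ be a hierarchical configuration model (HCM) on $n$ communities satisfying the Community regularity condition and the Inter-community connectivity condition (with this $\lambda$), both stated in the context. Let $\mathscr{C}_{(j)}$ denote the $j$-th largest connected component of $G$ (measured by its number of vertices $v(\mathscr{C}_{(j)})$), and let $N$ be the total number of vertices of $G$. Then $$N^{-2/3}\big(v(\mathscr{C}_{(j)})\big)_{j\geq 1}\overset{d}{\longrightarrow} \mathbb{E}[S]^{-2/3}\,\frac{\mathbb{E}[DS]}{\mathbb{E}[D]}\,\boldsymbol{\gamma}^{\lambda}$$ as $n\to\infty$, with respect to the product topology.
   Context: A community is a pair $H=(F,\boldsymbol d)$ where $F=(V_F,E_F)$ is a finite simple connected graph and $\boldsymbol d=(d_v^{(b)})_{v\in V_F}$ are nonnegative integers (inter-community degrees). Write $s_H=|V_F|$ (size) and $d_H=\sum_{v\in V_F}d_v^{(b)}$ (inter-community degree). The HCM with community sequence $(H_i)_{i\in[n]}$ is obtained by attaching $d_v^{(b)}$ half-edges to each vertex $v$ of each community and pairing all these inter-community half-edges uniformly at random (their total $\ell_n=\sum_i d_{H_i}$ is assumed even); the edges inside the communities are kept. The graph has $N=\sum_{i} s_{H_i}$ vertices. Let $H_n$ be a uniformly chosen community among the $n$, $D_n=d_{H_n}$, $S_n=s_{H_n}$, and $P_n(H)$ the fraction of communities equal to $H$. Community regularity condition: (i) $P_n(H)\to P(H)$ for every $H$, where $P$ is a probability distribution on (labeled) communities; let $(S,D)$ be the size and inter-community degree of a community with law $P$; (ii)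 $\mathbb{E}[S_n]\to\mathbb{E}[S]<\infty$; (iii) $\mathbb{E}[D_nS_n]\to\mathbb{E}[DS]<\infty$; (iv) $s_{\max}=\max_{i\in[n]}s_{H_i}$ satisfies $s_{\max}\log(n)/n^{2/3}\to0$. Inter-community connectivity condition: (i) $\mathbb{E}[D_n^3]\to\mathbb{E}[D^3]<\infty$; (ii) $\mathbb{P}(D=0)<1$ and $\mathbb{P}(D=1)\in(0,1)$; (iii) $\nu_n:=\mathbb{E}[D_n(D_n-1)]/\mathbb{E}[D_n]=1+\lambda n^{-1/3}+o(n^{-1/3})$. Let $\mu=\mathbb{E}[D]$, $\eta=\mathbb{E}[D^3]\mathbb{E}[D]-\mathbb{E}[D^2]^2$, $B$ a standard Brownian motion, $B^\mu_{\lambda,\eta}(t)=\frac{\sqrt\eta}{\mu}B(t)+\lambda t-\frac{\eta t^2}{2\mu^3}$, and $W^\lambda(t)=B^\mu_{\lambda,\eta}(t)-\min_{0\le s\le t}B^\mu_{\lambda,\eta}(s)$ its reflected version. $\boldsymbol\gamma^\lambda$ denotes the vector of lengths of the excursions of $W^\lambda$ away from $0$, ordered decreasingly. *)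

theory Defs
  imports "HOL-Probability.Probability" "HOL-Library.Multiset"
begin

text \<open>A (labeled) community: vertex set {0..<csize}, a simple graph cedge on it,
 and inter-community degrees cdeg. Values outside the vertex range are normalised
 (no edges, degree 0) so that equality of records is equality of communities.\<close>

record community =
  csize :: nat
  cedge :: "nat \<Rightarrow> nat \<Rightarrow> bool"
  cdeg  :: "nat \<Rightarrow> nat"

definition valid_community :: "community \<Rightarrow> bool" where
  "valid_community H \<longleftrightarrow>
     csize H \<ge> 1 \<and>
     (\<forall>u v. cedge H u v \<longrightarrow> u < csize H \<and> v < csize H) \<and>
     (\<forall>u v. cedge H u v \<longleftrightarrow> cedge H v u) \<and>
     (\<forall>u. \<not> cedge H u u) \<and>
     (\<forall>u v. u < csize H \<and> v < csize H \<longrightarrow> (cedge H)\<^sup>*\<^sup>* u v) \<and>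
     (\<forall>v. v \<ge> csize H \<longrightarrow> cdeg H v = 0)"

definition cdegree :: "community \<Rightarrow> nat" where
  "cdegree H = (\<Sum>v<csize H. cdeg H v)"

definition emp_frac :: "(nat \<Rightarrow> community) \<Rightarrow> nat \<Rightarrow> community \<Rightarrow> real" where
  "emp_frac Hs n H = real (card {i. i < n \<and> Hs i = H}) / real n"

definition emp_mean :: "(nat \<Rightarrow> community) \<Rightarrow> nat \<Rightarrow> (community \<Rightarrow> real) \<Rightarrow> real" where
  "emp_mean Hs n f = (\<Sum>i<n. f (Hs i)) / real n"

definition total_vertices :: "(nat \<Rightarrow> community) \<Rightarrow> nat \<Rightarrow> nat" where
  "total_vertices Hs n = (\<Sum>i<n. csize (Hs i))"

definition total_halfedges :: "(nat \<Rightarrow> community) \<Rightarrow> nat \<Rightarrow> nat" where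
  "total_halfedges Hs n = (\<Sum>i<n. cdegree (Hs i))"

definition max_size :: "(nat \<Rightarrow> community) \<Rightarrow> nat \<Rightarrow> nat" where
  "max_size Hs n = Max (insert 0 ((\<lambda>i. csize (Hs i)) ` {..<n}))"

definition hcm_vertices :: "(nat \<Rightarrow> community) \<Rightarrow> nat \<Rightarrow> (nat \<times> nat) set" where
  "hcm_vertices Hs n = {(i, v). i < n \<and> v < csize (Hs i)}"

definition hcm_halfedges :: "(nat \<Rightarrow> community) \<Rightarrow> nat \<Rightarrow> (nat \<times> nat \<times> nat) set" where
  "hcm_halfedges Hs n = {(i, v, k). i < n \<and> v < csize (Hs i) \<and> k < cdeg (Hs i) v}"

definition hcm_pairings :: "(nat \<Rightarrow> community) \<Rightarrow> nat \<Rightarrow> (nat \<times> nat \<times> nat \<Rightarrow> nat \<times> nat \<times> nat) set" where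
  "hcm_pairings Hs n =
     {m. (\<forall>x \<in> hcm_halfedges Hs n. m x \<in> hcm_halfedges Hs n \<and> m x \<noteq> x \<and> m (m x) = x) \<and>
         (\<forall>x. x \<notin> hcm_halfedges Hs n \<longrightarrow> m x = x)}"

definition hcm_pairing_pmf :: "(nat \<Rightarrow> community) \<Rightarrow> nat \<Rightarrow> (nat \<times> nat \<times> nat \<Rightarrow> nat \<times> nat \<times> nat) pmf" where
  "hcm_pairing_pmf Hs n = pmf_of_set (hcm_pairings Hs n)"

definition hcm_adj :: "(nat \<Rightarrow> community) \<Rightarrow> nat \<Rightarrow> (nat \<times> nat \<times> nat \<Rightarrow> nat \<times> nat \<times> nat)
     \<Rightarrow> nat \<times> nat \<Rightarrow> nat \<times> nat \<Rightarrow> bool" where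
  "hcm_adj Hs n m x y \<longleftrightarrow>
     x \<in> hcm_vertices Hs n \<and> y \<in> hcm_vertices Hs n \<and>
     ((fst x = fst y \<and> cedge (Hs (fst x)) (snd x) (snd y)) \<or>
      (\<exists>k k'. (fst x, snd x, k) \<in> hcm_halfedges Hs n \<and>
              m (fst x, snd x, k) = (fst y, snd y, k')))"

definition hcm_components :: "(nat \<Rightarrow> community) \<Rightarrow> nat \<Rightarrow> (nat \<times> nat \<times> nat \<Rightarrow> nat \<times> nat \<times> nat)
     \<Rightarrow> (nat \<times> nat) set set" where
  "hcm_components Hs n m =
     hcm_vertices Hs n // {(x, y). x \<in> hcm_vertices Hs n \<and> y \<in> hcm_vertices Hs n \<and>
                                    (hcm_adj Hs n m)\<^sup>*\<^sup>* x y}"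

text \<open>Component sizes in decreasing order, padded with zeros; index j = 0 is the
 largest component (C_(1) in the paper).\<close>
definition ordered_comp_sizes :: "(nat \<Rightarrow> community) \<Rightarrow> nat \<Rightarrow> (nat \<times> nat \<times> nat \<Rightarrow> nat \<times> nat \<times> nat)
     \<Rightarrow> nat \<Rightarrow> real" where
  "ordered_comp_sizes Hs n m j =
     (let xs = rev (sorted_list_of_multiset (image_mset card (mset_set (hcm_components Hs n m))))
      in if j < length xs then real (xs ! j) else 0)"

definition std_brownian_motion :: "'a measure \<Rightarrow> ('a \<Rightarrow> real \<Rightarrow> real) \<Rightarrow> bool" where
  "std_brownian_motion M B \<longleftrightarrow>
     prob_space M \<and>
     (\<forall>t. (\<lambda>\<omega>. B \<omega> t) \<in> borel_measurable M) \<and>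
     (\<forall>\<omega> \<in> space M. B \<omega> 0 = 0 \<and> continuous_on {0..} (B \<omega>)) \<and>
     (\<forall>s t. 0 \<le> s \<and> s < t \<longrightarrow>
        distributed M lborel (\<lambda>\<omega>. B \<omega> t - B \<omega> s) (normal_density 0 (sqrt (t - s)))) \<and>
     (\<forall>ts :: nat \<Rightarrow> real. \<forall>k. (\<forall>i<k. 0 \<le> ts i \<and> ts i < ts (Suc i)) \<longrightarrow>
        prob_space.indep_vars M (\<lambda>_. borel) (\<lambda>i \<omega>. B \<omega> (ts (Suc i)) - B \<omega> (ts i)) {..<k})"

definition bm_parabolic :: "real \<Rightarrow> real \<Rightarrow> real \<Rightarrow> (real \<Rightarrow> real) \<Rightarrow> real \<Rightarrow> real" where
  "bm_parabolic \<mu> lam \<eta> b t = sqrt \<eta> / \<mu> * b t + lam * t - \<eta> * t\<^sup>2 / (2 * \<mu> ^ 3)"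

definition reflected :: "(real \<Rightarrow> real) \<Rightarrow> real \<Rightarrow> real" where
  "reflected X t = X t - (INF s\<in>{0..t}. X s)"

definition excursions :: "(real \<Rightarrow> real) \<Rightarrow> (real \<times> real) set" where
  "excursions W = {(l, r). 0 \<le> l \<and> l < r \<and> W l = 0 \<and> W r = 0 \<and> (\<forall>t. l < t \<and> t < r \<longrightarrow> W t > 0)}"

text \<open>j-th largest value (j = 0 is the largest), counted with multiplicity, of the
 excursion lengths; 0 if there are fewer than j+1 excursions.\<close>
definition ordered_excursion_lengths :: "(real \<Rightarrow> real) \<Rightarrow> nat \<Rightarrow> real" where
  "ordered_excursion_lengths W j =
     Sup ({0} \<union> {x. x > 0 \<and> (infinite {e \<in> excursions W. snd e - fst e \<ge> x} \<or>
                               card {e \<in> excursions W. snd e - fst e \<ge> x} > j)})"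

definition conv_in_dist_pmf ::
  "(nat \<Rightarrow> 'b pmf) \<Rightarrow> (nat \<Rightarrow> 'b \<Rightarrow> (nat \<Rightarrow> real)) \<Rightarrow> 'a measure \<Rightarrow> ('a \<Rightarrow> (nat \<Rightarrow> real)) \<Rightarrow> bool" where
  "conv_in_dist_pmf p X M Y \<longleftrightarrow>
     Y \<in> borel_measurable M \<and>
     (\<forall>f :: (nat \<Rightarrow> real) \<Rightarrow> real. continuous_on UNIV f \<and> bounded (range f) \<longrightarrow>
        ((\<lambda>n. measure_pmf.expectation (p n) (\<lambda>\<omega>. f (X n \<omega>)))
           \<longlonglongrightarrow> integral\<^sup>L M (\<lambda>\<omega>. f (Y \<omega>))))"

end

theory Submission
  imports Defs
begin

text \<open>Write $a = n^{1/3}$. A uniform pairing is explored one community at a time, the candidate partners being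
 an i.i.d. sequence of uniform half-edges; a draw that hits an already paired half-edge is discarded, which
 happens rarely enough not to matter at time $T a^2$. The walk counting active half-edges minus the degrees of the
 component starts is then an i.i.d. sum with a parabolic drift, up to $o(a)$ in mean, so Donsker's theorem for
 Lipschitz functionals of paths applies. Components correspond to the gaps between zeros of the walk, and the number
 of vertices explored grows linearly in time, with slope $E[DS]/E[D]$.

 The vector of gap lengths is not a continuous function of the path. It is therefore replaced, inside a bounded
 Lipschitz test function, by an infimum over all approximate sets of zeros of the path, penalised by their error: this is
 Lipschitz in the path, bounds the quantity for the walk from below, and increases to the test function of the
 excursion lengths wherever the minima of the limit path over disjoint intervals differ. So only lower bounds are
 proved; applied to a test function and to its negative they give convergence.

 Components that do not meet the explored part are controlled by choosing the starts: $T a$ communities of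
 uniform vertices are explored first. They miss a given component of at least $x a^2$ vertices with probability at most
 $exp(- c T x)$, and their total degree $O(T a)$ is absorbed by the drift, of order $- T^2 a$, by time $T a^2$.
 That excursions of the limit have bounded length follows from the same estimates along the discrete sequence.\<close>

text \<open>Discarding keeps the law right because a rejected draw leaves the state as it was: given
  acceptance, the partner is uniform among the free half-edges. After any number of draws,
  completing the partial pairing uniformly gives back the uniform pairing. So the draws are exactly
  i.i.d. and a central limit theorem for sums suffices; all dependence sits in error terms that are
  bounded in mean.

  Only third moments are available, so the largest degree is merely \<open>o(a)\<close> and the
  largest community \<open>o(a^2)\<close>. One quantity \<open>\<delta>\<close> tending to 0
  measures both, and the errors are of order \<open>sqrt \<delta>\<close>.

  The errors are removed in a fixed order: a size threshold \<open>x\<close> is chosen from the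
  Lipschitz constant of the test function, then a time window \<open>T\<close> so long that
  components missed by the chosen starts are unlikely, then a penalty \<open>k\<close>, and only
  then does \<open>n\<close> go to infinity.\<close>

abbreviation expect :: "'a pmf => ('a => 'b::{banach, second_countable_topology}) => 'b" where
 "expect p == measure_pmf.expectation p"

abbreviation evtl :: "(nat => bool) => bool" (binder "EVTL " 10) where
 "evtl Q == eventually Q sequentially"

abbreviation nfl :: "real => nat" where "nfl x == nat \<lfloor>x\<rfloor>"
abbreviation N01 where "N01 == std_normal_distribution"
abbreviation emp where "emp Hs n == emp_mean (Hs n) n"
abbreviation rdeg :: "community => real" where "rdeg H == real (cdegree H)"

section \<open>Sums of i.i.d. variables\<close>

lemma expectation_bind_finite:
 fixes h :: "'b => 'c::{banach, second_countable_topology}"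
 assumes "finite (set_pmf p)" "!!x. x \<in> set_pmf p ==> finite (set_pmf (f x))"
 shows "expect (bind_pmf p f) h = expect p (%x. expect (f x) h)"
 using assms by (subst pmf_expectation_bind[of "set_pmf p"]) (auto simp: integral_measure_pmf[of "set_pmf p"])

lemma expectation_mono_finite:
 fixes F G :: "'a => real"
 assumes "finite (set_pmf p)" "!!x. x \<in> set_pmf p ==> F x <= G x"
 shows "expect p F <= expect p G"
 using assms by (intro integral_mono_AE integrable_measure_pmf_finite) (auto simp: AE_measure_pmf_iff)

lemma expectation_cong:
 assumes "!!x. x \<in> set_pmf p ==> F x = G x"
 shows "expect p F = expect p G"
 using assms by (intro integral_cong_AE) (auto simp: AE_measure_pmf_iff)

lemma prob_eq_expectation: "measure_pmf.prob p A = expect p (indicator A)"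
 by simp

text \<open>Finite support makes every function of the draws integrable, so integrability conditions
  do not arise for the discrete model.\<close>

locale iid =
 fixes q :: "'e pmf"
 assumes fin: "finite (set_pmf q)"
begin

abbreviation Ex :: "nat => ('e list => 'c::{banach, second_countable_topology}) => 'c" where
 "Ex n F \<equiv> expect (replicate_pmf n q) F"

lemma fin_rep: "finite (set_pmf (replicate_pmf n q))"
proof -
 have "{xs \<in> lists (set_pmf q). length xs = n} = {xs. set xs \<subseteq> set_pmf q & length xs = n}" by auto
 then show ?thesis using finite_lists_length_eq[OF fin, of n] by (simp add: set_replicate_pmf)
qed

lemma int_rep [simp]: "integrable (measure_pmf (replicate_pmf n q)) (F :: _ => 'c::{banach, second_countable_topology})"
 by (rule integrable_measure_pmf_finite[OF fin_rep])

lemma int_q [simp]: "integrable (measure_pmf q) (F :: _ => 'c::{banach, second_countable_topology})"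
 by (rule integrable_measure_pmf_finite[OF fin])

lemma Ex_append: "Ex (m + n) F = Ex m (%xs. Ex n (%ys. F (xs @ ys)))"
proof -
 have "Ex (m + n) F = Ex m (%xs. expect (bind_pmf (replicate_pmf n q) (%ys. return_pmf (xs @ ys))) F)"
  unfolding replicate_pmf_distrib using fin_rep by (subst expectation_bind_finite) auto
 also have "... = Ex m (%xs. Ex n (%ys. F (xs @ ys)))"
  by (simp add: expectation_bind_finite[OF fin_rep])
 finally show ?thesis .
qed

lemma Ex_snoc: "Ex (Suc n) F = Ex n (%xs. expect q (%e. F (xs @ [e])))"
proof -
 have "Ex (n + 1) F = Ex n (%xs. expect q (%e. F (xs @ [e])))"
  unfolding Ex_append replicate_pmf_1 by simp
 then show ?thesis by simp
qed

lemma Ex_0 [simp]: "Ex 0 F = F []" by simp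

lemma set_rep: "xs \<in> set_pmf (replicate_pmf n q) \<longleftrightarrow> xs \<in> lists (set_pmf q) & length xs = n"
 by (auto simp: set_replicate_pmf)

lemma Ex_mono:
 assumes "!!xs. xs \<in> lists (set_pmf q) ==> length xs = n ==> F xs <= (G xs :: real)"
 shows "Ex n F <= Ex n G"
 by (rule expectation_mono_finite[OF fin_rep]) (auto simp: set_rep assms)

lemma Ex_cong:
 assumes "!!xs. xs \<in> lists (set_pmf q) ==> length xs = n ==> F xs = G xs"
 shows "Ex n F = Ex n G"
 by (rule expectation_cong) (auto simp: set_rep assms)

lemma Ex_take:
 assumes "k <= n"
 shows "Ex n (%xs. F (take k xs)) = Ex k F"
proof -
 have "Ex (k + (n - k)) (%xs. F (take k xs)) = Ex k (%xs. Ex (n - k) (%ys. F (take k (xs @ ys))))" by (rule Ex_append)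
 also have "... = Ex k F" by (rule Ex_cong) simp
 finally show ?thesis using assms by simp
qed

lemma Ex_nonneg: "(!!xs. xs \<in> lists (set_pmf q) ==> length xs = n ==> 0 <= (F xs :: real)) ==> 0 <= Ex n F"
 using Ex_mono[of n "%_. 0" F] by simp

section \<open>Maximal inequalities along a list of draws\<close>

definition rmax :: "('e list => real) => 'e list => real" where
 "rmax M xs = Max ((%k. \<bar>M (take k xs)\<bar>) ` {..length xs})"

lemma rmax_snoc: "rmax M (xs @ [e]) = max (rmax M xs) \<bar>M (xs @ [e])\<bar>"
proof -
 have "{..length (xs @ [e])} = insert (Suc (length xs)) {..length xs}" by auto
 then have "(%k. \<bar>M (take k (xs @ [e]))\<bar>) ` {..length (xs @ [e])} =
  insert \<bar>M (xs @ [e])\<bar> ((%k. \<bar>M (take k xs)\<bar>) ` {..length xs})" by (auto simp: image_iff)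
 then show ?thesis unfolding rmax_def by (simp add: max.commute)
qed

lemma rmax_ge: "k <= length xs ==> \<bar>M (take k xs)\<bar> <= rmax M xs"
 unfolding rmax_def by (intro Max_ge) auto

text \<open>The potential \<open>m + s^2 / m\<close>, where \<open>m\<close> is the running maximum strictly before the present
 position \<open>s\<close>, increases on average by at most the variance of the step divided by \<open>m\<close>.\<close>
lemma maximal_inequality:
 fixes M v :: "'e list => real"
 assumes mart: "!!xs. xs \<in> lists (set_pmf q) ==> expect q (%e. M (xs @ [e])) = M xs"
  and var: "!!xs. xs \<in> lists (set_pmf q) ==> expect q (%e. (M (xs @ [e]) - M xs)^2) <= v xs"
  and m: "m > 0"
 shows "Ex n (rmax M) <= m + ((M [])^2 + (\<Sum>k<n. Ex k v)) / m"
proof -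
 define mm where "mm xs = Max (insert m ((%k. \<bar>M (take k xs)\<bar>) ` {..<length xs}))" for xs
 have mm_snoc: "mm (xs @ [e]) = max (mm xs) \<bar>M xs\<bar>" for xs e
 proof -
  have "insert m ((%k. \<bar>M (take k (xs @ [e]))\<bar>) ` {..<length (xs @ [e])}) =
   insert \<bar>M xs\<bar> (insert m ((%k. \<bar>M (take k xs)\<bar>) ` {..<length xs}))" by (auto simp: image_iff lessThan_Suc)
  then show ?thesis unfolding mm_def by (simp add: max.commute)
 qed
 have mm_ge: "mm xs >= m" for xs unfolding mm_def by auto
 have mm_last: "rmax M xs <= max (mm xs) \<bar>M xs\<bar>" for xs
 proof -
  have "(%k. \<bar>M (take k xs)\<bar>) ` {..length xs} = insert \<bar>M xs\<bar> ((%k. \<bar>M (take k xs)\<bar>) ` {..<length xs})"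
  proof -
   have "{..length xs} = insert (length xs) {..<length xs}" by auto
   then show ?thesis by simp
  qed
  then show ?thesis unfolding rmax_def mm_def by (auto intro!: Max.boundedI) (auto simp: le_max_iff_disj)
 qed
 define \<Phi> where "\<Phi> xs = mm xs + (M xs)^2 / mm xs" for xs
 have last: "max (mm xs) \<bar>M xs\<bar> <= \<Phi> xs" for xs
 proof -
  have p: "mm xs > 0" using mm_ge[of xs] m by simp
  have "\<bar>M xs\<bar> * mm xs <= (mm xs)^2 + (M xs)^2"
  proof -
   have "0 <= mm xs * \<bar>M xs\<bar>" using p by simp
   then show ?thesis using sum_squares_bound[of "mm xs" "\<bar>M xs\<bar>"] by (simp add: algebra_simps)
  qed
  then have "\<bar>M xs\<bar> <= \<Phi> xs" using p by (simp add: \<Phi>_def field_simps power2_eq_square)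
  moreover have "mm xs <= \<Phi> xs" using p by (simp add: \<Phi>_def)
  ultimately show ?thesis by simp
 qed
 have step: "expect q (%e. \<Phi> (xs @ [e])) <= \<Phi> xs + v xs / m" if xs: "xs \<in> lists (set_pmf q)" for xs
 proof -
  define a where "a = max (mm xs) \<bar>M xs\<bar>"
  have a: "a >= mm xs" "a >= m" "a > 0" using mm_ge[of xs] m by (auto simp: a_def)
  have v0: "v xs >= 0" using var[OF xs] by (rule order_trans[rotated]) (simp add: integral_nonneg)
  have "expect q (%e. (M (xs @ [e]))^2) =
    expect q (%e. (M (xs @ [e]) - M xs)^2 + 2 * M xs * M (xs @ [e]) - (M xs)^2)"
   by (intro Bochner_Integration.integral_cong refl) (simp add: power2_eq_square algebra_simps)
  also have "... = expect q (%e. (M (xs @ [e]) - M xs)^2) + 2 * M xs * M xs - (M xs)^2"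
   by (simp add: mart[OF xs])
  also have "... <= v xs + (M xs)^2" using var[OF xs] by (simp add: power2_eq_square)
  finally have sq: "expect q (%e. (M (xs @ [e]))^2) <= v xs + (M xs)^2" .
  have "expect q (%e. \<Phi> (xs @ [e])) = a + expect q (%e. (M (xs @ [e]))^2) / a"
   by (simp add: \<Phi>_def mm_snoc a_def[symmetric])
  also have "... <= a + (v xs + (M xs)^2) / a" using sq a by (intro add_left_mono divide_right_mono) auto
  also have "... <= a + (M xs)^2 / a + v xs / m" using v0 a m by (simp add: add_divide_distrib frac_le)
  \<comment> \<open>Raising the maximum to \<open>a\<close> costs nothing: if
    \<open>\<bar>M xs\<bar>\<close> is a new maximum, the left side is
    \<open>2 * \<bar>M xs\<bar>\<close>, and the potential is at least that by the inequality of the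
    means.\<close>
  also have "a + (M xs)^2 / a <= \<Phi> xs"
  proof (cases "\<bar>M xs\<bar> <= mm xs")
   case True
   then show ?thesis by (simp add: \<Phi>_def a_def max_def)
  next
   case False
   then have aM: "a = \<bar>M xs\<bar>" by (simp add: a_def)
   have p: "mm xs > 0" using mm_ge[of xs] m by simp
   have "a + (M xs)^2 / a = 2 * \<bar>M xs\<bar>" using a aM by (simp add: power2_eq_square field_simps)
   also have "... <= \<Phi> xs" using p sum_squares_bound[of "mm xs" "\<bar>M xs\<bar>"]
    by (simp add: \<Phi>_def field_simps power2_eq_square)
   finally show ?thesis .
  qed
  finally show ?thesis by simp
 qed
 have "Ex n \<Phi> <= \<Phi> [] + (\<Sum>k<n. Ex k v) / m"
 proof (induction n)
  case (Suc n)
  have "Ex (Suc n) \<Phi> = Ex n (%xs. expect q (%e. \<Phi> (xs @ [e])))" by (rule Ex_snoc)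
  also have "... <= Ex n (%xs. \<Phi> xs + v xs / m)" by (intro Ex_mono step)
  also have "... = Ex n \<Phi> + Ex n v / m" by simp
  finally show ?case using Suc by (simp add: add_divide_distrib)
 qed simp
 moreover have "Ex n (rmax M) <= Ex n \<Phi>" by (intro Ex_mono order_trans[OF mm_last last])
 ultimately show ?thesis by (simp add: \<Phi>_def mm_def add_divide_distrib)
qed

text \<open>By convexity \<open>M ^ 4\<close> has nonnegative conditional increments. Let
  \<open>H\<close> indicate that the running maximum has reached \<open>c\<close>. The mean of
  \<open>H * (M ^ 4 - c ^ 4)\<close> never decreases, since at the step where \<open>H\<close> turns
  to 1 the other factor is nonnegative. The fourth power is what the oscillation bound in Donsker's
  theorem requires.\<close>

lemma doob4:
 fixes M :: "'e list => real"
 assumes mart: "!!xs. xs \<in> lists (set_pmf q) ==> expect q (%e. M (xs @ [e])) = M xs"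
  and c: "c > 0"
 shows "measure_pmf.prob (replicate_pmf n q) {xs. c <= rmax M xs} <= Ex n (%xs. (M xs) ^ 4) / c ^ 4"
proof -
 define H where "H xs = (if c <= rmax M xs then 1 else 0 :: real)" for xs
 have conv: "y ^ 4 >= x ^ 4 + 4 * x ^ 3 * (y - x)" for x y :: real
 proof -
  have "y ^ 4 - (x ^ 4 + 4 * x ^ 3 * (y - x)) = (y - x)^2 * ((y + x)^2 + 2 * x^2)"
   by (simp add: power2_eq_square power3_eq_cube power4_eq_xxxx algebra_simps)
  also have "... >= 0" by simp
  finally show ?thesis by simp
 qed
 have j4: "expect q (%e. (M (xs @ [e])) ^ 4) >= (M xs) ^ 4" if xs: "xs \<in> lists (set_pmf q)" for xs
 proof -
  have "expect q (%e. (M xs) ^ 4 + 4 * (M xs) ^ 3 * (M (xs @ [e]) - M xs)) <= expect q (%e. (M (xs @ [e])) ^ 4)"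
   by (intro expectation_mono_finite fin conv)
  then show ?thesis by (simp add: mart[OF xs])
 qed
 have main: "Ex n (%xs. H xs * ((M xs) ^ 4 - c ^ 4)) >= 0"
 proof (induction n)
  case 0
  have "H [] * ((M []) ^ 4 - c ^ 4) >= 0"
   using power_mono[of c "\<bar>M []\<bar>" 4] c by (auto simp: H_def rmax_def power_even_abs)
  then show ?case by simp
 next
  case (Suc n)
  have "Ex n (%xs. H xs * ((M xs) ^ 4 - c ^ 4)) <= Ex n (%xs. expect q (%e. H (xs @ [e]) * ((M (xs @ [e])) ^ 4 - c ^ 4)))"
  proof (rule Ex_mono)
   fix xs assume xs: "xs \<in> lists (set_pmf q)"
   have "H xs * ((M xs) ^ 4 - c ^ 4) <= expect q (%e. H xs * ((M (xs @ [e])) ^ 4 - c ^ 4))"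
    using j4[OF xs] by (auto simp: H_def)
   also have "... <= expect q (%e. H (xs @ [e]) * ((M (xs @ [e])) ^ 4 - c ^ 4))"
   proof (rule expectation_mono_finite[OF fin])
    fix e
    show "H xs * ((M (xs @ [e])) ^ 4 - c ^ 4) <= H (xs @ [e]) * ((M (xs @ [e])) ^ 4 - c ^ 4)"
     using power_mono[of c "\<bar>M (xs @ [e])\<bar>" 4] c by (auto simp: H_def rmax_snoc power_even_abs le_max_iff_disj)
   qed
   finally show "H xs * ((M xs) ^ 4 - c ^ 4) <= expect q (%e. H (xs @ [e]) * ((M (xs @ [e])) ^ 4 - c ^ 4))" .
  qed
  then show ?case using Suc by (simp add: Ex_snoc del: replicate_pmf.simps)
 qed
 have "measure_pmf.prob (replicate_pmf n q) {xs. c <= rmax M xs} = Ex n H"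
  unfolding prob_eq_expectation by (intro Bochner_Integration.integral_cong) (auto simp: H_def)
 also have "c ^ 4 * Ex n H <= Ex n (%xs. H xs * (M xs) ^ 4)" using main by (simp add: right_diff_distrib algebra_simps)
 also have "... <= Ex n (%xs. (M xs) ^ 4)" by (intro Ex_mono) (auto simp: H_def)
 finally show ?thesis using c by (simp add: field_simps)
qed

section \<open>Moments and characteristic functions of i.i.d. sums\<close>

definition ssum :: "('e => real) => 'e list => real" where "ssum g xs = sum_list (map g xs)"

lemma ssum_snoc [simp]: "ssum g (xs @ [e]) = ssum g xs + g e" and ssum_Nil [simp]: "ssum g [] = 0"
 by (simp_all add: ssum_def)

lemma Ex_q_mult [simp]: "expect q (%e. x * F e) = x * expect q F" for x :: real
 by simp

lemma ssum_mart: "expect q g = 0 ==> expect q (%e. ssum g (xs @ [e])) = ssum g xs"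
 by simp

lemma ssum_mean: "Ex n (ssum g) = real n * expect q g"
 by (induction n) (simp_all add: Ex_snoc algebra_simps del: replicate_pmf.simps(2))

lemma ssum_2:
 assumes "expect q g = 0"
 shows "Ex n (%xs. (ssum g xs)^2) = real n * expect q (%e. (g e)^2)"
proof (induction n)
 case (Suc n)
 have "expect q (%e. (ssum g (xs @ [e]))^2) = (ssum g xs)^2 + expect q (%e. (g e)^2)" for xs
 proof -
  have "(%e. (ssum g (xs @ [e]))^2) = (%e. (ssum g xs)^2 + 2 * ssum g xs * g e + (g e)^2)"
   by (auto simp: power2_eq_square algebra_simps)
  then show ?thesis using assms by simp
 qed
 then show ?case using Suc by (simp add: Ex_snoc algebra_simps del: replicate_pmf.simps)
qed simp

text \<open>Terms with a single centred factor vanish. The exact coefficient of the squared variance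
  is \<open>3 * n * (n - 1)\<close>, enlarged here to \<open>3 * n^2\<close>.\<close>

lemma ssum_4:
 assumes "expect q g = 0"
 shows "Ex n (%xs. (ssum g xs) ^ 4) <= real n * expect q (%e. (g e) ^ 4) + 3 * (real n)^2 * (expect q (%e. (g e)^2))^2"
proof (induction n)
 case (Suc n)
 let ?m2 = "expect q (%e. (g e)^2)"
 have "expect q (%e. (ssum g (xs @ [e])) ^ 4) =
   (ssum g xs) ^ 4 + 6 * (ssum g xs)^2 * ?m2 + 4 * ssum g xs * expect q (%e. (g e) ^ 3) + expect q (%e. (g e) ^ 4)" for xs
 proof -
  have "(%e. (ssum g (xs @ [e])) ^ 4) = (%e. (ssum g xs) ^ 4 + 4 * (ssum g xs) ^ 3 * g e + 6 * (ssum g xs)^2 * (g e)^2 + 4 * ssum g xs * (g e) ^ 3 + (g e) ^ 4)"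
   by (rule ext) (simp add: power2_eq_square power3_eq_cube power4_eq_xxxx algebra_simps)
  then show ?thesis using assms by simp
 qed
 then have "Ex (Suc n) (%xs. (ssum g xs) ^ 4) = Ex n (%xs. (ssum g xs) ^ 4) + 6 * (real n * ?m2) * ?m2 + expect q (%e. (g e) ^ 4)"
  using ssum_2[OF assms, of n] ssum_mean[of n g] assms by (simp add: Ex_snoc del: replicate_pmf.simps)
 moreover have "3 * (real (Suc n))^2 * ?m2^2 >= 3 * (real n)^2 * ?m2^2 + 6 * (real n * ?m2) * ?m2"
  by (simp add: power2_eq_square algebra_simps)
 ultimately show ?case using Suc by (simp add: algebra_simps)
qed simp

lemma char_ssum:
 "char (distr (measure_pmf (replicate_pmf n q)) borel (%xs. ssum g xs / a)) t = (char (distr (measure_pmf q) borel (%e. g e / a)) t) ^ n"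
proof -
 have c: "char (distr (measure_pmf p) borel f) t = expect p (%x. iexp (t * f x))" for p :: "'z pmf" and f
  by (simp add: char_def integral_distr)
 show ?thesis unfolding c
 proof (induction n)
  case (Suc n)
  have "iexp (t * (ssum g (xs @ [e]) / a)) = iexp (t * (ssum g xs / a)) * iexp (t * (g e / a))" for xs e
   by (simp add: exp_add[symmetric] algebra_simps add_divide_distrib)
  then show ?case using Suc by (simp add: Ex_snoc mult.commute del: replicate_pmf.simps)
 qed simp
qed

end

section \<open>Exploration of a uniform pairing\<close>

text \<open>The number of perfect matchings of \<open>n\<close> points: the double factorial of
  \<open>n - 1\<close> for even \<open>n\<close>, and 0 for odd \<open>n\<close>.\<close>

fun dfac :: "nat => nat" where
 "dfac 0 = 1" | "dfac (Suc 0) = 0" | "dfac (Suc (Suc n)) = Suc n * dfac n"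

lemma dfac_pos: "even n ==> dfac n > 0"
 by (induction n rule: dfac.induct) auto

text \<open>\<open>E\<close> is the set of half-edges and \<open>c\<close> sends a half-edge to its
  community, so that at this level communities are the vertices of an ordinary configuration
  model.\<close>

locale half_edges =
 fixes E :: "'e set" and c :: "'e => 'i"
 assumes finE: "finite E"
begin

text \<open>A partial pairing is a total involution whose fixed points are the unpaired half-edges;
  joining two of them is then a function update.\<close>

definition unp :: "('e => 'e) => 'e set" where "unp p = {h \<in> E. p h = h}"

definition valid :: "('e => 'e) => bool" where
 "valid p \<longleftrightarrow> (ALL h. p (p h) = h) & (ALL h. p h ~= h --> h \<in> E & p h \<in> E)"

text \<open>The perfect matchings of \<open>E\<close> that contain all pairs of
  \<open>p\<close>.\<close>

definition Ext :: "('e => 'e) => ('e => 'e) set" where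
 "Ext p = {m. (ALL x:E. m x \<in> E & m x ~= x & m (m x) = x) & (ALL x. x \<notin> E --> m x = x) & (ALL x. p x ~= x --> m x = p x)}"

lemma valid_pair:
 assumes "valid p" "a \<in> unp p" "e \<in> unp p" "e ~= a"
 shows "valid (p(a := e, e := a))" "unp (p(a := e, e := a)) = unp p - {a, e}"
proof -
 have p: "p (p h) = h" "p h ~= h ==> h \<in> E & p h \<in> E" for h using assms(1) by (auto simp: valid_def)
 have pa: "p a = a" "p e = e" "a \<in> E" "e \<in> E" using assms(2,3) by (auto simp: unp_def)
 have ne: "p h ~= a" "p h ~= e" if "h ~= a" "h ~= e" for h using p(1)[of h] pa that by metis+
 show "valid (p(a := e, e := a))"
  unfolding valid_def using p pa ne assms(4) by (auto simp: fun_upd_def)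
 show "unp (p(a := e, e := a)) = unp p - {a, e}"
  using assms(4) by (auto simp: unp_def)
qed

lemma Ext_pair:
 assumes "valid p" "a \<in> unp p" "e \<in> unp p" "e ~= a"
 shows "Ext (p(a := e, e := a)) = {m \<in> Ext p. m a = e}"
proof -
 have pa: "p a = a" "p e = e" "a \<in> E" "e \<in> E" using assms(2,3) by (auto simp: unp_def)
 show ?thesis using pa assms(4) unfolding Ext_def by (auto split: if_splits)
qed

lemma Ext_partner:
 assumes "valid p" "a \<in> unp p" "m \<in> Ext p"
 shows "m a \<in> unp p - {a}"
proof -
 have a: "p a = a" "a \<in> E" using assms(2) by (auto simp: unp_def)
 have m: "m a \<in> E" "m a ~= a" "m (m a) = a" "p (m a) ~= m a ==> m (m a) = p (m a)"
  using assms(3) a by (auto simp: Ext_def)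
 have "p (m a) = m a"
 proof (rule ccontr)
  assume "p (m a) ~= m a"
  then have "p (m a) = a" using m by simp
  then have "p a = m a" using assms(1) unfolding valid_def by metis
  with a m show False by simp
 qed
 with m show ?thesis by (simp add: unp_def)
qed

text \<open>Fix an unpaired \<open>a\<close> and split the completions by the partner of
  \<open>a\<close>, which may be any other unpaired half-edge. Each class consists of the
  completions of a pairing with two free half-edges fewer.\<close>

lemma card_Ext:
 assumes "valid p"
 shows "finite (Ext p) & card (Ext p) = dfac (card (unp p))"
 using assms
proof (induction "card (unp p)" arbitrary: p rule: less_induct)
 case less
 have finu: "finite (unp p)" using finE by (simp add: unp_def)
 show ?case
 proof (cases "unp p = {}")
  case True
  then have ne: "p x ~= x" if "x \<in> E" for x using that by (auto simp: unp_def)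
  have "Ext p = {p}"
  proof (intro set_eqI iffI)
   fix m assume m: "m \<in> Ext p"
   have "m x = p x" for x
    using m ne[of x] less.prems by (cases "x \<in> E") (auto simp: Ext_def valid_def, metis)
   then show "m \<in> {p}" by auto
  next
   fix m assume "m \<in> {p}"
   then show "m \<in> Ext p" using ne less.prems unfolding Ext_def valid_def by auto
  qed
  then show ?thesis using True by simp
 next
  case False
  then obtain a where a: "a \<in> unp p" by auto
  define P where "P e = p(a := e, e := a)" for e
  have P: "finite (Ext (P e)) & card (Ext (P e)) = dfac (card (unp p) - 2)" if e: "e \<in> unp p - {a}" for e
  proof -
   have u: "unp (P e) = unp p - {a, e}" "valid (P e)" using valid_pair[OF less.prems a] e by (auto simp: P_def)
   have "card {a, e} <= card (unp p)" using e a by (intro card_mono finu) auto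
   moreover have "card (unp (P e)) = card (unp p) - 2"
    unfolding u(1) using e a finu by (subst card_Diff_subset) auto
   moreover have "card {a, e} = 2" using e by auto
   ultimately show ?thesis using less.hyps[OF _ u(2)] by auto
  qed
  have split: "Ext p = (\<Union>e\<in>unp p - {a}. Ext (P e))"
   using Ext_pair[OF less.prems a] Ext_partner[OF less.prems a] by (auto simp: P_def)
  have "card (Ext p) = (\<Sum>e\<in>unp p - {a}. card (Ext (P e)))"
   unfolding split using Ext_pair[OF less.prems a] finu P
   by (intro card_UN_disjoint) (auto simp: P_def)
  also have "... = (card (unp p) - 1) * dfac (card (unp p) - 2)"
   using P a finu by (simp add: card_Diff_singleton)
  also have "... = dfac (card (unp p))"
  proof -
   have "card (unp p) > 0" using a finu by (auto simp: card_gt_0_iff)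
   then show ?thesis by (cases "card (unp p)" rule: dfac.cases) auto
  qed
  finally show ?thesis unfolding split using P finu by auto
 qed
qed

lemma Ext_ne: "valid p ==> even (card (unp p)) ==> Ext p ~= {} & finite (Ext p)"
 using card_Ext[of p] dfac_pos[of "card (unp p)"] by auto

text \<open>With \<open>r\<close> free half-edges a completion \<open>m\<close> arises in two ways:
  from the \<open>card E - (r - 1)\<close> draws that change nothing, with weight
  \<open>1 / dfac r\<close> each, and from the single draw \<open>e = m a\<close>, with weight
  \<open>1 / dfac (r - 2) = (r - 1) / dfac r\<close>. The average over all \<open>card E\<close>
  draws is \<open>1 / dfac r\<close>.\<close>

lemma uniform_step:
 assumes v: "valid p" and a: "a \<in> unp p" and ev: "even (card (unp p))"
 shows "bind_pmf (pmf_of_set E) (%e. pmf_of_set (Ext (if e = a \<or> p e ~= e then p else p(a := e, e := a)))) = pmf_of_set (Ext p)"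
proof (rule pmf_eqI)
 fix m
 define P where "P e = (if e = a \<or> p e ~= e then p else p(a := e, e := a))" for e
 have aE: "a \<in> E" using a by (simp add: unp_def)
 have finu: "finite (unp p)" using finE by (simp add: unp_def)
 define r where "r = card (unp p)"
 have "r > 0" using a finu by (auto simp: r_def card_gt_0_iff)
 then have r2: "r >= 2" using ev unfolding r_def[symmetric] by (cases r) (auto elim: oddE)
 have vP: "valid (P e)" "even (card (unp (P e)))" "e \<in> unp p - {a} ==> card (unp (P e)) = r - 2" if "e \<in> E" for e
 proof -
  have c2: "card (unp p - {a, e}) = r - 2" if "e \<in> unp p" "e ~= a"
   using that a finu by (subst card_Diff_subset) (auto simp: r_def)
  show "valid (P e)" using valid_pair(1)[OF v a, of e] v that by (auto simp: P_def unp_def)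
  show "even (card (unp (P e)))" using valid_pair(2)[OF v a, of e] ev that c2 r2
   by (auto simp: P_def unp_def r_def)
  show "card (unp (P e)) = r - 2" if "e \<in> unp p - {a}" using valid_pair(2)[OF v a, of e] c2 that by (auto simp: P_def unp_def)
 qed
 have ne: "Ext (P e) ~= {}" "finite (Ext (P e))" if "e \<in> E" for e using Ext_ne vP that by auto
 have ne0: "Ext p ~= {}" "finite (Ext p)" "card (Ext p) = dfac r" using Ext_ne[OF v ev] card_Ext[OF v] by (auto simp: r_def)
 have "pmf (bind_pmf (pmf_of_set E) (%e. pmf_of_set (Ext (P e)))) m = (\<Sum>e\<in>E. pmf (pmf_of_set (Ext (P e))) m) / card E"
  using finE aE by (subst pmf_bind_pmf_of_set) auto
 also have "(\<Sum>e\<in>E. pmf (pmf_of_set (Ext (P e))) m) = (\<Sum>e\<in>E. indicator (Ext (P e)) m / card (Ext (P e)))"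
  using ne by (intro sum.cong) auto
 also have "... = real (card E) * (indicator (Ext p) m / card (Ext p))"
 proof (cases "m \<in> Ext p")
  case False
  then have "m \<notin> Ext (P e)" if "e \<in> E" for e using that Ext_pair[OF v a, of e] by (auto simp: P_def unp_def)
  with False show ?thesis by simp
 next
  case True
  have E: "E = (E - (unp p - {a})) \<union> (unp p - {a})" "unp p \<subseteq> E" by (auto simp: unp_def)
  have "(\<Sum>e\<in>E. indicator (Ext (P e)) m / card (Ext (P e)) :: real) =
   (\<Sum>e\<in>E - (unp p - {a}). indicator (Ext (P e)) m / card (Ext (P e))) + (\<Sum>e\<in>unp p - {a}. indicator (Ext (P e)) m / card (Ext (P e)))"
   using finE finu by (subst E(1), intro sum.union_disjoint) auto
  also have "(\<Sum>e\<in>E - (unp p - {a}). indicator (Ext (P e)) m / card (Ext (P e)) :: real) = (\<Sum>e\<in>E - (unp p - {a}). 1 / dfac r)"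
   using True ne0 by (intro sum.cong) (auto simp: P_def unp_def)
  also have "... = (real (card E) - (real r - 1)) / dfac r"
  proof -
   have "card (E - (unp p - {a})) = card E - (r - 1)"
    using E(2) finu a by (subst card_Diff_subset) (auto simp: r_def card_Diff_singleton)
   moreover have "r <= card E" unfolding r_def by (intro card_mono finE E(2))
   ultimately show ?thesis using r2 by (simp add: of_nat_diff)
  qed
  also have "(\<Sum>e\<in>unp p - {a}. indicator (Ext (P e)) m / card (Ext (P e)) :: real) = (\<Sum>e\<in>unp p - {a}. if e = m a then 1 / dfac (r - 2) else 0)"
  proof (intro sum.cong refl)
   fix e assume e: "e \<in> unp p - {a}"
   then have eE: "e \<in> E" by (simp add: unp_def)
   have "m \<in> Ext (P e) \<longleftrightarrow> e = m a" using Ext_pair[OF v a, of e] e True by (auto simp: P_def unp_def)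
   then show "indicator (Ext (P e)) m / card (Ext (P e)) = (if e = m a then 1 / dfac (r - 2) else 0 :: real)"
    using card_Ext[OF vP(1)[OF eE]] vP(3)[OF eE e] by auto
  qed
  also have "... = 1 / dfac (r - 2)" using Ext_partner[OF v a True] finu by simp
  also have "... = (real r - 1) / dfac r"
  proof -
   obtain r' where r': "r = Suc (Suc r')" using r2 by (metis add_2_eq_Suc le_Suc_ex)
   have "dfac r' > 0" using ev dfac_pos[of r'] r' by (simp add: r_def)
   moreover have "real (dfac r') + real r' * real (dfac r') > 0" using calculation by (simp add: add_pos_nonneg)
   ultimately show ?thesis unfolding r' by (simp add: field_simps)
  qed
  finally show ?thesis using True ne0 by (simp add: add_divide_distrib[symmetric])
 qed
 finally have "pmf (bind_pmf (pmf_of_set E) (%e. pmf_of_set (Ext (P e)))) m = indicator (Ext p) m / card (Ext p)"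
  using finE aE by (simp add: card_gt_0_iff) (metis card_0_eq empty_iff)
 then show "pmf (bind_pmf (pmf_of_set E) (%e. pmf_of_set (Ext (if e = a \<or> p e ~= e then p else p(a := e, e := a))))) m = pmf (pmf_of_set (Ext p)) m"
  using ne0 by (simp add: P_def[symmetric])
qed

definition deg :: "'i => nat" where "deg i = card {h \<in> E. c h = i}"

definition act :: "('e => 'e) => 'i set => 'e set" where "act p D = {h \<in> E. c h \<in> D & p h = h}"

abbreviation dg where "dg i \<equiv> real (deg i)"

lemma deg_pos: "e \<in> E ==> deg (c e) > 0"
 using finE by (auto simp: deg_def card_gt_0_iff)

text \<open>Connectivity of communities under a full pairing. As each community is connected inside,
  its classes correspond to the components of the graph.\<close>

definition reach :: "('e => 'e) => ('i \<times> 'i) set" where "reach m = {(c h, c (m h)) |h. h \<in> E}\<^sup>*"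

lemma sym_reach:
 assumes "m \<in> Ext p"
 shows "sym (reach m)"
proof -
 have "(c h, c (m h)) \<in> {(c h, c (m h)) |h. h \<in> E}\<inverse>" if "h \<in> E" for h
  using assms that by (auto simp: Ext_def intro!: exI[of _ "m h"])
 then have "sym {(c h, c (m h)) |h. h \<in> E}" unfolding sym_def by auto
 then show ?thesis unfolding reach_def by (rule sym_rtrancl)
qed

end

lemma replicate_pmf_snoc:
 "replicate_pmf (Suc n) q = bind_pmf (replicate_pmf n q) (%xs. bind_pmf q (%e. return_pmf (xs @ [e])))"
proof -
 have "replicate_pmf (Suc n) q = replicate_pmf (n + 1) q" by simp
 also have "... = bind_pmf (replicate_pmf n q) (%xs. bind_pmf (replicate_pmf 1 q) (%ys. return_pmf (xs @ ys)))"
  by (rule replicate_pmf_distrib)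
 finally show ?thesis unfolding replicate_pmf_1 map_pmf_def by (simp add: bind_assoc_pmf bind_return_pmf)
qed

section \<open>The exploration process and its walk\<close>

locale exploration = half_edges E c for E :: "'e set" and c :: "'e => 'i" +
 fixes ws :: "'i list"
 assumes cover: "c ` E \<subseteq> set ws"
begin

text \<open>Starts are tried in the order of \<open>ws\<close>. The list may repeat communities, so
  that a random prefix can be put in front of a full enumeration.\<close>

definition elig :: "'i set => 'i list" where "elig D = filter (%w. w \<notin> D & deg w > 0) ws"

text \<open>A state is a triple \<open>(p, D, Q)\<close>: a partial pairing, whose unpaired half-edges are its fixed points,
 the set of discovered communities, and the set of those which started a component. The step \<open>grow\<close> leaves the
 state unchanged if the drawn half-edge is not an admissible partner, so that the draws may be i.i.d.\<close>
definition adv :: "('e => 'e) \<times> 'i set \<times> 'i set => ('e => 'e) \<times> 'i set \<times> 'i set" where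
 "adv s = (case s of (p, D, Q) => if act p D = {} & elig D ~= [] then (p, insert (hd (elig D)) D, insert (hd (elig D)) Q) else (p, D, Q))"

definition grow :: "('e => 'e) \<times> 'i set \<times> 'i set => 'e => ('e => 'e) \<times> 'i set \<times> 'i set" where
 "grow s e = (case s of (p, D, Q) => if act p D = {} then (p, D, Q) else
   let a = (SOME h. h \<in> act p D) in if e = a \<or> p e ~= e then (p, D, Q) else (p(a := e, e := a), insert (c e) D, Q))"

definition st :: "'e list => ('e => 'e) \<times> 'i set \<times> 'i set" where
 "st xs = foldl (%s e. grow (adv s) e) (id, {}, {}) xs"

definition pm where "pm s = fst s" for s :: "('e => 'e) \<times> 'i set \<times> 'i set"
definition ds where "ds s = fst (snd s)" for s :: "('e => 'e) \<times> 'i set \<times> 'i set"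
definition qs where "qs s = snd (snd s)" for s :: "('e => 'e) \<times> 'i set \<times> 'i set"
definition ac where "ac s = act (pm s) (ds s)" for s :: "('e => 'e) \<times> 'i set \<times> 'i set"
definition qd where "qd s = (\<Sum>i\<in>qs s. deg i)" for s :: "('e => 'e) \<times> 'i set \<times> 'i set"

lemma st_Nil: "st [] = (id, {}, {})" and st_snoc: "st (xs @ [e]) = grow (adv (st xs)) e"
 by (simp_all add: st_def)

text \<open>Evenness of the number of unpaired half-edges guarantees that the partial pairing has
  completions.\<close>

definition inv :: "('e => 'e) \<times> 'i set \<times> 'i set => bool" where
 "inv s \<longleftrightarrow> valid (pm s) & even (card (unp (pm s))) & (ALL h. pm s h ~= h --> c h \<in> ds s) & ds s \<subseteq> c ` E & qs s \<subseteq> ds s"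

lemma ac_iff: "h \<in> ac s \<longleftrightarrow> h \<in> E & c h \<in> ds s & pm s h = h" by (auto simp: ac_def act_def)

lemma hd_elig: "elig D ~= [] ==> hd (elig D) \<notin> D & deg (hd (elig D)) > 0 & hd (elig D) \<in> set ws"
 using hd_in_set[of "elig D"] by (auto simp: elig_def)

lemma deg_pos_iff: "deg i > 0 \<longleftrightarrow> i \<in> c ` E"
 using finE by (auto simp: deg_def card_gt_0_iff)

lemma adv_cases:
 obtains "adv s = s" "ac s ~= {} \<or> elig (ds s) = []"
 | w where "ac s = {}" "elig (ds s) ~= []" "w = hd (elig (ds s))" "w \<notin> ds s" "w \<in> c ` E"
   "pm (adv s) = pm s" "ds (adv s) = insert w (ds s)" "qs (adv s) = insert w (qs s)"
proof -
 obtain p D Q where s: "s = (p, D, Q)" by (cases s)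
 note simps = s adv_def pm_def ds_def qs_def ac_def
 show thesis
 proof (cases "act p D = {} & elig D ~= []")
  case True
  have "hd (elig D) \<in> c ` E" using hd_elig[of D] True deg_pos_iff by blast
  then show thesis using that(2)[of "hd (elig D)"] hd_elig[of D] True by (simp add: simps)
 next
  case False
  then have "adv s = s" by (auto simp: simps)
  then show thesis using that(1) False by (auto simp: simps(1,3-6))
 qed
qed

lemma adv_pm [simp]: "pm (adv s) = pm s" by (cases s rule: adv_cases) auto

lemma inv_adv: "inv s ==> inv (adv s)"
 by (cases s rule: adv_cases) (auto simp: inv_def)

lemma adv_empty: assumes "ac (adv s) = {}" "inv s" shows "c ` E \<subseteq> ds (adv s)"
proof (cases s rule: adv_cases)
 case 1
 then have "elig (ds s) = []" using assms by auto
 then show ?thesis using 1 cover by (auto simp: elig_def filter_empty_conv deg_pos_iff)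
next
 case (2 w)
 then obtain h where "h \<in> E" "c h = w" by auto
 then have "h \<in> ac (adv s)" using 2 assms(2) by (auto simp: ac_iff inv_def)
 then show ?thesis using assms by auto
qed

text \<open>A draw that changes nothing lies in a discovered community all the same: it is the
  active half-edge itself, or it is already paired, or every community is discovered. So
  \<open>c e\<close> is discovered after every step.\<close>

lemma grow_cases:
 assumes "inv s" "e \<in> E" "ac s = {} --> c ` E \<subseteq> ds s"
 obtains "grow s e = s" "c e \<in> ds s"
 | a where "a \<in> ac s" "e ~= a" "e \<in> unp (pm s)" "pm (grow s e) = (pm s)(a := e, e := a)"
   "ds (grow s e) = insert (c e) (ds s)" "qs (grow s e) = qs s"
proof -
 obtain p D Q where s: "s = (p, D, Q)" by (cases s)
 note simps = s grow_def pm_def ds_def qs_def ac_def Let_def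
 show thesis
 proof (cases "act p D = {}")
  case True
  then show thesis using that(1) assms(2,3) by (auto simp: simps)
 next
  case False
  define a where "a = (SOME h. h \<in> act p D)"
  have a: "a \<in> act p D" using False unfolding a_def by (metis ex_in_conv someI)
  show thesis
  proof (cases "e = a \<or> p e ~= e")
   case True
   then have "grow s e = s" using False by (auto simp: simps a_def)
   moreover have "c e \<in> ds s" using True a assms(1) by (auto simp: simps act_def inv_def)
   ultimately show thesis using that(1) by auto
  next
   case ne: False
   then have "grow s e = (p(a := e, e := a), insert (c e) D, Q)" using False by (simp add: simps a_def)
   then show thesis using that(2)[of a] a ne assms(2) by (simp add: pm_def ds_def qs_def ac_def unp_def s)
  qed
 qed
qed

lemma inv_grow:
 assumes "inv s" "e \<in> E" "ac s = {} --> c ` E \<subseteq> ds s"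
 shows "inv (grow s e)"
 using assms
proof (cases rule: grow_cases)
 case (2 a)
 have au: "a \<in> unp (pm s)" "c a \<in> ds s" using 2(1) by (auto simp: ac_iff unp_def)
 have v: "valid (pm (grow s e))" "unp (pm (grow s e)) = unp (pm s) - {a, e}"
  using valid_pair[of "pm s" a e] 2 au assms(1) by (auto simp: inv_def)
 have fin: "finite (unp (pm s))" using finE by (simp add: unp_def)
 have "card (unp (pm s) - {a, e}) = card (unp (pm s)) - 2" using au 2(2,3) fin by (subst card_Diff_subset) auto
 then have "even (card (unp (pm (grow s e))))" using v(2) assms(1) by (auto simp: inv_def)
 then show ?thesis using v(1) 2 au assms(1,2) by (auto simp: inv_def)
qed (use assms in auto)

lemma inv_init: "even (card E) ==> inv (id, {}, {})"
 by (auto simp: inv_def pm_def ds_def qs_def valid_def unp_def)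

lemma inv_st: "even (card E) ==> xs \<in> lists E ==> inv (st xs)"
proof (induction xs rule: rev_induct)
 case (snoc e xs)
 then have "inv (st xs)" "e \<in> E" by auto
 then show ?case unfolding st_snoc using inv_adv adv_empty by (intro inv_grow) auto
qed (simp add: st_Nil inv_init)

text \<open>This couples the draws with a uniform pairing. The half-edge to be paired next is a
  function of the past state, so \<open>uniform_step\<close> applies at each step.\<close>

lemma uniform_completion:
 assumes ev: "even (card E)" and ne: "E ~= {}"
 shows "bind_pmf (replicate_pmf L (pmf_of_set E)) (%es. pmf_of_set (Ext (pm (st es)))) = pmf_of_set (Ext id)"
proof (induction L)
 case 0
 then show ?case by (simp add: st_Nil pm_def bind_return_pmf id_def)
next
 case (Suc L)
 have set: "set_pmf (pmf_of_set E) = E" using finE ne by simp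
 have "bind_pmf (replicate_pmf (Suc L) (pmf_of_set E)) (%es. pmf_of_set (Ext (pm (st es)))) =
  bind_pmf (replicate_pmf L (pmf_of_set E)) (%xs. bind_pmf (pmf_of_set E) (%e. pmf_of_set (Ext (pm (st (xs @ [e]))))))"
  unfolding replicate_pmf_snoc by (simp add: bind_assoc_pmf bind_return_pmf)
 also have "... = bind_pmf (replicate_pmf L (pmf_of_set E)) (%xs. pmf_of_set (Ext (pm (st xs))))"
 proof (intro bind_pmf_cong refl)
  fix xs assume "xs \<in> set_pmf (replicate_pmf L (pmf_of_set E))"
  then have xs: "xs \<in> lists E" by (auto simp: set_replicate_pmf set)
  define s where "s = adv (st xs)"
  have s: "inv s" "pm s = pm (st xs)" using inv_adv[OF inv_st[OF ev xs]] by (auto simp: s_def)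
  show "bind_pmf (pmf_of_set E) (%e. pmf_of_set (Ext (pm (st (xs @ [e]))))) = pmf_of_set (Ext (pm (st xs)))"
  proof (cases "ac s = {}")
   case True
   then have "pm (grow s e) = pm s" for e by (auto simp: grow_def pm_def ds_def ac_def split: prod.splits)
   then show ?thesis unfolding st_snoc s_def[symmetric] by (simp add: s(2))
  next
   case False
   define a where "a = (SOME h. h \<in> ac s)"
   have "a \<in> ac s" using False unfolding a_def by (metis ex_in_conv someI)
   then have a: "a \<in> unp (pm s)" by (auto simp: ac_iff unp_def)
   have "pm (grow s e) = (if e = a \<or> pm s e ~= e then pm s else (pm s)(a := e, e := a))" for e
    using False by (auto simp: grow_def pm_def ds_def ac_def a_def Let_def split: prod.splits)
   then show ?thesis unfolding st_snoc s_def[symmetric]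
    using uniform_step[OF _ a] s by (simp add: inv_def)
  qed
 qed
 finally show ?case using Suc by simp
qed

lemma ds_eq: "even (card E) ==> xs \<in> lists E ==> ds (st xs) = qs (st xs) \<union> c ` set xs"
proof (induction xs rule: rev_induct)
 case (snoc e xs)
 then have xs: "xs \<in> lists E" "e \<in> E" "inv (st xs)" "ds (st xs) = qs (st xs) \<union> c ` set xs" using inv_st by auto
 have "ds (adv (st xs)) = qs (adv (st xs)) \<union> c ` set xs"
  by (cases "st xs" rule: adv_cases) (use xs in auto)
 moreover have "ds (grow (adv (st xs)) e) = insert (c e) (ds (adv (st xs)))" "qs (grow (adv (st xs)) e) = qs (adv (st xs))"
  using adv_empty[OF _ xs(3)]
  using grow_cases[OF inv_adv[OF xs(3)] xs(2)] by (metis insert_absorb)+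
 ultimately show ?case by (auto simp: st_snoc)
qed (simp add: st_Nil ds_def qs_def)

lemma fin_sets: "inv s ==> finite (ds s) & finite (qs s)"
 using finE finite_subset[of "ds s" "c ` E"] finite_subset[of "qs s" "ds s"] by (auto simp: inv_def)

lemma fin_ac: "finite (ac s)" using finE by (simp add: ac_def act_def)

text \<open>The exploration walk: active half-edges minus the total degree of the component starts.\<close>
definition walk :: "'e list => real" where
 "walk xs = real (card (ac (st xs))) - real (qd (st xs))"

text \<open>A start is added only when nothing is active. It makes its whole degree active and adds
  the same amount to \<open>qd\<close>, so the difference does not move.\<close>

lemma adv_qd:
 assumes "inv s"
 shows "real (card (ac (adv s))) - real (qd (adv s)) = real (card (ac s)) - real (qd s)"
  and "qd s <= qd (adv s)" and "(!!i. i \<in> c ` E ==> deg i <= B) ==> qd (adv s) <= qd s + B"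
  and "ac s ~= {} ==> adv s = s"
proof -
 have "(real (card (ac (adv s))) - real (qd (adv s)) = real (card (ac s)) - real (qd s)) & qd s <= qd (adv s)
  & ((ALL i:c ` E. deg i <= B) --> qd (adv s) <= qd s + B) & (ac s ~= {} --> adv s = s)"
 proof (cases s rule: adv_cases)
  case (2 w)
  have "w \<notin> qs s" using 2 assms by (auto simp: inv_def)
  then have q: "qd (adv s) = deg w + qd s" using 2 fin_sets[OF assms] by (simp add: qd_def)
  have "ac (adv s) = {h \<in> E. c h = w}" using 2 assms by (auto simp: ac_iff inv_def)
  then have "card (ac (adv s)) = deg w" by (simp add: deg_def)
  with q 2 show ?thesis by auto
 qed auto
 then show "real (card (ac (adv s))) - real (qd (adv s)) = real (card (ac s)) - real (qd s)" "qd s <= qd (adv s)"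
  "(!!i. i \<in> c ` E ==> deg i <= B) ==> qd (adv s) <= qd s + B" "ac s ~= {} ==> adv s = s" by auto
qed

text \<open>In a new community the drawn half-edge is used up, and so is the active one it is joined
  to, hence the degree minus 2. A draw in a discovered community matters only if it is active, when
  two active half-edges may disappear.\<close>

lemma walk_snoc:
 assumes ev: "even (card E)" and xs: "xs \<in> lists E" and e: "e \<in> E"
 shows "\<bar>walk (xs @ [e]) - walk xs - (if c e \<notin> ds (adv (st xs)) then dg (c e) - 2 else 0)\<bar> <= (if e \<in> ac (adv (st xs)) then 2 else 0)"
  and "qd (st (xs @ [e])) = qd (adv (st xs))" "qs (st (xs @ [e])) = qs (adv (st xs))"
  and "ds (st (xs @ [e])) = insert (c e) (ds (adv (st xs)))"
proof -
 define s where "s = adv (st xs)"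
 have s: "inv s" "ac s = {} --> c ` E \<subseteq> ds s" using inv_adv[OF inv_st[OF ev xs]] adv_empty inv_st[OF ev xs] by (auto simp: s_def)
 have w: "walk xs = real (card (ac s)) - real (qd s)" using adv_qd(1)[OF inv_st[OF ev xs]] by (simp add: walk_def s_def)
 have "\<bar>walk (xs @ [e]) - walk xs - (if c e \<notin> ds s then dg (c e) - 2 else 0)\<bar> <= (if e \<in> ac s then 2 else 0)
   & qd (st (xs @ [e])) = qd s & qs (st (xs @ [e])) = qs s & ds (st (xs @ [e])) = insert (c e) (ds s)"
  using s(1) e s(2)
 proof (cases rule: grow_cases)
  case 1
  then show ?thesis using w by (auto simp: walk_def st_snoc s_def[symmetric])
 next
  case (2 a)
  have q: "qd (grow s e) = qd s" by (simp add: qd_def 2)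
  have au: "a \<in> E" "c a \<in> ds s" "pm s a = a" using 2(1) by (auto simp: ac_iff)
  have pe: "pm s e = e" using 2(3) by (simp add: unp_def)
  show ?thesis
  proof (cases "c e \<in> ds s")
   case True
   have "ac (grow s e) = ac s - {a, e}" using 2 True by (auto simp: ac_iff fun_upd_def split: if_splits)
   moreover have eac: "e \<in> ac s" using True e pe by (auto simp: ac_iff)
   moreover have "card {a, e} <= card (ac s)" using 2(1) eac by (intro card_mono fin_ac) auto
   ultimately have "card (ac (grow s e)) + 2 = card (ac s)" using 2(1,2) fin_ac[of s] by (simp add: card_Diff_subset)
   then have "walk (xs @ [e]) = walk xs - 2" using w q by (simp add: walk_def st_snoc s_def[symmetric])
   then show ?thesis using True eac q 2 by (simp add: st_snoc s_def[symmetric])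
  next
   case False
   have ch: "pm s h = h" if "c h = c e" for h using False s(1) that unfolding inv_def by metis
   have new: "ac (grow s e) = (ac s - {a}) \<union> ({h \<in> E. c h = c e} - {e})"
    using 2 False ch au e by (auto simp: ac_iff fun_upd_def split: if_splits)
   have "card (ac (grow s e)) = card (ac s - {a}) + card ({h \<in> E. c h = c e} - {e})"
    unfolding new using fin_ac finE False by (intro card_Un_disjoint) (auto simp: ac_iff)
   also have "... = (card (ac s) - 1) + (deg (c e) - 1)"
    using 2(1) e finE fin_ac[of s] by (simp add: deg_def card_Diff_singleton)
   finally have "real (card (ac (grow s e))) = real (card (ac s)) + dg (c e) - 2"
   proof -
    have "card (ac s) > 0" using 2(1) fin_ac[of s] by (auto simp: card_gt_0_iff)
    moreover assume "card (ac (grow s e)) = (card (ac s) - 1) + (deg (c e) - 1)"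
    ultimately show ?thesis using deg_pos[OF e] by linarith
   qed
   then have "walk (xs @ [e]) = walk xs + dg (c e) - 2" using w q by (simp add: walk_def st_snoc s_def[symmetric])
   then show ?thesis using False q 2 by (simp add: st_snoc s_def[symmetric])
  qed
 qed
 then show "\<bar>walk (xs @ [e]) - walk xs - (if c e \<notin> ds (adv (st xs)) then dg (c e) - 2 else 0)\<bar> <= (if e \<in> ac (adv (st xs)) then 2 else 0)"
  "qd (st (xs @ [e])) = qd (adv (st xs))" "qs (st (xs @ [e])) = qs (adv (st xs))"
  "ds (st (xs @ [e])) = insert (c e) (ds (adv (st xs)))" unfolding s_def by auto
qed

lemma Ext_snoc:
 assumes "even (card E)" "xs \<in> lists E" "e \<in> E" "m \<in> Ext (pm (st (xs @ [e])))"
 shows "m \<in> Ext (pm (st xs))"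
proof -
 define s where "s = adv (st xs)"
 have s: "inv s" "ac s = {} --> c ` E \<subseteq> ds s" "pm s = pm (st xs)"
  using inv_adv[OF inv_st[OF assms(1,2)]] adv_empty inv_st[OF assms(1,2)] by (auto simp: s_def)
 have "m \<in> Ext (pm s)"
  using s(1) assms(3) s(2)
 proof (cases rule: grow_cases)
  case 1
  then show ?thesis using assms(4) by (simp add: st_snoc s_def[symmetric])
 next
  case (2 a)
  have "a \<in> unp (pm s)" using 2(1) by (auto simp: ac_iff unp_def)
  then show ?thesis using Ext_pair[of "pm s" a e] 2 s(1) assms(4) by (simp add: inv_def st_snoc s_def[symmetric])
 qed
 then show ?thesis using s by simp
qed

end

section \<open>Zeros of the exploration and connected components\<close>

locale exploration_run = exploration E c ws for E :: "'e set" and c :: "'e => 'i" and ws +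
 fixes xs :: "'e list"
 assumes ev: "even (card E)" and xs: "xs \<in> lists E"
begin

abbreviation S where "S k \<equiv> st (take k xs)"

text \<open>Times at which no component is under exploration; a next start, if any, has yet to be
  made.\<close>

definition zer :: "nat => bool" where "zer k \<longleftrightarrow> k <= length xs & ac (S k) = {}"

lemma take_lists: "take k xs \<in> lists E" using xs by (auto dest: in_set_takeD)

lemma inv_S: "inv (S k)" by (rule inv_st[OF ev take_lists])

lemma nth_E: "k < length xs ==> xs ! k \<in> E" using xs by (auto simp: in_lists_conv_set)

lemma S_Suc: "k < length xs ==> S (Suc k) = grow (adv (S k)) (xs ! k)"
 by (simp add: take_Suc_conv_app_nth st_snoc)

lemma zer0: "zer 0" by (simp add: zer_def st_Nil ac_def act_def ds_def)

lemma step_facts: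
 assumes "k < length xs"
 shows "qd (S (Suc k)) = qd (adv (S k))" "qs (S (Suc k)) = qs (adv (S k))" "ds (S (Suc k)) = insert (c (xs ! k)) (ds (adv (S k)))"
 using walk_snoc[OF ev take_lists nth_E[OF assms], of k] assms by (auto simp: take_Suc_conv_app_nth)

lemma adv_mono: "ds s \<subseteq> ds (adv s)" "qs s \<subseteq> qs (adv s)"
 by (cases s rule: adv_cases; auto)+

lemma S_mono:
 assumes "j <= k" "k <= length xs"
 shows "qd (S j) <= qd (S k) & ds (S j) \<subseteq> ds (S k) & qs (S j) \<subseteq> qs (S k)"
 using assms
proof (induction k rule: dec_induct)
 case (step k)
 then show ?case using step_facts[of k] adv_qd(2)[OF inv_S, of k] adv_mono[of "S k"] by auto
qed simp

lemma qd_after_zero: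
 assumes "z <= k" "k <= length xs" "!!j. z < j ==> j <= k ==> ac (S j) ~= {}" and B: "!!i. i \<in> c ` E ==> deg i <= B"
 shows "qd (S k) <= qd (S z) + B"
proof -
 \<comment> \<open>A start made at \<open>z\<close> shows in \<open>qd\<close> only one step later,
   and no other start follows before the next zero.\<close>
 have "qd (S k) <= (if k = z then qd (S z) else qd (S z) + B)"
  using assms(1-3)
 proof (induction k rule: dec_induct)
  case (step k)
  have e: "qd (S (Suc k)) = qd (adv (S k))" using step_facts[of k] step by simp
  show ?case
  proof (cases "k = z")
   case True
   then show ?thesis using adv_qd(3)[OF inv_S B, of k] e by simp
  next
   case False
   then have "adv (S k) = S k" using step adv_qd(4)[OF inv_S] by simp
   then show ?thesis using e step False by simp
  qed
 qed simp
 then show ?thesis by (auto split: if_splits)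
qed

text \<open>At a zero the walk equals \<open>- qd\<close>. As \<open>qd\<close> never decreases and
  the number of active half-edges is nonnegative, the walk was at least as high at all earlier
  times.\<close>

lemma walk_zero_le:
 assumes "zer z" "j <= z"
 shows "walk (take z xs) <= walk (take j xs)"
 using S_mono[OF assms(2)] assms(1) by (auto simp: walk_def zer_def)

lemma walk_after_zero:
 assumes "zer z" "z <= k" "k <= length xs" "!!j. z < j ==> j <= k ==> ~ zer j" and B: "!!i. i \<in> c ` E ==> deg i <= B"
 shows "walk (take k xs) >= walk (take z xs) - real B"
proof -
 have "qd (S k) <= qd (S z) + B" by (rule qd_after_zero[OF assms(2,3) _ B]) (use assms in "auto simp: zer_def")
 then show ?thesis using assms(1) by (auto simp: walk_def zer_def)
qed

lemma Ext_take:
 assumes "m \<in> Ext (pm (st xs))" "k <= length xs"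
 shows "m \<in> Ext (pm (S k))"
 using assms(2)
proof (induction k rule: inc_induct)
 case (step k)
 have "xs ! k \<in> E" using nth_E step by auto
 then show ?case using Ext_snoc[OF ev take_lists, of "xs ! k" m k] step by (auto simp: take_Suc_conv_app_nth)
qed (use assms in auto)

lemma pm_mono:
 assumes "pm (S j) h ~= h" "j <= k" "k <= length xs"
 shows "pm (S k) h ~= h"
 using assms(2,3)
proof (induction k rule: dec_induct)
 case (step k)
 define s where "s = adv (S k)"
 have s: "inv s" "ac s = {} --> c ` E \<subseteq> ds s" "pm s h ~= h"
  using inv_adv[OF inv_S] adv_empty[OF _ inv_S] step by (auto simp: s_def)
 have kl: "k < length xs" using step by simp
 have "pm (grow s (xs ! k)) h ~= h" by (rule grow_cases[OF s(1) nth_E[OF kl] s(2)]) (use s in auto)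
 then show ?case by (simp add: S_Suc[OF kl] s_def)
qed (use assms in auto)

context
 fixes m assumes m: "m \<in> Ext (pm (st xs))"
begin

text \<open>At a zero every half-edge of a discovered community is already paired, with a partner in
  a discovered community, and \<open>m\<close> keeps these pairs. The discovered set is therefore a
  union of components.\<close>

lemma closed_zer:
 assumes "zer z" "(i, j) \<in> reach m"
 shows "i \<in> ds (S z) \<longleftrightarrow> j \<in> ds (S z)"
proof -
 have mz: "m \<in> Ext (pm (S z))" using Ext_take[OF m] assms by (simp add: zer_def)
 have cl: "c (m h) \<in> ds (S z)" if "h \<in> E" "c h \<in> ds (S z)" for h
 proof -
  have "pm (S z) h ~= h" using assms(1) that by (auto simp: zer_def ac_iff)
  then have "m h = pm (S z) h" "pm (S z) (pm (S z) h) = h" using mz inv_S[of z] by (auto simp: Ext_def inv_def valid_def)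
  moreover have "pm (S z) (m h) ~= m h" using \<open>pm (S z) h ~= h\<close> calculation by metis
  ultimately show ?thesis using inv_S[of z] unfolding inv_def by blast
 qed
 have *: "i \<in> ds (S z) \<longleftrightarrow> j \<in> ds (S z)" if "(i, j) \<in> {(c h, c (m h)) |h. h \<in> E}" for i j
 proof -
  have "EX h. h \<in> E & i = c h & j = c (m h)" using that by auto
  then obtain h where h: "h \<in> E" "i = c h" "j = c (m h)" by blast
  then have "m h \<in> E" "m (m h) = h" using m by (auto simp: Ext_def)
  then show ?thesis using cl[of h] cl[of "m h"] h by auto
 qed
 show ?thesis using assms(2) unfolding reach_def
 proof (induction rule: rtrancl_induct)
  case (step y z')
  then show ?case using *[of y z'] by blast
 qed simp
qed

lemma new_vertex:
 assumes k: "k < length xs" and new: "c (xs ! k) \<notin> ds (adv (S k))"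
 obtains a where "a \<in> ac (adv (S k))" "(c a, c (xs ! k)) \<in> {(c h, c (m h)) |h. h \<in> E}"
proof -
 define s where "s = adv (S k)"
 have s: "inv s" "ac s = {} --> c ` E \<subseteq> ds s" using inv_adv[OF inv_S] adv_empty[OF _ inv_S] by (auto simp: s_def)
 show thesis
 proof (rule grow_cases[OF s(1) nth_E[OF k] s(2)])
  assume "c (xs ! k) \<in> ds s"
  then show thesis using new by (simp add: s_def)
 next
  fix a assume a: "a \<in> ac s" "xs ! k ~= a" "pm (grow s (xs ! k)) = (pm s)(a := xs ! k, xs ! k := a)"
  have "m \<in> Ext (pm (grow s (xs ! k)))" using Ext_take[OF m, of "Suc k"] S_Suc[OF k] k by (simp add: s_def)
  then have "m a = xs ! k" using a by (auto simp: Ext_def dest!: spec[of _ a])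
  then have "(c a, c (xs ! k)) = (c a, c (m a)) & a \<in> E" using a(1) by (auto simp: ac_iff)
  then show thesis using that[of a] a(1) unfolding s_def by blast
 qed
qed

text \<open>Each community found between the two zeros is joined to an active half-edge. None was
  active at \<open>z1\<close>, so that half-edge belongs to a community found after
  \<open>z1\<close>, and all of them hang together with the one start \<open>w\<close>. Closedness
  at both zeros gives the converse inclusion. The hypothesis \<open>ne\<close> excludes the idle
  steps after everything has been found.\<close>

lemma gap_component:
 assumes z: "zer z1" "zer z2" "z1 < z2" "!!j. z1 < j ==> j < z2 ==> ~ zer j" and ne: "ds (S z2) ~= ds (S z1)"
 shows "EX w. w \<in> ds (S z2) - ds (S z1) & ds (S z2) - ds (S z1) = reach m `` {w} & qs (S z2) = insert w (qs (S z1)) & w \<notin> qs (S z1)"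
proof -
 have z2: "z2 <= length xs" using z by (simp add: zer_def)
 show ?thesis
 proof (cases "S z1" rule: adv_cases)
  case 1
  then have "elig (ds (S z1)) = []" using z by (simp add: zer_def)
  then have "c ` E \<subseteq> ds (S z1)" using cover by (auto simp: elig_def filter_empty_conv deg_pos_iff)
  then show ?thesis using inv_S[of z2] ne S_mono[of z1 z2] z2 z(3) by (auto simp: inv_def)
 next
  case (2 w)
  have main: "w \<in> ds (S k) & ds (S k) - ds (S z1) \<subseteq> reach m `` {w} & qs (S k) = insert w (qs (S z1))"
   if "Suc z1 <= k" "k <= z2" for k
   using that
  proof (induction k rule: dec_induct)
   case base
   have lz: "z1 < length xs" using z z2 by simp
   have "ds (S (Suc z1)) - ds (S z1) \<subseteq> reach m `` {w}"
   proof (cases "c (xs ! z1) \<in> ds (adv (S z1))")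
    case True
    then show ?thesis using step_facts(3)[OF lz] 2 by (auto simp: reach_def)
   next
    case False
    then obtain a where a: "a \<in> ac (adv (S z1))" "(c a, c (xs ! z1)) \<in> {(c h, c (m h)) |h. h \<in> E}"
     using new_vertex[OF lz] by blast
    have "a \<notin> ac (S z1)" using z(1) by (auto simp: zer_def)
    then have "c a = w" using a(1) 2 by (auto simp: ac_iff)
    then have "(w, c (xs ! z1)) \<in> reach m" using a(2) unfolding reach_def by blast
    then show ?thesis using step_facts(3)[OF lz] 2 by (auto simp: reach_def)
   qed
   then show ?case using step_facts[OF lz] 2 by auto
  next
   case (step k)
   have lk: "k < length xs" using step(1,2,4) z2 by simp
   have sk: "adv (S k) = S k" using adv_qd(4)[OF inv_S, of k] z(4)[of k] step(1,2,4) lk by (auto simp: zer_def)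
   have IH: "w \<in> ds (S k)" "ds (S k) - ds (S z1) \<subseteq> reach m `` {w}" "qs (S k) = insert w (qs (S z1))"
    using step by auto
   have "ds (S (Suc k)) - ds (S z1) \<subseteq> reach m `` {w}"
   proof (cases "c (xs ! k) \<in> ds (adv (S k))")
    case True
    then show ?thesis using step_facts(3)[OF lk] IH sk by auto
   next
    case False
    then obtain a where "a \<in> ac (adv (S k))" "(c a, c (xs ! k)) \<in> {(c h, c (m h)) |h. h \<in> E}"
     using new_vertex[OF lk] by blast
    then have a: "a \<in> ac (S k)" "(c a, c (xs ! k)) \<in> {(c h, c (m h)) |h. h \<in> E}" using sk by auto
    \<comment> \<open>Otherwise \<open>a\<close> was paired at \<open>z1\<close>, hence still is,
      and could not be active.\<close>
    have "c a \<notin> ds (S z1)"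
    proof
     assume "c a \<in> ds (S z1)"
     then have "pm (S z1) a ~= a" using a(1) z(1) by (auto simp: zer_def ac_iff)
     then have "pm (S k) a ~= a" using pm_mono[of z1 a k] step(1) lk by simp
     with a(1) show False by (simp add: ac_iff)
    qed
    then have "(w, c a) \<in> reach m" using IH(2) a(1) by (auto simp: ac_iff)
    then have "(w, c (xs ! k)) \<in> reach m" using a(2) unfolding reach_def by (rule rtrancl_into_rtrancl)
    then show ?thesis using step_facts(3)[OF lk] sk IH(2) by auto
   qed
   then show ?case using step_facts[OF lk] sk IH by auto
  qed
  from main[of z2] z have sub: "w \<in> ds (S z2)" "ds (S z2) - ds (S z1) \<subseteq> reach m `` {w}" "qs (S z2) = insert w (qs (S z1))" by auto
  have "reach m `` {w} \<subseteq> ds (S z2) - ds (S z1)"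
   using closed_zer[OF z(1), of w] closed_zer[OF z(2), of w] sub(1) 2 by auto
  then show ?thesis using sub 2 inv_S[of z1] by (intro exI[of _ w]) (auto simp: inv_def)
 qed
qed

lemma discovered_component:
 assumes z: "zer z" and w: "w \<in> ds (S z)"
 shows "EX z1 z2. zer z1 & zer z2 & z1 < z2 & z2 <= z & (ALL j. z1 < j & j < z2 --> ~ zer j) &
  w \<in> ds (S z2) - ds (S z1) & reach m `` {w} = ds (S z2) - ds (S z1)"
proof -
 \<comment> \<open>\<open>z2\<close> is the first zero at which \<open>w\<close> is discovered and
   \<open>z1\<close> the last zero before it, so the gap between them produced
   \<open>w\<close>.\<close>
 define z2 where "z2 = (LEAST y. zer y & w \<in> ds (S y))"
 have z2: "zer z2" "w \<in> ds (S z2)" "z2 <= z"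
  using LeastI[of "%y. zer y & w \<in> ds (S y)" z] Least_le[of "%y. zer y & w \<in> ds (S y)" z] z w by (auto simp: z2_def)
 have z2pos: "z2 > 0" using z2(2) by (cases z2) (auto simp: st_Nil ds_def)
 define z1 where "z1 = Max {y. zer y & y < z2}"
 have fin: "finite {y. zer y & y < z2}" and "0 \<in> {y. zer y & y < z2}" using zer0 z2pos by auto
 then have z1: "zer z1" "z1 < z2" "!!y. zer y ==> y < z2 ==> y <= z1"
  using Max_in[OF fin] Max_ge[OF fin] unfolding z1_def by blast+
 have "w \<notin> ds (S z1)" using not_less_Least[of z1 "%y. zer y & w \<in> ds (S y)"] z1 by (auto simp: z2_def)
 moreover have nz: "~ zer j" if "z1 < j" "j < z2" for j using z1(3)[of j] that by auto
 ultimately obtain w0 where w0: "ds (S z2) - ds (S z1) = reach m `` {w0}"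
  using gap_component[OF z1(1) z2(1) z1(2)] z2(2) by blast
 have "(w0, w) \<in> reach m" using w0 z2(2) \<open>w \<notin> ds (S z1)\<close> by blast
 moreover have "(w, w0) \<in> reach m" using calculation sym_reach[OF m] by (meson symD)
 moreover have "trans (reach m)" unfolding reach_def by (rule trans_rtrancl)
 ultimately have "reach m `` {w} = reach m `` {w0}" by (auto dest: transD)
 then show ?thesis using w0 z1 z2 nz \<open>w \<notin> ds (S z1)\<close> by blast
qed

end

text \<open>Starts are left out because uniform draws did not find them; the remaining communities
  were found by uniform draws, which is why the volume grows linearly. The single start of a gap is
  added again in \<open>vol_gap\<close>.\<close>

definition vol :: "('i => real) => nat => real" where
 "vol f k = (\<Sum>i\<in>ds (S k) - qs (S k). f i)"

lemma vol_Suc: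
 assumes k: "k < length xs"
 shows "vol f (Suc k) = vol f k + (if c (xs ! k) \<notin> ds (adv (S k)) then f (c (xs ! k)) else 0)"
proof -
 have inv: "inv (S k)" "inv (adv (S k))" using inv_S inv_adv by auto
 have adv: "ds (adv (S k)) - qs (adv (S k)) = ds (S k) - qs (S k)"
  by (cases "S k" rule: adv_cases) (use inv in "auto simp: inv_def")
 show ?thesis
 proof (cases "c (xs ! k) \<in> ds (adv (S k))")
  case True
  then show ?thesis using step_facts[OF k] adv by (simp add: vol_def insert_absorb)
 next
  case False
  then have "ds (S (Suc k)) - qs (S (Suc k)) = insert (c (xs ! k)) (ds (adv (S k)) - qs (adv (S k)))"
   using step_facts[OF k] inv(2) by (auto simp: inv_def)
  moreover have "finite (ds (adv (S k)) - qs (adv (S k)))" using fin_sets[OF inv(2)] by auto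
  moreover have "c (xs ! k) \<notin> ds (S k) - qs (S k)" using False adv by blast
  ultimately have "vol f (Suc k) = f (c (xs ! k)) + vol f k" unfolding vol_def by (simp add: adv)
  then show ?thesis using False by simp
 qed
qed

lemma vol_gap:
 assumes "z1 <= z2" "z2 <= length xs" "w \<in> ds (S z2) - ds (S z1)" "qs (S z2) = insert w (qs (S z1))" "w \<notin> qs (S z1)"
 shows "(\<Sum>i\<in>ds (S z2) - ds (S z1). f i) = vol f z2 - vol f z1 + f w"
proof -
 have fin: "finite (ds (S z1))" "finite (ds (S z2))" "finite (qs (S z1))" "finite (qs (S z2))" using fin_sets[OF inv_S] by auto
 have sub: "ds (S z1) \<subseteq> ds (S z2)" "qs (S z1) \<subseteq> ds (S z1)" "qs (S z2) \<subseteq> ds (S z2)"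
  using S_mono[OF assms(1,2)] inv_S by (auto simp: inv_def)
 have "sum f (ds (S z2) - ds (S z1)) = sum f (ds (S z2)) - sum f (ds (S z1))" using fin sub by (simp add: sum_diff)
 moreover have "vol f z2 = sum f (ds (S z2)) - sum f (qs (S z2))" "vol f z1 = sum f (ds (S z1)) - sum f (qs (S z1))"
  using fin sub by (simp_all add: vol_def sum_diff)
 moreover have "sum f (qs (S z2)) = f w + sum f (qs (S z1))" using assms fin by simp
 ultimately show ?thesis by simp
qed

lemma start_from_prefix:
 assumes ws: "ws = us @ vs" and u: "u \<in> set us" "u \<in> c ` E" "u \<notin> ds s" "qs s \<subseteq> set us"
 shows "qs (adv s) \<subseteq> set us"
proof (cases s rule: adv_cases)
 case (2 w)
 let ?F = "filter (%w. w \<notin> ds s & deg w > 0) us"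
 have "u \<in> set ?F" using u deg_pos_iff[of u] by auto
 then have ne: "?F ~= []" by (metis list.set(1) empty_iff)
 have "elig (ds s) = ?F @ filter (%w. w \<notin> ds s & deg w > 0) vs" unfolding elig_def by (subst ws) simp
 then have "w = hd ?F" using 2(3) ne by simp
 then have "w \<in> set us" using hd_in_set[OF ne] by auto
 then show ?thesis using 2 u by auto
qed (use u in auto)

text \<open>As long as \<open>u\<close> is undiscovered it is an eligible entry of the prefix, so
  any next start comes from the prefix. The total degree of the starts is then at most that of the
  prefix.\<close>

lemma starts_in_prefix:
 assumes ws: "ws = us @ vs" and u: "u \<in> set us" "u \<in> c ` E" and k: "k <= length xs" "u \<notin> ds (S k)"
 shows "qs (adv (S k)) \<subseteq> set us"
 using k
proof (induction k)
 case 0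
 show ?case using 0 by (intro start_from_prefix[OF ws u]) (simp_all add: st_Nil qs_def)
next
 case (Suc k)
 have k: "k < length xs" using Suc by simp
 have "u \<notin> ds (S k)" using S_mono[of k "Suc k"] Suc by auto
 then have "qs (adv (S k)) \<subseteq> set us" using Suc by simp
 then show ?case using start_from_prefix[OF ws u Suc(3)] step_facts(2)[OF k] by simp
qed

end

section \<open>Excursions and approximate zeros\<close>

text \<open>The ranking of \<open>ordered_excursion_lengths\<close> for an arbitrary index set, so
  that component sizes, gaps and excursions are compared by one device.\<close>

definition rk :: "'a set => ('a => real) => nat => real" where
 "rk I len j = Sup ({0} \<union> {x. x > 0 & (infinite {e \<in> I. len e >= x} \<or> card {e \<in> I. len e >= x} > j)})"

lemma many_iff: "(infinite A \<or> card A > j) \<longleftrightarrow> (EX F. F \<subseteq> A & finite F & card F = Suc j)"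
proof
 assume "infinite A \<or> card A > j"
 then show "EX F. F \<subseteq> A & finite F & card F = Suc j"
  by (metis Suc_leI infinite_arbitrarily_large obtain_subset_with_card_n finite_subset)
next
 assume "EX F. F \<subseteq> A & finite F & card F = Suc j"
 then show "infinite A \<or> card A > j" by (metis card_mono less_eq_Suc_le)
qed

lemma rk_alt: "rk I len j = Sup ({0} \<union> {x. x > 0 & (EX F. F \<subseteq> I & (ALL e:F. len e >= x) & finite F & card F = Suc j)})"
proof -
 have "F \<subseteq> {e \<in> I. len e >= x} \<longleftrightarrow> F \<subseteq> I & (ALL e:F. len e >= x)" for F x by auto
 then show ?thesis unfolding rk_def many_iff by (simp add: conj_assoc)
qed

lemma rk_gtD:
 fixes len :: "'a => real"
 assumes "rk I len j > y" "y >= 0"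
 obtains F where "F \<subseteq> I" "finite F" "card F = Suc j" "!!e. e \<in> F ==> len e > y"
proof -
 define S where "S = {0} \<union> {x. x > 0 & (EX F. F \<subseteq> I & (ALL e:F. len e >= x) & finite F & card F = Suc j)}"
 have "y < Sup S" using assms(1) unfolding rk_alt S_def .
 then have "EX x:S. y < x" by (intro less_cSupD) (auto simp: S_def)
 then obtain x where x: "x \<in> S" "x > y" by auto
 with assms(2) obtain F where "F \<subseteq> I" "ALL e:F. len e >= x" "finite F" "card F = Suc j" by (auto simp: S_def)
 with x(2) show thesis by (intro that[of F]) force+
qed

lemma rk_bdd:
 fixes len :: "'a => real"
 assumes "!!e. e \<in> I ==> len e <= B"
 shows "bdd_above ({0} \<union> {x. x > 0 & (EX F. F \<subseteq> I & (ALL e:F. len e >= x) & finite F & card F = Suc j)})"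
proof (intro bdd_aboveI[of _ "max 0 B"])
 fix x assume "x \<in> {0} \<union> {x. x > 0 & (EX F. F \<subseteq> I & (ALL e:F. len e >= x) & finite F & card F = Suc j)}"
 then consider "x = 0" | F where "F \<subseteq> I" "ALL e:F. len e >= x" "card F = Suc j" by auto
 then show "x <= max 0 B"
 proof cases
  case 2
  then obtain e where "e \<in> F" by fastforce
  with 2 assms[of e] show ?thesis by force
 qed simp
qed

lemma rk_nonneg:
 assumes "!!e. e \<in> I ==> len e <= B"
 shows "rk I len j >= 0"
 unfolding rk_alt by (rule cSup_upper[OF _ rk_bdd[OF assms]]) auto

lemma rk_gtI:
 assumes "F \<subseteq> I" "finite F" "card F = Suc j" "!!e. e \<in> F ==> len e > y" "y >= 0"
  "!!e. e \<in> I ==> len e <= B"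
 shows "rk I len j > y"
proof -
 define x where "x = Min (len ` F)"
 have ne: "F ~= {}" using assms(3) by auto
 have xy: "x > y" using assms(2,4) ne by (simp add: x_def)
 have "x \<in> {0} \<union> {x. x > 0 & (EX F. F \<subseteq> I & (ALL e:F. len e >= x) & finite F & card F = Suc j)}"
  using xy assms(1-3,5) ne by (auto simp: x_def intro!: exI[of _ F])
 then have "x <= rk I len j" unfolding rk_alt by (rule cSup_upper[OF _ rk_bdd[OF assms(6)]])
 with xy show ?thesis by simp
qed

lemma rk_upper:
 assumes "!!e. e \<in> I ==> len e <= B" "B >= 0"
 shows "rk I len j <= B"
proof (rule ccontr)
 assume "~ ?thesis"
 then have "rk I len j > B" by simp
 then obtain F where F: "F \<subseteq> I" "card F = Suc j" "!!e. e \<in> F ==> len e > B" using rk_gtD[OF _ assms(2)] by metis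
 then obtain e where "e \<in> F" by fastforce
 with F assms(1)[of e] show False by force
qed

text \<open>The injection \<open>h\<close> carries \<open>j + 1\<close> elements longer than the
  right side to as many elements of \<open>I'\<close>, each shorter by at most
  \<open>\<delta>\<close>. Elements of length up to \<open>y0\<close> are not controlled, whence the
  maximum.\<close>

lemma rk_le_comp:
 assumes y0: "y0 >= 0" and B: "!!e. e \<in> I' ==> len' e <= B" and
  inj: "inj_on h {e \<in> I. len e > y0}" and
  h: "!!e. e \<in> I ==> len e > y0 ==> h e \<in> I' & len' (h e) >= len e - \<delta>" and "\<delta> >= 0"
 shows "rk I len j <= max y0 (rk I' len' j + \<delta>)"
proof (rule ccontr)
 assume a: "~ ?thesis"
 define y where "y = max y0 (rk I' len' j + \<delta>)"
 have r0: "rk I' len' j >= 0" by (rule rk_nonneg[OF B])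
 have ry: "rk I len j > y" "y >= 0" using a y0 by (auto simp: y_def)
 then obtain F where F: "F \<subseteq> I" "finite F" "card F = Suc j" "!!e. e \<in> F ==> len e > y"
  using rk_gtD by metis
 have FF: "F \<subseteq> {e \<in> I. len e > y0}" using F by (auto simp: y_def)
 have "rk I' len' j > y - \<delta>"
 proof (rule rk_gtI[OF _ _ _ _ _ B])
  show "h ` F \<subseteq> I'" using FF h by auto
  show "finite (h ` F)" using F by simp
  show "card (h ` F) = Suc j" using F(3) inj_on_subset[OF inj FF] by (simp add: card_image)
  show "y - \<delta> >= 0" using r0 by (auto simp: y_def)
  fix e assume "e \<in> h ` F"
  then obtain e' where "e' \<in> F" "e = h e'" by auto
  then show "len' e > y - \<delta>" using F(4)[of e'] h[of e'] FF by force
 qed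
 then show False by (simp add: y_def)
qed

lemma rk_mono:
 assumes "I \<subseteq> I'" "!!e. e \<in> I' ==> len e <= B"
 shows "rk I len j <= rk I' len j"
 using rk_le_comp[of 0 I' len B "%x. x" I len 0 j] assms rk_nonneg[of I' len B j] by auto

definition gaps :: "real set => (real \<times> real) set" where
 "gaps Z = {(a, b). a \<in> Z & b \<in> Z & a < b & (ALL z:Z. ~ (a < z & z < b))}"

definition glen :: "real \<times> real => real" where "glen e = snd e - fst e"

text \<open>Zeros of the exploration process, up to an error \<open>\<epsilon>\<close>: each point of \<open>Z\<close> is a near running
 minimum of \<open>f\<close>, and between points of \<open>Z\<close> the function stays almost above the last such minimum.\<close>
definition edec :: "real => real => (real => real) => real set => bool" where
 "edec T \<epsilon> f Z \<longleftrightarrow> finite Z & Z \<subseteq> {0..T} & 0 \<in> Z &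
   (ALL z:Z. ALL t:{0..z}. f z <= f t + \<epsilon>) &
   (ALL z:Z. ALL t:{0..T}. z <= t & (ALL z':Z. z' <= t --> z' <= z) --> f t >= f z - \<epsilon>)"

lemma edec_last:
 assumes "edec T \<epsilon> f Z" "t \<in> {0..T}"
 obtains z where "z \<in> Z" "z <= t" "!!z'. z' \<in> Z ==> z' <= t ==> z' <= z" "f t >= f z - \<epsilon>"
proof -
 define z where "z = Max {z \<in> Z. z <= t}"
 have fin: "finite {z \<in> Z. z <= t}" and "0 \<in> {z \<in> Z. z <= t}" using assms by (auto simp: edec_def)
 then have "z \<in> {z \<in> Z. z <= t}" unfolding z_def using Max_in by blast
 moreover have "!!z'. z' \<in> Z ==> z' <= t ==> z' <= z" unfolding z_def using fin by simp
 ultimately show thesis using assms that[of z] unfolding edec_def by auto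
qed

text \<open>Each condition compares two values of the path, which accounts for
  \<open>2 * \<delta>\<close>. This stability is the source of the Lipschitz property of
  \<open>infconv\<close>.\<close>

lemma edec_shift:
 assumes "edec T \<epsilon> f Z" "!!t. t \<in> {0..T} ==> \<bar>f t - g t\<bar> <= \<delta>"
 shows "edec T (\<epsilon> + 2 * \<delta>) g Z"
 unfolding edec_def
proof (intro conjI ballI impI)
 fix z t assume z: "z \<in> Z" "t \<in> {0..z}"
 then have "z \<in> {0..T}" "t \<in> {0..T}" "f z <= f t + \<epsilon>" using assms(1) unfolding edec_def by force+
 then show "g z <= g t + (\<epsilon> + 2 * \<delta>)" using assms(2)[of z] assms(2)[of t] by auto
next
 fix z t assume z: "z \<in> Z" "t \<in> {0..T}" "z <= t & (ALL z':Z. z' <= t --> z' <= z)"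
 then have "z \<in> {0..T}" "f z - \<epsilon> <= f t" using assms(1) unfolding edec_def by auto
 then show "g z - (\<epsilon> + 2 * \<delta>) <= g t" using assms(2)[of z] assms(2)[of t] z(2) by auto
qed (use assms(1) in "auto simp: edec_def")

lemma edec_mono: "edec T \<epsilon> f Z ==> \<epsilon> <= \<epsilon>' ==> edec T \<epsilon>' f Z"
 using edec_shift[of T \<epsilon> f Z f "(\<epsilon>' - \<epsilon>) / 2"] by (simp add: field_simps)

definition excT :: "real => (real => real) => (real \<times> real) set" where
 "excT T f = {e \<in> excursions (reflected f). snd e <= T}"

text \<open>Quantifying over rationals makes this almost sure for a random path once it is almost
  sure for each triple.\<close>

definition distinct_minima :: "(real => real) => bool" where
 "distinct_minima f \<longleftrightarrow> (ALL b:\<rat>. ALL c:\<rat>. ALL d:\<rat>. 0 < b & b < c & c < d --> (INF s\<in>{0..b}. f s) ~= (INF s\<in>{c..d}. f s))"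

lemma INF_attained:
 fixes f :: "real => real"
 assumes "u \<in> A" "!!s. s \<in> A ==> f u <= f s"
 shows "(INF s\<in>A. f s) = f u"
 using assms by (intro cInf_eq_minimum) auto

lemma cont_INF:
 fixes f :: "real => real"
 assumes "continuous_on {a..b} f" "a <= b"
 obtains u where "u \<in> {a..b}" "!!s. s \<in> {a..b} ==> f u <= f s" "(INF s\<in>{a..b}. f s) = f u"
proof -
 obtain u where u: "u \<in> {a..b}" "ALL s:{a..b}. f u <= f s"
  using continuous_attains_inf[of "{a..b}" f] assms by auto
 then show thesis using that[of u] INF_attained[of u "{a..b}" f] by auto
qed

text \<open>Rational endpoints are squeezed in so that \<open>u\<close> minimises over an initial
  interval and \<open>v\<close> over a later disjoint one. The case \<open>v = v''\<close> with
  \<open>v\<close> rational serves for the end of the time window.\<close>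

lemma distinct_minimaD:
 assumes dm: "distinct_minima f" and u: "0 <= u" "u < u'" "!!s. s \<in> {0..u'} ==> f u <= f s"
  and v: "u' <= v'" "v' < v" "v <= v''" "v < v'' \<or> v \<in> \<rat>" "!!s. s \<in> {v'..v''} ==> f v <= f s"
 shows "f u ~= f v"
proof -
 obtain b where b: "b \<in> \<rat>" "u < b" "b < u'" using Rats_dense_in_real[OF u(2)] by auto
 obtain c where c: "c \<in> \<rat>" "v' < c" "c < v" using Rats_dense_in_real[OF v(2)] by auto
 obtain d where d: "d \<in> \<rat>" "v <= d" "d <= v''"
  using v(4) Rats_dense_in_real[of v v''] v(3) by (meson less_eq_real_def)
 have "(INF s\<in>{0..b}. f s) = f u" using u b by (intro INF_attained) auto
 moreover have "(INF s\<in>{c..d}. f s) = f v" using v c d by (intro INF_attained) auto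
 moreover have "(INF s\<in>{0..b}. f s) ~= (INF s\<in>{c..d}. f s)"
  using dm b c d u v unfolding distinct_minima_def by (smt (verit))
 ultimately show ?thesis by simp
qed

lemma reflected_zero_iff:
 assumes f: "continuous_on {0..} f" and "0 <= t"
 shows "reflected f t = 0 \<longleftrightarrow> (ALL s:{0..t}. f t <= f s)" and "reflected f t >= 0"
proof -
 obtain u where u: "u \<in> {0..t}" "!!s. s \<in> {0..t} ==> f u <= f s" "(INF s\<in>{0..t}. f s) = f u"
  using cont_INF[of 0 t f] continuous_on_subset[OF f, of "{0..t}"] \<open>0 <= t\<close> by auto
 then show "reflected f t = 0 \<longleftrightarrow> (ALL s:{0..t}. f t <= f s)" "reflected f t >= 0"
  using \<open>0 <= t\<close> by (auto simp: reflected_def dest: u(2)[of t] intro: antisym)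
qed

lemma excursions_iff:
 assumes f: "continuous_on {0..} f"
 shows "(l, r) \<in> excursions (reflected f) \<longleftrightarrow> 0 <= l & l < r & (ALL s:{0..r}. f l <= f s) & f r = f l & (ALL t:{l<..<r}. f t > f l)"
  (is "?L \<longleftrightarrow> ?R")
proof
 assume ?L
 then have l: "0 <= l" "l < r" "reflected f l = 0" "reflected f r = 0" "!!t. l < t ==> t < r ==> reflected f t > 0"
  by (auto simp: excursions_def)
 have fl: "ALL s:{0..l}. f l <= f s" and fr: "ALL s:{0..r}. f r <= f s"
  using reflected_zero_iff[OF f, of l] reflected_zero_iff[OF f, of r] l by auto
 have ft: "f t > f l" if t: "l < t" "t < r" for t
 proof -
  obtain u where u: "u \<in> {0..t}" "!!s. s \<in> {0..t} ==> f u <= f s" "(INF s\<in>{0..t}. f s) = f u"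
   using cont_INF[of 0 t f] continuous_on_subset[OF f, of "{0..t}"] \<open>0 <= l\<close> t by auto
  have "reflected f u = 0" using reflected_zero_iff[OF f, of u] u by auto
  then have "u <= l" using l(5)[of u] u(1) t by force
  then have "f l <= f u" using fl u(1) by auto
  moreover have "f t - f u > 0" using l(5)[of t] t u(3) by (auto simp: reflected_def)
  ultimately show ?thesis by simp
 qed
 \<comment> \<open>Otherwise a level between \<open>f r\<close> and \<open>f l\<close> would be
   taken strictly inside the excursion, where the path is above \<open>f l\<close>.\<close>
 have "f r >= f l"
 proof (rule ccontr)
  assume "~ ?thesis"
  moreover have "continuous_on {l..r} f" using f l by (auto intro: continuous_on_subset)
  ultimately obtain t where "t >= l" "t <= r" "f t = (f l + f r) / 2"
   using IVT2'[of f r "(f l + f r) / 2" l] l by auto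
  with \<open>~ f r >= f l\<close> ft[of t] show False by (cases "t = l"; cases "t = r") auto
 qed
 then have "f r = f l" using fr l by (intro antisym) auto
 then show ?R using l fl fr ft by auto
next
 assume R: ?R
 have "reflected f t > 0" if t: "l < t" "t < r" for t
 proof -
  have "l \<in> {0..t}" "f l < f t" using R t by auto
  then have "~ (ALL s:{0..t}. f t <= f s)" by (meson linorder_not_le)
  then show ?thesis using reflected_zero_iff[OF f, of t] R t by auto
 qed
 then show ?L using R reflected_zero_iff[OF f, of l] reflected_zero_iff[OF f, of r] by (auto simp: excursions_def)
qed

lemma excursions_disjoint:
 assumes "(l, r) \<in> excursions W" "(l', r') \<in> excursions W" "(l, r) ~= (l', r')"
 shows "r <= l' \<or> r' <= l"
proof (rule ccontr)
 assume "~ ?thesis"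
 then have *: "l' < r" "l < r'" by auto
 have e: "l < r" "W l = 0" "W r = 0" "!!t. l < t ==> t < r ==> W t > 0"
  "l' < r'" "W l' = 0" "W r' = 0" "!!t. l' < t ==> t < r' ==> W t > 0"
  using assms by (auto simp: excursions_def)
 have "l = l'" using e(4)[of l'] e(8)[of l] e * by linarith
 moreover have "r = r'" using e(4)[of r'] e(8)[of r] e * by linarith
 ultimately show False using assms by simp
qed

lemma excursions_levels:
 assumes f: "continuous_on {0..} f" and dm: "distinct_minima f"
  and e: "(l, r) \<in> excursions (reflected f)" "(l', r') \<in> excursions (reflected f)" "r <= l'"
 shows "f l' < f l"
proof -
 note e1 = e(1)[unfolded excursions_iff[OF f]] and e2 = e(2)[unfolded excursions_iff[OF f]]
 have "f l ~= f l'"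
  by (rule distinct_minimaD[OF dm, where u' = "(l + r)/2" and v' = "(l + r)/2" and v'' = "(l'+r')/2"])
   (use e1 e2 e(3) in auto)
 moreover have "f l' <= f l" using e1 e2 e(3) by auto
 ultimately show ?thesis by simp
qed

text \<open>Otherwise \<open>r\<close> would minimise the path on an interval reaching up to
  \<open>T\<close>, at the level of \<open>l\<close>, against distinctness of the minima. This later
  descent is what forces an approximate zero to close the corresponding gap before
  \<open>T\<close>.\<close>

lemma excT_returns_below:
 assumes f: "continuous_on {0..} f" and dm: "distinct_minima f" and "T \<in> \<rat>"
  and e: "(l, r) \<in> excT T f"
 obtains t where "r < t" "t <= T" "f t < f l"
proof -
 have e1: "0 <= l & l < r & (ALL s:{0..r}. f l <= f s) & f r = f l & (ALL t:{l<..<r}. f t > f l)" and "r <= T"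
  using e excursions_iff[OF f] by (auto simp: excT_def)
 have "EX t. r < t & t <= T & f t < f l"
 proof (rule ccontr)
  assume a: "~ ?thesis"
  have v: "f r <= f s" if "s \<in> {(l + r)/2..T}" for s
  proof (cases "s <= r")
   case True
   then have "s \<in> {0..r}" using that e1 by auto
   then show ?thesis using e1 by auto
  next
   case False
   then have "~ f s < f l" using a that by auto
   then show ?thesis using e1 by auto
  qed
  have "r < T \<or> r \<in> \<rat>" using \<open>r <= T\<close> \<open>T \<in> \<rat>\<close> by (cases "r = T") auto
  then have "f l ~= f r"
   by (intro distinct_minimaD[OF dm, of l "(l + r)/2" "(l + r)/2" r T])
    (use e1 v \<open>r <= T\<close> in auto)
  with e1 show False by simp
 qed
 with that show thesis by auto
qed

lemma finite_pos_lower: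
 assumes "finite F" "!!e. e \<in> F ==> E e > (0::real)"
 obtains \<epsilon> where "\<epsilon> > 0" "!!e. e \<in> F ==> \<epsilon> <= E e"
proof
 show "Min (insert 1 (E ` F)) > 0" using assms by auto
 show "!!e. e \<in> F ==> Min (insert 1 (E ` F)) <= E e" using assms by auto
qed

text \<open>Inside an excursion the path exceeds its level by a margin, so a slightly shorter
  interval contains no approximate zero. Afterwards the path falls below the level by a margin, so
  an approximate zero must follow. Hence some gap covers the shorter interval.\<close>

lemma excursions_to_gaps:
 assumes f: "continuous_on {0..} f" and dm: "distinct_minima f" and "T \<in> \<rat>"
  and F: "F \<subseteq> excT T f" "finite F" "!!e. e \<in> F ==> glen e > y" and "y >= 0"
 obtains \<epsilon> where "\<epsilon> > 0" "!!Z. edec T \<epsilon> f Z ==> EX h. inj_on h F & h ` F \<subseteq> gaps Z & (ALL e:F. glen (h e) > y)"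
proof -
 have exc: "e \<in> excursions (reflected f)" "snd e <= T" if "e \<in> F" for e using F(1) that by (auto simp: excT_def)
 have e1: "0 <= fst e" "fst e < snd e" "!!s. s \<in> {0..snd e} ==> f (fst e) <= f s" "f (snd e) = f (fst e)"
   "!!t. fst e < t ==> t < snd e ==> f t > f (fst e)" if "e \<in> F" for e
  using exc(1)[OF that] excursions_iff[OF f, of "fst e" "snd e"] by auto
 \<comment> \<open>A quarter of the surplus over \<open>y\<close> is cut off at either end, which
   leaves a length above \<open>y\<close>.\<close>
 define u where "u e = fst e + (glen e - y) / 4" for e
 define w where "w e = snd e - (glen e - y) / 4" for e
 have uw: "fst e < u e" "u e < w e" "w e < snd e" "w e - u e > y" if "e \<in> F" for e
  using F(3)[OF that] \<open>y >= 0\<close> e1(2)[OF that] by (auto simp: u_def w_def glen_def field_simps)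
 \<comment> \<open>Points where the path is lower than the level of \<open>e\<close>: the descent at
   \<open>t\<close> and the left ends of later excursions. The second kind serves to separate the
   gaps of different excursions.\<close>
 define Pts where "Pts e t = (%x. x = t \<or> (EX e':F. snd e <= fst e' & x = fst e'))" for e :: "real \<times> real" and t
 have "EX E t. E > 0 & snd e < t & t <= T & (ALL s:{u e..w e}. f s > f (fst e) + E) &
    (ALL x. Pts e t x --> f x < f (fst e) - E)" if e: "e \<in> F" for e
 proof -
  obtain t where t: "snd e < t" "t <= T" "f t < f (fst e)"
   using excT_returns_below[OF f dm \<open>T \<in> \<rat>\<close>, of "fst e" "snd e"] F(1) e by auto
  have "continuous_on {u e..w e} f" using uw[OF e] e1(1)[OF e] by (intro continuous_on_subset[OF f]) auto
  then obtain m where m: "m \<in> {u e..w e}" "!!s. s \<in> {u e..w e} ==> f m <= f s" "(INF s\<in>{u e..w e}. f s) = f m"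
   using cont_INF[OF _ less_imp_le[OF uw(2)[OF e]]] by metis
  have E1: "f m > f (fst e)" using e1(5)[OF e, of m] m(1) uw[OF e] by auto
  have fin: "finite (Collect (Pts e t))"
   by (rule finite_subset[of _ "insert t (fst ` F)"]) (use F(2) in "auto simp: Pts_def")
  have lev: "f x < f (fst e)" if "Pts e t x" for x
  proof -
   from that consider "x = t" | e' where "e' \<in> F" "snd e <= fst e'" "x = fst e'" unfolding Pts_def by blast
   then show ?thesis
   proof cases
    case 2
    then show ?thesis using excursions_levels[OF f dm, of "fst e" "snd e" "fst e'" "snd e'"] exc(1)[OF e] exc(1)[OF 2(1)] by simp
   qed (use t in simp)
  qed
  obtain E2 where E2: "E2 > 0" "!!x. x \<in> Collect (Pts e t) ==> E2 <= f (fst e) - f x"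
   by (rule finite_pos_lower[OF fin, of "%x. f (fst e) - f x"]) (use lev in auto)
  define E where "E = min ((f m - f (fst e)) / 2) (E2 / 2)"
  have "E > 0" using E1 E2 by (auto simp: E_def)
  moreover have "f s > f (fst e) + E" if "s \<in> {u e..w e}" for s
   using m(2)[OF that] E1 E2(1) by (auto simp: E_def min_def field_simps split: if_splits)
  moreover have "f x < f (fst e) - E" if "Pts e t x" for x
   using E2(2)[of x] that E2(1) by (auto simp: E_def min_def field_simps split: if_splits)
  ultimately show ?thesis using t by blast
 qed
 then have "ALL e. EX E t. e \<in> F --> E > 0 & snd e < t & t <= T & (ALL s:{u e..w e}. f s > f (fst e) + E) &
    (ALL x. Pts e t x --> f x < f (fst e) - E)" by blast
 then obtain E t where Et: "!!e. e \<in> F ==> E e > 0 & snd e < t e & t e <= T & (ALL s:{u e..w e}. f s > f (fst e) + E e) &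
    (ALL x. Pts e (t e) x --> f x < f (fst e) - E e)" by metis
 obtain \<epsilon> where eps: "\<epsilon> > 0" "!!e. e \<in> F ==> \<epsilon> <= E e" using finite_pos_lower[OF F(2), of E] Et by auto
 have "EX h. inj_on h F & h ` F \<subseteq> gaps Z & (ALL e:F. glen (h e) > y)" if Z: "edec T \<epsilon> f Z" for Z
 proof -
  have Z1: "Z \<subseteq> {0..T}" "finite Z" "!!z t. z \<in> Z ==> t \<in> {0..z} ==> f z <= f t + \<epsilon>" using Z by (auto simp: edec_def)
  have none: "~ (u e <= z & z <= w e)" if "e \<in> F" "z \<in> Z" for e z
  proof
   assume a: "u e <= z & z <= w e"
   then have "f z > f (fst e) + E e" using Et[OF that(1)] by auto
   moreover have "f z <= f (fst e) + \<epsilon>" using Z1(3)[OF that(2), of "fst e"] a uw[OF that(1)] e1(1)[OF that(1)] by auto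
   ultimately show False using eps(2)[OF that(1)] by simp
  qed
  have ret: "EX z:Z. w e < z & z <= x" if e: "e \<in> F" and x: "Pts e (t e) x" for e x
  proof -
   have xT: "x \<in> {0..T}" "w e < x"
   proof -
    from x consider "x = t e" | e' where "e' \<in> F" "snd e <= fst e'" "x = fst e'" unfolding Pts_def by blast
    then have "x \<in> {0..T} & w e < x"
    proof cases
     case 1
     then show ?thesis using Et[OF e] e1(1,2)[OF e] uw(3)[OF e] by auto
    next
     case 2
     then show ?thesis using e1(1,2)[OF 2(1)] exc(2)[OF 2(1)] uw(3)[OF e] by auto
    qed
    then show "x \<in> {0..T}" "w e < x" by auto
   qed
   obtain z where z: "z \<in> Z" "z <= x" "f x >= f z - \<epsilon>" using edec_last[OF Z xT(1)] by blast
   have "w e < z"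
   proof (rule ccontr)
    assume "~ w e < z"
    then have "z \<in> {0..snd e}" using uw[OF e] Z1(1) z(1) by auto
    then have "f (fst e) <= f z" using e1(3)[OF e] by auto
    moreover have "f x < f (fst e) - E e" using Et[OF e] x by blast
    ultimately show False using z(3) eps(2)[OF e] by linarith
   qed
   with z show ?thesis by auto
  qed
  have "EX a b. (a, b) \<in> gaps Z & a < u e & w e < b & (ALL x. Pts e (t e) x --> b <= x)" if e: "e \<in> F" for e
  proof -
   have ueT: "u e \<in> {0..T}" using uw[OF e] e1[OF e] exc(2)[OF e] by auto
   obtain a where a: "a \<in> Z" "a <= u e" "!!z'. z' \<in> Z ==> z' <= u e ==> z' <= a" using edec_last[OF Z ueT] by metis
   define b where "b = Min {z \<in> Z. w e < z}"
   have fin: "finite {z \<in> Z. w e < z}" and ne: "{z \<in> Z. w e < z} ~= {}"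
    using Z1(2) ret[OF e, of "t e"] by (auto simp: Pts_def)
   have b: "b \<in> Z" "w e < b" using Min_in[OF fin ne] by (auto simp: b_def)
   have b2: "b <= z" if "z \<in> Z" "w e < z" for z using fin that by (auto simp: b_def)
   have "a < u e" using none[OF e a(1)] a(2) uw[OF e] by auto
   moreover have "(a, b) \<in> gaps Z"
   proof -
    have "~ (a < z & z < b)" if "z \<in> Z" for z
     using a(3)[OF that] b2[OF that] none[OF e that] by linarith
    then show ?thesis using a(1) b \<open>a < u e\<close> uw(2)[OF e] unfolding gaps_def by auto
   qed
   moreover have "b <= x" if "Pts e (t e) x" for x using ret[OF e that] b2 by force
   ultimately show ?thesis using b(2) by blast
  qed
  then obtain a b where ab: "!!e. e \<in> F ==> (a e, b e) \<in> gaps Z & a e < u e & w e < b e & (ALL x. Pts e (t e) x --> b e <= x)"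
   by metis
  \<comment> \<open>The gap of \<open>e\<close> has ended when the later excursion \<open>e'\<close>
    begins, while the gap of \<open>e'\<close> reaches into \<open>e'\<close>.\<close>
  have key: "a e ~= a e' \<or> b e ~= b e'" if "e \<in> F" "e' \<in> F" "snd e <= fst e'" for e e'
  proof -
   have "b e <= fst e'" using ab[OF that(1)] that by (auto simp: Pts_def)
   also have "... < b e'" using uw[OF that(2)] ab[OF that(2)] by linarith
   finally show ?thesis by simp
  qed
  have "inj_on (%e. (a e, b e)) F"
  proof (rule inj_onI)
   fix e e' assume ee: "e \<in> F" "e' \<in> F" "(a e, b e) = (a e', b e')"
   show "e = e'"
   proof (rule ccontr)
    assume "e ~= e'"
    then have "snd e <= fst e' \<or> snd e' <= fst e"
     using excursions_disjoint[of "fst e" "snd e" "reflected f" "fst e'" "snd e'"] exc(1) ee by (auto simp: prod_eq_iff)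
    then show False using key[of e e'] key[of e' e] ee by auto
   qed
  qed
  moreover have "glen (a e, b e) > y" if "e \<in> F" for e
   using ab[OF that] uw[OF that] by (auto simp: glen_def)
  ultimately show ?thesis using ab by (intro exI[of _ "%e. (a e, b e)"]) auto
 qed
 then show thesis using that eps(1) by blast
qed

text \<open>By compactness, long gaps for tolerances tending to 0 that keep away from all excursions
  would have a limit point \<open>(l, r)\<close>. Both ends are running minima of the path, and
  between them the path stays at or above their level, strictly so because minima are distinct. Then
  \<open>(l, r)\<close> is itself an excursion, a contradiction.\<close>

lemma gaps_near_excursions:
 assumes f: "continuous_on {0..} f" and dm: "distinct_minima f" and "y > 0" "\<delta> > 0"
 obtains \<epsilon> where "\<epsilon> > 0" "!!Z a b. edec T \<epsilon> f Z ==> (a, b) \<in> gaps Z ==> b - a >= y ==>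
   \<exists>(l, r)\<in>excT T f. \<bar>a - l\<bar> < \<delta> & \<bar>b - r\<bar> < \<delta>"
proof (rule ccontr)
 assume "~ thesis"
 then have "\<forall>n::nat. EX Z a b. edec T (1 / Suc n) f Z & (a, b) \<in> gaps Z & b - a >= y &
   ~ (\<exists>(l, r)\<in>excT T f. \<bar>a - l\<bar> < \<delta> & \<bar>b - r\<bar> < \<delta>)"
  using that by (metis of_nat_0_less_iff zero_less_Suc zero_less_divide_1_iff)
 then obtain Z a b where Zab: "!!n::nat. edec T (1 / Suc n) f (Z n)" "!!n. (a n, b n) \<in> gaps (Z n)"
  "!!n. b n - a n >= y" "!!n. ~ (\<exists>(l, r)\<in>excT T f. \<bar>a n - l\<bar> < \<delta> & \<bar>b n - r\<bar> < \<delta>)"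
  by metis
 have abT: "a n \<in> {0..T}" "b n \<in> {0..T}" "a n \<in> Z n" "b n \<in> Z n" for n
  using Zab(1)[of n] Zab(2)[of n] by (auto simp: edec_def gaps_def)
 have "compact ({0..T} \<times> {0..T})" by (intro compact_Times) auto
 then obtain L s where L: "L \<in> {0..T} \<times> {0..T}" "strict_mono s" "((%n. (a n, b n)) \<circ> s) \<longlonglongrightarrow> L"
  using abT unfolding compact_def by (elim allE[of _ "%n. (a n, b n)"]) auto
 obtain l r where lr: "L = (l, r)" by (cases L)
 have la: "(%n. a (s n)) \<longlonglongrightarrow> l" and lb: "(%n. b (s n)) \<longlonglongrightarrow> r"
  using tendsto_fst[OF L(3)] tendsto_snd[OF L(3)] by (auto simp: lr o_def)
 have l0: "0 <= l" "r <= T" using L(1) lr by auto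
 have lry: "r - l >= y"
  by (rule LIMSEQ_le_const[OF tendsto_diff[OF lb la]]) (use Zab(3) in auto)
 have fa: "(%n. f (a (s n))) \<longlonglongrightarrow> f l" and fb: "(%n. f (b (s n))) \<longlonglongrightarrow> f r"
  using continuous_on_tendsto_compose[OF f la] continuous_on_tendsto_compose[OF f lb] abT l0 lry \<open>y > 0\<close> by auto
 have "(%n. 1 / real (Suc n)) \<longlonglongrightarrow> 0" using LIMSEQ_inverse_real_of_nat by (simp add: inverse_eq_divide)
 then have e0: "(%n. 1 / real (Suc (s n))) \<longlonglongrightarrow> 0" using LIMSEQ_subseq_LIMSEQ[OF _ L(2)] by (force simp: o_def)
 have minl: "f c <= f t" if c: "(%n. d (s n)) \<longlonglongrightarrow> c" "!!n. d n \<in> Z n" "0 <= t" "t <= c" for c d t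
 proof (cases "t = c")
  case False
  have cT: "d n \<in> {0..T}" for n using Zab(1)[of n] c(2)[of n] by (auto simp: edec_def)
  have "(%n. f (d (s n))) \<longlonglongrightarrow> f c"
   using continuous_on_tendsto_compose[OF f c(1)] cT c(3,4) by auto
  moreover have "(%n. f t + 1 / real (Suc (s n))) \<longlonglongrightarrow> f t + 0" by (intro tendsto_add tendsto_const e0)
  moreover have "eventually (%n. f (d (s n)) <= f t + 1 / real (Suc (s n))) sequentially"
   using order_tendstoD(1)[OF c(1), of t] False c(4)
   by (auto elim!: eventually_mono) (use Zab(1) c(2,3) in "auto simp: edec_def")
  ultimately have "f c <= f t + 0" using tendsto_le[OF sequentially_bot] by blast
  then show ?thesis by simp
 qed simp
 have mid: "f l <= f t" if t: "l < t" "t < r" for t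
 proof -
  have "(%n. f (a (s n)) - 1 / real (Suc (s n))) \<longlonglongrightarrow> f l - 0" by (intro tendsto_diff fa e0)
  moreover have "eventually (%n. f (a (s n)) - 1 / real (Suc (s n)) <= f t) sequentially"
   using order_tendstoD(2)[OF la t(1)] order_tendstoD(1)[OF lb t(2)]
  proof eventually_elim
   case (elim n)
   have ed: "edec T (1 / Suc (s n)) f (Z (s n))" and g: "(a (s n), b (s n)) \<in> gaps (Z (s n))" using Zab by auto
   have "ALL z':Z (s n). z' <= t --> z' <= a (s n)" using g elim unfolding gaps_def by fastforce
   then show ?case using ed abT[of "s n"] elim t l0 unfolding edec_def by auto
  qed
  ultimately have "f l - 0 <= f t" using tendsto_le[OF sequentially_bot tendsto_const] by blast
  then show ?thesis by simp
 qed
 have lr2: "l < r" using lry \<open>y > 0\<close> by simp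
 have min_r: "f r <= f t" if "0 <= t" "t <= r" for t using minl[OF lb abT(4) that] .
 have min_l: "f l <= f t" if "0 <= t" "t <= l" for t using minl[OF la abT(3) that] .
 have "f l <= f r"
 proof -
  have "eventually (%t. f l <= f t) (at_left r)"
   using lr2 eventually_at_left_real[OF lr2] by (auto elim!: eventually_mono intro: mid)
  moreover have "(f \<longlongrightarrow> f r) (at_left r)"
  proof -
   have "continuous_on {l..r} f" using l0 by (intro continuous_on_subset[OF f]) auto
   then show ?thesis using lr2 unfolding continuous_on_def by (auto dest!: bspec[of _ _ r] simp: at_within_Icc_at_left)
  qed
  ultimately show ?thesis using tendsto_lowerbound trivial_limit_at_left_real by blast
 qed
 then have fr: "f r = f l" using min_r[of l] l0 lr2 by auto
 have all: "f l <= f t" if "t \<in> {0..r}" for t using min_r that fr by auto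
 have "f t > f l" if t: "l < t" "t < r" for t
 proof -
  have "f l ~= f t" if eq: "f t = f l"
   by (rule distinct_minimaD[OF dm, of l "(l + t)/2" "(l + t)/2" t "(t + r)/2"])
    (use l0 t all eq in auto)
  then show ?thesis using all[of t] t l0 by force
 qed
 then have "(l, r) \<in> excT T f" using excursions_iff[OF f, of l r] l0 lr2 all fr by (auto simp: excT_def)
 moreover have "eventually (%n. \<bar>a (s n) - l\<bar> < \<delta> & \<bar>b (s n) - r\<bar> < \<delta>) sequentially"
  using tendstoD[OF la \<open>\<delta> > 0\<close>] tendstoD[OF lb \<open>\<delta> > 0\<close>] by (auto simp: dist_real_def elim: eventually_elim2)
 ultimately show False using Zab(4) by (auto simp: eventually_sequentially)
qed

lemma excT_glen: "e \<in> excT T f ==> glen e <= T" by (auto simp: excT_def excursions_def glen_def)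

lemma gaps_glen: "edec T \<epsilon> f Z ==> e \<in> gaps Z ==> glen e <= T"
proof -
 assume "edec T \<epsilon> f Z" "e \<in> gaps Z"
 then have "fst e \<in> {0..T}" "snd e \<in> {0..T}" by (auto simp: gaps_def edec_def)
 then show "glen e <= T" by (simp add: glen_def)
qed

lemma excT_rk_nonneg: "rk (excT T f) glen j >= 0" by (rule rk_nonneg[OF excT_glen])

lemma gaps_rk_nonneg: "edec T \<epsilon> f Z ==> rk (gaps Z) glen j >= 0" by (rule rk_nonneg[OF gaps_glen])

text \<open>Long gaps are matched with excursions for the upper bound, and \<open>j + 1\<close> long
  excursions with gaps for the lower one.\<close>

lemma gap_lengths_close:
 assumes f: "continuous_on {0..} f" and dm: "distinct_minima f" and "T \<in> \<rat>" "\<eta> > 0"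
 obtains \<epsilon> where "\<epsilon> > 0" "!!Z. edec T \<epsilon> f Z ==> \<bar>rk (gaps Z) glen j - rk (excT T f) glen j\<bar> <= \<eta>"
proof -
 obtain \<epsilon>1 where e1: "\<epsilon>1 > 0" "!!Z a b. edec T \<epsilon>1 f Z ==> (a, b) \<in> gaps Z ==> b - a >= \<eta> ==>
   \<exists>(l, r)\<in>excT T f. \<bar>a - l\<bar> < \<eta> / 4 & \<bar>b - r\<bar> < \<eta> / 4"
  using gaps_near_excursions[OF f dm, where y = \<eta> and \<delta> = "\<eta> / 4" and T = T] \<open>\<eta> > 0\<close> by auto
 have up: "rk (gaps Z) glen j <= rk (excT T f) glen j + \<eta>" if Z: "edec T \<epsilon>1 f Z" for Z
 proof -
  \<comment> \<open>The quarter makes the matching injective: two gaps near the same excursion have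
    ends within \<open>\<eta> / 2\<close> of each other, which is impossible for distinct, hence
    non-overlapping, gaps longer than \<open>\<eta>\<close>.\<close>
  have "ALL g. EX e. g \<in> gaps Z & glen g >= \<eta> --> e \<in> excT T f & \<bar>fst g - fst e\<bar> < \<eta> / 4 & \<bar>snd g - snd e\<bar> < \<eta> / 4"
   using e1(2)[OF Z, of "fst g" "snd g" for g] unfolding glen_def by fastforce
  then obtain h where h: "!!g. g \<in> gaps Z ==> glen g >= \<eta> ==> h g \<in> excT T f & \<bar>fst g - fst (h g)\<bar> < \<eta> / 4 & \<bar>snd g - snd (h g)\<bar> < \<eta> / 4"
   by metis
  have "inj_on h {g \<in> gaps Z. glen g > \<eta>}"
  proof (rule inj_onI)
   fix g g' assume g: "g \<in> {g \<in> gaps Z. glen g > \<eta>}" "g' \<in> {g \<in> gaps Z. glen g > \<eta>}" "h g = h g'"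
   have c: "\<bar>fst g - fst g'\<bar> < \<eta> / 2" "\<bar>snd g - snd g'\<bar> < \<eta> / 2" proof -
    have "\<bar>fst g - fst (h g)\<bar> < \<eta> / 4" "\<bar>snd g - snd (h g)\<bar> < \<eta> / 4"
     "\<bar>fst g' - fst (h g)\<bar> < \<eta> / 4" "\<bar>snd g' - snd (h g)\<bar> < \<eta> / 4" using h[of g] h[of g'] g by auto
    then show "\<bar>fst g - fst g'\<bar> < \<eta> / 2" "\<bar>snd g - snd g'\<bar> < \<eta> / 2" by linarith+
   qed
   have gg: "fst g \<in> Z" "snd g \<in> Z" "fst g' \<in> Z" "snd g' \<in> Z" "snd g - fst g > \<eta>" "snd g' - fst g' > \<eta>"
    "!!z. z \<in> Z ==> ~ (fst g < z & z < snd g)" "!!z. z \<in> Z ==> ~ (fst g' < z & z < snd g')"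
    using g by (auto simp: gaps_def glen_def)
   have "fst g = fst g'" using gg(7)[OF gg(3)] gg(8)[OF gg(1)] c gg(5,6) by linarith
   moreover have "snd g = snd g'" using gg(7)[OF gg(4)] gg(8)[OF gg(2)] c gg(5,6) by linarith
   ultimately show "g = g'" by (simp add: prod_eq_iff)
  qed
  then have "rk (gaps Z) glen j <= max \<eta> (rk (excT T f) glen j + \<eta> / 2)"
   using \<open>\<eta> > 0\<close>
  proof (intro rk_le_comp[where B = T and h = h] excT_glen)
   fix e assume "e \<in> gaps Z" "glen e > \<eta>"
   then show "h e \<in> excT T f & glen e - \<eta> / 2 <= glen (h e)" using h[of e] unfolding glen_def by linarith
  qed auto
  then show ?thesis using excT_rk_nonneg[of T f j] \<open>\<eta> > 0\<close> by auto
 qed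
 show thesis
 proof (cases "rk (excT T f) glen j > \<eta>")
  case False
  show thesis
  proof (rule that[OF e1(1)])
   fix Z assume Z: "edec T \<epsilon>1 f Z"
   show "\<bar>rk (gaps Z) glen j - rk (excT T f) glen j\<bar> <= \<eta>"
    using up[OF Z] False gaps_rk_nonneg[OF Z, of j] excT_rk_nonneg[of T f j] by auto
  qed
 next
  case True
  obtain F where F: "F \<subseteq> excT T f" "finite F" "card F = Suc j" "!!e. e \<in> F ==> glen e > rk (excT T f) glen j - \<eta>"
   by (rule rk_gtD[of "rk (excT T f) glen j - \<eta>" "excT T f" glen j]) (use True \<open>\<eta> > 0\<close> in auto)
  have y0: "rk (excT T f) glen j - \<eta> >= 0" using True by simp
  obtain \<epsilon>2 where e2: "\<epsilon>2 > 0" "!!Z. edec T \<epsilon>2 f Z ==> EX h. inj_on h F & h ` F \<subseteq> gaps Z & (ALL e:F. glen (h e) > rk (excT T f) glen j - \<eta>)"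
   using excursions_to_gaps[OF f dm \<open>T \<in> \<rat>\<close> F(1,2,4) y0] by blast
  show thesis
  proof (rule that[of "min \<epsilon>1 \<epsilon>2"])
   show "min \<epsilon>1 \<epsilon>2 > 0" using e1 e2 by simp
   fix Z assume "edec T (min \<epsilon>1 \<epsilon>2) f Z"
   then have Z: "edec T \<epsilon>1 f Z" "edec T \<epsilon>2 f Z" by (auto intro: edec_mono)
   obtain h where h: "inj_on h F" "h ` F \<subseteq> gaps Z" "!!e. e \<in> F ==> glen (h e) > rk (excT T f) glen j - \<eta>"
    using e2(2)[OF Z(2)] by auto
   have "rk (gaps Z) glen j > rk (excT T f) glen j - \<eta>"
    by (rule rk_gtI[OF h(2) _ _ _ y0 gaps_glen[OF Z(1)]]) (use F h in "auto simp: card_image")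
   then show "\<bar>rk (gaps Z) glen j - rk (excT T f) glen j\<bar> <= \<eta>" using up[OF Z(1)] by auto
  qed
 qed
qed

section \<open>Donsker's theorem for Lipschitz functionals\<close>

lemma exp_neg_quadratic:
 fixes x :: real
 assumes "x >= 0"
 shows "\<bar>(1 - x) - exp (- x)\<bar> <= x^2"
proof -
 have "exp (- x) <= 1 / (1 + x)" using exp_ge_add_one_self[of x] assms by (simp add: exp_minus field_simps)
 also have "... <= 1 - x + x^2" using assms by (simp add: field_simps power2_eq_square)
 finally show ?thesis using exp_ge_add_one_self[of "- x"] by (simp add: abs_if)
qed

text \<open>A uniform bound \<open>b n\<close> of smaller order than the scale \<open>a n\<close>
  takes the place of Lindeberg's condition.\<close>

locale triangular_array =
 fixes q :: "nat => 'e pmf" and g :: "nat => 'e => real" and a b :: "nat => real" and \<sigma> :: real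
 assumes fin: "!!n. finite (set_pmf (q n))"
  and mean: "!!n. expect (q n) (g n) = 0"
  and bnd: "!!n e. e \<in> set_pmf (q n) ==> \<bar>g n e\<bar> <= b n"
  and a: "!!n. a n > 0" "filterlim a at_top sequentially" and ba: "(%n. b n / a n) \<longlonglongrightarrow> 0"
  and var: "(%n. expect (q n) (%e. (g n e)^2)) \<longlonglongrightarrow> \<sigma>^2" and \<sigma>: "\<sigma> > 0"
begin

sublocale iid "q n" for n by unfold_locales (rule fin)

text \<open>The characteristic function of a step is compared with \<open>exp (- x n)\<close> rather
  than with \<open>1 - x n\<close>: powers of the former are Gaussian at once, and the difference of
  two powers is at most \<open>r n\<close> times that of the bases.\<close>

lemma clt_array:
 assumes r: "(%n. real (r n) / (a n)^2) \<longlonglongrightarrow> \<tau>" and \<tau>: "\<tau> > 0"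
 shows "weak_conv_m (%n. distr (measure_pmf (replicate_pmf (r n) (q n))) borel (%xs. ssum (g n) xs / (a n * \<sigma> * sqrt \<tau>))) N01"
proof (rule levy_continuity)
 show "real_distribution (distr (measure_pmf (replicate_pmf (r n) (q n))) borel (%xs. ssum (g n) xs / (a n * \<sigma> * sqrt \<tau>)))" for n
  by (intro prob_space.real_distribution_distr measure_pmf.prob_space_axioms) simp
 show "real_distribution N01" by (rule real_dist_normal_dist)
 fix t :: real
 define A where "A n = a n * \<sigma> * sqrt \<tau>" for n
 have A: "A n > 0" for n using a \<sigma> \<tau> by (simp add: A_def)
 define s where "s n = expect (q n) (%e. (g n e / A n)^2)" for n
 define \<phi> where "\<phi> n = char (distr (measure_pmf (q n)) borel (%e. g n e / A n)) t" for n
 have s_eq: "s n = expect (q n) (%e. (g n e)^2) / (A n)^2" for n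
  unfolding s_def by (simp add: power_divide)
 have s0: "s n >= 0" for n unfolding s_def by (simp add: integral_nonneg)
 have b0: "b n >= 0" for n using bnd set_pmf_not_empty[of "q n"] by (meson abs_ge_zero all_not_in_conv order_trans)
 have rs: "(%n. real (r n) * s n) \<longlonglongrightarrow> 1"
 proof -
  have "(%n. (real (r n) / (a n)^2) * expect (q n) (%e. (g n e)^2) / (\<sigma>^2 * \<tau>)) \<longlonglongrightarrow> \<tau> * \<sigma>^2 / (\<sigma>^2 * \<tau>)"
   by (intro tendsto_intros r var) (use \<sigma> \<tau> in auto)
  moreover have "(real (r n) / (a n)^2) * expect (q n) (%e. (g n e)^2) / (\<sigma>^2 * \<tau>) = real (r n) * s n" for n
   using \<tau> by (simp add: s_eq A_def power_mult_distrib)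
  ultimately show ?thesis using \<sigma> \<tau> by simp
 qed
 have bA: "(%n. b n / A n) \<longlonglongrightarrow> 0"
 proof -
  have "(%n. (b n / a n) / (\<sigma> * sqrt \<tau>)) \<longlonglongrightarrow> 0 / (\<sigma> * sqrt \<tau>)" by (intro tendsto_intros ba) (use \<sigma> \<tau> in auto)
  then show ?thesis by (simp add: A_def field_simps)
 qed
 have sb: "s n <= (b n / A n)^2" for n
 proof -
  have "s n <= expect (q n) (%e. (b n / A n)^2)"
   unfolding s_def
  proof (rule expectation_mono_finite[OF fin])
   fix e assume e: "e \<in> set_pmf (q n)"
   have "\<bar>g n e\<bar> / A n <= b n / A n" using bnd[OF e] A[of n] by (intro divide_right_mono) auto
   then have "\<bar>g n e / A n\<bar> <= \<bar>b n / A n\<bar>" using A[of n] b0[of n] by simp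
   then show "(g n e / A n)^2 <= (b n / A n)^2" by (rule iffD1[OF abs_le_square_iff])
  qed
  then show ?thesis by simp
 qed
 have s_0: "s \<longlonglongrightarrow> 0"
 proof (rule tendsto_sandwich[of "%_. 0" _ _ "%n. (b n / A n)^2"])
  have "(%n. (b n / A n)^2) \<longlonglongrightarrow> 0^2" by (intro tendsto_intros bA)
  then show "(%n. (b n / A n)^2) \<longlonglongrightarrow> 0" by simp
 qed (use s0 sb in auto)
 define x where "x n = t^2 * s n / 2" for n
 define e where "e n = \<bar>t\<bar> ^ 3 / 6 * (b n / A n) + t ^ 4 / 4 * s n" for n
 have x0: "x n >= 0" for n using s0[of n] by (simp add: x_def)
 have step: "cmod (\<phi> n - complex_of_real (exp (- x n))) <= s n * e n" for n
 proof -
  have X: "expect (q n) (%e. g n e / A n) = 0" using mean[of n] by simp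
  have "cmod (\<phi> n - (1 - t^2 * s n / 2)) <= (t^2 / 6) * expect (q n) (%e. min (6 * (g n e / A n)^2) (\<bar>t\<bar> * \<bar>g n e / A n\<bar> ^ 3))"
   unfolding \<phi>_def
   by (rule prob_space.char_approx3'[OF measure_pmf.prob_space_axioms]) (use X in "auto simp: s_def integrable_measure_pmf_finite[OF fin]")
  also have "... <= (t^2 / 6) * expect (q n) (%e. \<bar>t\<bar> * (b n / A n) * (g n e / A n)^2)"
  proof (rule mult_left_mono[OF expectation_mono_finite[OF fin]])
   fix e assume e: "e \<in> set_pmf (q n)"
   have "\<bar>g n e\<bar> / A n <= b n / A n" using bnd[OF e] A[of n] by (intro divide_right_mono) auto
   then have "\<bar>g n e / A n\<bar> <= b n / A n" using A[of n] by simp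
   then have "\<bar>g n e / A n\<bar> ^ 3 <= (b n / A n) * (g n e / A n)^2"
    using mult_right_mono[of "\<bar>g n e / A n\<bar>" "b n / A n" "(g n e / A n)^2"]
    by (simp add: power3_eq_cube power2_eq_square)
   then show "min (6 * (g n e / A n)^2) (\<bar>t\<bar> * \<bar>g n e / A n\<bar> ^ 3) <= \<bar>t\<bar> * (b n / A n) * (g n e / A n)^2"
    by (intro min.coboundedI2) (metis mult_left_mono mult.assoc abs_ge_zero)
  qed auto
  also have "... = \<bar>t\<bar> ^ 3 / 6 * (b n / A n) * s n" unfolding s_def by (simp add: power3_eq_cube power2_eq_square abs_mult_self_eq)
  finally have 1: "cmod (\<phi> n - (1 - x n)) <= \<bar>t\<bar> ^ 3 / 6 * (b n / A n) * s n" by (simp add: x_def)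
  have "cmod ((1 - x n) - complex_of_real (exp (- x n))) = \<bar>(1 - x n) - exp (- x n)\<bar>"
   by (metis norm_of_real of_real_diff of_real_1)
  also have "... <= (x n)^2" by (rule exp_neg_quadratic[OF x0])
  also have "... = t ^ 4 / 4 * s n * s n" by (simp add: x_def power2_eq_square power4_eq_xxxx)
  finally show ?thesis using 1 norm_triangle_ineq[of "\<phi> n - (1 - x n)" "(1 - x n) - complex_of_real (exp (- x n))"]
   by (simp add: e_def algebra_simps)
 qed
 have main: "cmod (\<phi> n ^ r n - complex_of_real (exp (- (real (r n) * x n)))) <= (real (r n) * s n) * e n" for n
 proof -
  have "cmod (\<phi> n ^ r n - complex_of_real (exp (- (real (r n) * x n)))) = cmod (\<phi> n ^ r n - complex_of_real (exp (- x n)) ^ r n)"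
   by (simp add: exp_of_nat_mult[symmetric] of_real_power[symmetric] del: of_real_power)
  also have "... <= real (r n) * cmod (\<phi> n - complex_of_real (exp (- x n)))"
  proof (rule norm_power_diff)
   interpret R: real_distribution "distr (measure_pmf (q n)) borel (%e. g n e / A n)"
    by (intro prob_space.real_distribution_distr measure_pmf.prob_space_axioms) simp
   show "cmod (\<phi> n) <= 1" unfolding \<phi>_def by (rule R.cmod_char_le_1)
   show "cmod (complex_of_real (exp (- x n))) <= 1" using x0[of n] by simp
  qed
  also have "... <= real (r n) * (s n * e n)" by (intro mult_left_mono step) simp
  finally show ?thesis by simp
 qed
 have "(%n. (real (r n) * s n) * e n) \<longlonglongrightarrow> 1 * (\<bar>t\<bar> ^ 3 / 6 * 0 + t ^ 4 / 4 * 0)"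
  unfolding e_def by (intro tendsto_intros rs bA s_0)
 then have z: "(%n. (real (r n) * s n) * e n) \<longlonglongrightarrow> 0" by simp
 have lim0: "(%n. \<phi> n ^ r n - complex_of_real (exp (- (real (r n) * x n)))) \<longlonglongrightarrow> 0"
  by (rule Lim_null_comparison[OF _ z], rule always_eventually, rule allI, rule main)
 have "(%n. complex_of_real (exp (- (t^2 * (real (r n) * s n) / 2)))) \<longlonglongrightarrow> complex_of_real (exp (- (t^2 * 1 / 2)))"
  by (intro tendsto_intros rs) auto
 moreover have "t^2 * (real (r n) * s n) / 2 = real (r n) * x n" for n by (simp add: x_def)
 ultimately have "(%n. \<phi> n ^ r n) \<longlonglongrightarrow> complex_of_real (exp (- (t^2 / 2)))" using tendsto_add[OF lim0] by fastforce
 then show "(%n. char (distr (measure_pmf (replicate_pmf (r n) (q n))) borel (%xs. ssum (g n) xs / (a n * \<sigma> * sqrt \<tau>))) t) \<longlonglongrightarrow> char N01 t"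
  unfolding char_ssum \<phi>_def A_def char_std_normal_distribution by simp
qed

end

text \<open>On Skorohod's probability space the difference is at most the mean of the minimum of
  \<open>2 * \<bar>C\<bar>\<close> and a multiple of the distance of the variables, and this does
  not involve \<open>g\<close>. The uniformity is essential in \<open>fdd_convergence\<close>, where
  \<open>g\<close> depends on the earlier increments.\<close>

lemma weak_conv_lipschitz:
 fixes \<mu> :: "nat => real measure"
 assumes \<mu>: "!!n. real_distribution (\<mu> n)" and N: "real_distribution N" and w: "weak_conv_m \<mu> N"
 obtains \<beta> :: "nat => real" where "\<beta> \<longlonglongrightarrow> 0"
  "ALL n g. (ALL x. \<bar>g x\<bar> <= C) & (ALL x y. \<bar>g x - g y\<bar> <= \<Lambda> * \<bar>x - y\<bar>) --> \<bar>(\<integral>x. g x \<partial>\<mu> n) - (\<integral>x. g x \<partial>N)\<bar> <= \<beta> n"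
proof -
 obtain \<Omega> :: "real measure" and Ys :: "nat => real => real" and Y where \<Omega>: "prob_space \<Omega>"
  "ALL n. Ys n \<in> measurable \<Omega> borel" "ALL n. distr \<Omega> borel (Ys n) = \<mu> n" "Y \<in> measurable \<Omega> lborel" "distr \<Omega> borel Y = N"
  "ALL x:space \<Omega>. (%n. Ys n x) \<longlonglongrightarrow> Y x"
  using Skorohod[OF \<mu> N w] by blast
 interpret prob_space \<Omega> by fact
 have [measurable]: "Ys n \<in> borel_measurable \<Omega>" "Y \<in> borel_measurable \<Omega>" for n using \<Omega> by auto
 define L where "L = \<bar>\<Lambda>\<bar>"
 define \<beta> where "\<beta> n = (\<integral>x. min (2 * \<bar>C\<bar>) (L * \<bar>Ys n x - Y x\<bar>) \<partial>\<Omega>)" for n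
 have "\<beta> \<longlonglongrightarrow> (\<integral>x. 0 \<partial>\<Omega>)"
  unfolding \<beta>_def[abs_def]
 proof (rule integral_dominated_convergence[where w = "%_. 2 * \<bar>C\<bar>"])
  show "AE x in \<Omega>. (%n. min (2 * \<bar>C\<bar>) (L * \<bar>Ys n x - Y x\<bar>)) \<longlonglongrightarrow> 0"
  proof (rule AE_I2)
   fix x assume x: "x \<in> space \<Omega>"
   have "(%n. min (2 * \<bar>C\<bar>) (L * \<bar>Ys n x - Y x\<bar>)) \<longlonglongrightarrow> min (2 * \<bar>C\<bar>) (L * \<bar>Y x - Y x\<bar>)"
    using \<Omega>(6) x by (intro tendsto_intros) auto
   then show "(%n. min (2 * \<bar>C\<bar>) (L * \<bar>Ys n x - Y x\<bar>)) \<longlonglongrightarrow> 0" by simp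
  qed
  show "AE x in \<Omega>. norm (min (2 * \<bar>C\<bar>) (L * \<bar>Ys n x - Y x\<bar>)) <= 2 * \<bar>C\<bar>" for n
   by (rule AE_I2) (simp add: L_def min_def abs_mult)
 qed auto
 then have "\<beta> \<longlonglongrightarrow> 0" by simp
 moreover have "\<bar>(\<integral>x. g x \<partial>\<mu> n) - (\<integral>x. g x \<partial>N)\<bar> <= \<beta> n"
  if g: "!!x. \<bar>g x\<bar> <= C" "!!x y. \<bar>g x - g y\<bar> <= \<Lambda> * \<bar>x - y\<bar>" for n g
 proof -
  have lip: "\<bar>g x - g y\<bar> <= L * \<bar>x - y\<bar>" for x y using g(2)[of x y] by (simp add: L_def) (smt (verit) mult_right_mono abs_ge_zero)
  have "continuous_on UNIV g"
  proof (rule lipschitz_on_continuous_on[OF lipschitz_onI])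
   show "dist (g x) (g y) <= L * dist x y" for x y using lip[of x y] by (simp add: dist_real_def)
  qed (simp add: L_def)
  then have [measurable]: "g \<in> borel_measurable borel" by (rule borel_measurable_continuous_onI)
  have i: "integrable \<Omega> (%x. g (Ys n x))" "integrable \<Omega> (%x. g (Y x))"
   using g(1) by (auto intro!: integrable_const_bound[where B = C])
  have "(\<integral>x. g x \<partial>\<mu> n) = (\<integral>x. g (Ys n x) \<partial>\<Omega>)" by (subst \<Omega>(3)[rule_format, symmetric]) (simp add: integral_distr)
  moreover have "(\<integral>x. g x \<partial>N) = (\<integral>x. g (Y x) \<partial>\<Omega>)" unfolding \<Omega>(5)[symmetric] by (simp add: integral_distr)
  ultimately have "\<bar>(\<integral>x. g x \<partial>\<mu> n) - (\<integral>x. g x \<partial>N)\<bar> = \<bar>\<integral>x. g (Ys n x) - g (Y x) \<partial>\<Omega>\<bar>" using i by simp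
  also have "... <= (\<integral>x. \<bar>g (Ys n x) - g (Y x)\<bar> \<partial>\<Omega>)" by (rule integral_abs_bound)
  also have "... <= \<beta> n" unfolding \<beta>_def
  proof (rule integral_mono)
   show "integrable \<Omega> (%x. \<bar>g (Ys n x) - g (Y x)\<bar>)" using i by simp
   show "integrable \<Omega> (%x. min (2 * \<bar>C\<bar>) (L * \<bar>Ys n x - Y x\<bar>))"
    by (rule integrable_const_bound[where B = "2 * \<bar>C\<bar>"]) (auto simp: L_def min_def abs_mult)
   show "\<bar>g (Ys n x) - g (Y x)\<bar> <= min (2 * \<bar>C\<bar>) (L * \<bar>Ys n x - Y x\<bar>)" for x
    using g(1)[of "Ys n x"] g(1)[of "Y x"] lip[of "Ys n x" "Y x"] by (auto simp: abs_if split: if_splits)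
  qed
  finally show ?thesis .
 qed
 ultimately show thesis using that by blast
qed

lemma lipschitz_coordinates_continuous:
 fixes \<Psi> :: "(nat => real) => real"
 assumes "!!x y. \<bar>\<Psi> x - \<Psi> y\<bar> <= \<Lambda> * (\<Sum>i<K. \<bar>x i - y i\<bar>)"
 shows "continuous_on UNIV \<Psi>"
proof (unfold continuous_on_def, intro ballI)
 fix x :: "nat => real"
 have "continuous_on UNIV (%y :: nat => real. \<Lambda> * (\<Sum>i<K. \<bar>y i - x i\<bar>))"
  by (intro continuous_intros continuous_on_product_coordinates)
 then have "((%y. \<Lambda> * (\<Sum>i<K. \<bar>y i - x i\<bar>)) \<longlongrightarrow> \<Lambda> * (\<Sum>i<K. \<bar>x i - x i\<bar>)) (at x within UNIV)"
  unfolding continuous_on_def by blast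
 then have z: "((%y. \<Lambda> * (\<Sum>i<K. \<bar>y i - x i\<bar>)) \<longlongrightarrow> 0) (at x within UNIV)" by simp
 have "((%y. \<Psi> y - \<Psi> x) \<longlongrightarrow> 0) (at x within UNIV)"
  by (rule Lim_null_comparison[OF _ z], rule always_eventually, rule allI) (use assms in simp)
 then show "(\<Psi> \<longlongrightarrow> \<Psi> x) (at x within UNIV)" using Lim_null by blast
qed

lemma (in prob_space) expectation_indep_pair:
 fixes \<Psi> :: "'c => 'c => real"
 assumes ind: "indep_var S X T Y" and m: "(%p. \<Psi> (fst p) (snd p)) \<in> borel_measurable (S \<Otimes>\<^sub>M T)"
  and b: "!!x y. \<bar>\<Psi> x y\<bar> <= C"
 shows "expectation (%\<omega>. \<Psi> (X \<omega>) (Y \<omega>)) = expectation (%\<omega>. \<integral>y. \<Psi> (X \<omega>) y \<partial>distr M T Y)"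
proof -
 have [measurable]: "X \<in> measurable M S" "Y \<in> measurable M T" using ind by (auto simp: indep_var_distribution_eq)
 interpret X: prob_space "distr M S X" by (rule prob_space_distr) simp
 interpret Y: prob_space "distr M T Y" by (rule prob_space_distr) simp
 interpret XY: pair_prob_space "distr M S X" "distr M T Y" ..
 have i: "integrable (distr M S X \<Otimes>\<^sub>M distr M T Y) (%p. \<Psi> (fst p) (snd p))"
  by (rule XY.P.integrable_const_bound[where B = C]) (use b m in "auto cong: measurable_cong_sets")
 have "expectation (%\<omega>. \<Psi> (X \<omega>) (Y \<omega>)) = (\<integral>p. \<Psi> (fst p) (snd p) \<partial>distr M (S \<Otimes>\<^sub>M T) (%\<omega>. (X \<omega>, Y \<omega>)))"
  using m by (subst integral_distr) auto
 also have "... = (\<integral>p. \<Psi> (fst p) (snd p) \<partial>(distr M S X \<Otimes>\<^sub>M distr M T Y))"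
  using ind by (simp add: indep_var_distribution_eq)
 also have "... = (\<integral>x. \<integral>y. \<Psi> x y \<partial>distr M T Y \<partial>distr M S X)"
  using XY.integral_fst'[OF i] by simp
 also have "... = expectation (%\<omega>. \<integral>y. \<Psi> (X \<omega>) y \<partial>distr M T Y)"
 proof (rule integral_distr)
  have "case_prod (%x y. \<Psi> x y) \<in> borel_measurable (S \<Otimes>\<^sub>M distr M T Y)"
   using m by (simp add: split_beta' cong: measurable_cong_sets)
  then show "(%x. \<integral>y. \<Psi> x y \<partial>distr M T Y) \<in> borel_measurable S"
   by (rule Y.borel_measurable_lebesgue_integral)
 qed simp
 finally show ?thesis .
qed

lemma coordinate_measurable: "(%x. x i) \<in> borel_measurable (borel :: (nat => real) measure)"
 by (intro borel_measurable_continuous_onI continuous_on_product_coordinates)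

text \<open>Families indexed by \<open>J\<close> are extended by 0, so that they all live in the
  single topological space \<open>nat => real\<close>, where continuous functionals are
  measurable.\<close>

lemma (in prob_space) expectation_split_coordinate:
 fixes G :: "nat => 'a => real" and \<Psi> :: "(nat => real) => real"
 assumes ind: "indep_vars (%_. borel) G J" and i: "i \<in> J" and m: "\<Psi> \<in> borel_measurable borel" and b: "!!x. \<bar>\<Psi> x\<bar> <= C"
 defines "F \<equiv> %\<omega> j. if j \<in> J then G j \<omega> else 0"
 shows "expectation (%\<omega>. \<Psi> (F \<omega>)) = expectation (%\<omega>. \<integral>z. \<Psi> ((F \<omega>)(i := z)) \<partial>distr M borel (G i))"
proof -
 let ?p = "%x j. if j \<in> J - {i} then x j else 0 :: real" and ?s = "%x j. if j = i then x j else 0 :: real"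
 have "indep_var (PiM (J - {i}) (%_. borel)) (%\<omega>. restrict (%j. G j \<omega>) (J - {i})) (PiM {i} (%_. borel)) (%\<omega>. restrict (%j. G j \<omega>) {i})"
  by (rule indep_var_restrict[OF ind]) (use i in auto)
 then have "indep_var borel (?p \<circ> (%\<omega>. restrict (%j. G j \<omega>) (J - {i}))) borel (?s \<circ> (%\<omega>. restrict (%j. G j \<omega>) {i}))"
 proof (rule indep_var_compose)
  show "?p \<in> measurable (PiM (J - {i}) (%_. borel)) borel"
  proof (rule measurable_coordinatewise_then_product)
   fix j show "(%x. ?p x j) \<in> borel_measurable (PiM (J - {i}) (%_. borel))" by (cases "j \<in> J - {i}") auto
  qed
  show "?s \<in> measurable (PiM {i} (%_. borel)) borel"
  proof (rule measurable_coordinatewise_then_product)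
   fix j show "(%x. ?s x j) \<in> borel_measurable (PiM {i} (%_. borel))" by (cases "j = i") auto
  qed
 qed
 moreover define X Y where "X \<omega> = (%j. if j \<in> J - {i} then G j \<omega> else 0)" and "Y \<omega> = (%j. if j = i then G i \<omega> else 0)" for \<omega>
 ultimately have ind': "indep_var borel X borel Y" by (simp add: comp_def X_def[abs_def] Y_def[abs_def] cong: if_cong)
 have upd: "(%p. \<Psi> ((f p)(i := h p))) \<in> borel_measurable N"
  if "!!j. (%p. f p j) \<in> borel_measurable N" "h \<in> borel_measurable N" for f N and h :: "_ => real"
  by (rule measurable_compose[OF measurable_coordinatewise_then_product m]) (use that in "auto simp: fun_upd_def")
 have "(%p. \<Psi> ((fst p)(i := snd p i))) \<in> borel_measurable (borel \<Otimes>\<^sub>M borel)"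
  by (rule upd) (rule measurable_compose[OF measurable_fst coordinate_measurable] measurable_compose[OF measurable_snd coordinate_measurable])+
 from expectation_indep_pair[OF ind' this b]
 have "expectation (%\<omega>. \<Psi> ((X \<omega>)(i := Y \<omega> i))) = expectation (%\<omega>. \<integral>y. \<Psi> ((X \<omega>)(i := y i)) \<partial>distr M borel Y)" .
 moreover have "(X \<omega>)(i := Y \<omega> i) = F \<omega>" "(X \<omega>)(i := z) = (F \<omega>)(i := z)" for \<omega> z using i by (auto simp: X_def Y_def F_def)
 moreover have "(\<integral>y. \<Psi> (x(i := y i)) \<partial>distr M borel Y) = (\<integral>z. \<Psi> (x(i := z)) \<partial>distr M borel (G i))" for x
 proof -
  have [measurable]: "Y \<in> borel_measurable M" "G i \<in> borel_measurable M" using ind' ind i by (auto simp: indep_var_distribution_eq indep_vars_def2)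
  have "(%y. \<Psi> (x(i := y i))) \<in> borel_measurable borel" "(%z. \<Psi> (x(i := z))) \<in> borel_measurable borel"
   by (rule upd; simp add: coordinate_measurable)+
  then show ?thesis by (simp add: integral_distr Y_def)
 qed
 ultimately show ?thesis by simp
qed

context triangular_array
begin

text \<open>Induction on the number of blocks. Given the earlier blocks, the last increment is a
  rescaled sum to which the central limit theorem applies, with an error uniform in those blocks. In
  the limit, independence allows the last increment to be integrated out in the same way.\<close>

lemma fdd_convergence:
 fixes \<kappa> :: "nat => nat => nat" and \<Psi> :: "(nat => real) => real"
 assumes \<kappa>: "!!n. \<kappa> n 0 = 0" "!!n i. i < K ==> \<kappa> n i <= \<kappa> n (Suc i)"
   "!!i. i < K ==> (%n. real (\<kappa> n (Suc i) - \<kappa> n i) / (a n)^2) \<longlonglongrightarrow> \<tau> i" and \<tau>: "!!i. i < K ==> \<tau> i > 0"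
  and M: "prob_space M" and ind: "prob_space.indep_vars M (%_. borel) G {..<K}"
  and G: "!!i. i < K ==> distr M borel (G i) = distr N01 borel (%x. \<sigma> * sqrt (\<tau> i) * x)"
  and I: "I <= K" and \<Psi>: "!!x. \<bar>\<Psi> x\<bar> <= C" "!!x y. \<bar>\<Psi> x - \<Psi> y\<bar> <= \<Lambda> * (\<Sum>i<K. \<bar>x i - y i\<bar>)"
 shows "(%n. Ex n (\<kappa> n I) (%xs. \<Psi> (%i. if i < I then (ssum (g n) (take (\<kappa> n (Suc i)) xs) - ssum (g n) (take (\<kappa> n i) xs)) / a n else 0)))
   \<longlonglongrightarrow> integral\<^sup>L M (%\<omega>. \<Psi> (%i. if i < I then G i \<omega> else 0))"
 using I \<Psi>
proof (induction I arbitrary: \<Psi>)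
 case 0
 interpret prob_space M by fact
 show ?case by (simp add: \<kappa> prob_space)
next
 case (Suc I)
 interpret prob_space M by fact
 have IK: "I < K" using Suc by simp
 have [measurable]: "G i \<in> borel_measurable M" if "i < K" for i using ind that by (auto simp: indep_vars_def2)
 define N where "N = distr M borel (G I)"
 interpret N: prob_space N unfolding N_def by (rule prob_space_distr) (simp add: IK)
 have NN: "N = distr N01 borel (%x. \<sigma> * sqrt (\<tau> I) * x)" using G[OF IK] by (simp add: N_def)
 have C0: "C >= 0" using Suc.prems(2)[of "%_. 0"] by linarith
 have L1: "\<bar>\<Psi> (x(I := u)) - \<Psi> (x(I := v))\<bar> <= \<Lambda> * \<bar>u - v\<bar>" for x u v
 proof -
  have "(\<Sum>i<K. \<bar>(x(I := u)) i - (x(I := v)) i\<bar>) = (\<Sum>i<K. if i = I then \<bar>u - v\<bar> else 0)" by (intro sum.cong) auto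
  also have "... = \<bar>u - v\<bar>" using IK by simp
  finally show ?thesis using Suc.prems(3)[of "x(I := u)" "x(I := v)"] by (simp del: fun_upd_apply)
 qed
 have L0: "\<Lambda> >= 0" using L1[of "%_. 0" 1 0] by simp
 have cont: "continuous_on UNIV \<Psi>" by (rule lipschitz_coordinates_continuous[OF Suc.prems(3)])
 have cont1: "continuous_on UNIV (%z. \<Psi> (x(I := z)))" for x
  by (rule lipschitz_on_continuous_on[OF lipschitz_onI[of _ _ \<Lambda>]]) (use L1 L0 in "auto simp: dist_real_def")
 have [measurable]: "(%z. \<Psi> (x(I := z))) \<in> borel_measurable borel" for x using cont1 by (rule borel_measurable_continuous_onI)
 have intN: "integrable N (%z. \<Psi> (x(I := z)))" for x
  by (rule N.integrable_const_bound[where B = C]) (use Suc.prems(2) in "auto simp: N_def")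
 \<comment> \<open>The last Gaussian increment is integrated out. The bound and the Lipschitz
   constant survive, as the induction hypothesis requires.\<close>
 define \<Psi>' where "\<Psi>' x = (\<integral>z. \<Psi> (x(I := z)) \<partial>N)" for x
 have P'1: "\<bar>\<Psi>' x\<bar> <= C" for x
 proof -
  have "\<bar>\<Psi>' x\<bar> <= (\<integral>z. \<bar>\<Psi> (x(I := z))\<bar> \<partial>N)" unfolding \<Psi>'_def by (rule integral_abs_bound)
  also have "... <= (\<integral>z. C \<partial>N)" by (intro integral_mono) (use intN Suc.prems(2) in auto)
  finally show ?thesis by (simp add: N.prob_space)
 qed
 have P'2: "\<bar>\<Psi>' x - \<Psi>' y\<bar> <= \<Lambda> * (\<Sum>i<K. \<bar>x i - y i\<bar>)" for x y
 proof -
  have "\<Psi>' x - \<Psi>' y = (\<integral>z. \<Psi> (x(I := z)) - \<Psi> (y(I := z)) \<partial>N)" unfolding \<Psi>'_def using intN by simp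
  then have "\<bar>\<Psi>' x - \<Psi>' y\<bar> <= (\<integral>z. \<bar>\<Psi> (x(I := z)) - \<Psi> (y(I := z))\<bar> \<partial>N)" by (simp add: integral_abs_bound)
  also have "... <= (\<integral>z. \<Lambda> * (\<Sum>i<K. \<bar>x i - y i\<bar>) \<partial>N)"
  proof (rule integral_mono)
   show "integrable N (%z. \<bar>\<Psi> (x(I := z)) - \<Psi> (y(I := z))\<bar>)" using intN by simp
   fix z
   have "(\<Sum>i<K. \<bar>(x(I := z)) i - (y(I := z)) i\<bar>) <= (\<Sum>i<K. \<bar>x i - y i\<bar>)" by (intro sum_mono) auto
   then show "\<bar>\<Psi> (x(I := z)) - \<Psi> (y(I := z))\<bar> <= \<Lambda> * (\<Sum>i<K. \<bar>x i - y i\<bar>)"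
    using Suc.prems(3)[of "x(I := z)" "y(I := z)"] L0 by (meson mult_left_mono order_trans)
  qed simp
  finally show ?thesis by (simp add: N.prob_space)
 qed
 let ?x = "%n xs i. if i < I then (ssum (g n) (take (\<kappa> n (Suc i)) xs) - ssum (g n) (take (\<kappa> n i) xs)) / a n else 0"
 let ?x' = "%n xs i. if i < Suc I then (ssum (g n) (take (\<kappa> n (Suc i)) xs) - ssum (g n) (take (\<kappa> n i) xs)) / a n else 0"
 define r where "r n = \<kappa> n (Suc I) - \<kappa> n I" for n
 define \<mu> where "\<mu> n = distr (measure_pmf (replicate_pmf (r n) (q n))) borel (%xs. ssum (g n) xs / (a n * \<sigma> * sqrt (\<tau> I)))" for n
 have w: "weak_conv_m \<mu> N01"
  unfolding \<mu>_def r_def by (rule clt_array[OF \<kappa>(3)[OF IK] \<tau>[OF IK]])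
 have mu: "real_distribution (\<mu> n)" for n unfolding \<mu>_def
  by (intro prob_space.real_distribution_distr measure_pmf.prob_space_axioms) simp
 obtain \<beta> where \<beta>: "\<beta> \<longlonglongrightarrow> 0" "ALL n g. (ALL x. \<bar>g x\<bar> <= C) & (ALL x y. \<bar>g x - g y\<bar> <= \<Lambda> * (\<sigma> * sqrt (\<tau> I)) * \<bar>x - y\<bar>) --> \<bar>(\<integral>x. g x \<partial>\<mu> n) - (\<integral>x. g x \<partial>N01)\<bar> <= \<beta> n"
  using weak_conv_lipschitz[OF mu real_dist_normal_dist w, where C = C and \<Lambda> = "\<Lambda> * (\<sigma> * sqrt (\<tau> I))"] by metis
 have kmono: "\<kappa> n i <= \<kappa> n j" if "i <= j" "j <= K" for n i j
  using that by (induction j rule: dec_induct) (use \<kappa>(2) in "auto intro: order_trans")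
 have dev: "\<bar>Ex n (\<kappa> n (Suc I)) (%xs. \<Psi> (?x' n xs)) - Ex n (\<kappa> n I) (%xs. \<Psi>' (?x n xs))\<bar> <= \<beta> n" for n
 proof -
  have split: "\<kappa> n (Suc I) = \<kappa> n I + r n" using \<kappa>(2)[OF IK, of n] by (simp add: r_def)
  have one: "\<bar>Ex n (r n) (%ys. \<Psi> (x(I := ssum (g n) ys / a n))) - \<Psi>' x\<bar> <= \<beta> n" for x
  proof -
   define h where "h z = \<Psi> (x(I := \<sigma> * sqrt (\<tau> I) * z))" for z
   have st: "\<sigma> * sqrt (\<tau> I) > 0" using \<sigma> \<tau>[OF IK] by simp
   have [measurable]: "h \<in> borel_measurable borel" unfolding h_def by measurable
   have h: "\<bar>h u - h v\<bar> <= \<Lambda> * (\<sigma> * sqrt (\<tau> I)) * \<bar>u - v\<bar>" for u v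
   proof -
    have "\<bar>\<sigma> * sqrt (\<tau> I) * u - \<sigma> * sqrt (\<tau> I) * v\<bar> = \<sigma> * sqrt (\<tau> I) * \<bar>u - v\<bar>"
     using abs_mult[of "\<sigma> * sqrt (\<tau> I)" "u - v"] abs_of_pos[OF st] by (simp only: right_diff_distrib)
    then show ?thesis using L1[of x "\<sigma> * sqrt (\<tau> I) * u" "\<sigma> * sqrt (\<tau> I) * v"] by (simp add: h_def mult.assoc)
   qed
   have "(\<integral>z. h z \<partial>\<mu> n) = Ex n (r n) (%ys. \<Psi> (x(I := ssum (g n) ys / a n)))"
   proof -
    have "\<sigma> * sqrt (\<tau> I) * (z / (a n * \<sigma> * sqrt (\<tau> I))) = z / a n" for z using \<sigma> \<tau>[OF IK] by simp
    then show ?thesis unfolding \<mu>_def by (subst integral_distr) (simp_all add: h_def)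
   qed
   moreover have "(\<integral>z. h z \<partial>N01) = \<Psi>' x"
    unfolding \<Psi>'_def NN by (subst integral_distr) (auto simp: h_def[abs_def])
   ultimately show ?thesis using \<beta>(2) h Suc.prems(2) by (metis h_def)
  qed
  have eq: "?x' n (xs @ ys) = (?x n xs)(I := ssum (g n) ys / a n)" if "length xs = \<kappa> n I" "length ys = r n" for xs ys
  proof
   fix i
   have "\<kappa> n (Suc i) <= \<kappa> n I" "\<kappa> n i <= \<kappa> n I" if "i < I" using kmono[of "Suc i" I n] kmono[of i I n] IK that by auto
   moreover have "ssum (g n) (xs @ ys) = ssum (g n) xs + ssum (g n) ys" by (simp add: ssum_def)
   ultimately show "?x' n (xs @ ys) i = ((?x n xs)(I := ssum (g n) ys / a n)) i"
    using that split by (auto simp: less_Suc_eq)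
  qed
  have "Ex n (\<kappa> n (Suc I)) (%xs. \<Psi> (?x' n xs)) = Ex n (\<kappa> n I) (%xs. Ex n (r n) (%ys. \<Psi> ((?x n xs)(I := ssum (g n) ys / a n))))"
   unfolding split Ex_append using eq[unfolded split] by (intro Ex_cong) (simp add: split)
  then have "\<bar>Ex n (\<kappa> n (Suc I)) (%xs. \<Psi> (?x' n xs)) - Ex n (\<kappa> n I) (%xs. \<Psi>' (?x n xs))\<bar> =
    \<bar>Ex n (\<kappa> n I) (%xs. Ex n (r n) (%ys. \<Psi> ((?x n xs)(I := ssum (g n) ys / a n))) - \<Psi>' (?x n xs))\<bar>" by simp
  also have "... <= Ex n (\<kappa> n I) (%xs. \<bar>Ex n (r n) (%ys. \<Psi> ((?x n xs)(I := ssum (g n) ys / a n))) - \<Psi>' (?x n xs)\<bar>)"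
   by (rule integral_abs_bound)
  also have "... <= Ex n (\<kappa> n I) (%xs. \<beta> n)" by (intro Ex_mono one)
  finally show ?thesis by simp
 qed
 have IH: "(%n. Ex n (\<kappa> n I) (%xs. \<Psi>' (?x n xs))) \<longlonglongrightarrow> integral\<^sup>L M (%\<omega>. \<Psi>' (%i. if i < I then G i \<omega> else 0))"
  using Suc.IH[of \<Psi>'] P'1 P'2 IK by simp
 have dev0: "(%n. Ex n (\<kappa> n (Suc I)) (%xs. \<Psi> (?x' n xs)) - Ex n (\<kappa> n I) (%xs. \<Psi>' (?x n xs))) \<longlonglongrightarrow> 0"
  by (rule Lim_null_comparison[OF _ \<beta>(1)], rule always_eventually, rule allI) (use dev in simp)
 have lim: "(%n. Ex n (\<kappa> n (Suc I)) (%xs. \<Psi> (?x' n xs))) \<longlonglongrightarrow> integral\<^sup>L M (%\<omega>. \<Psi>' (%i. if i < I then G i \<omega> else 0))"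
  using tendsto_add[OF dev0 IH] by simp
 have "integral\<^sup>L M (%\<omega>. \<Psi> (%i. if i < Suc I then G i \<omega> else 0)) = integral\<^sup>L M (%\<omega>. \<Psi>' (%i. if i < I then G i \<omega> else 0))"
 proof -
  have "indep_vars (%_. borel) G {..<Suc I}" by (rule indep_vars_subset[OF ind]) (use IK in auto)
  from expectation_split_coordinate[OF this _ borel_measurable_continuous_onI[OF cont] Suc.prems(2), of I]
  have "integral\<^sup>L M (%\<omega>. \<Psi> (%i. if i < Suc I then G i \<omega> else 0)) = expectation (%\<omega>. \<Psi>' (%i. if i < Suc I then G i \<omega> else 0))"
   using IK unfolding \<Psi>'_def N_def lessThan_iff by blast
  moreover have "\<Psi>' (%i. if i < Suc I then G i \<omega> else 0) = \<Psi>' (%i. if i < I then G i \<omega> else 0)" for \<omega>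
   unfolding \<Psi>'_def by (intro arg_cong[where f = "integral\<^sup>L N"] ext arg_cong[where f = \<Psi>]) auto
  ultimately show ?thesis by simp
 qed
 with lim show ?case by simp
qed

end

lemma (in iid) Ex_block:
 assumes "k + r <= L"
 shows "Ex L (%xs. F (take r (drop k xs))) = Ex r F"
proof -
 have "Ex L (%xs. F (take r (drop k xs))) = Ex L (%xs. F (drop k (take (k + r) xs)))" by (simp add: drop_take)
 also have "... = Ex (k + r) (%xs. F (drop k xs))" by (rule Ex_take[OF assms])
 also have "... = Ex k (%xs. Ex r (%ys. F (drop k (xs @ ys))))" by (rule Ex_append)
 also have "... = Ex k (%xs. Ex r F)" by (rule Ex_cong) simp
 finally show ?thesis by simp
qed

lemma floor_ratio_limit:
 assumes "filterlim A at_top sequentially" "0 <= x" "x <= y"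
 shows "(%n. real (nfl (y * A n) - nfl (x * A n)) / A n) \<longlonglongrightarrow> y - (x :: real)"
proof -
 let ?r = "%n. real (nfl (y * A n) - nfl (x * A n))"
 have ev: "eventually (%n. A n > 0) sequentially" using assms(1) by (simp add: filterlim_at_top_dense)
 have inv: "(%n. 1 / A n) \<longlonglongrightarrow> 0" using tendsto_inverse_0_at_top[OF assms(1)] by (simp add: inverse_eq_divide)
 have "(%n. ?r n / A n - (y - x)) \<longlonglongrightarrow> 0"
 proof (rule Lim_null_comparison[OF _ inv])
  show "eventually (%n. norm (?r n / A n - (y - x)) <= 1 / A n) sequentially"
   using ev
  proof eventually_elim
   case (elim n)
   have xy: "0 <= x * A n" "x * A n <= y * A n" using elim assms by (auto intro: mult_right_mono)
   then have f: "0 <= \<lfloor>x * A n\<rfloor>" "\<lfloor>x * A n\<rfloor> <= \<lfloor>y * A n\<rfloor>" by (auto intro: floor_mono)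
   then have "?r n = real_of_int \<lfloor>y * A n\<rfloor> - real_of_int \<lfloor>x * A n\<rfloor>"
    by (simp add: nat_diff_distrib[symmetric])
   then have "\<bar>?r n - (y - x) * A n\<bar> <= 1"
    by (simp add: left_diff_distrib) linarith
   moreover have "?r n / A n - (y - x) = (?r n - (y - x) * A n) / A n"
    using elim by (simp add: field_simps)
   ultimately show ?case using elim by (simp add: divide_right_mono)
  qed
 qed
 then show ?thesis using Lim_null by blast
qed

section \<open>From finitely many increments to functionals of the whole path\<close>

definition grid_path :: "real => nat => (nat => real) => real => real" where
 "grid_path T K x t = (\<Sum>i<nfl (t * real K / T). x i)"

lemma grid_index:
 assumes "T > 0" "K > 0" "t \<in> {0..T}"
 defines "j \<equiv> nfl (t * real K / T)"
 shows "j <= K" "real j * T / real K <= t" "t < real (Suc j) * T / real K" "j = K ==> t = T"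
proof -
 have t: "0 <= t * real K / T" "t * real K / T <= real K" using assms by (auto simp: field_simps)
 have j: "real j <= t * real K / T" "t * real K / T < real j + 1" using t by (auto simp: j_def)
 show "real j * T / real K <= t" "t < real (Suc j) * T / real K" using j assms by (auto simp: field_simps)
 show "j <= K" using j t by linarith
 show "j = K ==> t = T" using j assms by (auto simp: field_simps)
qed

lemma normal_increment_law:
 assumes "std_brownian_motion M B" "0 <= s" "s < t" "\<sigma> > 0"
 shows "distr M borel (%\<omega>. \<sigma> * (B \<omega> t - B \<omega> s)) = distr N01 borel (%x. \<sigma> * sqrt (t - s) * x)"
proof -
 interpret prob_space M using assms by (simp add: std_brownian_motion_def)
 have [measurable]: "(%\<omega>. B \<omega> t) \<in> borel_measurable M" for t using assms by (simp add: std_brownian_motion_def)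
 have st: "sqrt (t - s) > 0" using assms by simp
 have "distributed M lborel (%\<omega>. B \<omega> t - B \<omega> s) (normal_density 0 (sqrt (t - s)))"
  using assms by (simp add: std_brownian_motion_def)
 then have "distributed M lborel (%\<omega>. (B \<omega> t - B \<omega> s - 0) / sqrt (t - s)) std_normal_density"
  unfolding normal_standard_normal_convert[OF st] .
 then have d: "distr M borel (%\<omega>. (B \<omega> t - B \<omega> s) / sqrt (t - s)) = N01"
  by (simp add: distributed_def cong: distr_cong)
 have "distr N01 borel (%x. \<sigma> * sqrt (t - s) * x) = distr M borel ((%x. \<sigma> * sqrt (t - s) * x) \<circ> (%\<omega>. (B \<omega> t - B \<omega> s) / sqrt (t - s)))"
  unfolding d[symmetric] by (rule distr_distr) auto
 also have "... = distr M borel (%\<omega>. \<sigma> * (B \<omega> t - B \<omega> s))" using st by (intro distr_cong) (auto simp: o_def)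
 finally show ?thesis by simp
qed

context triangular_array
begin

context
 fixes T C \<Lambda> :: real and \<Phi> :: "(real => real) => real" and M :: "'a measure" and B :: "'a => real => real"
 assumes BM: "std_brownian_motion M B" and T: "T > 0"
  and \<Phi>: "!!f. \<bar>\<Phi> f\<bar> <= C" "!!f h \<delta>. \<delta> >= 0 ==> (!!t. t \<in> {0..T} ==> \<bar>f t - h t\<bar> <= \<delta>) ==> \<bar>\<Phi> f - \<Phi> h\<bar> <= \<Lambda> * \<delta>"
begin

interpretation prob_space M using BM by (simp add: std_brownian_motion_def)

private lemma B_meas [measurable]: "(%\<omega>. B \<omega> t) \<in> borel_measurable M" using BM by (simp add: std_brownian_motion_def)

private abbreviation "tm K i \<equiv> real i * T / real K"
private abbreviation "sz n \<equiv> nfl (T * (a n)^2)"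
private definition G where "G K i \<omega> = \<sigma> * (B \<omega> (tm K (Suc i)) - B \<omega> (tm K i))"
private definition Gc where "Gc K \<omega> = (%i. if i < K then G K i \<omega> else 0)"
private definition \<kappa> where "\<kappa> K n i = nfl ((tm K i) * (a n)^2)"
private definition inc where "inc K n xs = (%i. if i < K then (ssum (g n) (take (\<kappa> K n (Suc i)) xs) - ssum (g n) (take (\<kappa> K n i) xs)) / a n else 0)"
private definition wp where "wp n xs = (%t. ssum (g n) (take (nfl (t * (a n)^2)) xs) / a n)"
private abbreviation "gp K \<omega> \<equiv> grid_path T K (Gc K \<omega>)"
private abbreviation "wg K n xs \<equiv> grid_path T K (inc K n xs)"

private lemma L0: "\<Lambda> >= 0"
 using \<Phi>(2)[of 1 "%_. 0" "%_. 0"] by simp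

private lemma \<Psi>_lip:
 assumes "K > 0"
 shows "\<bar>\<Phi> (grid_path T K x) - \<Phi> (grid_path T K y)\<bar> <= \<Lambda> * (\<Sum>i<K. \<bar>x i - y i\<bar>)"
proof (rule \<Phi>(2))
 fix t assume t: "t \<in> {0..T}"
 have "\<bar>grid_path T K x t - grid_path T K y t\<bar> <= (\<Sum>i<nfl (t * real K / T). \<bar>x i - y i\<bar>)"
  unfolding grid_path_def sum_subtractf[symmetric] by (rule sum_abs)
 also have "... <= (\<Sum>i<K. \<bar>x i - y i\<bar>)" using grid_index(1)[OF T assms t] by (intro sum_mono2) auto
 finally show "\<bar>grid_path T K x t - grid_path T K y t\<bar> <= (\<Sum>i<K. \<bar>x i - y i\<bar>)" .
qed (simp add: sum_nonneg)

private lemma grid_telescope: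
 assumes "K > 0" "t \<in> {0..T}" "!!i. i < K ==> x i = F (Suc i) - F i"
 shows "grid_path T K x t = F (nfl (t * real K / T)) - (F 0 :: real)"
proof -
 have "grid_path T K x t = (\<Sum>i<nfl (t * real K / T). F (Suc i) - F i)"
  unfolding grid_path_def using grid_index(1)[OF T assms(1,2)] assms(3) by (intro sum.cong) auto
 then show ?thesis by (simp add: sum_lessThan_telescope)
qed

text \<open>Uniform continuity of the path makes its step approximations converge. Measurability of
  \<open>\<Phi>\<close> along the path is obtained here too, as a limit of continuous functions of
  finitely many increments.\<close>

private lemma B_limit:
 "(%\<omega>. \<Phi> (%t. \<sigma> * B \<omega> t)) \<in> borel_measurable M"
 "(%K. expectation (%\<omega>. \<Phi> (gp (Suc K) \<omega>))) \<longlonglongrightarrow> expectation (%\<omega>. \<Phi> (%t. \<sigma> * B \<omega> t))"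
proof -
 have m: "(%\<omega>. \<Phi> (gp (Suc K) \<omega>)) \<in> borel_measurable M" for K
 proof (rule measurable_compose[of "Gc (Suc K)" M borel "%x. \<Phi> (grid_path T (Suc K) x)" borel])
  show "Gc (Suc K) \<in> borel_measurable M"
  proof (rule measurable_coordinatewise_then_product)
   fix i show "(%\<omega>. Gc (Suc K) \<omega> i) \<in> borel_measurable M" by (cases "i < Suc K") (auto simp: Gc_def G_def)
  qed
  show "(%x. \<Phi> (grid_path T (Suc K) x)) \<in> borel_measurable borel"
   by (rule borel_measurable_continuous_onI[OF lipschitz_coordinates_continuous[OF \<Psi>_lip]]) simp
 qed
 have lim: "(%K. \<Phi> (gp (Suc K) \<omega>)) \<longlonglongrightarrow> \<Phi> (%t. \<sigma> * B \<omega> t)" if \<omega>: "\<omega> \<in> space M" for \<omega>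
 proof (rule LIMSEQ_I)
  fix \<eta> :: real assume \<eta>: "\<eta> > 0"
  define \<epsilon> where "\<epsilon> = \<eta> / (2 * (\<Lambda> + 1) * \<sigma>)"
  have \<epsilon>: "\<epsilon> > 0" using \<eta> L0 \<sigma> by (simp add: \<epsilon>_def)
  have B0: "B \<omega> 0 = 0" and Bc: "continuous_on {0..} (B \<omega>)" using BM \<omega> by (auto simp: std_brownian_motion_def)
  have "uniformly_continuous_on {0..T} (B \<omega>)"
   by (rule compact_uniformly_continuous[OF continuous_on_subset[OF Bc]]) auto
  then obtain d where d: "d > 0" "!!s t. s \<in> {0..T} ==> t \<in> {0..T} ==> dist t s < d ==> dist (B \<omega> t) (B \<omega> s) < \<epsilon>"
   unfolding uniformly_continuous_on_def using \<epsilon> by metis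
  obtain K0 :: nat where K0: "real K0 > T / d" using reals_Archimedean2 by blast
  have "norm (\<Phi> (gp (Suc K) \<omega>) - \<Phi> (%t. \<sigma> * B \<omega> t)) < \<eta>" if K: "K >= K0" for K
  proof -
   have Kd: "T / real (Suc K) < d"
   proof -
    have "T / d < real (Suc K)" using K0 K by linarith
    then show ?thesis using d(1) by (simp add: field_simps)
   qed
   have "\<bar>\<Phi> (gp (Suc K) \<omega>) - \<Phi> (%t. \<sigma> * B \<omega> t)\<bar> <= \<Lambda> * (\<sigma> * \<epsilon>)"
   proof (rule \<Phi>(2))
    fix t assume t: "t \<in> {0..T}"
    define j where "j = nfl (t * real (Suc K) / T)"
    note j = grid_index[OF T zero_less_Suc t, of K, folded j_def]
    have "gp (Suc K) \<omega> t = \<sigma> * B \<omega> (tm (Suc K) j) - \<sigma> * B \<omega> (tm (Suc K) 0)"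
     unfolding j_def by (rule grid_telescope[OF zero_less_Suc t]) (simp add: Gc_def G_def right_diff_distrib del: of_nat_Suc)
    then have eq: "gp (Suc K) \<omega> t = \<sigma> * B \<omega> (tm (Suc K) j)" using B0 by simp
    have "tm (Suc K) (Suc j) = tm (Suc K) j + T / real (Suc K)"
     by (simp only: of_nat_Suc[of j] distrib_right add_divide_distrib mult_1_left add.commute)
    moreover have "\<bar>u - t\<bar> < d" if "u <= t" "t < v" "v = u + e" "e < d" for u v e :: real using that by linarith
    ultimately have "dist (tm (Suc K) j) t < d" unfolding dist_real_def using j(2,3) Kd by blast
    moreover have "tm (Suc K) j \<in> {0..T}" using j(2) t T by auto
    ultimately have "\<bar>B \<omega> (tm (Suc K) j) - B \<omega> t\<bar> <= \<epsilon>" using d(2)[OF t, of "tm (Suc K) j"] by (simp add: dist_real_def)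
    then have "\<sigma> * \<bar>B \<omega> (tm (Suc K) j) - B \<omega> t\<bar> <= \<sigma> * \<epsilon>" using \<sigma> by simp
    then show "\<bar>gp (Suc K) \<omega> t - \<sigma> * B \<omega> t\<bar> <= \<sigma> * \<epsilon>"
     unfolding eq right_diff_distrib[symmetric] abs_mult using \<sigma> by simp
   qed (use \<sigma> \<epsilon> in simp)
   also have "... < \<eta>"
   proof -
    have "\<Lambda> * (\<sigma> * \<epsilon>) = (\<Lambda> / (\<Lambda> + 1)) * (\<eta> / 2)" using \<sigma> by (simp add: \<epsilon>_def)
    also have "... <= 1 * (\<eta> / 2)" using L0 \<eta> by (intro mult_right_mono) auto
    finally show ?thesis using \<eta> by simp
   qed
   finally show ?thesis by simp
  qed
  then show "EX no. ALL K>=no. norm (\<Phi> (gp (Suc K) \<omega>) - \<Phi> (%t. \<sigma> * B \<omega> t)) < \<eta>" by blast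
 qed
 show m': "(%\<omega>. \<Phi> (%t. \<sigma> * B \<omega> t)) \<in> borel_measurable M"
  by (rule borel_measurable_LIMSEQ_real[OF lim m])
 show "(%K. expectation (%\<omega>. \<Phi> (gp (Suc K) \<omega>))) \<longlonglongrightarrow> expectation (%\<omega>. \<Phi> (%t. \<sigma> * B \<omega> t))"
  by (rule integral_dominated_convergence[where w = "%_. C"]) (use m m' lim \<Phi>(1) in auto)
qed

private lemma fdd:
 assumes K: "K > 0"
 shows "(%n. Ex n (sz n) (%xs. \<Phi> (wg K n xs))) \<longlonglongrightarrow> expectation (%\<omega>. \<Phi> (gp K \<omega>))"
proof -
 have ts: "tm K i < tm K (Suc i)" for i using T K by (simp add: field_simps)
 have A: "filterlim (%n. (a n)^2) at_top sequentially" using a(2) by (rule filterlim_pow_at_top[rotated]) simp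
 have kK: "\<kappa> K n K = sz n" for n using K by (simp add: \<kappa>_def)
 have "(%n. Ex n (\<kappa> K n K) (%xs. \<Phi> (grid_path T K (%i. if i < K then (ssum (g n) (take (\<kappa> K n (Suc i)) xs) - ssum (g n) (take (\<kappa> K n i) xs)) / a n else 0))))
   \<longlonglongrightarrow> expectation (%\<omega>. \<Phi> (grid_path T K (%i. if i < K then G K i \<omega> else 0)))"
 proof (rule fdd_convergence[where \<tau> = "%i. tm K (Suc i) - tm K i"])
  show "\<kappa> K n 0 = 0" for n by (simp add: \<kappa>_def)
  show "\<kappa> K n i <= \<kappa> K n (Suc i)" for n i
   unfolding \<kappa>_def using ts[of i] by (intro nat_mono floor_mono mult_right_mono) auto
  show "(%n. real (\<kappa> K n (Suc i) - \<kappa> K n i) / (a n)^2) \<longlonglongrightarrow> tm K (Suc i) - tm K i" for i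
   unfolding \<kappa>_def using floor_ratio_limit[OF A, of "tm K i" "tm K (Suc i)"] ts[of i] T by simp
  show "tm K (Suc i) - tm K i > 0" for i using ts[of i] by simp
  show "prob_space M" by (rule prob_space_axioms)
  have "indep_vars (%_. borel) (%i \<omega>. B \<omega> (tm K (Suc i)) - B \<omega> (tm K i)) {..<K}"
   using BM ts T unfolding std_brownian_motion_def by (elim conjE allE[of _ "%i. tm K i"] allE[of _ K]) auto
  then show "indep_vars (%_. borel) (G K) {..<K}"
   unfolding G_def[abs_def] by (rule indep_vars_compose2[where Y = "%_ x. \<sigma> * x"]) auto
  show "distr M borel (G K i) = distr N01 borel (%x. \<sigma> * sqrt (tm K (Suc i) - tm K i) * x)" for i
   unfolding G_def[abs_def] by (rule normal_increment_law[OF BM _ ts \<sigma>]) (use T in simp)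
  show "\<bar>\<Phi> (grid_path T K x) - \<Phi> (grid_path T K y)\<bar> <= \<Lambda> * (\<Sum>i<K. \<bar>x i - y i\<bar>)" for x y by (rule \<Psi>_lip[OF K])
 qed (use \<Phi>(1) in auto)
 then show ?thesis by (simp add: kK inc_def Gc_def)
qed

text \<open>For large \<open>n\<close> each of the \<open>K\<close> blocks oscillates by more than
  \<open>\<epsilon> * a n\<close> with probability of order
  \<open>1 / (K^2 * \<epsilon> ^ 4)\<close>, so together they contribute order \<open>1 / K\<close>.
  Second moments would only give order 1.\<close>

private lemma osc:
 assumes K: "K > 0" and \<epsilon>: "\<epsilon> > 0"
 defines "m2 \<equiv> %n. expect (q n) (%e. (g n e)^2)" and "\<rho> \<equiv> %n i. real (\<kappa> K n (Suc i) - \<kappa> K n i) / (a n)^2"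
 shows "\<bar>Ex n (sz n) (%xs. \<Phi> (wp n xs)) - Ex n (sz n) (%xs. \<Phi> (wg K n xs))\<bar>
   <= \<Lambda> * \<epsilon> + 2 * C * (\<Sum>i<K. (\<rho> n i * (b n / a n)^2 * m2 n + 3 * (\<rho> n i)^2 * (m2 n)^2) / \<epsilon> ^ 4)"
proof -
 define L where "L = sz n"
 define r where "r i = \<kappa> K n (Suc i) - \<kappa> K n i" for i
 have kmono: "\<kappa> K n i <= \<kappa> K n j" if "i <= j" for i j
  unfolding \<kappa>_def using that T by (intro nat_mono floor_mono mult_right_mono divide_right_mono) auto
 have kK: "\<kappa> K n K = L" using K by (simp add: \<kappa>_def L_def)
 define bad where "bad i xs = (if \<epsilon> * a n <= rmax (ssum (g n)) (take (r i) (drop (\<kappa> K n i) xs)) then 1 else 0 :: real)" for i xs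
 have C0: "C >= 0" using \<Phi>(1)[of "%_. 0"] by linarith
 have pw: "\<bar>\<Phi> (wp n xs) - \<Phi> (wg K n xs)\<bar> <= \<Lambda> * \<epsilon> + 2 * C * (\<Sum>i<K. bad i xs)" if len: "length xs = L" for xs
 proof (cases "EX i<K. bad i xs = 1")
  case True
  then obtain i where i: "i < K" "bad i xs = 1" by auto
  have "1 <= (\<Sum>i<K. bad i xs)" using member_le_sum[of i "{..<K}" "%i. bad i xs"] i by (auto simp: bad_def)
  then have "2 * C * 1 <= 2 * C * (\<Sum>i<K. bad i xs)" using C0 by (intro mult_left_mono) auto
  moreover have "\<Lambda> * \<epsilon> >= 0" using L0 \<epsilon> by simp
  ultimately show ?thesis using \<Phi>(1)[of "wp n xs"] \<Phi>(1)[of "wg K n xs"] by linarith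
 next
  case False
  then have good: "rmax (ssum (g n)) (take (r i) (drop (\<kappa> K n i) xs)) < \<epsilon> * a n" if "i < K" for i
  proof -
   have "bad i xs ~= 1" using False that by blast
   then show ?thesis by (auto simp: bad_def split: if_splits)
  qed
  have "\<bar>\<Phi> (wp n xs) - \<Phi> (wg K n xs)\<bar> <= \<Lambda> * \<epsilon>"
  proof (rule \<Phi>(2))
   fix t assume t: "t \<in> {0..T}"
   define j where "j = nfl (t * real K / T)"
   note j = grid_index[OF T K t, folded j_def]
   define k where "k = nfl (t * (a n)^2)"
   have "wg K n xs t = ssum (g n) (take (\<kappa> K n j) xs) / a n - ssum (g n) (take (\<kappa> K n 0) xs) / a n"
    unfolding j_def by (rule grid_telescope[OF K t]) (simp add: inc_def diff_divide_distrib)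
   then have eq: "wg K n xs t = ssum (g n) (take (\<kappa> K n j) xs) / a n" by (simp add: \<kappa>_def)
   have kj: "\<kappa> K n j <= k" unfolding \<kappa>_def k_def using j(2) by (intro nat_mono floor_mono mult_right_mono) auto
   show "\<bar>wp n xs t - wg K n xs t\<bar> <= \<epsilon>"
   proof (cases "j = K")
    case True
    then have "k = \<kappa> K n j" using j(4) kK by (simp add: k_def L_def)
    then show ?thesis unfolding eq wp_def k_def[symmetric] using \<epsilon> by simp
   next
    case False
    then have jK: "j < K" using j(1) by simp
    have kj2: "k <= \<kappa> K n (Suc j)" unfolding \<kappa>_def k_def using j(3) by (intro nat_mono floor_mono mult_right_mono) auto
    have "take k xs = take (\<kappa> K n j) xs @ take (k - \<kappa> K n j) (take (r j) (drop (\<kappa> K n j) xs))"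
     using kj kj2 by (simp add: r_def min_def take_add[symmetric])
    then have "ssum (g n) (take k xs) - ssum (g n) (take (\<kappa> K n j) xs) = ssum (g n) (take (k - \<kappa> K n j) (take (r j) (drop (\<kappa> K n j) xs)))"
     by (simp add: ssum_def)
    moreover have "k - \<kappa> K n j <= length (take (r j) (drop (\<kappa> K n j) xs))"
     using kj kj2 kmono[of "Suc j" K] jK by (simp add: r_def len kK)
    ultimately have "\<bar>ssum (g n) (take k xs) - ssum (g n) (take (\<kappa> K n j) xs)\<bar> <= rmax (ssum (g n)) (take (r j) (drop (\<kappa> K n j) xs))"
     using rmax_ge[of "k - \<kappa> K n j" "take (r j) (drop (\<kappa> K n j) xs)" "ssum (g n)"] by simp
    then have "\<bar>ssum (g n) (take k xs) - ssum (g n) (take (\<kappa> K n j) xs)\<bar> <= \<epsilon> * a n" using good[OF jK] by simp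
    then have "\<bar>ssum (g n) (take k xs) - ssum (g n) (take (\<kappa> K n j) xs)\<bar> / a n <= \<epsilon>" using a(1)[of n] by (simp add: field_simps)
    then show ?thesis unfolding eq wp_def k_def[symmetric] diff_divide_distrib[symmetric] abs_divide using a(1)[of n] by simp
   qed
  qed (use \<epsilon> in simp)
  moreover have "0 <= (\<Sum>i<K. bad i xs)" by (intro sum_nonneg) (auto simp: bad_def)
  ultimately show ?thesis using C0 by (simp add: add_increasing2)
 qed
 have pbad: "Ex n L (bad i) <= (\<rho> n i * (b n / a n)^2 * m2 n + 3 * (\<rho> n i)^2 * (m2 n)^2) / \<epsilon> ^ 4" if i: "i < K" for i
 proof -
  have kr: "\<kappa> K n i + r i <= L" using kmono[of i "Suc i"] kmono[of "Suc i" K] i by (simp add: r_def kK)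
  have "Ex n L (bad i) = Ex n (r i) (%ys. if \<epsilon> * a n <= rmax (ssum (g n)) ys then 1 else 0 :: real)"
   unfolding bad_def by (rule Ex_block[OF kr])
  also have "... = measure_pmf.prob (replicate_pmf (r i) (q n)) {ys. \<epsilon> * a n <= rmax (ssum (g n)) ys}"
   unfolding prob_eq_expectation by (intro Bochner_Integration.integral_cong) auto
  also have "... <= Ex n (r i) (%ys. (ssum (g n) ys) ^ 4) / (\<epsilon> * a n) ^ 4"
   by (rule doob4) (use mean \<epsilon> a in auto)
  also have "... <= (real (r i) * ((b n)^2 * m2 n) + 3 * (real (r i))^2 * (m2 n)^2) / (\<epsilon> * a n) ^ 4"
  proof (rule divide_right_mono)
   have "expect (q n) (%e. (g n e) ^ 4) <= expect (q n) (%e. (b n)^2 * (g n e)^2)"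
   proof (rule expectation_mono_finite[OF fin])
    fix e assume e: "e \<in> set_pmf (q n)"
    have "(g n e)^2 <= (b n)^2" using bnd[OF e] by (metis abs_le_square_iff abs_ge_self order_trans)
    then have "(g n e)^2 * (g n e)^2 <= (b n)^2 * (g n e)^2" by (intro mult_right_mono) auto
    then show "(g n e) ^ 4 <= (b n)^2 * (g n e)^2" by (simp add: power4_eq_xxxx power2_eq_square mult.assoc)
   qed
   also have "... = (b n)^2 * m2 n" by (simp add: m2_def)
   finally have "real (r i) * expect (q n) (%e. (g n e) ^ 4) <= real (r i) * ((b n)^2 * m2 n)" by (intro mult_left_mono) auto
   then show "Ex n (r i) (%ys. (ssum (g n) ys) ^ 4) <= real (r i) * ((b n)^2 * m2 n) + 3 * (real (r i))^2 * (m2 n)^2"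
    using ssum_4[OF mean, where n = "r i" and na = n] unfolding m2_def by linarith
  qed (use \<epsilon> a(1)[of n] in auto)
  also have "... = (\<rho> n i * (b n / a n)^2 * m2 n + 3 * (\<rho> n i)^2 * (m2 n)^2) / \<epsilon> ^ 4"
   unfolding \<rho>_def r_def[symmetric] using a(1)[of n] \<epsilon> by (simp add: field_simps power2_eq_square power4_eq_xxxx)
  finally show ?thesis .
 qed
 have "\<bar>Ex n L (%xs. \<Phi> (wp n xs)) - Ex n L (%xs. \<Phi> (wg K n xs))\<bar> = \<bar>Ex n L (%xs. \<Phi> (wp n xs) - \<Phi> (wg K n xs))\<bar>" by simp
 also have "... <= Ex n L (%xs. \<bar>\<Phi> (wp n xs) - \<Phi> (wg K n xs)\<bar>)" by (rule integral_abs_bound)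
 also have "... <= Ex n L (%xs. \<Lambda> * \<epsilon> + 2 * C * (\<Sum>i<K. bad i xs))" by (intro Ex_mono pw)
 also have "... = \<Lambda> * \<epsilon> + 2 * C * (\<Sum>i<K. Ex n L (bad i))" by (simp add: Bochner_Integration.integral_sum)
 also have "... <= \<Lambda> * \<epsilon> + 2 * C * (\<Sum>i<K. (\<rho> n i * (b n / a n)^2 * m2 n + 3 * (\<rho> n i)^2 * (m2 n)^2) / \<epsilon> ^ 4)"
  using C0 pbad by (intro add_left_mono mult_left_mono sum_mono) auto
 finally show ?thesis by (simp add: L_def)
qed

lemma donsker_measurable: "(%\<omega>. \<Phi> (%t. \<sigma> * B \<omega> t)) \<in> borel_measurable M"
 by (rule B_limit)

theorem donsker:
 "(%n. expect (replicate_pmf (nfl (T * (a n)^2)) (q n)) (%xs. \<Phi> (%t. ssum (g n) (take (nfl (t * (a n)^2)) xs) / a n)))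
   \<longlonglongrightarrow> integral\<^sup>L M (%\<omega>. \<Phi> (%t. \<sigma> * B \<omega> t))"
proof (rule LIMSEQ_I)
 fix \<eta> :: real assume \<eta>: "\<eta> > 0"
 define \<epsilon> where "\<epsilon> = \<eta> / (4 * (\<Lambda> + 1))"
 have \<epsilon>: "\<epsilon> > 0" using \<eta> L0 by (simp add: \<epsilon>_def)
 have Le: "\<Lambda> * \<epsilon> <= \<eta> / 4"
 proof -
  have "\<Lambda> * \<epsilon> = (\<Lambda> / (\<Lambda> + 1)) * (\<eta> / 4)" by (simp add: \<epsilon>_def)
  also have "... <= 1 * (\<eta> / 4)" using L0 \<eta> by (intro mult_right_mono) auto
  finally show ?thesis by simp
 qed
 let ?E = "expectation (%\<omega>. \<Phi> (%t. \<sigma> * B \<omega> t))"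
 \<comment> \<open>The limit in \<open>n\<close> of the bound of \<open>osc\<close>: there are
   \<open>K\<close> blocks, each with \<open>\<rho>\<close> tending to \<open>T / K\<close>, and the
   term in \<open>b n / a n\<close> vanishes.\<close>
 have "(%K. (6 * C * T^2 * \<sigma> ^ 4 / \<epsilon> ^ 4) * (1 / real (Suc K))) \<longlonglongrightarrow> (6 * C * T^2 * \<sigma> ^ 4 / \<epsilon> ^ 4) * 0"
  using LIMSEQ_inverse_real_of_nat by (intro tendsto_intros) (simp add: inverse_eq_divide)
 then have "eventually (%K. (6 * C * T^2 * \<sigma> ^ 4 / \<epsilon> ^ 4) * (1 / real (Suc K)) < \<eta> / 8) sequentially"
  using \<eta> by (intro order_tendstoD(2)[of _ 0]) auto
 moreover have "eventually (%K. dist (expectation (%\<omega>. \<Phi> (gp (Suc K) \<omega>))) ?E < \<eta> / 4) sequentially"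
  using \<eta> by (intro tendstoD[OF B_limit(2)]) auto
 ultimately have "eventually (%K. (6 * C * T^2 * \<sigma> ^ 4 / \<epsilon> ^ 4) * (1 / real (Suc K)) < \<eta> / 8 &
   dist (expectation (%\<omega>. \<Phi> (gp (Suc K) \<omega>))) ?E < \<eta> / 4) sequentially" by (rule eventually_conj)
 then obtain K' where K': "(6 * C * T^2 * \<sigma> ^ 4 / \<epsilon> ^ 4) * (1 / real (Suc K')) < \<eta> / 8"
  "dist (expectation (%\<omega>. \<Phi> (gp (Suc K') \<omega>))) ?E < \<eta> / 4"
  by (auto simp: eventually_sequentially)
 define K where "K = Suc K'"
 have K: "K > 0" by (simp add: K_def)
 define m2 where "m2 n = expect (q n) (%e. (g n e)^2)" for n
 define \<rho> where "\<rho> n i = real (\<kappa> K n (Suc i) - \<kappa> K n i) / (a n)^2" for n i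
 have A: "filterlim (%n. (a n)^2) at_top sequentially" using a(2) by (rule filterlim_pow_at_top[rotated]) simp
 have rho: "(%n. \<rho> n i) \<longlonglongrightarrow> T / real K" for i
 proof -
  have "(%n. \<rho> n i) \<longlonglongrightarrow> tm K (Suc i) - tm K i"
   unfolding \<rho>_def \<kappa>_def using T K by (intro floor_ratio_limit A) (auto simp: field_simps)
  also have "tm K (Suc i) - tm K i = T / real K"
   by (simp add: distrib_right add_divide_distrib)
  finally show ?thesis .
 qed
 have m2: "m2 \<longlonglongrightarrow> \<sigma>^2" using var by (simp add: m2_def[abs_def])
 have "(%n. 2 * C * (\<Sum>i<K. (\<rho> n i * (b n / a n)^2 * m2 n + 3 * (\<rho> n i)^2 * (m2 n)^2) / \<epsilon> ^ 4))
  \<longlonglongrightarrow> 2 * C * (\<Sum>i<K. (T / real K * 0^2 * \<sigma>^2 + 3 * (T / real K)^2 * (\<sigma>^2)^2) / \<epsilon> ^ 4)"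
  using \<epsilon> by (intro tendsto_intros rho ba m2) auto
 also have "2 * C * (\<Sum>i<K. (T / real K * 0^2 * \<sigma>^2 + 3 * (T / real K)^2 * (\<sigma>^2)^2) / \<epsilon> ^ 4) = (6 * C * T^2 * \<sigma> ^ 4 / \<epsilon> ^ 4) * (1 / real K)"
  using K by (simp add: power2_eq_square power4_eq_xxxx field_simps)
 finally have "eventually (%n. 2 * C * (\<Sum>i<K. (\<rho> n i * (b n / a n)^2 * m2 n + 3 * (\<rho> n i)^2 * (m2 n)^2) / \<epsilon> ^ 4) < \<eta> / 8) sequentially"
  using K'(1) by (intro order_tendstoD(2)) (auto simp: K_def)
 moreover have "eventually (%n. dist (Ex n (sz n) (%xs. \<Phi> (wg K n xs))) (expectation (%\<omega>. \<Phi> (gp K \<omega>))) < \<eta> / 8) sequentially"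
  using \<eta> by (intro tendstoD[OF fdd[OF K]]) auto
 ultimately have "eventually (%n. norm (Ex n (sz n) (%xs. \<Phi> (wp n xs)) - ?E) < \<eta>) sequentially"
 proof eventually_elim
  case (elim n)
  have "\<bar>Ex n (sz n) (%xs. \<Phi> (wp n xs)) - Ex n (sz n) (%xs. \<Phi> (wg K n xs))\<bar> <= \<eta> / 4 + \<eta> / 8"
   using osc[OF K \<epsilon>, of n] elim(1) Le unfolding m2_def \<rho>_def by linarith
  then show ?case using elim(2) K'(2) \<eta> unfolding K_def[symmetric] dist_real_def real_norm_def by linarith
 qed
 then show "EX no. ALL n>=no. norm (expect (replicate_pmf (sz n) (q n)) (%xs. \<Phi> (%t. ssum (g n) (take (nfl (t * (a n)^2)) xs) / a n)) - ?E) < \<eta>"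
  by (simp add: eventually_sequentially wp_def)
qed

end

end

section \<open>Excursions of Brownian motion with drift\<close>

definition grid_min :: "nat => real => real => (real => real) => real" where
 "grid_min N a b f = Min ((%i. f (a + (b - a) * real i / real N)) ` {..N})"

lemma grid_min_limit:
 fixes f :: "real => real"
 assumes f: "continuous_on {a..b} f" and ab: "a <= b"
 shows "(%N. grid_min (Suc N) a b f) \<longlonglongrightarrow> (INF s\<in>{a..b}. f s)"
proof (rule LIMSEQ_I)
 fix \<epsilon> :: real assume \<epsilon>: "\<epsilon> > 0"
 obtain u where u: "u \<in> {a..b}" "!!s. s \<in> {a..b} ==> f u <= f s" "(INF s\<in>{a..b}. f s) = f u"
  using cont_INF[OF f ab] by metis
 have "uniformly_continuous_on {a..b} f" by (rule compact_uniformly_continuous[OF f]) simp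
 then obtain d where d: "d > 0" "!!s t. s \<in> {a..b} ==> t \<in> {a..b} ==> dist t s < d ==> dist (f t) (f s) < \<epsilon>"
  unfolding uniformly_continuous_on_def using \<epsilon> by metis
 obtain N0 :: nat where N0: "real N0 > (b - a) / d" using reals_Archimedean2 by blast
 have "norm (grid_min (Suc N) a b f - (INF s\<in>{a..b}. f s)) < \<epsilon>" if N: "N >= N0" for N
 proof -
  define g where "g i = a + (b - a) * real i / real (Suc N)" for i
  have g: "g i \<in> {a..b}" if "i <= Suc N" for i
  proof -
   have "(b - a) * (real i / real (Suc N)) <= (b - a) * 1" using that ab by (intro mult_left_mono) auto
   then show ?thesis using ab by (simp add: g_def)
  qed
  have lower: "f u <= grid_min (Suc N) a b f"
   unfolding grid_min_def g_def[symmetric] using g u(2) by (subst Min_ge_iff) auto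
  have "EX i<=Suc N. \<bar>g i - u\<bar> < d"
  proof (cases "a = b")
   case True
   then show ?thesis using u d(1) by (intro exI[of _ 0]) (auto simp: g_def)
  next
   case False
   then have ab': "b - a > 0" using ab by simp
   define i where "i = nfl ((u - a) * real (Suc N) / (b - a))"
   have p: "0 <= (u - a) * real (Suc N) / (b - a)" "(u - a) * real (Suc N) / (b - a) <= real (Suc N)"
    using u(1) ab' by (auto simp: pos_divide_le_eq mult.commute intro!: mult_left_mono divide_nonneg_pos)
   have i: "real i <= (u - a) * real (Suc N) / (b - a)" "(u - a) * real (Suc N) / (b - a) < real i + 1"
    using p by (auto simp: i_def)
   have "i <= Suc N" using i(1) p(2) by linarith
   moreover have "w * k / s <= x" if "k <= x * s / w" "s > 0" "w > 0" for k x s w :: real using that by (simp add: field_simps)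
   from this[OF i(1) _ ab'] have "g i <= u" by (simp add: g_def)
   moreover have "x < w * k / s + w / s" if "x * s / w < k + 1" "s > 0" "w > 0" for k x s w :: real using that by (simp add: field_simps)
   from this[OF i(2) _ ab'] have "u < g i + (b - a) / real (Suc N)" by (simp add: g_def)
   moreover have "(b - a) / real (Suc N) < d"
   proof -
    have "(b - a) / d < real (Suc N)" using N0 N by linarith
    then show ?thesis using d(1) by (simp add: field_simps)
   qed
   ultimately show ?thesis by (intro exI[of _ i]) linarith
  qed
  then obtain i where i: "i <= Suc N" "\<bar>g i - u\<bar> < d" by auto
  have "grid_min (Suc N) a b f <= f (g i)" unfolding grid_min_def g_def[symmetric] using i by (intro Min_le) auto
  also have "f (g i) < f u + \<epsilon>" using d(2)[OF u(1) g[OF i(1)]] i(2) by (auto simp: dist_real_def)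
  finally show ?thesis using lower u(3) by simp
 qed
 then show "EX no. ALL N>=no. norm (grid_min (Suc N) a b f - (INF s\<in>{a..b}. f s)) < \<epsilon>" by blast
qed

lemma std_normal_small_interval:
 assumes "\<rho> > 0" "\<epsilon> > 0"
 shows "measure N01 {x. \<bar>\<rho> * x + r\<bar> <= \<epsilon>} <= 2 * \<epsilon> / \<rho>"
proof -
 have eq: "{x. \<bar>\<rho> * x + r\<bar> <= \<epsilon>} = {(- \<epsilon> - r) / \<rho>..(\<epsilon> - r) / \<rho>}" using assms by (auto simp: field_simps abs_le_iff)
 have d1: "std_normal_density x <= 1" for x :: real
 proof -
  have "1 <= sqrt (2 * pi)" using pi_gt3 by (simp add: real_le_rsqrt)
  then have "1 / sqrt (2 * pi) <= 1" by (simp add: divide_le_eq)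
  moreover have "exp (- (x^2) / 2) <= 1" by simp
  ultimately have "1 / sqrt (2 * pi) * exp (- (x^2) / 2) <= 1 * 1" by (intro mult_mono) auto
  then show ?thesis by (simp add: std_normal_density_def)
 qed
 have "emeasure N01 {(- \<epsilon> - r) / \<rho>..(\<epsilon> - r) / \<rho>} = (\<integral>\<^sup>+x. ennreal (std_normal_density x) * indicator {(- \<epsilon> - r) / \<rho>..(\<epsilon> - r) / \<rho>} x \<partial>lborel)"
  by (rule emeasure_density) auto
 also have "... <= (\<integral>\<^sup>+x. indicator {(- \<epsilon> - r) / \<rho>..(\<epsilon> - r) / \<rho>} x \<partial>lborel)"
  using d1 by (intro nn_integral_mono) (auto simp: indicator_def)
 also have "... = ennreal ((\<epsilon> - r) / \<rho> - (- \<epsilon> - r) / \<rho>)" using assms by (simp add: divide_right_mono)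
 also have "(\<epsilon> - r) / \<rho> - (- \<epsilon> - r) / \<rho> = 2 * \<epsilon> / \<rho>" by (simp add: diff_divide_distrib[symmetric])
 finally show ?thesis unfolding eq using assms by (simp add: measure_def enn2real_leI)
qed

locale drifted_bm =
 fixes M :: "'a measure" and B :: "'a => real => real" and \<sigma> :: real and h :: "real => real"
 assumes BM: "std_brownian_motion M B" and \<sigma>: "\<sigma> > 0" and h: "continuous_on {0..} h"
begin

definition f where "f \<omega> t = \<sigma> * B \<omega> t + h t"

sublocale prob_space M using BM by (simp add: std_brownian_motion_def)

lemma B_measurable [measurable]: "(%\<omega>. B \<omega> t) \<in> borel_measurable M" using BM by (simp add: std_brownian_motion_def)

lemma f_measurable [measurable]: "(%\<omega>. f \<omega> t) \<in> borel_measurable M" unfolding f_def by measurable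

lemma f_cont: "\<omega> \<in> space M ==> continuous_on {0..} (f \<omega>)"
 unfolding f_def[abs_def] using BM by (intro continuous_intros h) (auto simp: std_brownian_motion_def)

lemma grid_min_measurable [measurable]: "(%\<omega>. grid_min N a b (f \<omega>)) \<in> borel_measurable M"
 unfolding grid_min_def by (rule borel_measurable_Min) auto

lemma INF_lim: "\<omega> \<in> space M ==> 0 <= a ==> a <= b ==> (%N. grid_min (Suc N) a b (f \<omega>)) \<longlonglongrightarrow> (INF s\<in>{a..b}. f \<omega> s)"
 by (rule grid_min_limit) (auto intro: continuous_on_subset[OF f_cont])

lemma INF_measurable: "0 <= a ==> a <= b ==> (%\<omega>. INF s\<in>{a..b}. f \<omega> s) \<in> borel_measurable M"
 by (rule borel_measurable_LIMSEQ_real[OF INF_lim]) auto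

text \<open>A tent equal to 1 at 0 and supported in \<open>[- \<epsilon>, \<epsilon>]\<close>. It
  detects equality of two minima and, being continuous, passes to limits along grids.\<close>

definition bump :: "real => real => real" where "bump \<epsilon> x = max 0 (1 - \<bar>x\<bar> / \<epsilon>)"

lemma bump: assumes "\<epsilon> > 0" shows "0 <= bump \<epsilon> x" "bump \<epsilon> x <= 1" "bump \<epsilon> x <= indicator {x. \<bar>x\<bar> <= \<epsilon>} x" "bump \<epsilon> 0 = 1"
 "continuous_on UNIV (bump \<epsilon>)"
proof -
 show "bump \<epsilon> x <= indicator {x. \<bar>x\<bar> <= \<epsilon>} x" using assms by (auto simp: bump_def indicator_def field_simps)
 show "continuous_on UNIV (bump \<epsilon>)" unfolding bump_def using assms by (intro continuous_intros) auto
qed (use assms in "auto simp: bump_def")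

text \<open>The increment over \<open>[b, c]\<close> is independent of the others and shifts every
  later value by the same amount. Given the rest, the difference of the two minima is Gaussian with
  standard deviation \<open>\<sigma> * sqrt (c - b)\<close>, so the bound does not depend on the
  grid size \<open>N\<close>.\<close>

lemma grid_bump_bound:
 assumes b: "0 < b" "b < c" "c < d" and \<epsilon>: "\<epsilon> > 0" and N: "N > 0"
 shows "expectation (%\<omega>. bump \<epsilon> (grid_min N c d (f \<omega>) - grid_min N 0 b (f \<omega>))) <= 2 * \<epsilon> / (\<sigma> * sqrt (c - b))"
proof -
 \<comment> \<open>A grid of \<open>[0, b]\<close> at the indices up to \<open>N\<close>, followed
   by one of \<open>[c, d]\<close> from \<open>Suc N\<close> on; the increment with index
   \<open>N\<close> is then the one over \<open>[b, c]\<close>.\<close>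
 define ts where "ts i = (if i <= N then b * real i / real N else c + (d - c) * real (i - Suc N) / real N)" for i
 define \<xi> where "\<xi> i \<omega> = B \<omega> (ts (Suc i)) - B \<omega> (ts i)" for i \<omega>
 have ts_pos: "0 <= ts i" for i using b by (auto simp: ts_def)
 have ts_mono: "ts i < ts (Suc i)" if "i < 2 * N + 1" for i
 proof -
  consider "i < N" | "i = N" | "i > N" by linarith
  then show ?thesis
  proof cases
   case 1
   then show ?thesis using b N by (simp add: ts_def divide_strict_right_mono)
  next
   case 2
   then show ?thesis using b N by (simp add: ts_def)
  next
   case 3
   then have "Suc i - Suc N = Suc (i - Suc N)" by simp
   then have "(d - c) * real (i - Suc N) / real N < (d - c) * real (Suc i - Suc N) / real N"
    using b N by (simp add: divide_strict_right_mono)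
   then show ?thesis using 3 by (simp add: ts_def)
  qed
 qed
 define I where "I = {..<2 * N + 1}"
 have ind: "indep_vars (%_. borel) \<xi> I"
  using BM ts_pos ts_mono unfolding std_brownian_motion_def \<xi>_def[abs_def] I_def by blast
 define P where "P x m = \<sigma> * (\<Sum>l<m. x l) + h (ts m)" for x :: "nat => real" and m
 define m1 where "m1 x = Min (P x ` {..N})" for x
 define m2 where "m2 x = Min (P x ` {Suc N..2 * N + 1})" for x
 have m1_ind: "m1 (x(N := y)) = m1 x" for x y
 proof -
  have "P (x(N := y)) m = P x m" if "m <= N" for m unfolding P_def using that by (intro arg_cong2[where f = "(+)"] arg_cong2[where f = "(*)"] sum.cong) auto
  then show ?thesis unfolding m1_def by (intro arg_cong[where f = Min] image_cong) auto
 qed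
 have m2_shift: "m2 (x(N := y)) = \<sigma> * y + m2 (x(N := 0))" for x y
 proof -
  have P: "P (x(N := y)) m = \<sigma> * y + P (x(N := 0)) m" if "m >= Suc N" for m
  proof -
   have "(\<Sum>l<m. (x(N := y)) l) = y + (\<Sum>l\<in>{..<m} - {N}. x l)" for y
    using that by (subst sum.remove[of _ N]) auto
   then show ?thesis by (simp add: P_def algebra_simps del: fun_upd_apply)
  qed
  have "P (x(N := y)) ` {Suc N..2 * N + 1} = (%z. \<sigma> * y + z) ` (P (x(N := 0)) ` {Suc N..2 * N + 1})"
   unfolding image_image by (intro image_cong refl P) simp
  then show ?thesis unfolding m2_def
   by (simp add: mono_Min_commute[of "%z. \<sigma> * y + z", symmetric] monoI)
 qed
 have Pm: "(%x. P x m) \<in> borel_measurable borel" for m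
  unfolding P_def by (intro borel_measurable_add borel_measurable_times borel_measurable_sum borel_measurable_const coordinate_measurable)
 have mm [measurable]: "m1 \<in> borel_measurable borel" "m2 \<in> borel_measurable borel"
  unfolding m1_def[abs_def] m2_def[abs_def] by (intro borel_measurable_Min Pm; simp)+
 have [measurable]: "bump \<epsilon> \<in> borel_measurable borel" using bump(5)[OF \<epsilon>] by (rule borel_measurable_continuous_onI)
 define \<Psi> where "\<Psi> x = bump \<epsilon> (m2 x - m1 x)" for x :: "nat => real"
 have \<Psi>m: "\<Psi> \<in> borel_measurable borel" unfolding \<Psi>_def by measurable
 have \<Psi>b: "\<bar>\<Psi> x\<bar> <= 1" for x using bump[OF \<epsilon>] by (simp add: \<Psi>_def)
 have inner: "(\<integral>z. \<Psi> (x(N := z)) \<partial>distr M borel (\<xi> N)) <= 2 * \<epsilon> / (\<sigma> * sqrt (c - b))" for x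
 proof -
  define r where "r = m2 (x(N := 0)) - m1 x"
  have \<Psi>_eq: "\<Psi> (x(N := z)) = bump \<epsilon> (\<sigma> * z + r)" for z
   using m2_shift[of x z] unfolding \<Psi>_def r_def m1_ind by (simp only: add_diff_eq)
  have \<xi>N: "\<xi> N = (%\<omega>. B \<omega> c - B \<omega> b)" using N by (simp add: \<xi>_def ts_def fun_eq_iff)
  have "(\<integral>z. \<Psi> (x(N := z)) \<partial>distr M borel (\<xi> N)) = (\<integral>z. bump \<epsilon> (z + r) \<partial>distr M borel (%\<omega>. \<sigma> * (B \<omega> c - B \<omega> b)))"
   unfolding \<Psi>_eq \<xi>N by (simp add: integral_distr)
  also have "... = (\<integral>z. bump \<epsilon> (\<sigma> * sqrt (c - b) * z + r) \<partial>N01)"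
   using b by (subst normal_increment_law[OF BM _ _ \<sigma>]) (auto simp: integral_distr)
  also have "... <= (\<integral>z. indicator {z. \<bar>\<sigma> * sqrt (c - b) * z + r\<bar> <= \<epsilon>} z \<partial>N01)"
  proof -
   interpret S: prob_space N01 by (rule prob_space_normal_density) simp
   show ?thesis
   proof (rule integral_mono)
    show "integrable N01 (%z. bump \<epsilon> (\<sigma> * sqrt (c - b) * z + r))"
     by (rule S.integrable_const_bound[where B = 1]) (use bump[OF \<epsilon>] in auto)
    show "integrable N01 (%z. indicator {z. \<bar>\<sigma> * sqrt (c - b) * z + r\<bar> <= \<epsilon>} z :: real)"
     by (rule S.integrable_const_bound[where B = 1]) (auto simp: indicator_def)
    show "bump \<epsilon> (\<sigma> * sqrt (c - b) * z + r) <= indicator {z. \<bar>\<sigma> * sqrt (c - b) * z + r\<bar> <= \<epsilon>} z" for z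
     using bump(3)[OF \<epsilon>, of "\<sigma> * sqrt (c - b) * z + r"] by (simp add: indicator_def)
   qed
  qed
  also have "... = measure N01 {z. \<bar>\<sigma> * sqrt (c - b) * z + r\<bar> <= \<epsilon>}" by simp
  also have "... <= 2 * \<epsilon> / (\<sigma> * sqrt (c - b))" using \<sigma> b \<epsilon> by (intro std_normal_small_interval) auto
  finally show ?thesis .
 qed
 have key: "bump \<epsilon> (grid_min N c d (f \<omega>) - grid_min N 0 b (f \<omega>)) = \<Psi> (%i. if i \<in> I then \<xi> i \<omega> else 0)" if \<omega>: "\<omega> \<in> space M" for \<omega>
 proof -
  define x where "x = (%i. if i \<in> I then \<xi> i \<omega> else 0)"
  have B0: "B \<omega> 0 = 0" using BM \<omega> by (simp add: std_brownian_motion_def)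
  have P: "P x m = f \<omega> (ts m)" if "m <= 2 * N + 1" for m
  proof -
   have "(\<Sum>l<m. x l) = (\<Sum>l<m. B \<omega> (ts (Suc l)) - B \<omega> (ts l))" using that by (intro sum.cong) (auto simp: x_def I_def \<xi>_def)
   also have "... = B \<omega> (ts m)" by (subst sum_lessThan_telescope) (simp add: ts_def B0)
   finally show ?thesis by (simp add: P_def f_def)
  qed
  have 1: "m1 x = grid_min N 0 b (f \<omega>)"
   unfolding m1_def grid_min_def using P by (intro arg_cong[where f = Min] image_cong) (auto simp: ts_def)
  have "y \<in> (%i. Suc N + i) ` {..N}" if "y \<in> {Suc N..2 * N + 1}" for y
   using that by (intro image_eqI[of _ _ "y - Suc N"]) auto
  then have "{Suc N..2 * N + 1} = (%i. Suc N + i) ` {..N}" by auto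
  then have "P x ` {Suc N..2 * N + 1} = (%i. P x (Suc N + i)) ` {..N}" by (simp add: image_image)
  also have "... = (%i. f \<omega> (c + (d - c) * real i / real N)) ` {..N}" using P by (intro image_cong refl) (auto simp: ts_def)
  finally show ?thesis using 1 by (simp add: \<Psi>_def x_def[symmetric] m2_def grid_min_def)
 qed
 have "expectation (%\<omega>. bump \<epsilon> (grid_min N c d (f \<omega>) - grid_min N 0 b (f \<omega>))) = expectation (%\<omega>. \<Psi> (%i. if i \<in> I then \<xi> i \<omega> else 0))"
  using key by (intro Bochner_Integration.integral_cong) auto
 also have "... = expectation (%\<omega>. \<integral>z. \<Psi> ((%i. if i \<in> I then \<xi> i \<omega> else 0)(N := z)) \<partial>distr M borel (\<xi> N))"
  by (rule expectation_split_coordinate[OF ind _ \<Psi>m \<Psi>b]) (simp add: I_def)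
 also have "... <= expectation (%\<omega>. 2 * \<epsilon> / (\<sigma> * sqrt (c - b)))"
  by (intro integral_mono') (use inner \<epsilon> \<sigma> b in auto)
 finally show ?thesis by (simp add: prob_space)
qed

text \<open>The grid bound passes to minima over intervals as the grid is refined, and then
  \<open>\<epsilon>\<close> tends to 0.\<close>

lemma minima_differ:
 assumes b: "0 < b" "b < c" "c < d"
 shows "AE \<omega> in M. (INF s\<in>{0..b}. f \<omega> s) ~= (INF s\<in>{c..d}. f \<omega> s)"
proof -
 let ?d = "%N \<omega>. grid_min (Suc N) c d (f \<omega>) - grid_min (Suc N) 0 b (f \<omega>)" and ?s = "\<sigma> * sqrt (c - b)"
 have [measurable]: "(%\<omega>. INF s\<in>{0..b}. f \<omega> s) \<in> borel_measurable M" "(%\<omega>. INF s\<in>{c..d}. f \<omega> s) \<in> borel_measurable M"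
  using b by (auto intro!: INF_measurable)
 define A where "A = {\<omega> \<in> space M. (INF s\<in>{0..b}. f \<omega> s) = (INF s\<in>{c..d}. f \<omega> s)}"
 have A: "A \<in> sets M" unfolding A_def by measurable
 have le: "prob A <= 2 * \<epsilon> / ?s" if \<epsilon>: "\<epsilon> > 0" for \<epsilon>
 proof -
  have [measurable]: "bump \<epsilon> \<in> borel_measurable borel" using bump(5)[OF \<epsilon>] by (rule borel_measurable_continuous_onI)
  define D where "D \<omega> = (INF s\<in>{c..d}. f \<omega> s) - (INF s\<in>{0..b}. f \<omega> s)" for \<omega>
  have Dm: "(%\<omega>. bump \<epsilon> (D \<omega>)) \<in> borel_measurable M"
   by (rule measurable_compose[of D M borel "bump \<epsilon>"]) (simp_all add: D_def[abs_def])
  have "prob A = expectation (indicator A)" using A by simp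
  also have "... <= expectation (%\<omega>. bump \<epsilon> (D \<omega>))"
  proof (rule integral_mono)
   show "integrable M (%\<omega>. bump \<epsilon> (D \<omega>))"
    by (rule integrable_const_bound[OF _ Dm, where B = 1]) (use bump(1,2)[OF \<epsilon>] in "simp add: abs_of_nonneg")
   show "integrable M (indicator A :: 'a => real)"
    by (rule integrable_const_bound[where B = 1]) (use A in "auto simp: indicator_def")
   show "indicator A \<omega> <= bump \<epsilon> (D \<omega>)" for \<omega>
    using bump(1)[OF \<epsilon>, of "D \<omega>"] bump(4)[OF \<epsilon>] by (auto simp: A_def D_def indicator_def)
  qed
  also have "... <= 2 * \<epsilon> / ?s"
  proof (rule LIMSEQ_le_const2)
   show "(%N. expectation (%\<omega>. bump \<epsilon> (?d N \<omega>))) \<longlonglongrightarrow> expectation (%\<omega>. bump \<epsilon> (D \<omega>))"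
   proof (rule integral_dominated_convergence[where w = "%_. 1"])
    show "AE \<omega> in M. (%N. bump \<epsilon> (?d N \<omega>)) \<longlonglongrightarrow> bump \<epsilon> (D \<omega>)"
    proof (rule AE_I2)
     fix \<omega> assume \<omega>: "\<omega> \<in> space M"
     have "(%N. ?d N \<omega>) \<longlonglongrightarrow> D \<omega>"
      unfolding D_def by (rule tendsto_diff; rule INF_lim) (use b \<omega> in auto)
     then show "(%N. bump \<epsilon> (?d N \<omega>)) \<longlonglongrightarrow> bump \<epsilon> (D \<omega>)"
      by (rule continuous_on_tendsto_compose[OF bump(5)[OF \<epsilon>]]) auto
    qed
    show "AE \<omega> in M. norm (bump \<epsilon> (?d N \<omega>)) <= 1" for N
     using bump(1,2)[OF \<epsilon>] by (simp add: abs_of_nonneg)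
    show "(%\<omega>. bump \<epsilon> (?d N \<omega>)) \<in> borel_measurable M" for N
     by (rule measurable_compose[OF borel_measurable_diff[OF grid_min_measurable grid_min_measurable] borel_measurable_continuous_onI[OF bump(5)[OF \<epsilon>]]])
    show "(%\<omega>. bump \<epsilon> (D \<omega>)) \<in> borel_measurable M" by (rule Dm)
   qed simp
   show "EX N. ALL n>=N. expectation (%\<omega>. bump \<epsilon> (?d n \<omega>)) <= 2 * \<epsilon> / ?s"
    using grid_bump_bound[OF b \<epsilon>] by auto
  qed
  finally show ?thesis .
 qed
 have "prob A <= 0"
 proof (rule field_le_epsilon)
  fix e :: real assume e: "e > 0"
  define \<epsilon> where "\<epsilon> = e * ?s / 2"
  have p: "?s > 0" using \<sigma> b by simp
  have "prob A <= 2 * \<epsilon> / ?s" using e p by (intro le) (simp add: \<epsilon>_def)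
  also have "2 * \<epsilon> / ?s = e * ?s / ?s" by (simp add: \<epsilon>_def)
  also have "... = e" using p by (intro nonzero_mult_div_cancel_right) linarith
  finally show "prob A <= 0 + e" by simp
 qed
 then have "prob A = 0" by (simp add: measure_le_0_iff)
 then have "AE \<omega> in M. \<omega> \<notin> A" using A by (simp add: AE_iff_measurable[OF _ refl] prob_eq_0)
 then show ?thesis by (auto simp: A_def elim!: AE_mp)
qed

lemma distinct_minima_AE: "AE \<omega> in M. distinct_minima (f \<omega>)"
proof -
 have "AE \<omega> in M. ALL b:\<rat>. ALL c:\<rat>. ALL d:\<rat>. 0 < b & b < c & c < d --> (INF s\<in>{0..b}. f \<omega> s) ~= (INF s\<in>{c..d}. f \<omega> s)"
  unfolding AE_ball_countable[OF countable_rat]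
 proof (intro ballI)
  fix b c d :: real
  show "AE \<omega> in M. 0 < b & b < c & c < d --> (INF s\<in>{0..b}. f \<omega> s) ~= (INF s\<in>{c..d}. f \<omega> s)"
   by (cases "0 < b & b < c & c < d") (use minima_differ[of b c d] in auto)
 qed
 then show ?thesis unfolding distinct_minima_def .
qed

end

text \<open>Countable description of the excursion lengths: \<open>zero_in g a b\<close> says that the running minimum of \<open>g\<close>
 is attained at some point of \<open>[a, b]\<close>, and excursions are located by rational points.\<close>
definition zero_in :: "(real => real) => real => real => bool" where
 "zero_in g a b \<longleftrightarrow> (INF s\<in>{a..b}. g s) <= (INF s\<in>{0..a}. g s)"

primrec many_exc :: "(real => real) => real => nat => real => bool" where
 "many_exc g y 0 s = (\<exists>c::rat. s <= of_rat c & zero_in g s (of_rat c))"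
| "many_exc g y (Suc n) s = (\<exists>a b::rat. s <= of_rat a & of_rat a < (of_rat b :: real) & of_rat b - of_rat a > y &
   zero_in g s (of_rat a) & ~ zero_in g (of_rat a) (of_rat b) & many_exc g y n (of_rat b))"

section \<open>Running minima and measurability of the ranked excursion lengths\<close>

definition run_min :: "(real => real) => real => bool" where
 "run_min g t \<longleftrightarrow> 0 <= t & (ALL u:{0..t}. g t <= g u)"

lemma zero_in_iff:
 assumes g: "continuous_on {0..} g" and ab: "0 <= a" "a <= b"
 shows "zero_in g a b \<longleftrightarrow> (EX t:{a..b}. run_min g t)"
proof -
 have "continuous_on {a..b} g" "continuous_on {0..a} g" using ab by (auto intro: continuous_on_subset[OF g])
 then obtain u v where u: "u \<in> {a..b}" "!!s. s \<in> {a..b} ==> g u <= g s" "(INF s\<in>{a..b}. g s) = g u"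
  and v: "v \<in> {0..a}" "!!s. s \<in> {0..a} ==> g v <= g s" "(INF s\<in>{0..a}. g s) = g v"
  using cont_INF[of a b g] cont_INF[of 0 a g] ab by metis
 have z: "zero_in g a b \<longleftrightarrow> g u <= g v" unfolding zero_in_def u(3) v(3) ..
 show ?thesis
 proof
  assume "zero_in g a b"
  then have "g u <= g s" if "s \<in> {0..u}" for s
   using u(1) u(2)[of s] v(2)[of s] that z by (cases "s <= a") force+
  then show "EX t:{a..b}. run_min g t" using u(1) ab by (intro bexI[of _ u]) (auto simp: run_min_def)
 next
  assume "EX t:{a..b}. run_min g t"
  then obtain t where t: "t \<in> {a..b}" "!!s. s \<in> {0..t} ==> g t <= g s" by (auto simp: run_min_def)
  then have "g u <= g t" "g t <= g v" using u(2) v(1) by auto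
  then show "zero_in g a b" using z by simp
 qed
qed

lemma excursions_run_min:
 assumes g: "continuous_on {0..} g"
 shows "(l, r) \<in> excursions (reflected g) \<longleftrightarrow> l < r & run_min g l & run_min g r & (ALL t. l < t & t < r --> ~ run_min g t)"
proof -
 have z: "reflected g t = 0 \<longleftrightarrow> run_min g t" "reflected g t > 0 \<longleftrightarrow> ~ run_min g t" if "0 <= t" for t
  using reflected_zero_iff[OF g that] that by (auto simp: run_min_def less_le)
 show ?thesis
 proof (cases "0 <= l & l < r")
  case True
  then show ?thesis using z by (auto simp: excursions_def)
 next
  case False
  then show ?thesis by (auto simp: excursions_def run_min_def)
 qed
qed

lemma compact_subset_Icc: "closed C ==> C \<subseteq> {a..b} ==> compact (C :: real set)"
 by (metis compact_Icc compact_Int_closed inf.absorb_iff2)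

lemma last_run_min:
 assumes g: "continuous_on {0..} g" and "0 <= a"
 obtains l where "l <= a" "run_min g l" "!!t. t <= a ==> run_min g t ==> t <= l"
proof -
 have ga: "continuous_on {0..a} g" by (auto intro: continuous_on_subset[OF g])
 obtain u where u: "u \<in> {0..a}" "!!s. s \<in> {0..a} ==> g u <= g s" using cont_INF[OF ga \<open>0 <= a\<close>] by metis
 define C where "C = {t \<in> {0..a}. g t = g u}"
 have "closed C" unfolding C_def by (rule continuous_closed_preimage_constant[OF ga]) simp
 then have "compact C" by (rule compact_subset_Icc[of _ 0 a]) (auto simp: C_def)
 moreover have uC: "u \<in> C" using u by (auto simp: C_def)
 ultimately have "EX l:C. ALL t:C. t <= l" by (intro compact_attains_sup) auto
 then obtain l where lC: "l \<in> C" "ALL t:C. t <= l" by blast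
 then have l: "0 <= l" "l <= a" "g l = g u" "u <= l" using uC by (auto simp: C_def)
 show thesis
 proof
  show "l <= a" "run_min g l" using l u(2) by (auto simp: run_min_def)
  fix t assume t: "t <= a" "run_min g t"
  show "t <= l"
  proof (rule ccontr)
   assume "~ t <= l"
   then have "g t <= g u" "0 <= t" using t l u(1) by (auto simp: run_min_def)
   then have "t \<in> C" using u(2)[of t] t by (auto simp: C_def)
   then show False using lC(2) \<open>~ t <= l\<close> by auto
  qed
 qed
qed

lemma first_run_min:
 assumes g: "continuous_on {0..} g" and b: "0 <= b" "b <= z" "run_min g z"
 obtains r where "b <= r" "run_min g r" "!!t. b <= t ==> run_min g t ==> r <= t"
proof -
 have gb: "continuous_on {0..b} g" and gz: "continuous_on {b..z} g" using b by (auto intro: continuous_on_subset[OF g])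
 obtain v where v: "v \<in> {0..b}" "!!s. s \<in> {0..b} ==> g v <= g s" using cont_INF[OF gb b(1)] by metis
 define C where "C = {t \<in> {b..z}. g t <= g v}"
 have "closed C" unfolding C_def by (rule continuous_on_closed_Collect_le[OF gz continuous_on_const]) simp
 then have "compact C" by (rule compact_subset_Icc[of _ b z]) (auto simp: C_def)
 moreover have "z \<in> C" using b v(1) by (auto simp: run_min_def C_def)
 ultimately have "EX r:C. ALL t:C. r <= t" by (intro compact_attains_inf) auto
 then obtain r where rC: "r \<in> C" "ALL t:C. r <= t" by blast
 then have r: "b <= r" "r <= z" "g r <= g v" "!!t. b <= t ==> t <= z ==> g t <= g v ==> r <= t" by (auto simp: C_def)
 show thesis
 proof
  show "b <= r" using r by simp
  have "g r <= g s" if s: "s \<in> {0..r}" for s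
  proof (cases "s <= b")
   case True
   then show ?thesis using v(2)[of s] s r by auto
  next
   case False
   show ?thesis
   proof (rule ccontr)
    assume "~ g r <= g s"
    then have "s < r" "g s <= g v" using s r by (auto simp: less_le)
    then show False using r(2) r(4)[of s] False by auto
   qed
  qed
  then show "run_min g r" using r b by (auto simp: run_min_def)
  fix t assume t: "b <= t" "run_min g t"
  show "r <= t"
  proof (cases "t <= z")
   case True
   have "g t <= g v" using t v(1) by (auto simp: run_min_def)
   then show ?thesis using r(4) t True by auto
  qed (use r in auto)
 qed
qed

text \<open>Rational points \<open>a < b\<close> without a running minimum between them lie in one
  excursion, which extends from the last running minimum before \<open>a\<close> to the first one
  after \<open>b\<close>; the latter exists by the base case of \<open>many_exc\<close>. Conversely,
  rational points are chosen in the excursion that begins first, and the others come after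
  it.\<close>

lemma many_exc_iff:
 assumes g: "continuous_on {0..} g" and y: "y >= 0" and "s >= 0"
 shows "many_exc g y n s \<longleftrightarrow> (EX z>=s. run_min g z) & (EX F. F \<subseteq> excursions (reflected g) & finite F & card F = n & (ALL e:F. glen e > y & fst e >= s))"
 using \<open>s >= 0\<close>
proof (induction n arbitrary: s)
 case 0
 have "many_exc g y 0 s \<longleftrightarrow> (EX z>=s. run_min g z)"
 proof
  assume "many_exc g y 0 s"
  then obtain c :: rat where c: "s <= of_rat c" "zero_in g s (of_rat c)" by auto
  then show "EX z>=s. run_min g z" using zero_in_iff[OF g 0 c(1)] by (meson atLeastAtMost_iff)
 next
  assume "EX z>=s. run_min g z"
  then obtain z where z: "z >= s" "run_min g z" by auto
  obtain c :: rat where "z < of_rat c" using of_rat_dense[of z "z + 1"] by auto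
  then show "many_exc g y 0 s" using z zero_in_iff[OF g 0, of "of_rat c"] by (auto intro!: exI[of _ c])
 qed
 then show ?case by auto
next
 case (Suc n)
 show ?case
 proof
  assume "many_exc g y (Suc n) s"
  then obtain a b :: rat where ab: "s <= of_rat a" "of_rat a < (of_rat b :: real)" "of_rat b - of_rat a > y"
   "zero_in g s (of_rat a)" "~ zero_in g (of_rat a) (of_rat b)" "many_exc g y n (of_rat b)" by auto
  have pos: "0 <= (of_rat a :: real)" "0 <= (of_rat b :: real)" using ab Suc.prems by linarith+
  obtain t1 where t1: "t1 \<in> {s..of_rat a}" "run_min g t1" using ab(4) zero_in_iff[OF g Suc.prems ab(1)] by auto
  have none: "~ run_min g t" if "t \<in> {of_rat a..of_rat b}" for t using ab(5) zero_in_iff[OF g pos(1), of "of_rat b"] ab(2) that by auto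
  obtain z F where zF: "z >= of_rat b" "run_min g z" "F \<subseteq> excursions (reflected g)" "finite F" "card F = n" "ALL e:F. glen e > y & fst e >= of_rat b"
   using ab(6) Suc.IH[OF pos(2)] by auto
  obtain l where l: "l <= of_rat a" "run_min g l" "!!t. t <= of_rat a ==> run_min g t ==> t <= l"
   using last_run_min[OF g pos(1)] by metis
  obtain r where r: "of_rat b <= r" "run_min g r" "!!t. of_rat b <= t ==> run_min g t ==> r <= t"
   using first_run_min[OF g pos(2) zF(1,2)] by metis
  have nz: "~ run_min g t" if "l < t" "t < r" for t using l(3)[of t] r(3)[of t] none[of t] that by force
  have e: "(l, r) \<in> excursions (reflected g)" using l r nz ab(2) by (auto simp: excursions_run_min[OF g])
  have ls: "s <= l" using l(3)[of t1] t1 by auto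
  have "(l, r) \<notin> F" using zF(6) l(1) ab(2) by force
  then have "insert (l, r) F \<subseteq> excursions (reflected g) & finite (insert (l, r) F) & card (insert (l, r) F) = Suc n & (ALL e:insert (l, r) F. glen e > y & fst e >= s)"
   using zF e ls l(1) r(1) ab by (force simp: glen_def)
  then show "(EX z>=s. run_min g z) & (EX F. F \<subseteq> excursions (reflected g) & finite F & card F = Suc n & (ALL e:F. glen e > y & fst e >= s))"
   using l(2) ls by blast
 next
  assume "(EX z>=s. run_min g z) & (EX F. F \<subseteq> excursions (reflected g) & finite F & card F = Suc n & (ALL e:F. glen e > y & fst e >= s))"
  then obtain F where F: "F \<subseteq> excursions (reflected g)" "finite F" "card F = Suc n" "!!e. e \<in> F ==> glen e > y & fst e >= s" by blast
  have "fst ` F ~= {}" using F(3) by auto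
  then have "Min (fst ` F) \<in> fst ` F" using F(2) by (intro Min_in) auto
  then obtain e0 where e0: "e0 \<in> F" "fst e0 = Min (fst ` F)" by auto
  then have min: "fst e0 <= fst e" if "e \<in> F" for e using F(2) that by simp
  obtain l r where lr: "e0 = (l, r)" by (cases e0)
  have ex: "(l, r) \<in> excursions (reflected g)" using e0 lr F(1) by auto
  note ex' = ex[unfolded excursions_run_min[OF g]]
  have len: "r - l > y" "l >= s" using F(4)[OF e0(1)] by (auto simp: lr glen_def)
  define \<delta> where "\<delta> = (r - l - y) / 2"
  have d: "\<delta> > 0" using len by (simp add: \<delta>_def)
  obtain a :: rat where a: "l < of_rat a" "of_rat a < l + \<delta>" using of_rat_dense[of l "l + \<delta>"] d by auto
  obtain b :: rat where b: "r - \<delta> < of_rat b" "of_rat b < r" using of_rat_dense[of "r - \<delta>" r] d by auto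
  have "(r - \<delta>) - (l + \<delta>) = y" by (simp add: \<delta>_def field_simps)
  then have bay: "of_rat b - of_rat a > y" using a b by linarith
  then have ab: "of_rat a < (of_rat b :: real)" using y by linarith
  have sa: "s <= of_rat a" using a len by linarith
  have pos: "0 <= (of_rat a :: real)" "0 <= (of_rat b :: real)" using sa Suc.prems ab by linarith+
  have "zero_in g s (of_rat a)" using zero_in_iff[OF g Suc.prems sa] ex' len a by force
  moreover have "~ zero_in g (of_rat a) (of_rat b)" using zero_in_iff[OF g pos(1), of "of_rat b"] ex' ab a b by force
  moreover have "many_exc g y n (of_rat b)"
  proof -
   have "fst e >= of_rat b" if e: "e \<in> F - {e0}" for e
   proof -
    have e1: "(fst e, snd e) \<in> excursions (reflected g)" using e F(1) by auto
    then have "r <= fst e \<or> snd e <= l" using excursions_disjoint[OF ex e1] e lr by (auto simp: prod_eq_iff)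
    moreover have "fst e < snd e" "l <= fst e" using e1 min[of e] e lr by (auto simp: excursions_def)
    ultimately show ?thesis using b by linarith
   qed
   then have "F - {e0} \<subseteq> excursions (reflected g) & finite (F - {e0}) & card (F - {e0}) = n & (ALL e:F - {e0}. glen e > y & fst e >= of_rat b)"
    using F e0(1) by (auto simp: card_Diff_singleton)
   moreover have "EX z>=of_rat b. run_min g z" using ex' b by (intro exI[of _ r]) auto
   ultimately show ?thesis using Suc.IH[OF pos(2)] by blast
  qed
  ultimately show "many_exc g y (Suc n) s" using sa ab bay by auto
 qed
qed

text \<open>Convergence in distribution asks for measurability on the whole space, also where
  lengths are unbounded and the real supremum is a default value. By \<open>Sup_real_def\<close>
  this value is the constant \<open>LEAST z. False\<close>, which gives the first branch.\<close>

lemma rk_measurable_aux: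
 fixes len :: "'b => real" and I :: "'b set" and j :: nat
 defines "L \<equiv> %y. EX F. F \<subseteq> I & finite F & card F = Suc j & (ALL e:F. len e > y)"
 shows "rk I len j > y \<longleftrightarrow> (if \<forall>N::nat. L (real N) then (LEAST z::real. False) > y else y < 0 \<or> L y)"
proof (cases "\<forall>N::nat. L (real N)")
 case True
 define S where "S = {0} \<union> {x. x > 0 & (EX F. F \<subseteq> I & (ALL e:F. len e >= x) & finite F & card F = Suc j)}"
 have "~ (ALL x:S. x <= z)" for z
 proof
  assume z: "ALL x:S. x <= z"
  obtain N :: nat where N: "real N > max z 1" using reals_Archimedean2 by blast
  obtain F where F: "F \<subseteq> I" "finite F" "card F = Suc j" "ALL e:F. len e > real N" using True unfolding L_def by blast
  then have "real N \<in> S" using N by (auto simp: S_def intro!: exI[of _ F])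
  then show False using z N by auto
 qed
 then have eq: "(ALL x:S. x <= z) = False" for z by auto
 have "Sup S = (LEAST z::real. False)" by (simp only: Sup_real_def eq)
 then have "rk I len j = (LEAST z::real. False)" by (simp only: rk_alt S_def)
 then show ?thesis by (simp only: True if_True simp_thms)
next
 case False
 then obtain N :: nat where N: "~ L (real N)" by auto
 define S where "S = {0} \<union> {x. x > 0 & (EX F. F \<subseteq> I & (ALL e:F. len e >= x) & finite F & card F = Suc j)}"
 have "x <= real N" if "x \<in> S" for x
 proof (rule ccontr)
  assume "~ x <= real N"
  moreover have "x = 0 \<or> (EX F. F \<subseteq> I & (ALL e:F. len e >= x) & finite F & card F = Suc j)" using that unfolding S_def by blast
  ultimately obtain F where "F \<subseteq> I" "ALL e:F. len e >= x" "finite F" "card F = Suc j" by auto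
  then have "L (real N)" unfolding L_def using \<open>~ x <= real N\<close> by (intro exI[of _ F]) force
  with N show False by simp
 qed
 then have bdd: "bdd_above S" by (auto intro!: bdd_aboveI)
 have "y < Sup S \<longleftrightarrow> (EX x:S. y < x)" by (rule less_cSup_iff[OF _ bdd]) (auto simp: S_def)
 also have "... \<longleftrightarrow> y < 0 \<or> L y"
 proof
  assume "EX x:S. y < x"
  then obtain x where x: "x \<in> S" "y < x" by auto
  show "y < 0 \<or> L y"
  proof (cases "x = 0")
   case False
   then obtain F where "F \<subseteq> I" "ALL e:F. len e >= x" "finite F" "card F = Suc j" using x by (auto simp: S_def)
   then have "L y" unfolding L_def using x by (intro exI[of _ F]) force
   then show ?thesis ..
  qed (use x in auto)
 next
  assume "y < 0 \<or> L y"
  then show "EX x:S. y < x"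
  proof (cases "y < 0")
   case True
   then show ?thesis by (auto simp: S_def)
  next
   case False
   then obtain F where F: "F \<subseteq> I" "finite F" "card F = Suc j" "ALL e:F. len e > y" using \<open>y < 0 \<or> L y\<close> unfolding L_def by blast
   have ne: "F ~= {}" using F(3) by auto
   have "Min (len ` F) > y" using F ne by simp
   moreover have "Min (len ` F) \<in> S" using F ne False calculation by (auto simp: S_def intro!: exI[of _ F])
   ultimately show ?thesis by auto
  qed
 qed
 finally have "y < Sup S \<longleftrightarrow> y < 0 \<or> L y" .
 moreover have "rk I len j = Sup S" by (simp only: rk_alt S_def)
 ultimately show ?thesis by (simp only: False if_False)
qed

context drifted_bm
begin

lemma many_exc_measurable: "0 <= s ==> Measurable.pred M (%\<omega>. many_exc (f \<omega>) y n s)"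
proof (induction n arbitrary: s)
 case 0
 have z: "Measurable.pred M (%\<omega>. zero_in (f \<omega>) s (of_rat c))" if "s <= of_rat c" for c
  unfolding zero_in_def using INF_measurable[OF 0 that] INF_measurable[of 0 s] 0 by measurable
 have "Measurable.pred M (%\<omega>. s <= of_rat c & zero_in (f \<omega>) s (of_rat c))" for c
  by (cases "s <= of_rat c") (use z in auto)
 then show ?case unfolding many_exc.simps by (rule pred_intros_countable(2))
next
 case (Suc n)
 have z: "Measurable.pred M (%\<omega>. zero_in (f \<omega>) s t)" if "0 <= s" "s <= t" for s t
  unfolding zero_in_def using INF_measurable[OF that] INF_measurable[of 0 s] that by measurable
 have "Measurable.pred M (%\<omega>. s <= of_rat a & of_rat a < (of_rat b :: real) & of_rat b - of_rat a > y &
   zero_in (f \<omega>) s (of_rat a) & ~ zero_in (f \<omega>) (of_rat a) (of_rat b) & many_exc (f \<omega>) y n (of_rat b))" for a b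
 proof (cases "s <= of_rat a & of_rat a < (of_rat b :: real) & of_rat b - of_rat a > y")
  case True
  then have "0 <= (of_rat a :: real)" "0 <= (of_rat b :: real)" using Suc.prems by linarith+
  then have "Measurable.pred M (%\<omega>. zero_in (f \<omega>) s (of_rat a))" "Measurable.pred M (%\<omega>. zero_in (f \<omega>) (of_rat a) (of_rat b))"
   "Measurable.pred M (%\<omega>. many_exc (f \<omega>) y n (of_rat b))"
   using z[OF Suc.prems, of "of_rat a"] z[of "of_rat a" "of_rat b"] Suc.IH[of "of_rat b"] True by auto
  then show ?thesis using True by simp
 next
  case False
  then have "(%\<omega>. s <= of_rat a & of_rat a < (of_rat b :: real) & of_rat b - of_rat a > y &
   zero_in (f \<omega>) s (of_rat a) & ~ zero_in (f \<omega>) (of_rat a) (of_rat b) & many_exc (f \<omega>) y n (of_rat b)) = (%\<omega>. False)" by auto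
  then show ?thesis by simp
 qed
 then show ?case unfolding many_exc.simps by (intro pred_intros_countable(2))
qed

lemma excursion_lengths_measurable:
 "(%\<omega> j. rk (excursions (reflected (f \<omega>))) glen j) \<in> borel_measurable M"
proof (rule measurable_coordinatewise_then_product)
 fix j
 show "(%\<omega>. rk (excursions (reflected (f \<omega>))) glen j) \<in> borel_measurable M"
 proof (subst borel_measurable_iff_greater, intro allI)
  fix y :: real
  have L: "many_exc (f \<omega>) z (Suc j) 0 \<longleftrightarrow> (EX F. F \<subseteq> excursions (reflected (f \<omega>)) & finite F & card F = Suc j & (ALL e:F. glen e > z))"
   if "\<omega> \<in> space M" "z >= 0" for z \<omega>
  proof -
   have "run_min (f \<omega>) 0" by (auto simp: run_min_def)
   moreover have "fst e >= 0" if "e \<in> excursions W" for e W using that by (auto simp: excursions_def)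
   ultimately show ?thesis unfolding many_exc_iff[OF f_cont[OF that(1)] that(2) order_refl] by blast
  qed
  have m: "Measurable.pred M (%\<omega>. many_exc (f \<omega>) z (Suc j) 0)" for z by (rule many_exc_measurable) simp
  have p0: "Measurable.pred M (%\<omega>. \<forall>N::nat. many_exc (f \<omega>) (real N) (Suc j) 0)"
   by (intro pred_intros_countable(1) m)
  define A where "A \<omega> \<longleftrightarrow> (\<forall>N::nat. many_exc (f \<omega>) (real N) (Suc j) 0)" for \<omega>
  define A' where "A' \<omega> \<longleftrightarrow> many_exc (f \<omega>) (max 0 y) (Suc j) 0" for \<omega>
  have A: "Measurable.pred M A" "Measurable.pred M A'" unfolding A_def[abs_def] A'_def[abs_def] by (rule p0, rule m)
  have p: "Measurable.pred M (%\<omega>. if A \<omega> then c1 else c2 \<or> A' \<omega>)" for c1 c2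
   by (cases c1; cases c2) (use A in auto)
  have eq: "y < rk (excursions (reflected (f \<omega>))) glen j \<longleftrightarrow> (if A \<omega> then (LEAST z::real. False) > y else y < 0 \<or> A' \<omega>)" if \<omega>: "\<omega> \<in> space M" for \<omega>
  proof -
   have LN: "many_exc (f \<omega>) (real N) (Suc j) 0 \<longleftrightarrow> (EX F. F \<subseteq> excursions (reflected (f \<omega>)) & finite F & card F = Suc j & (ALL e:F. glen e > real N))" for N :: nat
    by (rule L[OF \<omega>]) simp
   have Ly: "y < 0 \<or> A' \<omega> \<longleftrightarrow> y < 0 \<or> (EX F. F \<subseteq> excursions (reflected (f \<omega>)) & finite F & card F = Suc j & (ALL e:F. glen e > y))"
   proof (cases "y < 0")
    case False
    then have "max 0 y = y" by simp
    then show ?thesis using L[OF \<omega>, of y] False by (simp only: A'_def)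
   qed simp
   show ?thesis unfolding rk_measurable_aux A_def LN Ly ..
  qed
  have "{\<omega> \<in> space M. y < rk (excursions (reflected (f \<omega>))) glen j} = {\<omega> \<in> space M. if A \<omega> then (LEAST z::real. False) > y else y < 0 \<or> A' \<omega>}"
   by (intro Collect_cong conj_cong refl eq)
  then show "{\<omega> \<in> space M. y < rk (excursions (reflected (f \<omega>))) glen j} \<in> sets M"
   using p[of "(LEAST z::real. False) > y" "y < 0"] by (simp only: pred_def)
 qed
qed

end

section \<open>Components of the hierarchical model\<close>

lemma length_filter_descending:
 fixes xs :: "nat list"
 assumes "sorted_wrt (\<ge>) xs"
 shows "length (filter (%y. x <= real y) xs) > j \<longleftrightarrow> j < length xs & x <= real (xs ! j)"
 using assms
proof (induction xs arbitrary: j)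
 case (Cons y ys)
 show ?case
 proof (cases "x <= real y")
  case True
  then show ?thesis using Cons by (cases j) auto
 next
  case False
  then have "ALL z:set ys. ~ x <= real z" using Cons.prems by force
  then have "filter (%y. x <= real y) (y # ys) = []" using False by (simp add: filter_empty_conv)
  moreover have "~ x <= real ((y # ys) ! j)" if "j < length (y # ys)"
   using nth_mem[OF that] False \<open>ALL z:set ys. ~ x <= real z\<close> by auto
  ultimately show ?thesis by auto
 qed
qed simp

text \<open>In a descending list more than \<open>j\<close> entries are at least \<open>x\<close>
  iff the entry with index \<open>j\<close> exists and is at least \<open>x\<close>; the supremum in
  \<open>rk\<close> is that entry.\<close>

lemma sorted_list_rk:
 fixes f :: "'b => nat"
 assumes fin: "finite I"
 defines "xs \<equiv> rev (sorted_list_of_multiset (image_mset f (mset_set I)))"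
 shows "(if j < length xs then real (xs ! j) else 0) = rk I (%e. real (f e)) j"
proof -
 have srt: "sorted_wrt (\<ge>) xs" unfolding xs_def sorted_wrt_rev by simp
 have "card {e \<in> I. x <= real (f e)} = length (filter (%y. x <= real y) xs)" for x
 proof -
  have "length (filter (%y. x <= real y) xs) = size (filter_mset (%y. x <= real y) (mset xs))"
   by (metis mset_filter size_mset)
  also have "mset xs = image_mset f (mset_set I)" by (simp add: xs_def)
  also have "size (filter_mset (%y. x <= real y) (image_mset f (mset_set I))) = card {e \<in> I. x <= real (f e)}"
   using fin by (simp add: filter_mset_image_mset)
  finally show ?thesis by simp
 qed
 then have "{x. x > 0 & (infinite {e \<in> I. real (f e) >= x} \<or> card {e \<in> I. real (f e) >= x} > j)} =
  {x. x > 0 & j < length xs & x <= real (xs ! j)}"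
  using fin length_filter_descending[OF srt] by auto
 then have rk: "rk I (%e. real (f e)) j = Sup ({0} \<union> {x. x > 0 & j < length xs & x <= real (xs ! j)})"
  by (simp add: rk_def)
 show ?thesis
 proof (cases "j < length xs")
  case True
  then have "{0} \<union> {x. x > 0 & j < length xs & x <= real (xs ! j)} = {0..real (xs ! j)}" by auto
  then show ?thesis using True by (simp add: rk)
 qed (simp add: rk)
qed

locale hcm =
 fixes Hs :: "nat => community" and n :: nat
 assumes valid: "!!i. i < n ==> valid_community (Hs i)"
begin

lemma hcm_halfedges_Sigma: "hcm_halfedges Hs n = (SIGMA i:{..<n}. SIGMA v:{..<csize (Hs i)}. {..<cdeg (Hs i) v})"
 by (auto simp: hcm_halfedges_def)

sublocale half_edges "hcm_halfedges Hs n" fst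
 by unfold_locales (auto simp: hcm_halfedges_Sigma)

lemma hcm_pairings_Ext: "hcm_pairings Hs n = Ext id"
 by (auto simp: hcm_pairings_def Ext_def)

lemma card_halfedges: "card (hcm_halfedges Hs n) = total_halfedges Hs n"
 by (simp add: hcm_halfedges_Sigma total_halfedges_def cdegree_def)

lemma deg_eq: "i < n ==> deg i = cdegree (Hs i)"
proof -
 assume "i < n"
 then have "{h \<in> hcm_halfedges Hs n. fst h = i} = Pair i ` (SIGMA v:{..<csize (Hs i)}. {..<cdeg (Hs i) v})"
  by (auto simp: hcm_halfedges_Sigma)
 moreover have "inj_on (Pair i) X" for X :: "(nat \<times> nat) set" by (auto simp: inj_on_def)
 ultimately show ?thesis by (simp add: deg_def card_image cdegree_def)
qed

lemma halfedges_community: "fst ` hcm_halfedges Hs n \<subseteq> {..<n}"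
 by (auto simp: hcm_halfedges_def)

definition community_components where
 "community_components m = (%i. reach m `` {i}) ` {..<n}"

context
 fixes m assumes m: "m \<in> hcm_pairings Hs n"
begin

lemma reach_lt: "(i, j) \<in> reach m ==> i < n ==> j < n"
 unfolding reach_def
proof (induction rule: rtrancl_induct)
 case (step y z)
 then obtain h where "h \<in> hcm_halfedges Hs n" "z = fst (m h)" by auto
 then have "m h \<in> hcm_halfedges Hs n" using m by (auto simp: hcm_pairings_def)
 then show ?case using \<open>z = fst (m h)\<close> by (auto simp: hcm_halfedges_def)
qed

lemma adj_inside: "i < n ==> v < csize (Hs i) ==> w < csize (Hs i) ==> (hcm_adj Hs n m)\<^sup>*\<^sup>* (i, v) (i, w)"
proof -
 assume i: "i < n" and v: "v < csize (Hs i)" "w < csize (Hs i)"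
 have "(cedge (Hs i))\<^sup>*\<^sup>* v w" using valid[OF i] v by (auto simp: valid_community_def)
 then show ?thesis
 proof (induction rule: rtranclp_induct)
  case (step y z)
  have "y < csize (Hs i) & z < csize (Hs i)" using valid[OF i] step(2) unfolding valid_community_def by blast
  then have "hcm_adj Hs n m (i, y) (i, z)" using step(2) i by (auto simp: hcm_adj_def hcm_vertices_def)
  then show ?case using step.IH by (rule rtranclp.rtrancl_into_rtrancl[rotated])
 qed simp
qed

text \<open>A chain of paired half-edges lifts to a path of vertices by walking inside each
  community from the vertex of arrival to that of departure.\<close>

lemma connected_iff:
 assumes i: "i < n" "v < csize (Hs i)" and j: "j < n" "w < csize (Hs j)"
 shows "(hcm_adj Hs n m)\<^sup>*\<^sup>* (i, v) (j, w) \<longleftrightarrow> (i, j) \<in> reach m"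
proof
 have "(fst x, fst y) \<in> reach m" if "(hcm_adj Hs n m)\<^sup>*\<^sup>* x y" for x y
  using that
 proof (induction rule: rtranclp_induct)
  case (step y z)
  have "fst y = fst z \<or> (fst y, fst z) \<in> {(fst h, fst (m h)) |h. h \<in> hcm_halfedges Hs n}"
   using step(2) unfolding hcm_adj_def by force
  then show ?case using step.IH unfolding reach_def by (auto intro: rtrancl_into_rtrancl)
 qed (simp add: reach_def)
 then show "(hcm_adj Hs n m)\<^sup>*\<^sup>* (i, v) (j, w) ==> (i, j) \<in> reach m" by force
next
 assume "(i, j) \<in> reach m"
 then show "(hcm_adj Hs n m)\<^sup>*\<^sup>* (i, v) (j, w)"
  using j unfolding reach_def
 proof (induction arbitrary: w rule: rtrancl_induct)
  case base
  then show ?case using adj_inside i by auto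
 next
  case (step y z)
  then obtain h where h: "h \<in> hcm_halfedges Hs n" "y = fst h" "z = fst (m h)" by auto
  obtain a k where h1: "h = (y, a, k)" using h by (cases h) auto
  obtain b k' where h2: "m h = (z, b, k')" using h by (cases "m h") auto
  have mh: "m h \<in> hcm_halfedges Hs n" using m h by (auto simp: hcm_pairings_def)
  have ya: "y < n" "a < csize (Hs y)" and zb: "z < n" "b < csize (Hs z)"
   using h(1) mh unfolding h1 h2[unfolded h1] by (auto simp: hcm_halfedges_def)
  have "hcm_adj Hs n m (y, a) (z, b)"
   unfolding hcm_adj_def using ya zb h(1) h1 h2 by (auto simp: hcm_vertices_def)
  then have "(hcm_adj Hs n m)\<^sup>*\<^sup>* (y, a) (z, w)" using adj_inside[OF zb step.prems(2)] by (rule converse_rtranclp_into_rtranclp)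
  then show ?case using step.IH[OF ya] by (rule rtranclp_trans[rotated])
 qed
qed

definition vertices_of where "vertices_of C = {(j, w). j \<in> C & w < csize (Hs j)}"

lemma hcm_components_eq: "hcm_components Hs n m = vertices_of ` community_components m"
proof -
 have cls: "{(x, y). x \<in> hcm_vertices Hs n & y \<in> hcm_vertices Hs n & (hcm_adj Hs n m)\<^sup>*\<^sup>* x y} `` {(i, v)} = vertices_of (reach m `` {i})"
  if "i < n" "v < csize (Hs i)" for i v
  using that connected_iff[OF that] reach_lt by (auto simp: vertices_of_def hcm_vertices_def)
 have "hcm_components Hs n m = (%(i, v). vertices_of (reach m `` {i})) ` hcm_vertices Hs n"
 proof -
  have "(%(i, v). vertices_of (reach m `` {i})) x =
   {(x, y). x \<in> hcm_vertices Hs n & y \<in> hcm_vertices Hs n & (hcm_adj Hs n m)\<^sup>*\<^sup>* x y} `` {x}" if "x \<in> hcm_vertices Hs n" for x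
   using that cls by (cases x) (simp add: hcm_vertices_def)
  then show ?thesis unfolding hcm_components_def quotient_def UNION_singleton_eq_range by (rule image_cong[OF refl, symmetric])
 qed
 also have "... = (%i. vertices_of (reach m `` {i})) ` {..<n}"
 proof -
  have "fst ` hcm_vertices Hs n = {..<n}"
  proof
   show "{..<n} \<subseteq> fst ` hcm_vertices Hs n"
   proof
    fix i assume "i \<in> {..<n}"
    then have "(i, 0) \<in> hcm_vertices Hs n" using valid[of i] by (auto simp: hcm_vertices_def valid_community_def)
    then show "i \<in> fst ` hcm_vertices Hs n" by force
   qed
  qed (auto simp: hcm_vertices_def)
  then have "(%i. vertices_of (reach m `` {i})) ` {..<n} = (%i. vertices_of (reach m `` {i})) ` fst ` hcm_vertices Hs n" by simp
  then show ?thesis by (simp add: image_image case_prod_beta)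
 qed
 finally show ?thesis by (simp add: community_components_def image_image)
qed

lemma component_lt: "C \<in> community_components m ==> C \<subseteq> {..<n}"
 using reach_lt by (auto simp: community_components_def)

lemma ordered_comp_sizes_rk:
 "ordered_comp_sizes Hs n m j = rk (community_components m) (%C. \<Sum>i\<in>C. real (csize (Hs i))) j"
proof -
 \<comment> \<open>Each community has the vertex 0, so a set of communities can be read off from its
   vertices, and distinct components stay distinct.\<close>
 have inj: "inj_on vertices_of (community_components m)"
 proof (rule inj_onI)
  fix C C' assume C: "C \<in> community_components m" "C' \<in> community_components m" "vertices_of C = vertices_of C'"
  have "C = fst ` vertices_of C" if "C \<in> community_components m" for C
  proof
   show "C \<subseteq> fst ` vertices_of C"
   proof
    fix i assume i: "i \<in> C"
    then have "i < n" using component_lt[OF that] by auto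
    then have "(i, 0) \<in> vertices_of C" using i valid[of i] by (auto simp: vertices_of_def valid_community_def)
    then show "i \<in> fst ` vertices_of C" by force
   qed
  qed (auto simp: vertices_of_def)
  with C show "C = C'" by metis
 qed
 have card: "card (vertices_of C) = (\<Sum>i\<in>C. csize (Hs i))" if "C \<in> community_components m" for C
 proof -
  have "finite C" using component_lt[OF that] finite_subset by blast
  moreover have "vertices_of C = (SIGMA i:C. {..<csize (Hs i)})" by (auto simp: vertices_of_def)
  ultimately show ?thesis by simp
 qed
 have fin: "finite (community_components m)" by (simp add: community_components_def)
 have "image_mset card (mset_set (hcm_components Hs n m)) = image_mset (%C. card (vertices_of C)) (mset_set (community_components m))"
  unfolding hcm_components_eq image_mset_mset_set[OF inj, symmetric] by (simp add: image_mset.compositionality comp_def)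
 also have "... = image_mset (%C. \<Sum>i\<in>C. csize (Hs i)) (mset_set (community_components m))"
  using fin by (intro image_mset_cong) (simp add: card)
 finally show ?thesis
  unfolding ordered_comp_sizes_def Let_def
  using sorted_list_rk[OF fin, of j "%C. \<Sum>i\<in>C. csize (Hs i)"] by (simp only: of_nat_sum)
qed

end

end

section \<open>Concentration of the exploration walk\<close>

text \<open>An additive functional of the history; by \<open>Ex_acc\<close> its mean is a sum of
  one-step conditional means.\<close>

definition acc :: "('e list => 'e => real) => 'e list => real" where
 "acc f xs = (\<Sum>k<length xs. f (take k xs) (xs ! k))"

lemma acc_Nil [simp]: "acc f [] = 0" by (simp add: acc_def)

lemma acc_snoc [simp]: "acc f (xs @ [e]) = acc f xs + f xs e"
 unfolding acc_def by (simp add: nth_append)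

lemma acc_take_mono:
 assumes "!!xs e. f xs e >= 0"
 shows "acc f (take k xs) <= acc f xs"
proof -
 have "acc f (take k xs) = (\<Sum>j<length (take k xs). f (take j xs) (xs ! j))"
  unfolding acc_def by (intro sum.cong) (auto simp: min_def split: if_splits)
 also have "... <= acc f xs" unfolding acc_def using assms by (intro sum_mono2) auto
 finally show ?thesis .
qed

lemma (in iid) Ex_acc: "Ex n (acc f) = (\<Sum>j<n. Ex j (%xs. expect q (f xs)))"
 by (induction n) (simp_all add: Ex_snoc del: replicate_pmf.simps(2))

locale exploration_walk = exploration E c ws for E :: "'e set" and c :: "'e => 'i" and ws +
 assumes ev: "even (card E)" and E_ne: "E ~= {}"
begin

abbreviation u where "u \<equiv> pmf_of_set E"

lemma set_u [simp]: "set_pmf u = E" using finE E_ne by simp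

sublocale iid u by unfold_locales (simp add: finE)

definition ell :: real where "ell = real (card E)"

lemma ell_pos: "ell > 0" using finE E_ne by (simp add: ell_def card_gt_0_iff)

text \<open>Divided by \<open>ell\<close>, this is the mean of \<open>F\<close> at the community of
  a uniform half-edge, that is, the size-biased mean.\<close>

definition wsum :: "('i => real) => real" where "wsum F = (\<Sum>i\<in>c ` E. dg i * F i)"

lemma wsum_mono: "(!!i. i \<in> c ` E ==> F i <= G i) ==> wsum F <= wsum G"
 unfolding wsum_def by (intro sum_mono mult_left_mono) auto

lemma expectation_u: "expect u F = (\<Sum>e\<in>E. F e) / ell"
 using integral_pmf_of_set[OF E_ne finE, of F] by (simp add: ell_def)

lemma avg_on:
 assumes "Q \<subseteq> c ` E"
 shows "expect u (%e. if c e \<in> Q then F (c e) else 0) = (\<Sum>i\<in>Q. dg i * F i) / ell"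
proof -
 have finQ: "finite Q" using finite_subset[OF assms] finE by auto
 have "(\<Sum>e\<in>E. if c e \<in> Q then F (c e) else 0) = (\<Sum>i\<in>c ` E. \<Sum>e\<in>{e \<in> E. c e = i}. if c e \<in> Q then F (c e) else 0)"
  using finE by (rule sum.image_gen)
 also have "... = (\<Sum>i\<in>c ` E. if i \<in> Q then dg i * F i else 0)"
 proof (intro sum.cong refl)
  fix i
  have "(\<Sum>e\<in>{e \<in> E. c e = i}. if c e \<in> Q then F (c e) else 0) = (\<Sum>e\<in>{e \<in> E. c e = i}. if i \<in> Q then F i else 0)"
   by (intro sum.cong) auto
  then show "(\<Sum>e\<in>{e \<in> E. c e = i}. if c e \<in> Q then F (c e) else 0) = (if i \<in> Q then dg i * F i else 0)"
   by (simp add: deg_def)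
 qed
 also have "... = (\<Sum>i\<in>Q. dg i * F i)"
 proof -
  have "(\<Sum>i\<in>c ` E. if i \<in> Q then dg i * F i else 0) = (\<Sum>i\<in>c ` E \<inter> Q. dg i * F i)"
   using finE by (simp add: sum.If_cases Int_def)
  then show ?thesis using assms by (simp add: Int_absorb1)
 qed
 finally show ?thesis by (simp add: expectation_u)
qed

lemma avg: "expect u (%e. F (c e)) = wsum F / ell"
proof -
 have "expect u (%e. F (c e)) = expect u (%e. if c e \<in> c ` E then F (c e) else 0)"
  by (rule expectation_cong) simp
 then show ?thesis using avg_on[OF order_refl] by (simp add: wsum_def)
qed

definition dd :: "'e => real" where "dd e = dg (c e)"

text \<open>Charges a draw in a community that was drawn before; such a draw discovers
  nothing.\<close>

definition rep :: "('i => real) => 'e list => 'e => real" where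
 "rep g xs e = (if c e \<in> c ` set xs then g (c e) else 0)"

definition wt :: "('i => real) => 'e list => real" where
 "wt g xs = (\<Sum>i\<in>c ` set xs. dg i * g i)"

lemma rep_avg: "xs \<in> lists E ==> expect u (rep g xs) = wt g xs / ell"
 unfolding rep_def wt_def by (rule avg_on) auto

lemma Ex_wt_le:
 assumes g: "!!i. i \<in> c ` E ==> g i >= 0"
 shows "Ex j (wt g) <= real j * wsum (%i. dg i * g i) / ell"
proof -
 have "wt g xs <= ssum (%e. dd e * g (c e)) xs" if "xs \<in> lists E" for xs
  using that
 proof (induction xs rule: rev_induct)
  case (snoc e xs)
  have "wt g (xs @ [e]) <= wt g xs + dd e * g (c e)"
   using g[of "c e"] snoc.prems by (auto simp: wt_def dd_def insert_absorb)
    (smt (verit, best) finite_imageI finite_set insert_absorb sum.insert mult_nonneg_nonneg of_nat_0_le_iff imageI)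
  then show ?case using snoc by simp
 qed (simp add: wt_def)
 then have "Ex j (wt g) <= Ex j (ssum (%e. dd e * g (c e)))" by (intro Ex_mono) simp
 also have "... = real j * (wsum (%i. dg i * g i) / ell)"
  using avg[of "%i. dg i * g i"] by (simp add: ssum_mean dd_def)
 finally show ?thesis by simp
qed

text \<open>Given the past, the mean charge is \<open>wt g / ell\<close>, and each of the at most
  \<open>n\<close> past draws adds at most \<open>wsum (%i. dg i * g i) / ell\<close> to
  \<open>wt g\<close> on average.\<close>

lemma Ex_acc_rep_le:
 assumes g: "!!i. i \<in> c ` E ==> g i >= 0"
 shows "Ex n (acc (rep g)) <= (real n)^2 * wsum (%i. dg i * g i) / ell^2"
proof -
 have w0: "wsum (%i. dg i * g i) >= 0" unfolding wsum_def using g by (intro sum_nonneg) auto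
 have "Ex n (acc (rep g)) = (\<Sum>j<n. Ex j (%xs. wt g xs / ell))"
  unfolding Ex_acc by (intro sum.cong refl Ex_cong) (simp add: rep_avg)
 also have "... = (\<Sum>j<n. Ex j (wt g) / ell)" by simp
 also have "... <= (\<Sum>j<n. real n * wsum (%i. dg i * g i) / ell / ell)"
 proof (intro sum_mono divide_right_mono)
  fix j assume "j \<in> {..<n}"
  then have "real j * wsum (%i. dg i * g i) / ell <= real n * wsum (%i. dg i * g i) / ell"
   using w0 ell_pos by (intro divide_right_mono mult_right_mono) auto
  then show "Ex j (wt g) <= real n * wsum (%i. dg i * g i) / ell" using Ex_wt_le[of g j, OF g] by linarith
 qed (use ell_pos in auto)
 finally show ?thesis by (simp add: power2_eq_square)
qed

text \<open>Bounds what repetitions do not explain: the draw falls in a community that was a start,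
  or on an active half-edge.\<close>

definition exi :: "'e list => 'e => real" where
 "exi xs e = (if c e \<in> qs (adv (st xs)) then dd e else 0) + (if e \<in> ac (adv (st xs)) then 2 else 0)"

text \<open>Apart from exceptional steps, the walk moves by \<open>dd e - 2\<close> exactly when the
  community of \<open>e\<close> is drawn for the first time.\<close>

lemma walk_approx:
 assumes "xs \<in> lists E"
 shows "\<bar>walk xs - (ssum (%e. dd e - 2) xs - acc (rep (%i. dg i - 2)) xs)\<bar> <= acc exi xs"
 using assms
proof (induction xs rule: rev_induct)
 case Nil
 then show ?case by (simp add: walk_def st_Nil ac_def act_def ds_def qd_def qs_def)
next
 case (snoc e xs)
 then have xs: "xs \<in> lists E" and e: "e \<in> E" by auto
 let ?s = "adv (st xs)"
 have d1: "dg (c e) >= 1" using deg_pos[OF e] by simp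
 have ds: "ds ?s = qs ?s \<union> c ` set xs"
  by (cases "st xs" rule: adv_cases) (use ds_eq[OF ev xs] in auto)
 have sub: "c e \<in> ds ?s" if "e \<in> ac ?s" using that by (simp add: ac_iff)
 have w: "\<bar>walk (xs @ [e]) - walk xs - (if c e \<notin> ds ?s then dg (c e) - 2 else 0)\<bar> <= (if e \<in> ac ?s then 2 else 0)"
  by (rule walk_snoc(1)[OF ev xs e])
 have "\<bar>(walk (xs @ [e]) - walk xs) - ((dd e - 2) - rep (%i. dg i - 2) xs e)\<bar> <= exi xs e"
 proof (cases "c e \<in> ds ?s")
  case False
  then have "c e \<notin> c ` set xs" "c e \<notin> qs ?s" using ds by auto
  then show ?thesis using w False sub by (auto simp: rep_def exi_def dd_def split: if_splits)
 next
  case True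
  show ?thesis
  proof (cases "c e \<in> c ` set xs")
   case True
   then show ?thesis using w \<open>c e \<in> ds ?s\<close> d1 by (auto simp: rep_def exi_def dd_def split: if_splits)
  next
   case False
   then have "c e \<in> qs ?s" using \<open>c e \<in> ds ?s\<close> ds by auto
   then show ?thesis using w \<open>c e \<in> ds ?s\<close> False d1 by (auto simp: rep_def exi_def dd_def split: if_splits)
  qed
 qed
 with snoc.IH[OF xs] show ?case by (simp add: abs_le_iff)
qed

text \<open>Starts are made only at zeros, where \<open>qd\<close> is minus the walk; until the next
  zero it exceeds this value by at most the degree of one start. So the starts are controlled by how
  low the walk has been.\<close>

lemma qd_adv_bound:
 assumes xs: "xs \<in> lists E" and D: "!!i. i \<in> c ` E ==> deg i <= D"
 shows "EX z<=length xs. real (qd (adv (st xs))) <= real D - walk (take z xs)"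
 using xs
proof (induction xs rule: rev_induct)
 case Nil
 have "ac (st []) = {}" "qd (st []) = 0" by (simp_all add: st_Nil ac_def act_def ds_def qd_def qs_def)
 then show ?case using adv_qd(3)[OF inv_st[OF ev] D, of "[]"] by (simp add: walk_def)
next
 case (snoc e xs)
 then have xs: "xs \<in> lists E" and e: "e \<in> E" by auto
 have inv: "inv (st (xs @ [e]))" using inv_st[OF ev] snoc.prems by simp
 show ?case
 proof (cases "ac (st (xs @ [e])) = {}")
  case True
  then have "real (qd (adv (st (xs @ [e])))) <= real D - walk (xs @ [e])"
   using adv_qd(3)[OF inv D] by (simp add: walk_def)
  then show ?thesis by (intro exI[of _ "length (xs @ [e])"]) simp
 next
  case False
  then have "qd (adv (st (xs @ [e]))) = qd (adv (st xs))" using adv_qd(4)[OF inv] walk_snoc(2)[OF ev xs e] by simp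
  moreover obtain z where "z <= length xs" "real (qd (adv (st xs))) <= real D - walk (take z xs)" using snoc.IH[OF xs] by auto
  ultimately show ?thesis by (intro exI[of _ z]) simp
 qed
qed

abbreviation lin where "lin \<equiv> ssum (%e. dd e - 2)"

text \<open>A majorant of the walk that is monotone along the draws. It contains
  \<open>acc exi\<close>, whose mean is itself estimated through \<open>HH\<close>; this circle is
  broken in \<open>Ex_exi\<close>.\<close>

definition HH :: "'e list => real" where
 "HH xs = rmax (lin) xs + acc (rep dg) xs + acc exi xs"

lemma exi_nonneg: "exi xs e >= 0" by (simp add: exi_def dd_def)

lemma rmax_take: "rmax M (take j xs) <= rmax M xs"
 unfolding rmax_def by (intro Max_mono) (auto simp: min_def)

lemma HH_take: "HH (take j xs) <= HH xs"
 unfolding HH_def by (intro add_mono rmax_take acc_take_mono exi_nonneg) (simp add: rep_def)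

lemma walk_le_HH:
 assumes xs: "xs \<in> lists E"
 shows "\<bar>walk xs\<bar> <= HH xs"
proof -
 have "\<bar>acc (rep (%i. dg i - 2)) xs\<bar> <= acc (rep dg) xs"
  using xs
 proof (induction xs rule: rev_induct)
  case (snoc e xs)
  have "\<bar>rep (%i. dg i - 2) xs e\<bar> <= rep dg xs e"
   using deg_pos[of e] snoc.prems by (auto simp: rep_def)
  then show ?case using snoc by (simp add: abs_le_iff)
 qed simp
 moreover have "\<bar>lin (take (length xs) xs)\<bar> <= rmax (lin) xs" by (rule rmax_ge) simp
 ultimately show ?thesis using walk_approx[OF xs] unfolding HH_def by simp
qed

lemma qd_HH:
 assumes xs: "xs \<in> lists E" and D: "!!i. i \<in> c ` E ==> deg i <= D"
 shows "real (qd (adv (st xs))) <= real D + HH xs" "real (card (ac (adv (st xs)))) <= real D + 2 * HH xs"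
proof -
 obtain z where z: "real (qd (adv (st xs))) <= real D - walk (take z xs)" using qd_adv_bound[OF xs D] by auto
 have "take z xs \<in> lists E" using xs by (auto dest: in_set_takeD)
 then have "\<bar>walk (take z xs)\<bar> <= HH xs" using walk_le_HH[of "take z xs"] HH_take[of z xs] by linarith
 then show 1: "real (qd (adv (st xs))) <= real D + HH xs" using z by linarith
 have "real (card (ac (adv (st xs)))) = walk xs + real (qd (adv (st xs)))"
  using adv_qd(1)[OF inv_st[OF ev xs]] by (simp add: walk_def)
 then show "real (card (ac (adv (st xs)))) <= real D + 2 * HH xs" using 1 walk_le_HH[OF xs] by linarith
qed

lemma exi_avg:
 assumes xs: "xs \<in> lists E" and D: "!!i. i \<in> c ` E ==> deg i <= D"
 shows "expect u (exi xs) <= (real D + 4) * (real D + HH xs) / ell"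
proof -
 let ?s = "adv (st xs)"
 have inv: "inv ?s" using inv_adv inv_st[OF ev xs] by auto
 have qsub: "qs ?s \<subseteq> c ` E" and acsub: "ac ?s \<subseteq> E" using inv by (auto simp: inv_def ac_iff)
 have h0: "HH xs >= 0" using walk_le_HH[OF xs] by linarith
 have "expect u (exi xs) = (\<Sum>i\<in>qs ?s. dg i * dg i) / ell + expect u (%e. if e \<in> ac ?s then 2 else 0)"
  unfolding exi_def dd_def using avg_on[OF qsub, of "%i. dg i"] by simp
 also have "expect u (%e. if e \<in> ac ?s then 2 else 0) = 2 * real (card (ac ?s)) / ell"
 proof -
  have "E \<inter> ac ?s = ac ?s" using acsub by auto
  then show ?thesis unfolding expectation_u using finE by (simp add: sum.If_cases)
 qed
 also have "(\<Sum>i\<in>qs ?s. dg i * dg i) <= (\<Sum>i\<in>qs ?s. real D * dg i)"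
  using D qsub by (intro sum_mono mult_right_mono) auto
 also have "... = real D * real (qd ?s)" by (simp add: qd_def sum_distrib_left)
 finally have "expect u (exi xs) <= (real D * real (qd ?s) + 2 * real (card (ac ?s))) / ell"
  using ell_pos by (simp add: add_divide_distrib divide_right_mono)
 also have "... <= (real D * (real D + HH xs) + 2 * (real D + 2 * HH xs)) / ell"
  using qd_HH[OF xs D] ell_pos by (intro divide_right_mono add_mono mult_left_mono) auto
 also have "... <= (real D + 4) * (real D + HH xs) / ell"
  using ell_pos h0 by (intro divide_right_mono) (auto simp: algebra_simps)
 finally show ?thesis .
qed

text \<open>The conditional mean of an exceptional step is bounded through \<open>HH\<close>, hence
  through \<open>acc exi\<close> itself, with a total factor of at most 1/2. That part is absorbed
  on the left side.\<close>

lemma Ex_exi: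
 assumes D: "!!i. i \<in> c ` E ==> deg i <= D" and small: "real n * (real D + 4) / ell <= 1/2"
 shows "Ex n (acc exi) <= 2 * (real n * (real D + 4) / ell) * (real D + Ex n (rmax (lin)) + Ex n (acc (rep dg)))"
proof -
 define \<alpha> where "\<alpha> = real n * (real D + 4) / ell"
 have \<alpha>0: "\<alpha> >= 0" using ell_pos by (simp add: \<alpha>_def)
 define X where "X = Ex n (rmax (lin)) + Ex n (acc (rep dg))"
 have "Ex n (acc exi) = (\<Sum>j<n. Ex j (%xs. expect u (exi xs)))" by (rule Ex_acc)
 also have "... <= (\<Sum>j<n. (real D + 4) * (real D + Ex n HH) / ell)"
 proof (rule sum_mono)
  fix j assume j: "j \<in> {..<n}"
  have "Ex j (%xs. expect u (exi xs)) <= Ex j (%xs. (real D + 4) * (real D + HH xs) / ell)"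
   by (intro Ex_mono exi_avg D) simp_all
  also have "... = (real D + 4) * (real D + Ex j HH) / ell" by simp
  also have "Ex j HH = Ex n (%xs. HH (take j xs))" using j by (intro Ex_take[symmetric]) simp
  also have "... <= Ex n HH" by (intro Ex_mono HH_take)
  finally show "Ex j (%xs. expect u (exi xs)) <= (real D + 4) * (real D + Ex n HH) / ell"
   using ell_pos by (simp add: divide_right_mono)
 qed
 also have "... = \<alpha> * (real D + Ex n HH)" by (simp add: \<alpha>_def)
 also have "Ex n HH = X + Ex n (acc exi)" by (simp add: HH_def[abs_def] X_def)
 finally have 1: "Ex n (acc exi) <= \<alpha> * (real D + X) + \<alpha> * Ex n (acc exi)" by (simp add: algebra_simps)
 have "Ex n (acc exi) >= 0" by (intro Ex_nonneg) (simp add: acc_def sum_nonneg exi_nonneg)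
 then have "\<alpha> * Ex n (acc exi) <= 1/2 * Ex n (acc exi)" using small by (intro mult_right_mono) (simp_all add: \<alpha>_def)
 with 1 have "Ex n (acc exi) <= 2 * (\<alpha> * (real D + X))" by linarith
 then show ?thesis by (simp add: \<alpha>_def X_def add.assoc)
qed

text \<open>The mean contribution of one draw to the weight \<open>wt\<close>. After
  \<open>j\<close> draws the repetition charge has conditional mean about
  \<open>j * omega / ell\<close>, which adds up to the parabola
  \<open>omega * k^2 / (2 * ell)\<close>.\<close>

definition omega :: real where "omega = wsum (%i. dg i * (dg i - 2)) / ell"

abbreviation "gg \<equiv> %i. dg i - 2"

text \<open>Repetitions minus their conditional means: a martingale.\<close>

definition repM :: "'e list => real" where
 "repM xs = acc (rep gg) xs - (\<Sum>j<length xs. wt gg (take j xs)) / ell"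

lemma gg_sq: "i \<in> c ` E ==> (gg i)^2 <= (dg i)^2"
 using deg_pos_iff[of i] by (intro iffD1[OF abs_le_square_iff]) auto

lemma repM_max:
 assumes m: "m > 0"
 shows "Ex n (rmax repM) <= m + (real n)^2 * wsum (%i. dg i ^ 3) / ell^2 / m"
proof -
 have snoc: "repM (xs @ [e]) = repM xs + rep gg xs e - wt gg xs / ell" for xs e
  by (simp add: repM_def add_divide_distrib)
 define v where "v xs = wt (%i. (dg i)^2) xs / ell" for xs
 have "Ex n (rmax repM) <= m + ((repM [])^2 + (\<Sum>k<n. Ex k v)) / m"
 proof (rule maximal_inequality[OF _ _ m])
  fix xs assume "xs \<in> lists (set_pmf u)"
  then have xs: "xs \<in> lists E" by simp
  show "expect u (%e. repM (xs @ [e])) = repM xs" unfolding snoc using rep_avg[OF xs, of gg] by simp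
  have "expect u (%e. (repM (xs @ [e]) - repM xs)^2) = expect u (%e. (rep gg xs e)^2 - 2 * (wt gg xs / ell) * rep gg xs e + (wt gg xs / ell)^2)"
   unfolding snoc by (intro Bochner_Integration.integral_cong refl) (simp add: power2_eq_square algebra_simps)
  also have "... = expect u (%e. (rep gg xs e)^2) - (wt gg xs / ell)^2"
   using rep_avg[OF xs, of gg] by (simp add: power2_eq_square)
  also have "... <= expect u (%e. (rep gg xs e)^2)" by simp
  also have "... <= expect u (rep (%i. (dg i)^2) xs)"
   using gg_sq by (intro expectation_mono_finite) (auto simp: finE rep_def)
  also have "... = v xs" unfolding v_def by (rule rep_avg[OF xs])
  finally show "expect u (%e. (repM (xs @ [e]) - repM xs)^2) <= v xs" .
 qed
 also have "(\<Sum>k<n. Ex k v) = Ex n (acc (rep (%i. (dg i)^2)))"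
  unfolding Ex_acc v_def by (intro sum.cong refl Ex_cong) (simp add: rep_avg)
 also have "... <= (real n)^2 * wsum (%i. dg i * (dg i)^2) / ell^2" by (rule Ex_acc_rep_le) simp
 finally have "Ex n (rmax repM) <= m + ((repM [])^2 + (real n)^2 * wsum (%i. dg i * (dg i)^2) / ell^2) / m"
  using m by (simp add: divide_right_mono)
 moreover have "repM [] = 0" by (simp add: repM_def)
 ultimately show ?thesis by (simp add: power3_eq_cube power2_eq_square mult.assoc)
qed

lemma Ex_abs_le_sqrt:
 "Ex n (%xs. \<bar>F xs\<bar>) <= sqrt (Ex n (%xs. (F xs)^2))"
proof -
 define x where "x = Ex n (%xs. \<bar>F xs\<bar>)"
 have "0 <= Ex n (%xs. (\<bar>F xs\<bar> - x)^2)" by (intro Ex_nonneg) simp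
 also have "... = Ex n (%xs. (F xs)^2 - 2 * x * \<bar>F xs\<bar> + x^2)"
  by (intro Bochner_Integration.integral_cong refl) (simp add: power2_diff algebra_simps)
 also have "... = Ex n (%xs. (F xs)^2) - x^2" by (simp add: x_def power2_eq_square)
 finally show ?thesis unfolding x_def[symmetric] by (simp add: real_le_rsqrt)
qed

text \<open>\<open>wt\<close> counts each community once, whereas an i.i.d. sum counts it at each
  draw. The difference is a charge for repetitions, and the i.i.d. sum is close to its mean by its
  variance.\<close>

lemma wt_LLN:
 "Ex j (%xs. \<bar>wt gg xs - real j * omega\<bar>) <= sqrt (real j * (wsum (%i. dg i ^ 4) / ell)) + (real j)^2 * wsum (%i. dg i ^ 3) / ell^2"
proof -
 define \<xi> where "\<xi> e = dd e * gg (c e) - omega" for e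
 have mean: "expect u \<xi> = 0"
  unfolding \<xi>_def dd_def using avg[of "%i. dg i * gg i"] by (simp add: omega_def)
 have pw: "\<bar>wt gg xs - real (length xs) * omega\<bar> <= \<bar>ssum \<xi> xs\<bar> + acc (rep (%i. (dg i)^2)) xs" if "xs \<in> lists E" for xs
 proof -
  have "\<bar>(wt gg xs - real (length xs) * omega) - ssum \<xi> xs\<bar> <= acc (rep (%i. (dg i)^2)) xs"
   using that
  proof (induction xs rule: rev_induct)
   case (snoc e xs)
   have d: "dg (c e) >= 1" using deg_pos[of e] snoc.prems by simp
   have g1: "\<bar>dg (c e) * gg (c e)\<bar> <= (dg (c e))^2"
    unfolding abs_mult power2_eq_square using d by (intro mult_mono) auto
   have w: "wt gg (xs @ [e]) = wt gg xs + (if c e \<in> c ` set xs then 0 else dg (c e) * gg (c e))"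
    unfolding wt_def by (simp add: insert_absorb)
   show ?case using snoc g1 unfolding w by (auto simp: \<xi>_def dd_def rep_def algebra_simps)
  qed (simp add: wt_def)
  then show ?thesis by linarith
 qed
 have "Ex j (%xs. \<bar>wt gg xs - real j * omega\<bar>) <= Ex j (%xs. \<bar>ssum \<xi> xs\<bar> + acc (rep (%i. (dg i)^2)) xs)"
  using pw by (intro Ex_mono) auto
 also have "... = Ex j (%xs. \<bar>ssum \<xi> xs\<bar>) + Ex j (acc (rep (%i. (dg i)^2)))" by simp
 also have "Ex j (acc (rep (%i. (dg i)^2))) <= (real j)^2 * wsum (%i. dg i * (dg i)^2) / ell^2"
  by (rule Ex_acc_rep_le) simp
 also have "Ex j (%xs. \<bar>ssum \<xi> xs\<bar>) <= sqrt (real j * (wsum (%i. dg i ^ 4) / ell))"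
 proof -
  have "expect u (%e. (\<xi> e)^2) <= wsum (%i. dg i ^ 4) / ell"
  proof -
   have "expect u (%e. (\<xi> e)^2) = expect u (%e. (dd e * gg (c e))^2 - 2 * omega * (dd e * gg (c e)) + omega^2)"
    unfolding \<xi>_def by (intro Bochner_Integration.integral_cong refl) (simp add: power2_eq_square algebra_simps)
   also have "... = expect u (%e. (dd e * gg (c e))^2) - omega^2"
    using avg[of "%i. dg i * gg i"] by (simp add: dd_def omega_def power2_eq_square)
   also have "... <= expect u (%e. (dd e * gg (c e))^2)" by simp
   also have "... <= expect u (%e. dg (c e) ^ 4)"
   proof (rule expectation_mono_finite)
    fix e assume "e \<in> set_pmf u"
    then have "(gg (c e))^2 <= (dg (c e))^2" by (intro gg_sq) simp
    then have "(dg (c e))^2 * (gg (c e))^2 <= (dg (c e))^2 * (dg (c e))^2" by (intro mult_left_mono) auto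
    then show "(dd e * gg (c e))^2 <= dg (c e) ^ 4" unfolding dd_def power_mult_distrib by (simp add: power4_eq_xxxx power2_eq_square mult.assoc)
   qed (simp add: finE)
   also have "... = wsum (%i. dg i ^ 4) / ell" by (rule avg)
   finally show ?thesis .
  qed
  then have "Ex j (%xs. (ssum \<xi> xs)^2) <= real j * (wsum (%i. dg i ^ 4) / ell)"
   unfolding ssum_2[OF mean] by (intro mult_left_mono) auto
  then show ?thesis using Ex_abs_le_sqrt[of j "ssum \<xi>"] by (meson order_trans real_sqrt_le_mono)
 qed
 finally show ?thesis by (simp add: power3_eq_cube power2_eq_square mult.assoc)
qed

abbreviation walk_err where
 "walk_err ys \<equiv> walk ys - (lin ys - omega * (real (length ys))^2 / (2 * ell))"

lemma walk_deviation:
 assumes xs: "xs \<in> lists E"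
 shows "rmax walk_err xs
  <= acc exi xs + rmax repM xs + (\<Sum>j<length xs. \<bar>wt gg (take j xs) - real j * omega\<bar>) / ell + \<bar>omega\<bar> * real (length xs) / (2 * ell)"
 unfolding rmax_def[of walk_err]
proof (rule Max.boundedI)
 fix x assume "x \<in> (%k. \<bar>walk (take k xs) - (lin (take k xs) - omega * (real (length (take k xs)))^2 / (2 * ell))\<bar>) ` {..length xs}"
 then obtain k where k: "k <= length xs" "x = \<bar>walk (take k xs) - (lin (take k xs) - omega * (real k)^2 / (2 * ell))\<bar>"
  by (auto simp: min_def split: if_splits)
 define ys where "ys = take k xs"
 have ys: "ys \<in> lists E" "length ys = k" using xs k by (auto simp: ys_def dest: in_set_takeD)
 have 1: "\<bar>walk ys - (lin ys - acc (rep gg) ys)\<bar> <= acc exi xs"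
  using walk_approx[OF ys(1)] acc_take_mono[of exi k xs] exi_nonneg unfolding ys_def by force
 have 2: "\<bar>repM ys\<bar> <= rmax repM xs" unfolding ys_def by (rule rmax_ge[OF k(1)])
 have tk: "take j ys = take j xs" if "j < k" for j using that by (simp add: ys_def min_def)
 \<comment> \<open>The sum falls short of \<open>k^2 / 2\<close> by \<open>k / 2\<close>; this
   discrepancy is the last term of the bound.\<close>
 have gauss: "(\<Sum>j<k. real j) = real k * (real k - 1) / 2" by (induction k) (simp_all add: field_simps)
 have "(\<Sum>j<k. wt gg (take j ys)) / ell - omega * (real k)^2 / (2 * ell) = (\<Sum>j<k. wt gg (take j xs) - real j * omega) / ell - omega * real k / (2 * ell)"
 proof -
  have "(\<Sum>j<k. wt gg (take j xs) - real j * omega) = (\<Sum>j<k. wt gg (take j ys)) - real k * (real k - 1) / 2 * omega"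
   using gauss tk by (simp add: sum_subtractf sum_distrib_right[symmetric])
  then show ?thesis using ell_pos by (simp add: field_simps power2_eq_square)
 qed
 moreover have "\<bar>(\<Sum>j<k. wt gg (take j xs) - real j * omega) / ell\<bar> <= (\<Sum>j<length xs. \<bar>wt gg (take j xs) - real j * omega\<bar>) / ell"
 proof -
  have "\<bar>\<Sum>j<k. wt gg (take j xs) - real j * omega\<bar> <= (\<Sum>j<k. \<bar>wt gg (take j xs) - real j * omega\<bar>)" by (rule sum_abs)
  also have "... <= (\<Sum>j<length xs. \<bar>wt gg (take j xs) - real j * omega\<bar>)" using k by (intro sum_mono2) auto
  finally show ?thesis using ell_pos by (simp add: divide_right_mono)
 qed
 moreover have "\<bar>omega * real k / (2 * ell)\<bar> <= \<bar>omega\<bar> * real (length xs) / (2 * ell)"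
  using k ell_pos by (simp add: abs_mult divide_right_mono mult_left_mono)
 moreover have "acc (rep gg) ys = repM ys + (\<Sum>j<k. wt gg (take j ys)) / ell" using ys by (simp add: repM_def)
 ultimately show "x <= acc exi xs + rmax repM xs + (\<Sum>j<length xs. \<bar>wt gg (take j xs) - real j * omega\<bar>) / ell + \<bar>omega\<bar> * real (length xs) / (2 * ell)"
  using 1 2 k(2) unfolding ys_def[symmetric] by linarith
qed auto

section \<open>Volume of the explored communities\<close>

definition volw :: "('i => real) => 'e list => real" where
 "volw f xs = (\<Sum>i\<in>ds (st xs) - qs (st xs). f i)"

definition hit :: "('i => real) => 'e list => 'e => real" where
 "hit f xs e = (if c e \<in> qs (adv (st xs)) then f (c e) else 0)"

lemma volw_snoc:
 assumes "xs \<in> lists E" "e \<in> E"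
 shows "volw f (xs @ [e]) = volw f xs + (if c e \<notin> ds (adv (st xs)) then f (c e) else 0)"
proof -
 interpret R: exploration_run E c ws "xs @ [e]" by unfold_locales (use ev assms in auto)
 show ?thesis using R.vol_Suc[of "length xs" f] by (simp add: R.vol_def volw_def)
qed

lemma volw_approx:
 assumes "xs \<in> lists E" and f: "!!i. i \<in> c ` E ==> f i >= 0"
 shows "\<bar>volw f xs - ssum (%e. f (c e)) xs\<bar> <= acc (rep f) xs + acc (hit f) xs"
 using assms(1)
proof (induction xs rule: rev_induct)
 case Nil
 then show ?case by (simp add: volw_def st_Nil ds_def)
next
 case (snoc e xs)
 then have xs: "xs \<in> lists E" and e: "e \<in> E" by auto
 have f0: "f (c e) >= 0" using f e by simp
 have "ds (adv (st xs)) = qs (adv (st xs)) \<union> c ` set xs"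
  by (cases "st xs" rule: adv_cases) (use ds_eq[OF ev xs] in auto)
 then have "\<bar>(if c e \<notin> ds (adv (st xs)) then f (c e) else 0) - f (c e)\<bar> <= rep f xs e + hit f xs e"
  using f0 by (auto simp: rep_def hit_def)
 then show ?case using snoc.IH[OF xs] by (simp add: volw_snoc[OF xs e])
qed

lemma hit_avg:
 assumes xs: "xs \<in> lists E" and D: "!!i. i \<in> c ` E ==> deg i <= D"
  and b: "!!i. i \<in> c ` E ==> f i <= b" and b0: "b >= 0"
 shows "expect u (hit f xs) <= b * (real D + HH xs) / ell"
proof -
 have "inv (adv (st xs))" using inv_adv inv_st[OF ev xs] by auto
 then have qsub: "qs (adv (st xs)) \<subseteq> c ` E" by (auto simp: inv_def)
 have "expect u (hit f xs) = (\<Sum>i\<in>qs (adv (st xs)). dg i * f i) / ell"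
  unfolding hit_def by (rule avg_on[OF qsub])
 also have "... <= (\<Sum>i\<in>qs (adv (st xs)). b * dg i) / ell"
  using b qsub ell_pos by (intro divide_right_mono sum_mono) (auto simp: mult.commute mult_right_mono mult_left_mono)
 also have "... = b * real (qd (adv (st xs))) / ell" by (simp add: qd_def sum_distrib_left)
 also have "... <= b * (real D + HH xs) / ell"
  using qd_HH(1)[OF xs D] ell_pos b0 by (intro divide_right_mono mult_left_mono) auto
 finally show ?thesis .
qed

lemma Ex_hit:
 assumes D: "!!i. i \<in> c ` E ==> deg i <= D"
  and b: "!!i. i \<in> c ` E ==> f i <= b" and b0: "b >= 0"
 shows "Ex n (acc (hit f)) <= real n * (b * (real D + Ex n HH) / ell)"
proof -
 have "Ex n (acc (hit f)) = (\<Sum>j<n. Ex j (%xs. expect u (hit f xs)))" by (rule Ex_acc)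
 also have "... <= (\<Sum>j<n. b * (real D + Ex n HH) / ell)"
 proof (rule sum_mono)
  fix j assume j: "j \<in> {..<n}"
  have "Ex j (%xs. expect u (hit f xs)) <= Ex j (%xs. b * (real D + HH xs) / ell)"
   by (rule Ex_mono, rule hit_avg) (use D b b0 in auto)
  also have "... = b * (real D + Ex j HH) / ell" by simp
  also have "Ex j HH = Ex n (%xs. HH (take j xs))" using j by (intro Ex_take[symmetric]) simp
  also have "... <= Ex n HH" by (intro Ex_mono HH_take)
  finally show "Ex j (%xs. expect u (hit f xs)) <= b * (real D + Ex n HH) / ell"
   using ell_pos b0 by (simp add: divide_right_mono mult_left_mono)
 qed
 finally show ?thesis by simp
qed

lemma rmax_ssum_centred:
 fixes f :: "'i => real"
 assumes m: "m > 0"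
 defines "\<kappa> \<equiv> wsum f / ell"
 shows "Ex n (rmax (ssum (%e. f (c e) - \<kappa>))) <= m + real n * (wsum (%i. (f i)^2) / ell) / m"
proof -
 have mean: "expect u (%e. f (c e) - \<kappa>) = 0" using avg[of f] by (simp add: \<kappa>_def)
 have var: "expect u (%e. (f (c e) - \<kappa>)^2) <= wsum (%i. (f i)^2) / ell"
 proof -
  have "expect u (%e. (f (c e) - \<kappa>)^2) = expect u (%e. (f (c e))^2 - 2 * \<kappa> * f (c e) + \<kappa>^2)"
   by (intro Bochner_Integration.integral_cong refl) (simp add: power2_eq_square algebra_simps)
  also have "... = wsum (%i. (f i)^2) / ell - \<kappa>^2"
   using avg[of f] avg[of "%i. (f i)^2"] by (simp add: \<kappa>_def power2_eq_square)
  finally show ?thesis by simp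
 qed
 have "Ex n (rmax (ssum (%e. f (c e) - \<kappa>))) <= m + ((ssum (%e. f (c e) - \<kappa>) [])^2 + (\<Sum>k<n. Ex k (%_. wsum (%i. (f i)^2) / ell))) / m"
  by (rule maximal_inequality[OF _ _ m]) (use ssum_mart[OF mean] var in auto)
 then show ?thesis by simp
qed

lemma ssum_diff: "ssum (%e. F e - x) xs = ssum F xs - real (length xs) * x"
 by (induction xs rule: rev_induct) (simp_all add: algebra_simps)

lemma vol_deviation:
 assumes xs: "xs \<in> lists E" and f: "!!i. i \<in> c ` E ==> f i >= 0"
 shows "rmax (%ys. volw f ys - \<kappa> * real (length ys)) xs <= rmax (ssum (%e. f (c e) - \<kappa>)) xs + acc (rep f) xs + acc (hit f) xs"
 unfolding rmax_def[of "%ys. volw f ys - \<kappa> * real (length ys)"]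
proof (rule Max.boundedI)
 fix x assume "x \<in> (%k. \<bar>volw f (take k xs) - \<kappa> * real (length (take k xs))\<bar>) ` {..length xs}"
 then obtain k where k: "k <= length xs" "x = \<bar>volw f (take k xs) - \<kappa> * real (length (take k xs))\<bar>" by auto
 have ys: "take k xs \<in> lists E" using xs by (auto dest: in_set_takeD)
 have r: "rep f xs e >= 0" "hit f xs e >= 0" if "c e \<in> c ` E" for xs e using f[OF that] by (auto simp: rep_def hit_def)
 have m: "acc F (take k xs) <= acc F xs" if "!!ys e. e \<in> E ==> F ys e >= 0" for F :: "'e list => 'e => real"
 proof -
  have "acc F (take k xs) = (\<Sum>j<length (take k xs). F (take j xs) (xs ! j))"
   unfolding acc_def by (intro sum.cong) (auto simp: min_def split: if_splits)
  also have "... <= acc F xs" unfolding acc_def using that xs by (intro sum_mono2) (auto simp: in_lists_conv_set)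
  finally show ?thesis .
 qed
 have "acc (rep f) (take k xs) <= acc (rep f) xs" "acc (hit f) (take k xs) <= acc (hit f) xs"
  by (rule m, rule r, simp)+
 moreover have "\<bar>ssum (%e. f (c e) - \<kappa>) (take k xs)\<bar> <= rmax (ssum (%e. f (c e) - \<kappa>)) xs" by (rule rmax_ge[OF k(1)])
 ultimately show "x <= rmax (ssum (%e. f (c e) - \<kappa>)) xs + acc (rep f) xs + acc (hit f) xs"
  using volw_approx[of "take k xs" f, OF ys f] k(2) unfolding ssum_diff[where xs = "take k xs"] by (simp add: mult.commute)
qed auto

end

text \<open>\<open>a\<close> is the scale and \<open>K\<close> collects fixed constants. The small
  \<open>\<delta>\<close> bounds \<open>1 / a\<close>, the degrees in units of \<open>a\<close> and
  the sizes in units of \<open>a^2\<close>. The inequality \<open>dK\<close> provides the factor 1/2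
  that \<open>Ex_exi\<close> asks for.\<close>

locale exploration_bounds = exploration_walk E c ws for E :: "'e set" and c :: "'e => 'i" and ws +
 fixes a K \<delta> :: real and D L :: nat and f :: "'i => real"
 assumes a1: "a >= 1" and K1: "K >= 1" and da: "1 / a <= \<delta>" and dK: "\<delta> <= 1 / (10 * K^2)"
  and ell_ge: "ell >= a ^ 3 / K" and L_le: "real L <= K * a^2"
  and A3: "wsum (%i. (dg i)^2) <= K * a ^ 3" and Af: "wsum f <= K * a ^ 3"
  and degD: "!!i. i \<in> c ` E ==> deg i <= D" and D_le: "real D <= \<delta> * a"
  and f0: "!!i. i \<in> c ` E ==> f i >= 0" and f_le: "!!i. i \<in> c ` E ==> f i <= \<delta> * a^2"
  and drift: "\<bar>wsum dg / ell - 2\<bar> <= K / a"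
begin

lemma pos: "a > 0" "K > 0" "\<delta> > 0" using a1 K1 da by (auto intro: less_le_trans[of 0 "1/a"])

lemma d1: "\<delta> <= 1"
proof -
 have "1 <= K^2" using K1 by simp
 then have "1 / (10 * K^2) <= 1" by (subst divide_le_eq_1_pos) auto
 then show ?thesis using dK by linarith
qed

lemma da1: "1 <= \<delta> * a" using da pos by (simp add: field_simps)

lemma sq: "\<delta> <= sqrt \<delta>" "sqrt \<delta> > 0"
 using pos d1 by (auto simp: real_le_rsqrt power2_eq_square mult_left_le)

lemma div_ell: "x >= 0 ==> x <= y ==> x / ell <= K * y / a ^ 3"
proof -
 assume x: "x >= 0" "x <= y"
 have "x / ell <= y / (a ^ 3 / K)" using x ell_ge pos by (intro frac_le) auto
 then show ?thesis by (simp add: mult.commute)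
qed

lemma Lell: "real L / ell <= K^2 / a"
proof -
 have "real L / ell <= K * (K * a^2) / a ^ 3" by (rule div_ell) (use L_le in auto)
 then show ?thesis using pos by (simp add: power2_eq_square power3_eq_cube)
qed

lemma Lell2: "wsum F >= 0 ==> wsum F <= y ==> (real L)^2 * wsum F / ell^2 <= K ^ 4 / a^2 * y"
proof -
 assume w: "wsum F >= 0" "wsum F <= y"
 have "(real L / ell)^2 <= (K^2 / a)^2" using Lell ell_pos by (intro power_mono) auto
 also have "... = K ^ 4 / a^2" by (simp add: power_divide)
 finally have "(real L / ell)^2 * wsum F <= K ^ 4 / a^2 * y" using w by (intro mult_mono) auto
 then show ?thesis by (simp add: power_divide)
qed

lemma wsum_nonneg: "(!!i. i \<in> c ` E ==> F i >= 0) ==> wsum F >= 0"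
 unfolding wsum_def by (intro sum_nonneg) auto

lemma wsum_scale: "wsum (%i. x * F i) = x * wsum F"
 unfolding wsum_def sum_distrib_left by (intro sum.cong) auto

lemma degD': "i \<in> c ` E ==> dg i <= \<delta> * a" using degD[of i] D_le by linarith

lemma wsum_bound:
 assumes "!!i. i \<in> c ` E ==> G i <= x * F i" "wsum F <= K * a ^ 3" "x >= 0"
 shows "wsum G <= x * (K * a ^ 3)"
proof -
 have "wsum G <= wsum (%i. x * F i)" using assms by (intro wsum_mono)
 also have "... = x * wsum F" by (rule wsum_scale)
 also have "... <= x * (K * a ^ 3)" using assms by (intro mult_left_mono)
 finally show ?thesis .
qed

lemma W3: "wsum (%i. dg i ^ 3) <= \<delta> * a * (K * a ^ 3)"
proof (rule wsum_bound[OF _ A3])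
 fix i assume "i \<in> c ` E"
 then have "dg i * (dg i)^2 <= \<delta> * a * (dg i)^2" by (intro mult_right_mono degD') auto
 then show "dg i ^ 3 <= \<delta> * a * (dg i)^2" by (simp add: power3_eq_cube power2_eq_square mult.assoc)
qed (use pos in auto)

lemma W4: "wsum (%i. dg i ^ 4) <= (\<delta> * a)^2 * (K * a ^ 3)"
proof (rule wsum_bound[OF _ A3])
 fix i assume "i \<in> c ` E"
 then have "(dg i)^2 <= (\<delta> * a)^2" by (intro power_mono degD') auto
 then have "(dg i)^2 * (dg i)^2 <= (\<delta> * a)^2 * (dg i)^2" by (intro mult_right_mono) auto
 then show "dg i ^ 4 <= (\<delta> * a)^2 * (dg i)^2" by (simp add: power4_eq_xxxx power2_eq_square mult.assoc)
qed auto

lemma repM_bound: "Ex L (rmax repM) <= 2 * K ^ 5 * sqrt \<delta> * a"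
proof -
 \<comment> \<open>The level \<open>sqrt \<delta> * a\<close> balances the two terms, as the
   variance is of order \<open>\<delta> * a^2\<close>.\<close>
 have "Ex L (rmax repM) <= sqrt \<delta> * a + (real L)^2 * wsum (%i. dg i ^ 3) / ell^2 / (sqrt \<delta> * a)"
  by (rule repM_max) (use pos in auto)
 also have "(real L)^2 * wsum (%i. dg i ^ 3) / ell^2 <= K ^ 4 / a^2 * (\<delta> * a * (K * a ^ 3))"
  by (rule Lell2[OF wsum_nonneg W3]) auto
 also have "K ^ 4 / a^2 * (\<delta> * a * (K * a ^ 3)) = K ^ 5 * sqrt \<delta> * a * (sqrt \<delta> * a)"
  using pos by (simp add: field_simps eval_nat_numeral)
 finally have "Ex L (rmax repM) <= sqrt \<delta> * a + K ^ 5 * sqrt \<delta> * a"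
  using pos sq by (simp add: divide_right_mono)
 moreover have "1 * (sqrt \<delta> * a) <= K ^ 5 * (sqrt \<delta> * a)" using K1 pos by (intro mult_right_mono) auto
 ultimately show ?thesis by (simp add: algebra_simps)
qed

lemma K_mono: "m <= n ==> K ^ m <= K ^ n" by (rule power_increasing) (use K1 in auto)

lemma wt_bound: "Ex L (%xs. (\<Sum>j<length xs. \<bar>wt gg (take j xs) - real j * omega\<bar>) / ell) <= 2 * K ^ 7 * \<delta> * a"
proof -
 have b: "Ex j (%xs. \<bar>wt gg xs - real j * omega\<bar>) <= 2 * K ^ 5 * \<delta> * a^2" if j: "j <= L" for j
 proof -
  have W4': "wsum (%i. dg i ^ 4) >= 0" by (rule wsum_nonneg) simp
  have W3': "wsum (%i. dg i ^ 3) >= 0" by (rule wsum_nonneg) simp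
  have "real j * (wsum (%i. dg i ^ 4) / ell) <= (K * a^2) * (K * ((\<delta> * a)^2 * (K * a ^ 3)) / a ^ 3)"
   using j L_le W4' ell_pos pos by (intro mult_mono div_ell W4) auto
  also have "... = K ^ 3 * (\<delta> * a^2)^2" using pos by (simp add: field_simps eval_nat_numeral)
  also have "... <= K ^ 10 * (\<delta> * a^2)^2" by (intro mult_right_mono K_mono) auto
  also have "... = (K ^ 5 * (\<delta> * a^2))^2" by (simp add: power_mult_distrib)
  finally have "sqrt (real j * (wsum (%i. dg i ^ 4) / ell)) <= K ^ 5 * (\<delta> * a^2)"
   using pos by (intro real_le_lsqrt) auto
  moreover have "(real j)^2 * wsum (%i. dg i ^ 3) / ell^2 <= K ^ 5 * (\<delta> * a^2)"
  proof -
   have "(real j)^2 * wsum (%i. dg i ^ 3) / ell^2 <= (real L)^2 * wsum (%i. dg i ^ 3) / ell^2"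
    using j W3' by (intro divide_right_mono mult_right_mono power_mono) auto
   also have "... <= K ^ 4 / a^2 * (\<delta> * a * (K * a ^ 3))" by (rule Lell2[OF W3' W3])
   also have "... = K ^ 5 * (\<delta> * a^2)" using pos by (simp add: field_simps eval_nat_numeral)
   finally show ?thesis .
  qed
  ultimately show ?thesis using wt_LLN[of j] by linarith
 qed
 have "Ex L (%xs. (\<Sum>j<length xs. \<bar>wt gg (take j xs) - real j * omega\<bar>) / ell) = Ex L (%xs. (\<Sum>j<L. \<bar>wt gg (take j xs) - real j * omega\<bar>) / ell)"
  by (rule Ex_cong) simp
 also have "... = (\<Sum>j<L. Ex L (%xs. \<bar>wt gg (take j xs) - real j * omega\<bar>)) / ell"
  by (simp add: Bochner_Integration.integral_sum)
 also have "(\<Sum>j<L. Ex L (%xs. \<bar>wt gg (take j xs) - real j * omega\<bar>)) = (\<Sum>j<L. Ex j (%xs. \<bar>wt gg xs - real j * omega\<bar>))"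
  by (intro sum.cong refl Ex_take[where F = "%xs. \<bar>wt gg xs - real _ * omega\<bar>"]) simp
 also have "... <= (\<Sum>j<L. 2 * K ^ 5 * \<delta> * a^2)" by (intro sum_mono b) simp
 also have "... / ell = (real L / ell) * (2 * K ^ 5 * \<delta> * a^2)" by simp
 also have "... <= K^2 / a * (2 * K ^ 5 * \<delta> * a^2)" using Lell pos by (intro mult_right_mono) auto
 also have "... = 2 * K ^ 7 * \<delta> * a" using pos by (simp add: field_simps eval_nat_numeral)
 finally show ?thesis using ell_pos by (simp add: divide_right_mono)
qed

lemma omega_bound: "\<bar>omega\<bar> * real L / (2 * ell) <= K ^ 4 * \<delta> * a"
proof -
 have "\<bar>wsum (%i. dg i * gg i)\<bar> <= wsum (%i. (dg i)^2)"
 proof -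
  have "\<bar>wsum (%i. dg i * gg i)\<bar> <= (\<Sum>i\<in>c ` E. \<bar>dg i * (dg i * gg i)\<bar>)"
   unfolding wsum_def by (rule sum_abs)
  also have "... <= wsum (%i. (dg i)^2)"
   unfolding wsum_def
  proof (rule sum_mono)
   fix i assume "i \<in> c ` E"
   then have "\<bar>gg i\<bar> <= dg i" using deg_pos_iff[of i] by auto
   then show "\<bar>dg i * (dg i * gg i)\<bar> <= dg i * (dg i)^2"
    by (auto simp: abs_mult power2_eq_square intro!: mult_left_mono)
  qed
  finally show ?thesis .
 qed
 then have "\<bar>omega\<bar> <= wsum (%i. (dg i)^2) / ell"
  unfolding omega_def abs_divide using ell_pos by (simp add: divide_right_mono)
 also have "... <= K * (K * a ^ 3) / a ^ 3" by (rule div_ell[OF wsum_nonneg A3]) simp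
 finally have "\<bar>omega\<bar> <= K * (K * a ^ 3) / a ^ 3" .
 then have "\<bar>omega\<bar> <= K^2" using pos by (simp add: power2_eq_square)
 then have "\<bar>omega\<bar> * (real L / ell) <= K^2 * (K^2 / a)" using Lell ell_pos by (intro mult_mono) auto
 also have "... = K ^ 4 * (1 / a)" by (simp add: eval_nat_numeral)
 also have "... <= K ^ 4 * (\<delta> * a)" using da a1 pos da1 by (intro mult_left_mono) (auto intro: order_trans[of _ 1])
 finally have "\<bar>omega\<bar> * (real L / ell) <= K ^ 4 * \<delta> * a" by (simp add: mult.assoc)
 moreover have "\<bar>omega\<bar> * real L / (2 * ell) <= \<bar>omega\<bar> * (real L / ell)" using ell_pos by (simp add: field_simps)
 ultimately show ?thesis by linarith
qed

lemma dd_rmax_bound: "Ex L (rmax (lin)) <= 3 * K ^ 3 * a"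
proof -
 define \<kappa> where "\<kappa> = wsum dg / ell"
 have "rmax (lin) xs <= rmax (ssum (%e. dg (c e) - \<kappa>)) xs + real L * (K / a)" if "length xs = L" for xs
  unfolding rmax_def[of "lin"]
 proof (rule Max.boundedI)
  fix x assume "x \<in> (%k. \<bar>lin (take k xs)\<bar>) ` {..length xs}"
  then obtain k where k: "k <= length xs" "x = \<bar>lin (take k xs)\<bar>" by auto
  have "lin ys = ssum (%e. dg (c e) - \<kappa>) ys + real (length ys) * (\<kappa> - 2)" for ys
   unfolding ssum_diff dd_def by (simp add: algebra_simps)
  from this[of "take k xs"] have "x <= \<bar>ssum (%e. dg (c e) - \<kappa>) (take k xs)\<bar> + real k * \<bar>\<kappa> - 2\<bar>"
   using k by (simp add: abs_mult min_def abs_triangle_ineq order_trans[OF abs_triangle_ineq])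
  moreover have "real k * \<bar>\<kappa> - 2\<bar> <= real L * (K / a)" using k that drift by (intro mult_mono) (auto simp: \<kappa>_def)
  ultimately show "x <= rmax (ssum (%e. dg (c e) - \<kappa>)) xs + real L * (K / a)"
   using rmax_ge[OF k(1), of "ssum (%e. dg (c e) - \<kappa>)"] by linarith
 qed auto
 then have "Ex L (rmax (lin)) <= Ex L (%xs. rmax (ssum (%e. dg (c e) - \<kappa>)) xs + real L * (K / a))"
  by (intro Ex_mono)
 also have "... = Ex L (rmax (ssum (%e. dg (c e) - \<kappa>))) + real L * (K / a)" by simp
 also have "Ex L (rmax (ssum (%e. dg (c e) - \<kappa>))) <= a + real L * (wsum (%i. (dg i)^2) / ell) / a"
  unfolding \<kappa>_def by (rule rmax_ssum_centred) (use pos in auto)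
 also have "real L * (wsum (%i. (dg i)^2) / ell) <= (K * a^2) * (K * (K * a ^ 3) / a ^ 3)"
  using L_le ell_pos pos wsum_nonneg[of "%i. (dg i)^2"] by (intro mult_mono div_ell A3) auto
 also have "(K * a^2) * (K * (K * a ^ 3) / a ^ 3) = K ^ 3 * a * a" using pos by (simp add: field_simps eval_nat_numeral)
 also have "real L * (K / a) <= (K * a^2) * (K / a)" using L_le pos by (intro mult_right_mono) auto
 also have "(K * a^2) * (K / a) = K^2 * a" using pos by (simp add: field_simps eval_nat_numeral)
 finally have "Ex L (rmax (lin)) <= a + K ^ 3 * a + K^2 * a"
  using pos by (simp add: divide_right_mono)
 moreover have "1 * a <= K ^ 3 * a" "K^2 * a <= K ^ 3 * a" using K1 pos K_mono[of 2 3] by (auto intro!: mult_right_mono)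
 ultimately show ?thesis by linarith
qed

lemma rep_bound: "Ex L (acc (rep dg)) <= K ^ 5 * a"
proof -
 have "Ex L (acc (rep dg)) <= (real L)^2 * wsum (%i. dg i * dg i) / ell^2"
  by (rule Ex_acc_rep_le) simp
 also have "... <= K ^ 4 / a^2 * (K * a ^ 3)"
  by (rule Lell2) (use A3 in "auto simp: power2_eq_square intro!: wsum_nonneg")
 also have "... = K ^ 5 * a" using pos by (simp add: field_simps eval_nat_numeral)
 finally show ?thesis .
qed

lemma exi_bound: "Ex L (acc exi) <= 50 * K ^ 7 * \<delta> * a" "real D + Ex L HH <= 10 * K ^ 5 * a"
proof -
 have Da: "real D <= a" using D_le d1 pos by (smt (verit) mult_left_le_one_le)
 have 1: "real L * (real D + 4) / ell <= 5 * K^2 * \<delta>"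
 proof -
  have "real L / ell * (real D + 4) <= K^2 / a * (5 * (\<delta> * a))"
   using Lell ell_pos D_le da1 pos by (intro mult_mono) auto
  then show ?thesis using pos by (simp add: mult_ac)
 qed
 also have "5 * K^2 * \<delta> <= 5 * K^2 * (1 / (10 * K^2))" by (intro mult_left_mono dK) auto
 also have "... = 1/2" using pos by simp
 finally have small: "real L * (real D + 4) / ell <= 1/2" .
 have k35: "K ^ 3 * a <= K ^ 5 * a" "1 * a <= K ^ 5 * a" using pos K_mono[of 3 5] K_mono[of 0 5] by (auto intro!: mult_right_mono)
 have X: "real D + Ex L (rmax (lin)) + Ex L (acc (rep dg)) <= 5 * K ^ 5 * a"
  using Da dd_rmax_bound rep_bound k35 by linarith
 have "Ex L (acc exi) <= 2 * (real L * (real D + 4) / ell) * (real D + Ex L (rmax (lin)) + Ex L (acc (rep dg)))"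
  by (rule Ex_exi[OF degD small])
 also have "... <= 2 * (5 * K^2 * \<delta>) * (5 * K ^ 5 * a)"
 proof (rule mult_mono)
  have "0 <= Ex L (rmax (lin))"
  proof (rule Ex_nonneg)
   fix xs :: "'e list"
   have "\<bar>lin (take 0 xs)\<bar> <= rmax (lin) xs" by (rule rmax_ge) simp
   then show "0 <= rmax (lin) xs" by simp
  qed
  moreover have "0 <= Ex L (acc (rep dg))" by (intro Ex_nonneg) (simp add: acc_def rep_def sum_nonneg)
  ultimately show "0 <= real D + Ex L (rmax (lin)) + Ex L (acc (rep dg))" by simp
 qed (use 1 X pos in auto)
 also have "... = 50 * K ^ 7 * \<delta> * a" by (simp add: eval_nat_numeral)
 finally show exi: "Ex L (acc exi) <= 50 * K ^ 7 * \<delta> * a" .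
 have "50 * K ^ 7 * \<delta> * a <= 50 * K ^ 7 * (1 / (10 * K^2)) * a" using dK pos by (intro mult_right_mono mult_left_mono) auto
 also have "... = 5 * K ^ 5 * a" using pos by (simp add: field_simps eval_nat_numeral)
 finally have "Ex L (acc exi) <= 5 * K ^ 5 * a" using exi by linarith
 moreover have "Ex L HH = Ex L (rmax (lin)) + Ex L (acc (rep dg)) + Ex L (acc exi)"
  by (simp add: HH_def[abs_def])
 ultimately show "real D + Ex L HH <= 10 * K ^ 5 * a" using X by linarith
qed

theorem walk_close:
 "Ex L (rmax walk_err) <= 55 * K ^ 7 * sqrt \<delta> * a"
proof -
 have "Ex L (rmax walk_err) <=
  Ex L (%xs. acc exi xs + rmax repM xs + (\<Sum>j<length xs. \<bar>wt gg (take j xs) - real j * omega\<bar>) / ell + \<bar>omega\<bar> * real L / (2 * ell))"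
  by (rule Ex_mono) (use walk_deviation in auto)
 also have "... = Ex L (acc exi) + Ex L (rmax repM) + Ex L (%xs. (\<Sum>j<length xs. \<bar>wt gg (take j xs) - real j * omega\<bar>) / ell) + \<bar>omega\<bar> * real L / (2 * ell)"
  by simp
 also have "... <= 50 * K ^ 7 * \<delta> * a + 2 * K ^ 5 * sqrt \<delta> * a + 2 * K ^ 7 * \<delta> * a + K ^ 4 * \<delta> * a"
  by (intro add_mono exi_bound repM_bound wt_bound omega_bound)
 also have "... <= 50 * K ^ 7 * sqrt \<delta> * a + 2 * K ^ 7 * sqrt \<delta> * a + 2 * K ^ 7 * sqrt \<delta> * a + K ^ 7 * sqrt \<delta> * a"
  using sq pos K_mono[of 5 7] K_mono[of 4 7] by (intro add_mono mult_right_mono mult_mono) auto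
 finally show ?thesis by (simp add: mult_ac)
qed

abbreviation vol_err where "vol_err ys \<equiv> volw f ys - wsum f / ell * real (length ys)"

theorem vol_close:
 "Ex L (rmax vol_err) <= 13 * K ^ 7 * sqrt \<delta> * a^2"
proof -
 let ?\<kappa> = "wsum f / ell"
 have b0: "\<delta> * a^2 >= 0" using pos by simp
 have "Ex L (rmax (%ys. volw f ys - ?\<kappa> * real (length ys))) <= Ex L (%xs. rmax (ssum (%e. f (c e) - ?\<kappa>)) xs + acc (rep f) xs + acc (hit f) xs)"
  by (rule Ex_mono, rule vol_deviation[OF _ f0]) auto
 also have "... = Ex L (rmax (ssum (%e. f (c e) - ?\<kappa>))) + Ex L (acc (rep f)) + Ex L (acc (hit f))" by simp
 also have "... <= (sqrt \<delta> * a^2 + K ^ 3 * sqrt \<delta> * a^2) + K ^ 5 * \<delta> * a^2 + 10 * K ^ 7 * \<delta> * a^2"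
 proof (intro add_mono)
  have W: "wsum (%i. (f i)^2) <= \<delta> * a^2 * (K * a ^ 3)"
   by (rule wsum_bound[OF _ Af]) (use f0 f_le pos in \<open>auto simp: power2_eq_square[of "f _"] intro!: mult_right_mono\<close>)
  have "Ex L (rmax (ssum (%e. f (c e) - ?\<kappa>))) <= sqrt \<delta> * a^2 + real L * (wsum (%i. (f i)^2) / ell) / (sqrt \<delta> * a^2)"
   by (rule rmax_ssum_centred) (use pos in auto)
  also have "real L * (wsum (%i. (f i)^2) / ell) <= (K * a^2) * (K * (\<delta> * a^2 * (K * a ^ 3)) / a ^ 3)"
   using L_le ell_pos pos wsum_nonneg[of "%i. (f i)^2"] by (intro mult_mono div_ell W) auto
  also have "... = K ^ 3 * sqrt \<delta> * a^2 * (sqrt \<delta> * a^2)" using pos by (simp add: field_simps eval_nat_numeral)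
  finally show "Ex L (rmax (ssum (%e. f (c e) - ?\<kappa>))) <= sqrt \<delta> * a^2 + K ^ 3 * sqrt \<delta> * a^2"
   using pos sq by (simp add: divide_right_mono)
  have "Ex L (acc (rep f)) <= (real L)^2 * wsum (%i. dg i * f i) / ell^2" by (rule Ex_acc_rep_le[OF f0])
  also have "... <= K ^ 4 / a^2 * (\<delta> * a * (K * a ^ 3))"
  proof (rule Lell2)
   show "wsum (%i. dg i * f i) >= 0" by (rule wsum_nonneg) (use f0 in auto)
   show "wsum (%i. dg i * f i) <= \<delta> * a * (K * a ^ 3)"
    by (rule wsum_bound[OF _ Af]) (use f0 degD' pos in "auto intro!: mult_right_mono")
  qed
  also have "... = K ^ 5 * \<delta> * a^2" using pos by (simp add: field_simps eval_nat_numeral)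
  finally show "Ex L (acc (rep f)) <= K ^ 5 * \<delta> * a^2" .
  have "Ex L (acc (hit f)) <= real L * (\<delta> * a^2 * (real D + Ex L HH) / ell)" by (rule Ex_hit[OF degD f_le b0])
  also have "... = (real L / ell) * (\<delta> * a^2 * (real D + Ex L HH))" by simp
  also have "... <= (real L / ell) * (\<delta> * a^2 * (10 * K ^ 5 * a))" using exi_bound(2) b0 ell_pos by (intro mult_left_mono) auto
  also have "... <= (K^2 / a) * (\<delta> * a^2 * (10 * K ^ 5 * a))" using pos Lell by (intro mult_right_mono) auto
  also have "... = 10 * K ^ 7 * \<delta> * a^2" using pos by (simp add: field_simps eval_nat_numeral)
  finally show "Ex L (acc (hit f)) <= 10 * K ^ 7 * \<delta> * a^2" .
 qed
 also have "... <= (K ^ 7 * sqrt \<delta> * a^2 + K ^ 7 * sqrt \<delta> * a^2) + K ^ 7 * sqrt \<delta> * a^2 + 10 * K ^ 7 * sqrt \<delta> * a^2"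
 proof -
  have "1 * sqrt \<delta> * a^2 <= K ^ 7 * sqrt \<delta> * a^2" using pos sq K1 by (intro mult_right_mono) auto
  moreover have "K ^ 3 * sqrt \<delta> * a^2 <= K ^ 7 * sqrt \<delta> * a^2" using pos sq K_mono[of 3 7] by (intro mult_right_mono) auto
  moreover have "K ^ 5 * \<delta> * a^2 <= K ^ 7 * sqrt \<delta> * a^2" using pos sq K_mono[of 5 7] by (intro mult_right_mono mult_mono) auto
  moreover have "10 * K ^ 7 * \<delta> * a^2 <= 10 * K ^ 7 * sqrt \<delta> * a^2" using pos sq by (intro mult_right_mono mult_left_mono) auto
  ultimately show ?thesis by linarith
 qed
 finally show ?thesis by (simp add: mult_ac)
qed

end

section \<open>Components and gaps\<close>

lemma rk_scale:
 fixes len :: "'b => real"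
 assumes c: "c > 0" and B: "!!e. e \<in> I ==> len e <= B"
 shows "rk I (%e. c * len e) j = c * rk I len j"
proof -
 define A where "A len = {0} \<union> {x. x > 0 & (EX F. F \<subseteq> I & (ALL e:F. len e >= x) & finite F & card F = Suc j)}" for len :: "'b => real"
 have "A (%e. c * len e) = (%x. c * x) ` A len"
 proof (intro equalityI subsetI)
  fix x assume x: "x \<in> A (%e. c * len e)"
  have "x / c \<in> A len" using x c by (auto simp: A_def divide_le_eq mult.commute)
  moreover have "x = c * (x / c)" using c by simp
  ultimately show "x \<in> (%x. c * x) ` A len" by (rule rev_image_eqI)
 next
  fix x assume "x \<in> (%x. c * x) ` A len"
  then obtain y where y: "y \<in> A len" "x = c * y" by auto
  show "x \<in> A (%e. c * len e)"
  proof (cases "y = 0")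
   case False
   then obtain F where "F \<subseteq> I" "ALL e:F. y <= len e" "finite F" "card F = Suc j" "y > 0" using y(1) by (auto simp: A_def)
   then have "F \<subseteq> I & (ALL e:F. c * y <= c * len e) & finite F & card F = Suc j" "c * y > 0" using c by simp_all
   then show ?thesis unfolding A_def y(2) by blast
  qed (simp add: y A_def)
 qed
 moreover have "bdd_above (A len)" unfolding A_def by (rule rk_bdd[OF B])
 then have "c * Sup (A len) = Sup ((%x. c * x) ` A len)"
  using c by (intro continuous_at_Sup_mono) (auto intro!: monoI mult_left_mono continuous_intros simp: A_def)
 ultimately show ?thesis by (simp add: rk_alt A_def)
qed

lemma disjoint_gaps_card:
 assumes F: "F \<subseteq> gaps Z" and Z: "Z \<subseteq> {0..T}" and fin: "finite F" and len: "!!e. e \<in> F ==> glen e >= y" and T: "T >= 0"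
 shows "real (card F) * y <= T"
proof -
 have "real (card F) * y <= (\<Sum>e\<in>F. measure lborel {fst e <..< snd e})"
 proof -
  have "real (card F) * y = (\<Sum>e\<in>F. y)" by simp
  also have "... <= (\<Sum>e\<in>F. measure lborel {fst e <..< snd e})"
  proof (rule sum_mono)
   fix e assume "e \<in> F"
   then have "fst e < snd e" "glen e >= y" using F len by (auto simp: gaps_def)
   then show "y <= measure lborel {fst e <..< snd e}" by (simp add: glen_def)
  qed
  finally show ?thesis .
 qed
 also have "... = measure lborel (\<Union>e\<in>F. {fst e <..< snd e})"
 proof (rule measure_finite_Union[symmetric])
  show "disjoint_family_on (%e. {fst e <..< snd e}) F"
   unfolding disjoint_family_on_def
  proof (intro ballI impI)
   fix e e' assume "e \<in> F" "e' \<in> F" "e ~= e'"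
   then have g: "e \<in> gaps Z" "e' \<in> gaps Z" using F by auto
   have "snd e <= fst e' \<or> snd e' <= fst e"
   proof (rule ccontr)
    assume n: "~ ?thesis"
    have "~ fst e < fst e'" "~ fst e' < fst e" "~ snd e < snd e'" "~ snd e' < snd e"
     using g n by (auto simp: gaps_def not_le)
    then have "e = e'" by (metis linorder_neqE_linordered_idom prod_eqI)
    then show False using \<open>e ~= e'\<close> by simp
   qed
   then show "{fst e <..< snd e} \<inter> {fst e' <..< snd e'} = {}" by auto
  qed
  show "emeasure lborel {fst e <..< snd e} ~= \<infinity>" if "e \<in> F" for e
   using that F by (auto simp: gaps_def)
 qed (use fin in auto)
 also have "... <= measure lborel {0..T}"
 proof (rule measure_mono_fmeasurable)
  show "(\<Union>e\<in>F. {fst e <..< snd e}) \<subseteq> {0..T}"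
  proof safe
   fix a b t assume "(a, b) \<in> F" "t \<in> {fst (a, b) <..< snd (a, b)}"
   then have "a \<in> {0..T}" "b \<in> {0..T}" "a < t" "t < b" using F Z by (auto simp: gaps_def)
   then show "t \<in> {0..T}" by auto
  qed
 qed (use fin in "auto simp: fmeasurable_def emeasure_lborel_Icc_eq")
 finally show ?thesis using T by simp
qed

lemma (in half_edges) reach_outside:
 assumes "i \<notin> c ` E"
 shows "reach m `` {i} = {i}"
proof -
 have "j = i" if "(i, j) \<in> reach m" for j
  using that unfolding reach_def by (induction rule: rtrancl_induct) (use assms in auto)
 then show ?thesis by (auto simp: reach_def)
qed

text \<open>Without discoveries the volume can only lose members to the starts. As volume grows
  linearly up to an error, this excludes long gaps that find nothing.\<close>

lemma (in exploration_run) zero_step: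
 assumes "k1 < k2" "zer k1" "zer k2" "!!j. k1 < j ==> j < k2 ==> ~ zer j"
  and same: "ds (S k2) = ds (S k1)" and f0: "!!i. i \<in> c ` E ==> f i >= 0"
 shows "vol f k2 <= vol f k1"
proof -
 have "k2 <= length xs" using assms by (simp add: zer_def)
 then have "qs (S k1) \<subseteq> qs (S k2)" using S_mono[of k1 k2] assms(1) by simp
 then have "ds (S k2) - qs (S k2) \<subseteq> ds (S k1) - qs (S k1)" using same by auto
 moreover have "ds (S k1) \<subseteq> c ` E" "finite (ds (S k1))" using inv_S[of k1] fin_sets by (auto simp: inv_def)
 ultimately show ?thesis unfolding vol_def using f0 by (intro sum_mono2) auto
qed

section \<open>Matching gaps with components for a single outcome\<close>

locale found_components = exploration_run E c ws xs for E :: "'e set" and c :: "'e => 'i" and ws and xs :: "'e list" +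
 fixes m :: "'e => 'e" and V :: "'i set" and f :: "'i => real" and a \<kappa> e1 e2 T :: real and D :: nat
 assumes m: "m \<in> Ext (pm (st xs))" and V: "c ` E \<subseteq> V" "finite V"
  and f0: "!!i. i \<in> V ==> f i >= 0" and f_le: "!!i. i \<in> V ==> f i <= e2 * a^2"
  and a: "a > 0" and \<kappa>: "\<kappa> > 0" and T: "T >= 0" and e0: "e1 >= 0" "e2 >= 0"
  and len: "length xs = nfl (T * a^2)"
  and vol: "!!k. k <= length xs ==> \<bar>vol f k - \<kappa> * real k\<bar> <= e1 * a^2"
  and D: "!!i. i \<in> c ` E ==> deg i <= D"
begin

definition Z :: "real set" where "Z = (%k. real k / a^2) ` {k. zer k}"

definition comps :: "'i set set" where "comps = (%i. reach m `` {i}) ` V"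

definition csz :: "'i set => real" where "csz C = (\<Sum>i\<in>C. f i) / a^2"

definition gap :: "nat => nat => bool" where
 "gap k1 k2 \<longleftrightarrow> zer k1 & zer k2 & k1 < k2 & (ALL j. k1 < j & j < k2 --> ~ zer j)"

lemma len_le: "k <= length xs \<longleftrightarrow> real k / a^2 <= T"
 using a T by (simp add: len le_nat_iff le_floor_iff pos_divide_le_eq)

lemma gaps_iff: "e \<in> gaps Z \<longleftrightarrow> (EX k1 k2. gap k1 k2 & e = (real k1 / a^2, real k2 / a^2))"
 using a unfolding gaps_def Z_def gap_def by (fastforce simp: divide_less_cancel divide_strict_right_mono)

lemma Z_sub: "Z \<subseteq> {0..T}" and Z_fin: "finite Z" and Z0: "0 \<in> Z"
proof -
 show "Z \<subseteq> {0..T}" unfolding Z_def zer_def using len_le by auto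
 have "finite {k. zer k}" by (rule finite_subset[of _ "{..length xs}"]) (auto simp: zer_def)
 then show "finite Z" by (simp add: Z_def)
 show "0 \<in> Z" unfolding Z_def using zer0 by (intro image_eqI[of _ _ 0]) auto
qed

text \<open>Over so long a gap the volume must grow, so a component is discovered. In units of
  \<open>a^2\<close> its size is the growth of the volume, known up to \<open>2 * e1\<close>, plus
  its start, at most \<open>e2\<close>.\<close>

lemma gap_comp:
 assumes g: "gap k1 k2" and big: "\<kappa> * (real k2 - real k1) > 2 * e1 * a^2"
 shows "ds (S k2) - ds (S k1) \<in> comps" "\<bar>csz (ds (S k2) - ds (S k1)) - \<kappa> * (real k2 / a^2 - real k1 / a^2)\<bar> <= 2 * e1 + e2"
  "ds (S k2) - ds (S k1) ~= {}"
proof -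
 have z: "zer k1" "zer k2" "k1 < k2" "!!j. k1 < j ==> j < k2 ==> ~ zer j" and k: "k1 <= length xs" "k2 <= length xs"
  using g by (auto simp: gap_def zer_def)
 have ne: "ds (S k2) ~= ds (S k1)"
 proof
  assume same: "ds (S k2) = ds (S k1)"
  have "vol f k2 <= vol f k1" by (rule zero_step[OF z(3,1,2,4) same]) (use f0 V in auto)
  then show False using vol[OF k(1)] vol[OF k(2)] big by (simp add: algebra_simps abs_le_iff)
 qed
 then obtain w where w: "w \<in> ds (S k2) - ds (S k1)" "ds (S k2) - ds (S k1) = reach m `` {w}"
  "qs (S k2) = insert w (qs (S k1))" "w \<notin> qs (S k1)" using gap_component[OF m z] by auto
 have "ds (S k2) \<subseteq> c ` E" using inv_S[of k2] by (auto simp: inv_def)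
 then have wV: "w \<in> V" using w(1) V by auto
 then show "ds (S k2) - ds (S k1) \<in> comps" unfolding comps_def w(2) by auto
 show "ds (S k2) - ds (S k1) ~= {}" using w(1) by auto
 have "(\<Sum>i\<in>ds (S k2) - ds (S k1). f i) = vol f k2 - vol f k1 + f w"
  using w z k by (intro vol_gap) auto
 then have "\<bar>(\<Sum>i\<in>ds (S k2) - ds (S k1). f i) - \<kappa> * (real k2 - real k1)\<bar> <= (2 * e1 + e2) * a^2"
  using vol[OF k(1)] vol[OF k(2)] f0[OF wV] f_le[OF wV] by (simp add: algebra_simps abs_le_iff)
 then have "\<bar>(\<Sum>i\<in>ds (S k2) - ds (S k1). f i) - \<kappa> * (real k2 - real k1)\<bar> / a^2 <= 2 * e1 + e2"
  using a by (simp add: pos_divide_le_eq)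
 also have "\<bar>(\<Sum>i\<in>ds (S k2) - ds (S k1). f i) - \<kappa> * (real k2 - real k1)\<bar> / a^2 =
  \<bar>((\<Sum>i\<in>ds (S k2) - ds (S k1). f i) - \<kappa> * (real k2 - real k1)) / a^2\<bar>" by simp
 also have "((\<Sum>i\<in>ds (S k2) - ds (S k1). f i) - \<kappa> * (real k2 - real k1)) / a^2 =
  csz (ds (S k2) - ds (S k1)) - \<kappa> * (real k2 / a^2 - real k1 / a^2)"
  by (simp add: csz_def diff_divide_distrib right_diff_distrib)
 finally show "\<bar>csz (ds (S k2) - ds (S k1)) - \<kappa> * (real k2 / a^2 - real k1 / a^2)\<bar> <= 2 * e1 + e2" .
qed

lemma comp_gap:
 assumes C: "C \<in> comps" and w: "w \<in> C" "w \<in> ds (S z)" "zer z"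
 shows "EX k1 k2. gap k1 k2 & C = ds (S k2) - ds (S k1) & csz C - (2 * e1 + e2) <= \<kappa> * (real k2 / a^2 - real k1 / a^2)"
proof -
 obtain z1 z2 where z: "zer z1" "zer z2" "z1 < z2" "!!j. z1 < j ==> j < z2 ==> ~ zer j"
  and wz: "w \<in> ds (S z2) - ds (S z1)" "reach m `` {w} = ds (S z2) - ds (S z1)"
  using discovered_component[OF m w(3,2)] by blast
 obtain i where i: "C = reach m `` {i}" using C by (auto simp: comps_def)
 have "sym (reach m)" "trans (reach m)" using sym_reach[OF m] by (simp_all add: reach_def trans_rtrancl)
 then have "C = reach m `` {w}" using w(1) unfolding i by (auto dest: symD transD)
 then have CD: "C = ds (S z2) - ds (S z1)" using wz by simp
 have k: "z1 <= length xs" "z2 <= length xs" using z by (auto simp: zer_def)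
 obtain w' where w': "w' \<in> ds (S z2) - ds (S z1)"
  "qs (S z2) = insert w' (qs (S z1))" "w' \<notin> qs (S z1)" using gap_component[OF m z] wz by blast
 have "ds (S z2) \<subseteq> c ` E" using inv_S[of z2] by (auto simp: inv_def)
 then have wV: "w' \<in> V" using w'(1) V by auto
 have "(\<Sum>i\<in>C. f i) = vol f z2 - vol f z1 + f w'"
  unfolding CD using w' z k by (intro vol_gap) auto
 then have "(\<Sum>i\<in>C. f i) <= \<kappa> * (real z2 - real z1) + (2 * e1 + e2) * a^2"
  using vol[OF k(1)] vol[OF k(2)] f_le[OF wV] by (simp add: algebra_simps abs_le_iff)
 then have "csz C <= (\<kappa> * (real z2 - real z1) + (2 * e1 + e2) * a^2) / a^2"
  unfolding csz_def by (intro divide_right_mono) auto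
 also have "... = \<kappa> * (real z2 / a^2 - real z1 / a^2) + (2 * e1 + e2)" using a by (simp add: field_simps)
 finally show ?thesis using CD z by (intro exI[of _ z1] exI[of _ z2]) (auto simp: gap_def)
qed

lemma gap_sets_disjoint:
 assumes "gap k1 k2" "gap l1 l2" "(k1, k2) ~= (l1, l2)"
 shows "(ds (S k2) - ds (S k1)) \<inter> (ds (S l2) - ds (S l1)) = {}"
proof -
 have *: "(ds (S k2) - ds (S k1)) \<inter> (ds (S l2) - ds (S l1)) = {}" if "gap k1 k2" "gap l1 l2" "k2 <= l1" for k1 k2 l1 l2
  using that S_mono[of k2 l1] by (auto simp: gap_def zer_def)
 have "k2 <= l1 \<or> l2 <= k1"
 proof (rule ccontr)
  assume n: "~ ?thesis"
  have "~ k1 < l1" "~ l1 < k1" "~ k2 < l2" "~ l2 < k2" using assms n by (auto simp: gap_def not_le)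
  then show False using assms(3) by simp
 qed
 then show ?thesis using *[OF assms(1,2)] *[OF assms(2,1)] by auto
qed

lemma comps_fin: "finite comps" using V by (simp add: comps_def)

lemma glen_le: assumes "e \<in> gaps Z" shows "glen e <= T"
proof -
 have "fst e \<in> {0..T}" "snd e \<in> {0..T}" using assms Z_sub by (auto simp: gaps_def)
 then show ?thesis by (simp add: glen_def)
qed

lemma csz_bound: "EX b. ALL C:comps. csz C <= b"
 using comps_fin by (intro exI[of _ "Max (insert 0 (csz ` comps))"]) auto

text \<open>Gaps short enough to be hidden by the volume error may contain no component, hence the
  cut at \<open>2 * e1\<close>.\<close>

lemma gaps_le_comps: "\<kappa> * rk (gaps Z) glen j <= rk comps csz j + (2 * e1 + e2)"
proof -
 obtain b where b: "!!C. C \<in> comps ==> csz C <= b" using csz_bound by auto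
 define h where "h e = ds (S (nfl (snd e * a^2))) - ds (S (nfl (fst e * a^2)))" for e
 have h: "h (real k1 / a^2, real k2 / a^2) = ds (S k2) - ds (S k1)" for k1 k2 using a by (simp add: h_def)
 have big: "\<kappa> * (real k2 - real k1) > 2 * e1 * a^2" if "\<kappa> * glen (real k1 / a^2, real k2 / a^2) > 2 * e1" for k1 k2
  using that a by (simp add: glen_def diff_divide_distrib[symmetric] pos_less_divide_eq)
 have "rk (gaps Z) (%e. \<kappa> * glen e) j <= max (2 * e1) (rk comps csz j + (2 * e1 + e2))"
 proof (rule rk_le_comp[where h = h])
  show "inj_on h {e \<in> gaps Z. 2 * e1 < \<kappa> * glen e}"
  proof (rule inj_onI)
   fix x y assume x: "x \<in> {e \<in> gaps Z. 2 * e1 < \<kappa> * glen e}" and y: "y \<in> {e \<in> gaps Z. 2 * e1 < \<kappa> * glen e}" and eq: "h x = h y"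
   obtain k1 k2 where k: "gap k1 k2" "x = (real k1 / a^2, real k2 / a^2)" using x gaps_iff by auto
   obtain l1 l2 where l: "gap l1 l2" "y = (real l1 / a^2, real l2 / a^2)" using y gaps_iff by auto
   have "ds (S k2) - ds (S k1) ~= {}" using gap_comp(3)[OF k(1) big] x k(2) by auto
   then have "(k1, k2) = (l1, l2)" using gap_sets_disjoint[OF k(1) l(1)] eq unfolding k l h by auto
   then show "x = y" using k l by simp
  qed
  fix e assume e: "e \<in> gaps Z" "2 * e1 < \<kappa> * glen e"
  then obtain k1 k2 where k: "gap k1 k2" "e = (real k1 / a^2, real k2 / a^2)" using gaps_iff by auto
  show "h e \<in> comps & \<kappa> * glen e - (2 * e1 + e2) <= csz (h e)"
   using gap_comp(1,2)[OF k(1) big] e(2) unfolding k h glen_def by auto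
 qed (use b e0 in auto)
 moreover have "rk (gaps Z) (%e. \<kappa> * glen e) j = \<kappa> * rk (gaps Z) glen j" by (rule rk_scale[OF \<kappa> glen_le])
 moreover have "rk comps csz j >= 0" by (rule rk_nonneg[OF b])
 ultimately show ?thesis using e0 by linarith
qed

definition large :: "real => 'i set set" where "large x = {C \<in> comps. csz C > x}"

definition found :: "'i set => bool" where "found C \<longleftrightarrow> (EX z. zer z & C \<inter> ds (S z) ~= {})"

lemma comps_le_gaps:
 assumes x: "x >= 0" and all: "!!C. C \<in> large x ==> found C"
 shows "rk comps csz j <= max x (\<kappa> * rk (gaps Z) glen j + (2 * e1 + e2))"
proof -
 have ex: "EX p. gap (fst p) (snd p) & C = ds (S (snd p)) - ds (S (fst p)) & csz C - (2 * e1 + e2) <= \<kappa> * (real (snd p) / a^2 - real (fst p) / a^2)"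
  if "C \<in> large x" for C
  using all[OF that] that comp_gap[of C] unfolding found_def large_def by force
 define g where "g C = (SOME p. gap (fst p) (snd p) & C = ds (S (snd p)) - ds (S (fst p)) & csz C - (2 * e1 + e2) <= \<kappa> * (real (snd p) / a^2 - real (fst p) / a^2))" for C
 have g: "gap (fst (g C)) (snd (g C)) & C = ds (S (snd (g C))) - ds (S (fst (g C))) & csz C - (2 * e1 + e2) <= \<kappa> * (real (snd (g C)) / a^2 - real (fst (g C)) / a^2)"
  if "C \<in> large x" for C
  unfolding g_def using ex[OF that] by (rule someI_ex)
 define h where "h C = (real (fst (g C)) / a^2, real (snd (g C)) / a^2)" for C
 have "rk comps csz j <= max x (rk (gaps Z) (%e. \<kappa> * glen e) j + (2 * e1 + e2))"
 proof (rule rk_le_comp[where h = h])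
  show "inj_on h {e \<in> comps. x < csz e}"
  proof (rule inj_onI)
   fix C C' assume C: "C \<in> {e \<in> comps. x < csz e}" "C' \<in> {e \<in> comps. x < csz e}" "h C = h C'"
   then have "g C = g C'" using a by (auto simp: h_def prod_eq_iff)
   then show "C = C'" using g[of C] g[of C'] C(1,2) unfolding large_def by (metis (mono_tags, lifting))
  qed
  fix C assume "C \<in> comps" "csz C > x"
  then have "C \<in> large x" by (simp add: large_def)
  from g[OF this] show "h C \<in> gaps Z & csz C - (2 * e1 + e2) <= \<kappa> * glen (h C)"
   unfolding gaps_iff h_def glen_def by auto
 next
  fix e assume "e \<in> gaps Z"
  then show "\<kappa> * glen e <= \<kappa> * T" using glen_le \<kappa> by (intro mult_left_mono) auto
 qed (use x e0 in auto)
 moreover have "rk (gaps Z) (%e. \<kappa> * glen e) j = \<kappa> * rk (gaps Z) glen j" by (rule rk_scale[OF \<kappa> glen_le])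
 ultimately show ?thesis by simp
qed

text \<open>Different components occupy different, hence non-overlapping, gaps in
  \<open>[0, T]\<close>, each of length at least \<open>x / (2 * \<kappa>)\<close>.\<close>

lemma few_large_found:
 assumes F: "F \<subseteq> large x" "!!C. C \<in> F ==> found C" and x: "2 * e1 + e2 <= x / 2" "x > 0"
 shows "real (card F) <= 2 * \<kappa> * T / x"
proof -
 have ex: "EX p. gap (fst p) (snd p) & C = ds (S (snd p)) - ds (S (fst p)) & csz C - (2 * e1 + e2) <= \<kappa> * (real (snd p) / a^2 - real (fst p) / a^2)"
  if "C \<in> F" for C
  using F(2)[OF that] F(1) that comp_gap[of C] unfolding found_def large_def by force
 then obtain g where g: "!!C. C \<in> F ==> gap (fst (g C)) (snd (g C)) & C = ds (S (snd (g C))) - ds (S (fst (g C))) & csz C - (2 * e1 + e2) <= \<kappa> * (real (snd (g C)) / a^2 - real (fst (g C)) / a^2)"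
  by metis
 define h where "h C = (real (fst (g C)) / a^2, real (snd (g C)) / a^2)" for C
 have fin: "finite F" using F(1) comps_fin by (auto simp: large_def intro: finite_subset)
 have inj: "inj_on h F"
 proof (rule inj_onI)
  fix C C' assume C: "C \<in> F" "C' \<in> F" "h C = h C'"
  then have "g C = g C'" using a by (auto simp: h_def prod_eq_iff)
  then show "C = C'" using g[OF C(1)] g[OF C(2)] by metis
 qed
 have "real (card (h ` F)) * (x / (2 * \<kappa>)) <= T"
 proof (rule disjoint_gaps_card[OF _ Z_sub])
  show "h ` F \<subseteq> gaps Z"
  proof
   fix e assume "e \<in> h ` F"
   then obtain C where "C \<in> F" "e = h C" by auto
   then show "e \<in> gaps Z" using g[of C] unfolding gaps_iff h_def by auto
  qed
  fix e assume "e \<in> h ` F"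
  then obtain C where C: "C \<in> F" "e = h C" by auto
  then have "x < csz C" using F(1) by (auto simp: large_def)
  moreover have "csz C - (2 * e1 + e2) <= \<kappa> * glen e" using g[OF C(1)] unfolding C(2) h_def glen_def by auto
  ultimately have "x / 2 <= \<kappa> * glen e" using x by linarith
  then show "x / (2 * \<kappa>) <= glen e" using \<kappa> by (simp add: field_simps)
 qed (use fin T in auto)
 then show ?thesis using x \<kappa> by (simp add: card_image[OF inj] field_simps)
qed

text \<open>If \<open>u\<close> were not found by the last zero, all starts up to then would come
  from \<open>us\<close>, and at most one more follows. The walk is at least minus the total degree
  of the starts, so it could not be as low as \<open>low\<close> says.\<close>

lemma starts_exhausted:
 assumes ws: "ws = us @ vs" and low: "walk xs < - (\<Sum>i\<leftarrow>us. dg i) - real D" and u: "u \<in> set us" "u \<in> c ` E"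
 shows "EX z. zer z & u \<in> ds (S z)"
proof (rule ccontr)
 assume n: "~ ?thesis"
 define z where "z = Max {k. zer k}"
 have fin: "finite {k. zer k}" by (rule finite_subset[of _ "{..length xs}"]) (auto simp: zer_def)
 have z: "zer z" using Max_in[OF fin] zer0 by (auto simp: z_def)
 have last: "~ zer j" if "z < j" for j using Max_ge[OF fin, of j] that by (auto simp: z_def)
 have zl: "z <= length xs" using z by (simp add: zer_def)
 have "u \<notin> ds (S z)" using n z by auto
 then have "qs (adv (S z)) \<subseteq> set us" by (rule starts_in_prefix[OF ws u zl])
 then have "qs (S z) \<subseteq> set us" using adv_mono(2)[of "S z"] by auto
 then have "qd (S z) <= (\<Sum>i\<in>set us. deg i)" unfolding qd_def by (intro sum_mono2) auto
 also have "... <= (\<Sum>i\<leftarrow>us. deg i)" by (induction us) (auto simp: insert_absorb sum.insert_if)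
 finally have 1: "qd (S z) <= (\<Sum>i\<leftarrow>us. deg i)" .
 have "qd (S (length xs)) <= qd (S z) + D"
  by (rule qd_after_zero[OF zl order_refl _ D]) (use last in "auto simp: zer_def")
 then have "real (qd (st xs)) <= real (\<Sum>i\<leftarrow>us. deg i) + real D" using 1 by simp
 moreover have "real (\<Sum>i\<leftarrow>us. deg i) = (\<Sum>i\<leftarrow>us. dg i)" by (induction us) auto
 moreover have "walk xs >= - real (qd (st xs))" by (simp add: walk_def)
 ultimately show False using low by linarith
qed

lemma large_found:
 assumes ws: "ws = us @ vs" and low: "walk xs < - (\<Sum>i\<leftarrow>us. dg i) - real D"
  and C: "C \<in> large x" "C \<inter> set us ~= {}" and x: "e2 <= x"
 shows "found C"
proof -
 obtain u where u: "u \<in> C" "u \<in> set us" using C by auto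
 have Cc: "C \<in> comps" and Cx: "csz C > x" using C by (auto simp: large_def)
 obtain i where i: "C = reach m `` {i}" "i \<in> V" using Cc by (auto simp: comps_def)
 \<comment> \<open>Without half-edges at \<open>u\<close> the component would be a single community,
   of size at most \<open>e2 \<le> x\<close>.\<close>
 have "u \<in> c ` E"
 proof (rule ccontr)
  assume n: "u \<notin> c ` E"
  have "(u, i) \<in> reach m" using u(1) sym_reach[OF m] i by (auto dest: symD)
  then have "i = u" using reach_outside[OF n, of m] by auto
  then have "C = {u}" using reach_outside[OF n, of m] i by simp
  then have "csz C <= e2" using f_le[OF i(2)] \<open>i = u\<close> a by (simp add: csz_def pos_divide_le_eq)
  then show False using Cx x by linarith
 qed
 then show ?thesis unfolding found_def using starts_exhausted[OF ws low u(2)] u(1) by auto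
qed

text \<open>Zeros are exact running minima of the walk. Until the next zero the walk falls below the
  last one by at most the degree of one start, which gives the tolerance
  \<open>D / a\<close>.\<close>

lemma walk_edec: "edec T (real D / a) (%t. walk (take (nfl (t * a^2)) xs) / a) Z"
 unfolding edec_def
proof (intro conjI ballI impI)
 show "finite Z" "Z \<subseteq> {0..T}" "0 \<in> Z" by (rule Z_fin Z_sub Z0)+
 fix z assume "z \<in> Z"
 then obtain k where k: "zer k" "z = real k / a^2" by (auto simp: Z_def)
 have zk: "nfl (z * a^2) = k" using a by (simp add: k)
 { fix t assume "t \<in> {0..z}"
  then have "nfl (t * a^2) <= k" unfolding zk[symmetric] using a by (intro nat_mono floor_mono mult_right_mono) auto
  then have "walk (take k xs) <= walk (take (nfl (t * a^2)) xs)" by (rule walk_zero_le[OF k(1)])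
  then have "walk (take k xs) / a <= walk (take (nfl (t * a^2)) xs) / a" using a by (intro divide_right_mono) auto
  moreover have "real D / a >= 0" using a by simp
  ultimately show "walk (take (nfl (z * a^2)) xs) / a <= walk (take (nfl (t * a^2)) xs) / a + real D / a" unfolding zk by linarith }
 fix t assume t: "t \<in> {0..T}" and zt: "z <= t & (ALL z':Z. z' <= t --> z' <= z)"
 let ?l = "nfl (t * a^2)"
 have kl: "k <= ?l" unfolding zk[symmetric] using a zt by (intro nat_mono floor_mono mult_right_mono) auto
 have ll: "?l <= length xs" unfolding len using a t by (intro nat_mono floor_mono mult_right_mono) auto
 have nz: "~ zer j" if "k < j" "j <= ?l" for j
 proof
  assume "zer j"
  then have "real j / a^2 \<in> Z" by (auto simp: Z_def)
  moreover have "real j <= t * a^2" using that(2) t a by (simp add: le_nat_iff le_floor_iff)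
  then have "real j / a^2 <= t" using a by (simp add: pos_divide_le_eq)
  ultimately have "real j / a^2 <= real k / a^2" using zt k by auto
  then show False using that(1) a by (simp add: divide_le_cancel)
 qed
 have "walk (take ?l xs) >= walk (take k xs) - real D" by (rule walk_after_zero[OF k(1) kl ll nz D])
 then have "(walk (take k xs) - real D) / a <= walk (take ?l xs) / a" using a by (intro divide_right_mono) auto
 then show "walk (take ?l xs) / a >= walk (take (nfl (z * a^2)) xs) / a - real D / a" unfolding zk by (simp add: diff_divide_distrib)
qed

end

section \<open>The product metric and the penalised infimum\<close>

lemma dist_fun_le:
 fixes y z :: "nat => real"
 assumes "!!j. \<bar>y j - z j\<bar> <= e"
 shows "dist y z <= 2 * e"
proof (rule LIMSEQ_le_const)
 show "(%N. 2 * e + (1/2) ^ N) \<longlonglongrightarrow> 2 * e" by (rule tendsto_eq_intros LIMSEQ_power_zero refl)+ auto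
 have "dist y z <= 2 * e + (1/2) ^ N" for N
 proof -
  have "dist y z <= 2 * Max {dist (y (from_nat n)) (z (from_nat n))|n. n <= N} + (1/2)^N" by (rule dist_fun_le_dist_first_terms)
  moreover have "Max {dist (y (from_nat n)) (z (from_nat n))|n. n <= N} <= e"
  proof (rule Max.boundedI)
   show "finite {dist (y (from_nat n)) (z (from_nat n))|n. n <= N}" by simp
  qed (use assms in "auto simp: dist_real_def")
  ultimately show ?thesis by linarith
 qed
 then show "EX N. ALL n>=N. dist y z <= 2 * e + (1/2) ^ n" by blast
qed

lemma dist_fun_finite_coordinates:
 assumes "\<eta> > 0"
 obtains J e where "e > 0" "!!y z :: nat => real. (!!j. j <= (J::nat) ==> \<bar>y j - z j\<bar> <= e) ==> dist y z <= \<eta>"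
proof -
 obtain N where N: "(1/2::real) ^ N < \<eta> / 2" using assms real_arch_pow_inv[of "\<eta>/2" "1/2"] by auto
 define J :: nat where "J = Max (from_nat ` {..N})"
 have "dist y z <= \<eta>" if "!!j. j <= J ==> \<bar>y j - z j\<bar> <= \<eta> / 4" for y z :: "nat => real"
 proof -
  have "dist y z <= 2 * Max {dist (y (from_nat n)) (z (from_nat n))|n. n <= N} + (1/2)^N" by (rule dist_fun_le_dist_first_terms)
  moreover have "Max {dist (y (from_nat n)) (z (from_nat n))|n. n <= N} <= \<eta> / 4"
  proof (rule Max.boundedI)
   show "finite {dist (y (from_nat n)) (z (from_nat n))|n. n <= N}" by simp
   fix x assume "x \<in> {dist (y (from_nat n)) (z (from_nat n))|n. n <= N}"
   then obtain n where n: "n <= N" "x = dist (y (from_nat n)) (z (from_nat n))" by auto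
   have "(from_nat n :: nat) <= J" unfolding J_def using n(1) by (intro Max_ge) auto
   then show "x <= \<eta> / 4" using that n(2) by (simp add: dist_real_def)
  qed auto
  ultimately show ?thesis using N by linarith
 qed
 then show ?thesis using that[of "\<eta>/4" J] assms by auto
qed

text \<open>The penalty \<open>k * \<epsilon>\<close> makes this Lipschitz in the path, although the excursion lengths are not continuous.\<close>
definition infconv :: "real => real => (real => real) => real => ((nat => real) => real) => real => (real => real) => real" where
 "infconv T \<kappa> h C \<phi> k g = Inf (insert C {\<phi> (%j. \<kappa> * rk (gaps Z) glen j) + k * \<epsilon> |\<epsilon> Z. edec T \<epsilon> (%t. g t + h t) Z})"

lemma edec_nonneg:
 assumes "edec T \<epsilon> f Z"
 shows "\<epsilon> >= 0"
proof -
 have "0 \<in> Z" and le: "!!z t. z \<in> Z ==> t \<in> {0..z} ==> f z <= f t + \<epsilon>" using assms unfolding edec_def by blast+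
 then have "f 0 <= f 0 + \<epsilon>" by (intro le) auto
 then show ?thesis by simp
qed

context
 fixes T \<kappa> C k :: real and h :: "real => real" and \<phi> :: "(nat => real) => real"
 assumes C: "!!y. \<bar>\<phi> y\<bar> <= C" and k: "k >= 0"
begin

lemma C0: "C >= 0" using C[of undefined] by linarith

lemma infconv_elem: "v \<in> insert C {\<phi> (%j. \<kappa> * rk (gaps Z) glen j) + k * \<epsilon> |\<epsilon> Z. edec T \<epsilon> (%t. g t + h t) Z} ==> - C <= v"
proof -
 have "- C <= \<phi> y + k * \<epsilon>" if "\<epsilon> >= 0" for y \<epsilon> using C[of y] mult_nonneg_nonneg[OF k that] by linarith
 then show "v \<in> insert C {\<phi> (%j. \<kappa> * rk (gaps Z) glen j) + k * \<epsilon> |\<epsilon> Z. edec T \<epsilon> (%t. g t + h t) Z} ==> - C <= v"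
  using C0 edec_nonneg by fastforce
qed

lemma infconv_bdd: "bdd_below (insert C {\<phi> (%j. \<kappa> * rk (gaps Z) glen j) + k * \<epsilon> |\<epsilon> Z. edec T \<epsilon> (%t. g t + h t) Z})"
 using infconv_elem by (rule bdd_belowI)

text \<open>\<open>C\<close> belongs to the set in \<open>infconv\<close> so that the set is never
  empty and the infimum never exceeds the bound of the test function.\<close>

lemma infconv_bounds: "- C <= infconv T \<kappa> h C \<phi> k g" "infconv T \<kappa> h C \<phi> k g <= C"
 unfolding infconv_def by (rule cInf_greatest, simp, rule infconv_elem, assumption) (rule cInf_lower[OF _ infconv_bdd], simp)

lemma infconv_abs: "\<bar>infconv T \<kappa> h C \<phi> k g\<bar> <= C" using infconv_bounds[of g] by linarith

lemma infconv_le: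
 assumes "edec T \<epsilon> (%t. g t + h t) Z"
 shows "infconv T \<kappa> h C \<phi> k g <= \<phi> (%j. \<kappa> * rk (gaps Z) glen j) + k * \<epsilon>"
 unfolding infconv_def by (rule cInf_lower[OF _ infconv_bdd]) (use assms in blast)

text \<open>A set admissible for \<open>g\<close> with tolerance \<open>\<epsilon>\<close> is
  admissible for \<open>g'\<close> with tolerance \<open>\<epsilon> + 2 * \<delta>\<close>, which
  raises the penalty by \<open>2 * k * \<delta>\<close>.\<close>

lemma infconv_Lipschitz_le:
 assumes "\<delta> >= 0" "!!t. t \<in> {0..T} ==> \<bar>g t - g' t\<bar> <= \<delta>"
 shows "infconv T \<kappa> h C \<phi> k g' - 2 * k * \<delta> <= infconv T \<kappa> h C \<phi> k g"
 unfolding infconv_def[of T \<kappa> h C \<phi> k g]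
proof (rule cInf_greatest)
 fix v assume "v \<in> insert C {\<phi> (%j. \<kappa> * rk (gaps Z) glen j) + k * \<epsilon> |\<epsilon> Z. edec T \<epsilon> (%t. g t + h t) Z}"
 then consider "v = C" | \<epsilon> Z where "v = \<phi> (%j. \<kappa> * rk (gaps Z) glen j) + k * \<epsilon>" "edec T \<epsilon> (%t. g t + h t) Z" by auto
 then show "infconv T \<kappa> h C \<phi> k g' - 2 * k * \<delta> <= v"
 proof cases
  case 1
  then show ?thesis using infconv_bounds(2)[of g'] mult_nonneg_nonneg[OF k assms(1)] by linarith
 next
  case 2
  have "edec T (\<epsilon> + 2 * \<delta>) (%t. g' t + h t) Z" by (rule edec_shift[OF 2(2)]) (use assms(2) in force)
  from infconv_le[OF this] show ?thesis using 2(1) by (simp add: algebra_simps)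
 qed
qed simp

lemma infconv_Lipschitz:
 assumes "\<delta> >= 0" "!!t. t \<in> {0..T} ==> \<bar>g t - g' t\<bar> <= \<delta>"
 shows "\<bar>infconv T \<kappa> h C \<phi> k g - infconv T \<kappa> h C \<phi> k g'\<bar> <= 2 * k * \<delta>"
proof -
 have "\<bar>g' t - g t\<bar> <= \<delta>" if "t \<in> {0..T}" for t using assms(2)[OF that] by (simp add: abs_minus_commute)
 then show ?thesis using infconv_Lipschitz_le[of \<delta> g g', OF assms] infconv_Lipschitz_le[OF assms(1), of g' g] by (simp add: abs_le_iff)
qed

end

lemma infconv_mono:
 assumes C: "!!y. \<bar>\<phi> y\<bar> <= C" and k: "0 <= k" "k <= k'"
 shows "infconv T \<kappa> h C \<phi> k g <= infconv T \<kappa> h C \<phi> k' g"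
 unfolding infconv_def[of T \<kappa> h C \<phi> k' g]
proof (rule cInf_greatest)
 fix v assume "v \<in> insert C {\<phi> (%j. \<kappa> * rk (gaps Z) glen j) + k' * \<epsilon> |\<epsilon> Z. edec T \<epsilon> (%t. g t + h t) Z}"
 then consider "v = C" | \<epsilon> Z where "v = \<phi> (%j. \<kappa> * rk (gaps Z) glen j) + k' * \<epsilon>" "edec T \<epsilon> (%t. g t + h t) Z" by auto
 then show "infconv T \<kappa> h C \<phi> k g <= v"
 proof cases
  case 1
  then show ?thesis using infconv_bounds(2)[of \<phi> C k, OF C k(1)] by simp
 next
  case 2
  have "k * \<epsilon> <= k' * \<epsilon>" using edec_nonneg[OF 2(2)] k by (intro mult_right_mono) auto
  then show ?thesis using infconv_le[where \<kappa> = \<kappa> and \<phi> = \<phi>, OF C k(1) 2(2)] 2(1) by linarith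
 qed
qed simp

text \<open>In the product metric finitely many ranks suffice. Up to a tolerance
  \<open>\<epsilon>0\<close> the gap lengths of these ranks are close to the excursion lengths;
  beyond it a penalty with \<open>k \<ge> 2 * C / \<epsilon>0\<close> outweighs the whole range of
  the test function.\<close>

lemma infconv_limit:
 fixes \<phi> :: "(nat => real) => real"
 assumes C: "!!y. \<bar>\<phi> y\<bar> <= C" and Lip: "!!y z. \<bar>\<phi> y - \<phi> z\<bar> <= \<Lambda> * dist y z" and "\<Lambda> >= 0" and \<kappa>: "\<kappa> > 0"
  and f: "continuous_on {0..} (%t. g t + h t)" and dm: "distinct_minima (%t. g t + h t)" and T: "T \<in> \<rat>" and \<eta>: "\<eta> > 0"
 shows "EX k0>=0. ALL k>=k0. infconv T \<kappa> h C \<phi> k g >= \<phi> (%j. \<kappa> * rk (excT T (%t. g t + h t)) glen j) - \<eta>"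
proof -
 let ?f = "%t. g t + h t" let ?y = "%j. \<kappa> * rk (excT T (%t. g t + h t)) glen j"
 have "\<eta> / (\<Lambda> + 1) > 0" using \<eta> \<open>\<Lambda> >= 0\<close> by simp
 then obtain J :: nat and e where e: "e > 0" and J: "!!y z :: nat => real. (!!j. j <= J ==> \<bar>y j - z j\<bar> <= e) ==> dist y z <= \<eta> / (\<Lambda> + 1)"
  by (rule dist_fun_finite_coordinates) blast
 have ek: "e / \<kappa> > 0" using e \<kappa> by simp
 have "\<exists>\<epsilon>>0. ALL Z. edec T \<epsilon> ?f Z --> \<bar>rk (gaps Z) glen j - rk (excT T ?f) glen j\<bar> <= e / \<kappa>" for j
  using gap_lengths_close[OF f dm T ek, of j] by metis
 then obtain E where E: "!!j. E j > 0" "!!j Z. edec T (E j) ?f Z ==> \<bar>rk (gaps Z) glen j - rk (excT T ?f) glen j\<bar> <= e / \<kappa>" by metis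
 define \<epsilon>0 where "\<epsilon>0 = Min (E ` {..J})"
 have \<epsilon>0: "\<epsilon>0 > 0" unfolding \<epsilon>0_def using E(1) by (subst Min_gr_iff) auto
 have C0: "C >= 0" using C[of undefined] by linarith
 have close: "\<phi> (%j. \<kappa> * rk (gaps Z) glen j) >= \<phi> ?y - \<eta>" if Z: "edec T \<epsilon> ?f Z" "\<epsilon> <= \<epsilon>0" for \<epsilon> Z
 proof -
  have "\<bar>\<kappa> * rk (gaps Z) glen j - ?y j\<bar> <= e" if "j <= J" for j
  proof -
   have "\<epsilon>0 <= E j" unfolding \<epsilon>0_def using that by (intro Min_le) auto
   then have "edec T (E j) ?f Z" using edec_mono[OF Z(1)] Z(2) by simp
   from E(2)[OF this] have "\<kappa> * \<bar>rk (gaps Z) glen j - rk (excT T ?f) glen j\<bar> <= \<kappa> * (e / \<kappa>)" using \<kappa> by (intro mult_left_mono) auto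
   then show ?thesis using \<kappa> by (simp add: right_diff_distrib[symmetric] abs_mult)
  qed
  then have "dist (%j. \<kappa> * rk (gaps Z) glen j) ?y <= \<eta> / (\<Lambda> + 1)" by (rule J)
  then have "\<Lambda> * dist (%j. \<kappa> * rk (gaps Z) glen j) ?y <= \<Lambda> * (\<eta> / (\<Lambda> + 1))" using \<open>\<Lambda> >= 0\<close> by (intro mult_left_mono)
  also have "... <= \<eta>" using \<open>\<Lambda> >= 0\<close> \<eta> by (simp add: field_simps)
  finally show ?thesis using Lip[of "%j. \<kappa> * rk (gaps Z) glen j" ?y] by linarith
 qed
 have "infconv T \<kappa> h C \<phi> k g >= \<phi> ?y - \<eta>" if k: "k >= 2 * C / \<epsilon>0" for k
 proof -
  have k0: "k >= 0" using k C0 \<epsilon>0 by (smt (verit) divide_nonneg_pos)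
  have "\<phi> ?y - \<eta> <= v" if v: "v \<in> insert C {\<phi> (%j. \<kappa> * rk (gaps Z) glen j) + k * \<epsilon> |\<epsilon> Z. edec T \<epsilon> ?f Z}" for v
  proof -
   consider "v = C" | \<epsilon> Z where "v = \<phi> (%j. \<kappa> * rk (gaps Z) glen j) + k * \<epsilon>" "edec T \<epsilon> ?f Z" using v by auto
   then show ?thesis
   proof cases
    case 1
    then show ?thesis using C[of ?y] \<eta> by linarith
   next
    case 2
    note e0 = edec_nonneg[OF 2(2)]
    show ?thesis
    proof (cases "\<epsilon> <= \<epsilon>0")
     case True
     then show ?thesis using close[OF 2(2)] 2(1) mult_nonneg_nonneg[OF k0 e0] by linarith
    next
     case False
     have "2 * C = 2 * C / \<epsilon>0 * \<epsilon>0" using \<epsilon>0 by simp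
     also have "... <= k * \<epsilon>" using k False \<epsilon>0 k0 by (intro mult_mono) auto
     finally show ?thesis using 2(1) C[of ?y] C[of "%j. \<kappa> * rk (gaps Z) glen j"] \<eta> by linarith
    qed
   qed
  qed
  then show ?thesis unfolding infconv_def by (intro cInf_greatest) auto
 qed
 moreover have "2 * C / \<epsilon>0 >= 0" using C0 \<epsilon>0 by simp
 ultimately show ?thesis by blast
qed

lemma rk_excT_tendsto:
 assumes b: "!!e. e \<in> excursions (reflected f) ==> glen e <= b"
 shows "(%T. rk (excT (real T) f) glen j) \<longlonglongrightarrow> rk (excursions (reflected f)) glen j"
proof (rule LIMSEQ_I)
 fix r :: real assume r: "r > 0"
 let ?R = "rk (excursions (reflected f)) glen j"
 have sub: "excT T f \<subseteq> excursions (reflected f)" for T by (auto simp: excT_def)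
 have up: "rk (excT T f) glen j <= ?R" for T by (rule rk_mono[OF sub b])
 have R0: "?R >= 0" by (rule rk_nonneg[OF b])
 have "EX N. ALL T>=N. rk (excT (real T) f) glen j > ?R - r"
 proof (cases "?R - r < 0")
  case True
  then show ?thesis using excT_rk_nonneg by (smt (verit))
 next
  case False
  then obtain F where F: "F \<subseteq> excursions (reflected f)" "finite F" "card F = Suc j" "!!e. e \<in> F ==> glen e > ?R - r"
   using rk_gtD[of "?R - r"] r by (metis diff_less_eq less_add_same_cancel1 not_less)
  obtain N :: nat where N: "Max (snd ` F) <= real N" using real_arch_simple by blast
  have "rk (excT (real T) f) glen j > ?R - r" if "T >= N" for T
  proof (rule rk_gtI[OF _ F(2,3,4) _ excT_glen])
   show "F \<subseteq> excT (real T) f"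
   proof
    fix e assume e: "e \<in> F"
    then have "snd e <= Max (snd ` F)" using F(2) by (intro Max_ge) auto
    then show "e \<in> excT (real T) f" using e F(1) N that by (auto simp: excT_def)
   qed
  qed (use False in auto)
  then show ?thesis by blast
 qed
 then obtain N where "!!T. T >= N ==> rk (excT (real T) f) glen j > ?R - r" by blast
 then have "norm (rk (excT (real T) f) glen j - ?R) < r" if "T >= N" for T
  using that up[of "real T"] r by (smt (verit, best) real_norm_def)
 then show "EX no. ALL n>=no. norm (rk (excT (real n) f) glen j - ?R) < r" by blast
qed

section \<open>The lower bound for a finite graph\<close>

lemma avoid_prob:
 assumes fin: "finite (set_pmf q)" and p: "measure_pmf.prob q C >= p"
 shows "expect (replicate_pmf J q) (%us. of_bool (C \<inter> set us = {})) <= (1 - p) ^ J"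
proof -
 interpret iid q by unfold_locales (rule fin)
 have mean: "expect q (%e. of_bool (e \<notin> C)) = 1 - measure_pmf.prob q C"
 proof -
  have "expect q (%e. of_bool (e \<notin> C)) = expect q (%e. 1 - indicator C e :: real)"
   by (intro Bochner_Integration.integral_cong) (auto simp: indicator_def)
  then show ?thesis by (simp add: measure_pmf.emeasure_eq_measure)
 qed
 have le: "0 <= 1 - measure_pmf.prob q C" "1 - measure_pmf.prob q C <= 1 - p" using p by auto
 show ?thesis
 proof (induction J)
  case (Suc J)
  have "Ex (Suc J) (%us. of_bool (C \<inter> set us = {}) :: real) = Ex J (%us. expect q (%e. of_bool (C \<inter> set us = {}) * of_bool (e \<notin> C)))"
   unfolding Ex_snoc by (intro Bochner_Integration.integral_cong refl) auto
  also have "... = Ex J (%us. of_bool (C \<inter> set us = {})) * (1 - measure_pmf.prob q C)"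
   by (simp only: Ex_q_mult mean) simp
  also have "... <= (1 - p) ^ J * (1 - p)" using Suc le by (intro mult_mono) (auto intro: Ex_nonneg zero_le_power order_trans[OF le])
  finally show ?case by (simp only: power_Suc2)
 qed simp
qed

text \<open>The entries of \<open>us\<close> are independent of the pairing. For a fixed pairing the
  union bound over at most \<open>M0\<close> sets applies, and averaging over pairings preserves
  it.\<close>

lemma miss_prob:
 fixes sel :: "'m => 'i set set"
 assumes fin: "finite (set_pmf q)" and finR: "finite (set_pmf R)"
  and sel: "!!m. m \<in> set_pmf R ==> finite (sel m) & card (sel m) <= M0 & (ALL C:sel m. measure_pmf.prob q C >= p)" and p: "p <= 1"
 shows "expect (replicate_pmf J q) (%us. expect R (%m. of_bool (EX C:sel m. C \<inter> set us = {}))) <= real M0 * (1 - p) ^ J"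
proof -
 interpret iid q by unfold_locales (rule fin)
 have "Ex J (%us. expect R (%m. of_bool (EX C:sel m. C \<inter> set us = {}) :: real))
  = Ex J (%us. \<Sum>m\<in>set_pmf R. pmf R m * of_bool (EX C:sel m. C \<inter> set us = {}))"
  by (subst integral_measure_pmf[OF finR]) auto
 also have "... = (\<Sum>m\<in>set_pmf R. pmf R m * Ex J (%us. of_bool (EX C:sel m. C \<inter> set us = {})))"
  by (subst Bochner_Integration.integral_sum) auto
 also have "... <= (\<Sum>m\<in>set_pmf R. pmf R m * (real M0 * (1 - p) ^ J))"
 proof (intro sum_mono mult_left_mono)
  fix m assume m: "m \<in> set_pmf R"
  have "Ex J (%us. of_bool (EX C:sel m. C \<inter> set us = {}) :: real) <= Ex J (%us. \<Sum>C\<in>sel m. of_bool (C \<inter> set us = {}))"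
  proof (rule Ex_mono)
   fix us
   show "of_bool (EX C:sel m. C \<inter> set us = {}) <= (\<Sum>C\<in>sel m. of_bool (C \<inter> set us = {}) :: real)"
   proof (cases "EX C:sel m. C \<inter> set us = {}")
    case True
    then obtain C where C: "C \<in> sel m" "C \<inter> set us = {}" by auto
    have "of_bool (C \<inter> set us = {}) <= (\<Sum>C\<in>sel m. of_bool (C \<inter> set us = {}) :: real)"
     using sel[OF m] C by (intro member_le_sum) auto
    then show ?thesis using C True by simp
   qed (simp add: sum_nonneg)
  qed
  also have "... = (\<Sum>C\<in>sel m. Ex J (%us. of_bool (C \<inter> set us = {})))" by (subst Bochner_Integration.integral_sum) auto
  also have "... <= (\<Sum>C\<in>sel m. (1 - p) ^ J)" using sel[OF m] by (intro sum_mono avoid_prob[OF fin]) auto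
  also have "... = real (card (sel m)) * (1 - p) ^ J" by simp
  also have "... <= real M0 * (1 - p) ^ J" using sel[OF m] p by (intro mult_right_mono) auto
  finally show "Ex J (%us. of_bool (EX C:sel m. C \<inter> set us = {})) <= real M0 * (1 - p) ^ J" .
 qed simp
 also have "... = (\<Sum>m\<in>set_pmf R. pmf R m) * (real M0 * (1 - p) ^ J)" by (rule sum_distrib_right[symmetric])
 also have "(\<Sum>m\<in>set_pmf R. pmf R m) = 1" by (rule sum_pmf_eq_1[OF finR]) simp
 finally show ?thesis by simp
qed

abbreviation walk_drift :: "(nat => real) => nat => real => real => real => real" where
 "walk_drift d n l a t \<equiv> (real (nfl (t * a^2)) * ((\<Sum>i<n. d i ^ 2) / l - 2)
  - (\<Sum>i<n. d i * (d i * (d i - 2))) / l * (real (nfl (t * a^2)))^2 / (2 * l)) / a"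

context hcm
begin

abbreviation E where "E \<equiv> hcm_halfedges Hs n"
abbreviation f where "f i \<equiv> real (csize (Hs i))"
abbreviation el where "el \<equiv> real (total_halfedges Hs n)"
abbreviation R where "R \<equiv> hcm_pairing_pmf Hs n"
abbreviation d where "d i \<equiv> real (cdegree (Hs i))"

lemma finite_vertices: "finite (hcm_vertices Hs n)" and card_vertices: "card (hcm_vertices Hs n) = total_vertices Hs n"
proof -
 have "hcm_vertices Hs n = (SIGMA i:{..<n}. {..<csize (Hs i)})" by (auto simp: hcm_vertices_def)
 then show "finite (hcm_vertices Hs n)" "card (hcm_vertices Hs n) = total_vertices Hs n" by (simp_all add: total_vertices_def)
qed

text \<open>The community of a uniform vertex, so that a component is hit with probability
  proportional to its number of vertices.\<close>

definition q where "q = map_pmf fst (pmf_of_set (hcm_vertices Hs n))"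

context
 assumes n: "n > 0"
begin

lemma vertices_ne: "hcm_vertices Hs n ~= {}"
proof -
 have "(0, 0) \<in> hcm_vertices Hs n" using n valid[OF n] by (auto simp: hcm_vertices_def valid_community_def)
 then show ?thesis by blast
qed

lemma finite_q: "finite (set_pmf q)" using finite_vertices vertices_ne by (simp add: q_def)

lemma expectation_q: "expect q F = (\<Sum>i<n. f i * F i) / real (total_vertices Hs n)"
proof -
 have V: "hcm_vertices Hs n = (SIGMA i:{..<n}. {..<csize (Hs i)})" by (auto simp: hcm_vertices_def)
 have "expect q F = (\<Sum>x\<in>hcm_vertices Hs n. F (fst x)) / real (total_vertices Hs n)"
  using integral_pmf_of_set[OF vertices_ne finite_vertices, of "%x. F (fst x)"] by (simp add: q_def card_vertices)
 also have "(\<Sum>x\<in>hcm_vertices Hs n. F (fst x)) = (\<Sum>i<n. \<Sum>v<csize (Hs i). F i)"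
  unfolding V by (subst sum.Sigma) (auto simp: case_prod_beta)
 finally show ?thesis by simp
qed

lemma prob_q: "C \<subseteq> {..<n} ==> measure_pmf.prob q C = (\<Sum>i\<in>C. f i) / real (total_vertices Hs n)"
proof -
 assume C: "C \<subseteq> {..<n}"
 have "measure_pmf.prob q C = (\<Sum>i<n. f i * indicator C i) / real (total_vertices Hs n)"
  unfolding prob_eq_expectation by (rule expectation_q)
 also have "(\<Sum>i<n. f i * indicator C i) = (\<Sum>i\<in>C. f i)"
  using C by (intro sum.mono_neutral_cong_right) auto
 finally show ?thesis .
qed

end

lemma wsum_eq:
 assumes "exploration_walk E fst ws"
 shows "exploration_walk.wsum E fst F = (\<Sum>i<n. d i * F i)"
proof -
 interpret exploration_walk E fst ws by (rule assms)
 have "wsum F = (\<Sum>i\<in>fst ` E. d i * F i)" unfolding wsum_def using halfedges_community by (intro sum.cong refl) (auto simp: deg_eq)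
 also have "... = (\<Sum>i<n. d i * F i)"
 proof (rule sum.mono_neutral_left)
  show "ALL i:{..<n} - fst ` E. d i * F i = 0"
  proof
   fix i assume i: "i \<in> {..<n} - fst ` E"
   then have "deg i = 0" using deg_pos_iff[of i] by auto
   then show "d i * F i = 0" using deg_eq[of i] i by simp
  qed
 qed (use halfedges_community in auto)
 finally show ?thesis .
qed

end

text \<open>\<open>\<epsilon>\<close> measures the errors of the rescaled walk and volume,
  \<open>x\<close> is the size below which components may be missed, and \<open>\<rho>\<close>
  bounds the error of the normalised sizes. The conditions on \<open>\<beta>\<close> place the walk
  at time \<open>T\<close> so low that all chosen starts have been used, and \<open>M0\<close>
  exceeds the number of large components that can be found in the window.\<close>

locale hcm_estimate = hcm Hs n for Hs n +
 fixes a K \<delta> T x \<epsilon> C \<Lambda> k cc \<kappa>' \<beta> \<rho> c1 c2 c3 :: real and D M0 :: nat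
  and h :: "real => real" and \<phi> :: "(nat => real) => real"
 assumes n0: "n > 0" and even_E: "even (total_halfedges Hs n)" and E_pos: "total_halfedges Hs n > 0"
  and a1: "a >= 1" and K1: "K >= 1" and da: "1 / a <= \<delta>" and dK: "\<delta> <= 1 / (10 * K^2)"
  and ell_ge: "el >= a ^ 3 / K" and T: "1 <= T" "T <= K"
  and A3: "(\<Sum>i<n. d i ^ 3) <= K * a ^ 3" and Af: "(\<Sum>i<n. d i * f i) <= K * a ^ 3"
  and degD: "!!i. i < n ==> cdegree (Hs i) <= D" and D_le: "real D <= \<delta> * a"
  and f_le: "!!i. i < n ==> f i <= \<delta> * a^2"
  and drift: "\<bar>(\<Sum>i<n. d i ^ 2) / el - 2\<bar> <= K / a"
  and C: "!!y. \<bar>\<phi> y\<bar> <= C" and Lip: "!!y z. \<bar>\<phi> y - \<phi> z\<bar> <= \<Lambda> * dist y z" and \<Lambda>: "\<Lambda> >= 0" and k: "k >= 0"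
  and \<epsilon>: "\<epsilon> > 0" "real D <= \<epsilon> * a" and x: "x > 0" "2 * \<epsilon> + \<delta> <= x / 2" and cc: "cc >= 0" and \<kappa>': "\<kappa>' > 0"
  and hh: "!!t. t \<in> {0..T} ==> \<bar>walk_drift d n el a t - h t\<bar> <= \<epsilon>"
  and \<rho>: "cc * a^2 * (2 * x) + \<bar>cc * a^2 * ((\<Sum>i<n. d i * f i) / el) - \<kappa>'\<bar> * T <= \<rho>"
  and \<beta>: "\<beta> > 0" "2 * \<beta> + h T + 3 * \<epsilon> < 0"
  and M0: "2 * ((\<Sum>i<n. d i * f i) / el) * T / x < real M0"
  and c1: "(\<Sum>i<n. f i * d i) / real (total_vertices Hs n) <= c1" and c2: "real (total_vertices Hs n) <= c2 * a ^ 3"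
  and c3: "(\<Sum>i<n. d i ^ 3) / el <= c3"
begin

abbreviation u where "u \<equiv> pmf_of_set E"
abbreviation L where "L \<equiv> nfl (T * a^2)"
abbreviation J where "J \<equiv> nat \<lceil>T * a\<rceil>"
definition \<zeta> where "\<zeta> e = d (fst e) - (\<Sum>i<n. d i ^ 2) / el"
definition G where "G xs t = iid.ssum \<zeta> (take (nfl (t * a^2)) xs) / a" for xs :: "(nat \<times> nat \<times> nat) list"
definition \<kappa> where "\<kappa> = (\<Sum>i<n. d i * f i) / el"
abbreviation ic where "ic xs \<equiv> infconv T \<kappa>' h C \<phi> k (G xs)"
abbreviation cs where "cs m \<equiv> %j. cc * ordered_comp_sizes Hs n m j"

lemma E_ne: "E ~= {}" using E_pos card_halfedges by fastforce

lemma bounds: "exploration_bounds E fst (us @ [0..<n]) a K \<delta> D L f"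
proof -
 interpret W: exploration_walk E fst "us @ [0..<n]"
  by unfold_locales (use halfedges_community E_ne even_E card_halfedges in auto)
 note w = wsum_eq[OF W.exploration_walk_axioms]
 have ell: "W.ell = el" by (simp add: W.ell_def card_halfedges)
 have deg: "dg i = d i" if "i < n" for i using that by (simp add: deg_eq)
 have L: "real L <= K * a^2"
 proof -
  have "real L <= T * a^2" using T a1 by simp
  also have "... <= K * a^2" using T by (intro mult_right_mono) auto
  finally show ?thesis .
 qed
 show ?thesis
 proof
  show "W.wsum (%i. (dg i)^2) <= K * a ^ 3"
   using A3 unfolding w by (simp add: deg_eq power3_eq_cube power2_eq_square mult.assoc)
  show "W.wsum f <= K * a ^ 3" using Af unfolding w .
  show "\<bar>W.wsum dg / W.ell - 2\<bar> <= K / a"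
   using drift unfolding w ell by (simp add: deg_eq power2_eq_square)
  show "deg i <= D" "f i <= \<delta> * a^2" if "i \<in> fst ` E" for i using that halfedges_community degD f_le by (auto simp: deg_eq)
 qed (use a1 K1 da dK ell_ge L D_le in "auto simp: ell")
qed

lemma \<kappa>_pos: "\<kappa> > 0"
proof -
 have "el = (\<Sum>i<n. d i * 1)" by (simp add: total_halfedges_def)
 also have "... <= (\<Sum>i<n. d i * f i)"
  using valid by (intro sum_mono mult_left_mono) (auto simp: valid_community_def)
 finally show ?thesis using E_pos by (simp add: \<kappa>_def)
qed

definition big where "big m = {C \<in> community_components m. (\<Sum>i\<in>C. f i) / a^2 > x}"

context
 fixes us :: "nat list"
begin

interpretation X: exploration_bounds E fst "us @ [0..<n]" a K \<delta> D L f by (rule bounds)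

lemma Xell: "X.ell = el" by (simp add: X.ell_def card_halfedges)

lemma Xwsum: "X.wsum F = (\<Sum>i<n. d i * F i)" by (rule wsum_eq[OF X.exploration_walk_axioms])

lemma ssum_\<zeta>:
 assumes "xs \<in> lists E"
 shows "X.lin xs = X.ssum \<zeta> xs + real (length xs) * ((\<Sum>i<n. d i ^ 2) / el - 2)"
 using assms
proof (induction xs rule: rev_induct)
 case (snoc e xs)
 then have "fst e < n" using halfedges_community by auto
 then show ?case using snoc by (simp add: \<zeta>_def X.dd_def deg_eq algebra_simps add_divide_distrib)
qed simp

text \<open>On this event the walk at time \<open>T\<close> is lower than the degrees of the chosen
  starts allow, so all of these that have half-edges are discovered, and with them the components in
  \<open>sel\<close>. The rescaled zeros are then an admissible set for \<open>infconv\<close>, with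
  gaps close to the component sizes.\<close>

lemma pointwise:
 assumes xs: "xs \<in> lists E" "length xs = L" and m: "m \<in> Ext (X.pm (X.st xs))"
  and B1: "X.rmax X.walk_err xs <= \<epsilon> * a"
  and B2: "X.rmax X.vol_err xs <= \<epsilon> * a^2"
  and B3: "X.ssum \<zeta> xs < \<beta> * a" "(\<Sum>i\<leftarrow>us. d i) < \<beta> * a" and us: "set us \<subseteq> {..<n}"
  and sel: "sel \<subseteq> big m" "card sel = M0 \<or> sel = big m" "!!C. C \<in> sel ==> C \<inter> set us ~= {}"
 shows "ic xs - 5 * k * \<epsilon> - 2 * \<Lambda> * \<rho> <= \<phi> (cs m)"
proof -
 have pos: "a > 0" using a1 by simp
 have \<delta>0: "\<delta> > 0" using X.pos by simp
 interpret F: found_components E fst "us @ [0..<n]" xs m "{..<n}" f a \<kappa> \<epsilon> \<delta> T D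
 proof
  show "\<bar>exploration_run.vol E fst (us @ [0..<n]) xs f k - \<kappa> * real k\<bar> <= \<epsilon> * a^2" if "k <= length xs" for k
  proof -
   interpret Y: exploration_run E fst "us @ [0..<n]" xs by unfold_locales (use xs X.ev in auto)
   have "\<bar>X.volw f (take k xs) - X.wsum f / X.ell * real (length (take k xs))\<bar> <= \<epsilon> * a^2"
    using X.rmax_ge[OF that, of X.vol_err] B2 by linarith
   moreover have "X.wsum f / X.ell = \<kappa>" by (simp add: Xwsum Xell \<kappa>_def)
   moreover have "length (take k xs) = k" using that by simp
   ultimately show ?thesis by (simp only: Y.vol_def X.volw_def)
  qed
 qed (use xs m X.ev halfedges_community f_le pos \<kappa>_pos T \<epsilon> \<delta>0 degD in "auto simp: deg_eq")
 have mp: "m \<in> hcm_pairings Hs n" using m by (auto simp: hcm_pairings_def Ext_def)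
 have comps: "F.comps = community_components m" by (simp add: F.comps_def community_components_def)
 have large: "F.large x = big m" by (simp add: F.large_def F.csz_def big_def comps)
 let ?W = "%t. X.walk (take (nfl (t * a^2)) xs) / a"
 have close: "\<bar>?W t - (G xs t + h t)\<bar> <= 2 * \<epsilon>" if t: "t \<in> {0..T}" for t
 proof -
  define l where "l = nfl (t * a^2)"
  have l: "l <= length xs" unfolding l_def xs(2) using t by (intro nat_mono floor_mono mult_right_mono) auto
  have tk: "take l xs \<in> lists E" "length (take l xs) = l" using xs l by (auto dest: in_set_takeD)
  let ?mn = "(\<Sum>i<n. d i ^ 2) / el - 2"
  let ?dr = "(real l * ?mn - X.omega * (real l)^2 / (2 * X.ell)) / a"
  let ?e = "X.walk (take l xs) - (X.ssum \<zeta> (take l xs) + real l * ?mn - X.omega * (real l)^2 / (2 * X.ell))"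
  have "\<bar>?e\<bar> <= \<epsilon> * a"
   using X.rmax_ge[OF l, of X.walk_err] B1
   unfolding ssum_\<zeta>[OF tk(1)] tk(2) by linarith
  then have "\<bar>?e\<bar> / a <= \<epsilon>"
   using pos by (simp add: pos_divide_le_eq)
  also have "\<bar>?e\<bar> / a =
   \<bar>(?e) / a\<bar>" using pos by simp
  also have "(?e) / a = ?W t - G xs t - ?dr"
   by (simp add: G_def l_def diff_divide_distrib add_divide_distrib)
  finally have 1: "\<bar>?W t - G xs t - ?dr\<bar> <= \<epsilon>" .
  have gen: "\<bar>w - (g + h')\<bar> <= 2 * \<epsilon>" if "\<bar>w - g - r\<bar> <= \<epsilon>" "\<bar>r - h'\<bar> <= \<epsilon>" for w g r h' :: real
   using that by linarith
  have "\<bar>?dr - h t\<bar> <= \<epsilon>"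
   using hh[OF t] unfolding X.omega_def Xwsum Xell l_def
   by (simp add: deg_eq)
  with 1 show ?thesis unfolding l_def[symmetric] by (rule gen)
 qed
 have wl: "X.walk xs < - (\<Sum>i\<leftarrow>us. dg i) - real D"
 proof -
  have "(\<Sum>i\<leftarrow>us. dg i) = (\<Sum>i\<leftarrow>us. d i)" using us by (intro arg_cong[of _ _ sum_list] map_cong) (auto simp: deg_eq)
  moreover have "\<bar>X.walk xs / a - (X.ssum \<zeta> xs / a + h T)\<bar> <= 2 * \<epsilon>" using close[of T] T xs(2) by (simp add: G_def)
  moreover have "X.ssum \<zeta> xs / a < \<beta>" using B3(1) pos by (simp add: pos_divide_less_eq)
  ultimately have "X.walk xs / a < \<beta> + h T + 2 * \<epsilon>" by linarith
  then have "X.walk xs / a < - \<beta> - \<epsilon>" using \<beta>(2) by linarith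
  then have "X.walk xs < (- \<beta> - \<epsilon>) * a" using pos by (simp only: pos_divide_less_eq)
  also have "... = - (\<beta> * a) - \<epsilon> * a" by (simp add: algebra_simps)
  finally show ?thesis using B3(2) \<epsilon>(2) \<open>(\<Sum>i\<leftarrow>us. dg i) = (\<Sum>i\<leftarrow>us. d i)\<close> by linarith
 qed
 have dx: "\<delta> <= x" using x \<epsilon> by linarith
 have fnd: "F.found C" if "C \<in> sel" for C
  using F.large_found[OF refl wl, of C x] that sel(1,3) dx large by auto
 \<comment> \<open>If \<open>sel\<close> had \<open>M0\<close> elements, more large components would
   be found than there is room for in the window. So \<open>sel\<close> was not truncated, and every
   large component is found.\<close>
 have "sel = big m"
 proof -
  have "real (card sel) <= 2 * \<kappa> * T / x" by (rule F.few_large_found) (use sel(1) large fnd x in auto)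
  then have "card sel ~= M0" using M0 by (auto simp: \<kappa>_def)
  then show ?thesis using sel(2) by auto
 qed
 then have up: "rk F.comps F.csz j <= max x (\<kappa> * rk (gaps F.Z) glen j + (2 * \<epsilon> + \<delta>))" for j
  using F.comps_le_gaps[of x j] fnd large x by auto
 have lo: "\<kappa> * rk (gaps F.Z) glen j <= rk F.comps F.csz j + (2 * \<epsilon> + \<delta>)" for j by (rule F.gaps_le_comps)
 obtain b where b: "!!C. C \<in> F.comps ==> F.csz C <= b" using F.csz_bound by auto
 have ord: "ordered_comp_sizes Hs n m j = a^2 * rk F.comps F.csz j" for j
 proof -
  have "ordered_comp_sizes Hs n m j = rk F.comps (%C. a^2 * F.csz C) j"
   using ordered_comp_sizes_rk[OF mp, of j] pos by (simp add: comps F.csz_def)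
  also have "... = a^2 * rk F.comps F.csz j" by (rule rk_scale[OF _ b]) (use pos in auto)
  finally show ?thesis .
 qed
 have "\<bar>cc * ordered_comp_sizes Hs n m j - \<kappa>' * rk (gaps F.Z) glen j\<bar> <= \<rho>" for j
 proof -
  let ?R = "rk F.comps F.csz j" let ?g = "rk (gaps F.Z) glen j"
  have g: "0 <= ?g" by (rule rk_nonneg[OF F.glen_le])
  moreover have "?g <= T" by (rule rk_upper[OF F.glen_le]) (use T in auto)
  ultimately have g: "0 <= ?g" "?g <= T" by simp_all
  have "0 <= \<kappa> * ?g" using g \<kappa>_pos by simp
  then have "\<bar>?R - \<kappa> * ?g\<bar> <= 2 * x" using up[of j] lo[of j] x \<epsilon> \<delta>0 by (simp add: max_def abs_le_iff split: if_splits)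
  then have "cc * a^2 * \<bar>?R - \<kappa> * ?g\<bar> <= cc * a^2 * (2 * x)" using cc by (intro mult_left_mono) auto
  moreover have "\<bar>cc * a^2 * \<kappa> - \<kappa>'\<bar> * ?g <= \<bar>cc * a^2 * \<kappa> - \<kappa>'\<bar> * T" using g by (intro mult_left_mono) auto
  moreover have "cc * (a^2 * ?R) - \<kappa>' * ?g = cc * a^2 * (?R - \<kappa> * ?g) + (cc * a^2 * \<kappa> - \<kappa>') * ?g" by (simp add: algebra_simps)
  moreover have "\<bar>cc * a^2 * (?R - \<kappa> * ?g)\<bar> = cc * a^2 * \<bar>?R - \<kappa> * ?g\<bar>" using cc by (simp add: abs_mult)
  moreover have "\<bar>(cc * a^2 * \<kappa> - \<kappa>') * ?g\<bar> = \<bar>cc * a^2 * \<kappa> - \<kappa>'\<bar> * ?g" using g by (simp add: abs_mult)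
  ultimately show ?thesis using \<rho> unfolding ord \<kappa>_def[symmetric] by linarith
 qed
 then have "dist (cs m) (%j. \<kappa>' * rk (gaps F.Z) glen j) <= 2 * \<rho>" by (rule dist_fun_le)
 then have "\<Lambda> * dist (cs m) (%j. \<kappa>' * rk (gaps F.Z) glen j) <= \<Lambda> * (2 * \<rho>)" using \<Lambda> by (rule mult_left_mono)
 then have 1: "\<phi> (cs m) >= \<phi> (%j. \<kappa>' * rk (gaps F.Z) glen j) - 2 * \<Lambda> * \<rho>"
  using Lip[of "cs m" "%j. \<kappa>' * rk (gaps F.Z) glen j"] by (simp add: abs_le_iff)
 \<comment> \<open>\<open>D / a\<close> is at most \<open>\<epsilon>\<close>, and the distance
   \<open>2 * \<epsilon>\<close> between the walk and the approximating path counts twice; hence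
   \<open>5 * \<epsilon>\<close>.\<close>
 have "edec T (real D / a + 2 * (2 * \<epsilon>)) (%t. G xs t + h t) F.Z"
  by (rule edec_shift[OF F.walk_edec close])
 then have "edec T (5 * \<epsilon>) (%t. G xs t + h t) F.Z"
  by (rule edec_mono) (use \<epsilon> pos in "simp add: pos_divide_le_eq")
 from infconv_le[where \<phi> = \<phi> and C = C and k = k and \<kappa> = \<kappa>', OF C k this]
 show ?thesis using 1 by (simp add: algebra_simps)
qed

text \<open>For fixed starts, the draws together with a uniform completion. One marginal is i.i.d.
  and the other is the uniform pairing, whatever the starts are.\<close>

definition joint where
 "joint = bind_pmf (replicate_pmf L u) (%xs. map_pmf (Pair xs) (pmf_of_set (Ext (X.pm (X.st xs)))))"

lemma joint_fst: "map_pmf fst joint = replicate_pmf L u"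
 by (simp add: joint_def map_bind_pmf map_pmf_comp map_pmf_const bind_return_pmf')

lemma joint_snd: "map_pmf snd joint = R"
proof -
 have "map_pmf snd joint = bind_pmf (replicate_pmf L u) (%xs. pmf_of_set (Ext (X.pm (X.st xs))))"
  by (simp add: joint_def map_bind_pmf map_pmf_comp pmf.map_id[unfolded id_def])
 also have "... = pmf_of_set (Ext id)" by (rule X.uniform_completion[OF X.ev E_ne])
 finally show ?thesis by (simp add: hcm_pairing_pmf_def hcm_pairings_Ext)
qed

lemma completions:
 assumes "xs \<in> lists E"
 shows "Ext (X.pm (X.st xs)) ~= {}" "finite (Ext (X.pm (X.st xs)))"
proof -
 have "X.inv (X.st xs)" by (rule X.inv_st[OF X.ev assms])
 then show "Ext (X.pm (X.st xs)) ~= {}" "finite (Ext (X.pm (X.st xs)))" using Ext_ne[of "X.pm (X.st xs)"] by (auto simp: X.inv_def)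
qed

lemma joint_set: "(xs, m) \<in> set_pmf joint ==> xs \<in> lists E & length xs = L & m \<in> Ext (X.pm (X.st xs))"
 unfolding joint_def using completions by (auto simp: X.set_rep simp del: in_lists_conv_set)

lemma joint_finite: "finite (set_pmf joint)"
proof -
 have "finite (set_pmf (replicate_pmf L u))" by (rule X.fin_rep)
 then show ?thesis unfolding joint_def using completions by (auto simp: X.set_rep simp del: in_lists_conv_set)
qed

lemma Markov:
 fixes F :: "_ => real"
 assumes c: "c > 0" and F: "!!xs. 0 <= F xs"
 shows "X.Ex l (%xs. of_bool (~ F xs <= c)) <= X.Ex l F / c" "X.Ex l (%xs. of_bool (~ F xs < c)) <= X.Ex l F / c"
proof -
 have "X.Ex l (%xs. of_bool (~ F xs <= c)) <= X.Ex l (%xs. F xs / c)"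
  by (rule X.Ex_mono) (use c F in "auto simp: pos_le_divide_eq")
 then show "X.Ex l (%xs. of_bool (~ F xs <= c)) <= X.Ex l F / c" by simp
 have "X.Ex l (%xs. of_bool (~ F xs < c)) <= X.Ex l (%xs. F xs / c)"
  by (rule X.Ex_mono) (use c F in "auto simp: pos_le_divide_eq")
 then show "X.Ex l (%xs. of_bool (~ F xs < c)) <= X.Ex l F / c" by simp
qed

lemma rmax_nonneg: "0 <= X.rmax F xs"
 using X.rmax_ge[of 0 xs F] by simp

lemma final_position: "X.Ex L (%xs. of_bool (~ X.ssum \<zeta> xs < \<beta> * a)) <= T * c3 / \<beta>^2"
proof -
 define mn where "mn = X.wsum dg / X.ell"
 have avg: "expect u (%e. dg (fst e)) = mn" unfolding mn_def by (rule X.avg)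
 have \<zeta>: "\<zeta> e = dg (fst e) - mn" if "e \<in> E" for e
 proof -
  have "fst e < n" using that halfedges_community by auto
  moreover have "mn = (\<Sum>i<n. d i ^ 2) / el"
   unfolding mn_def Xwsum Xell by (simp add: deg_eq power2_eq_square)
  ultimately show ?thesis by (simp add: \<zeta>_def deg_eq)
 qed
 have mean: "expect u \<zeta> = 0"
 proof -
  have "expect u \<zeta> = expect u (%e. dg (fst e) - mn)"
   by (rule expectation_cong) (simp add: \<zeta>)
  then show ?thesis using avg by simp
 qed
 have "expect u (%e. (\<zeta> e)^2) = expect u (%e. (dg (fst e))^2 - 2 * mn * dg (fst e) + mn^2)"
  by (rule expectation_cong) (simp add: \<zeta> power2_eq_square algebra_simps)
 also have "... = X.wsum (%i. (dg i)^2) / X.ell - mn^2"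
  using avg X.avg[of "%i. (dg i)^2"] by (simp add: power2_eq_square)
 also have "... <= X.wsum (%i. (dg i)^2) / X.ell" by simp
 also have "... <= c3" using c3 unfolding Xwsum Xell by (simp add: deg_eq power3_eq_cube power2_eq_square mult.assoc)
 finally have v: "expect u (%e. (\<zeta> e)^2) <= c3" .
 have v0: "expect u (%e. (\<zeta> e)^2) >= 0" by (rule Bochner_Integration.integral_nonneg) simp
 have ba: "\<beta> * a > 0" using \<beta> a1 by simp
 have "X.Ex L (%xs. of_bool (~ X.ssum \<zeta> xs < \<beta> * a) :: real) <= X.Ex L (%xs. of_bool (~ (X.ssum \<zeta> xs)^2 < (\<beta> * a)^2))"
  by (rule X.Ex_mono) (use ba in "auto intro!: power_mono simp: not_less")
 also have "... <= X.Ex L (%xs. (X.ssum \<zeta> xs)^2) / (\<beta> * a)^2" by (rule Markov(2)) (use ba in auto)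
 also have "... = real L * expect u (%e. (\<zeta> e)^2) / (\<beta> * a)^2" by (simp add: X.ssum_2[OF mean])
 also have "... <= (T * a^2) * c3 / (\<beta> * a)^2"
  using T v v0 by (intro divide_right_mono mult_mono) auto
 also have "... = T * c3 / \<beta>^2" using a1 by (simp add: power_mult_distrib)
 finally show ?thesis .
qed

text \<open>Test function and infimum lie in \<open>[- C, C]\<close>, so each exceptional event
  costs at most \<open>2 * C\<close> times its probability. Missing a component of
  \<open>sel\<close> is an event of the pairing alone, so its probability does not involve the
  draws.\<close>

lemma us_bound:
 assumes us: "set us \<subseteq> {..<n}" and sel: "!!m. m \<in> hcm_pairings Hs n ==> sel m \<subseteq> big m & (card (sel m) = M0 \<or> sel m = big m)"
 shows "X.Ex L ic - 5 * k * \<epsilon> - 2 * \<Lambda> * \<rho>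
   - 2 * C * (68 * K ^ 7 * sqrt \<delta> / \<epsilon> + T * c3 / \<beta>^2 + of_bool (~ (\<Sum>i\<leftarrow>us. d i) < \<beta> * a)
    + expect R (%m. of_bool (EX C:sel m. C \<inter> set us = {})))
  <= expect R (%m. \<phi> (cs m))"
proof -
 define b1 where "b1 xs = X.rmax X.walk_err xs" for xs
 define b2 where "b2 xs = X.rmax X.vol_err xs" for xs
 define I where "I xs = ic xs" for xs
 define bad where "bad xs = of_bool (~ b1 xs <= \<epsilon> * a) + of_bool (~ b2 xs <= \<epsilon> * a^2) + (of_bool (~ X.ssum \<zeta> xs < \<beta> * a) :: real)" for xs
 define ub :: real where "ub = of_bool (~ (\<Sum>i\<leftarrow>us. d i) < \<beta> * a)"
 define miss :: "_ => real" where "miss m = of_bool (EX C:sel m. C \<inter> set us = {})" for m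
 define Y where "Y m = \<phi> (cs m)" for m
 define s where "s = 5 * k * \<epsilon> + 2 * \<Lambda> * \<rho>"
 have C0: "C >= 0" using C[of undefined] by linarith
 have "cc * a^2 * (2 * x) >= 0" "\<bar>cc * a^2 * ((\<Sum>i<n. d i * f i) / el) - \<kappa>'\<bar> * T >= 0" using cc x T by auto
 then have "\<rho> >= 0" using \<rho> by linarith
 then have s0: "s >= 0" using k \<epsilon> \<Lambda> by (simp add: s_def)
 have pw: "I (fst y) - s - 2 * C * (bad (fst y) + ub + miss (snd y)) <= Y (snd y)" if "y \<in> set_pmf joint" for y
 proof -
  obtain xs m where y: "y = (xs, m)" by (cases y)
  have xs: "xs \<in> lists E" "length xs = L" "m \<in> Ext (X.pm (X.st xs))" using joint_set that y by auto
  have mp: "m \<in> hcm_pairings Hs n" using xs(3) by (auto simp: hcm_pairings_def Ext_def)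
  show ?thesis
  proof (cases "bad xs + ub + miss m = 0")
   case True
   then have g: "b1 xs <= \<epsilon> * a" "b2 xs <= \<epsilon> * a^2" "X.ssum \<zeta> xs < \<beta> * a" "(\<Sum>i\<leftarrow>us. d i) < \<beta> * a" "ALL C:sel m. C \<inter> set us ~= {}"
    by (auto simp: bad_def ub_def miss_def split: if_splits simp: of_bool_def)
   have "I xs - 5 * k * \<epsilon> - 2 * \<Lambda> * \<rho> <= Y m"
    unfolding I_def Y_def
    by (rule pointwise[OF xs g(1)[unfolded b1_def] g(2)[unfolded b2_def] g(3,4) us, of "sel m"]) (use sel[OF mp] g(5) in auto)
   then show ?thesis using True by (simp add: y s_def)
  next
   case False
   then have "bad xs + ub + miss m >= 1" by (auto simp: bad_def ub_def miss_def of_bool_def split: if_splits)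
   then have "2 * C * 1 <= 2 * C * (bad xs + ub + miss m)" using C0 by (intro mult_left_mono) auto
   moreover have "I xs <= C" unfolding I_def using infconv_abs[where \<phi> = \<phi> and C = C and k = k, OF C k] abs_le_D1 by blast
   moreover have "- C <= Y m" unfolding Y_def using C abs_le_D2 minus_le_iff by blast
   ultimately show ?thesis using s0 unfolding y by simp
  qed
 qed
 have int: "integrable (measure_pmf joint) F" for F :: "_ => real" by (rule integrable_measure_pmf_finite[OF joint_finite])
 have "expect joint (%y. I (fst y) - s - 2 * C * (bad (fst y) + ub + miss (snd y))) <= expect joint (%y. Y (snd y))"
  by (rule expectation_mono_finite[OF joint_finite pw])
 moreover have "expect joint (%y. I (fst y) - s - 2 * C * (bad (fst y) + ub + miss (snd y))) =
  expect joint (%y. I (fst y)) - s - 2 * C * (expect joint (%y. bad (fst y)) + ub + expect joint (%y. miss (snd y)))"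
  using int by simp
 moreover have "expect joint (%y. F (fst y)) = X.Ex L F" for F :: "_ => real"
  using integral_map_pmf[of fst joint F] by (simp add: joint_fst)
 moreover have "expect joint (%y. F (snd y)) = expect R F" for F :: "_ => real"
  using integral_map_pmf[of snd joint F] by (simp add: joint_snd)
 ultimately have main: "X.Ex L I - s - 2 * C * (X.Ex L bad + ub + expect R miss)
  <= expect R Y" by simp
 have "X.Ex L bad <= 68 * K ^ 7 * sqrt \<delta> / \<epsilon> + T * c3 / \<beta>^2"
 proof -
  have pos: "\<epsilon> * a > 0" "\<epsilon> * a^2 > 0" using \<epsilon> a1 by auto
  have "X.Ex L (%xs. of_bool (~ b1 xs <= \<epsilon> * a)) <= X.Ex L b1 / (\<epsilon> * a)"
   by (rule Markov(1)[OF pos(1)]) (simp add: b1_def rmax_nonneg)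
  also have "... <= 55 * K ^ 7 * sqrt \<delta> * a / (\<epsilon> * a)"
   unfolding b1_def using X.walk_close pos by (intro divide_right_mono) auto
  also have "... = 55 * K ^ 7 * sqrt \<delta> / \<epsilon>" using a1 by simp
  finally have 1: "X.Ex L (%xs. of_bool (~ b1 xs <= \<epsilon> * a)) <= 55 * K ^ 7 * sqrt \<delta> / \<epsilon>" .
  have "X.Ex L (%xs. of_bool (~ b2 xs <= \<epsilon> * a^2)) <= X.Ex L b2 / (\<epsilon> * a^2)"
   by (rule Markov(1)[OF pos(2)]) (simp add: b2_def rmax_nonneg)
  also have "... <= 13 * K ^ 7 * sqrt \<delta> * a^2 / (\<epsilon> * a^2)"
   unfolding b2_def using X.vol_close pos by (intro divide_right_mono) auto
  also have "... = 13 * K ^ 7 * sqrt \<delta> / \<epsilon>" using a1 by simp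
  finally have 2: "X.Ex L (%xs. of_bool (~ b2 xs <= \<epsilon> * a^2)) <= 13 * K ^ 7 * sqrt \<delta> / \<epsilon>" .
  have "X.Ex L bad = X.Ex L (%xs. of_bool (~ b1 xs <= \<epsilon> * a)) + X.Ex L (%xs. of_bool (~ b2 xs <= \<epsilon> * a^2)) + X.Ex L (%xs. of_bool (~ X.ssum \<zeta> xs < \<beta> * a))"
   unfolding bad_def[abs_def] by simp
  moreover have "68 * K ^ 7 * sqrt \<delta> / \<epsilon> = 55 * K ^ 7 * sqrt \<delta> / \<epsilon> + 13 * K ^ 7 * sqrt \<delta> / \<epsilon>"
   by (simp add: add_divide_distrib[symmetric])
  ultimately show ?thesis using 1 2 final_position by linarith
 qed
 then have "2 * C * (X.Ex L bad + ub + expect R miss)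
  <= 2 * C * (68 * K ^ 7 * sqrt \<delta> / \<epsilon> + T * c3 / \<beta>^2 + ub + expect R miss)"
  using C0 by (intro mult_left_mono) auto
 then show ?thesis using main unfolding s_def I_def[abs_def] Y_def[abs_def] miss_def[abs_def] ub_def by linarith
qed

end

lemma finite_pairings: "finite (set_pmf R)" "set_pmf R = hcm_pairings Hs n"
proof -
 have "Ext id ~= {} & finite (Ext id)"
  by (rule Ext_ne) (use even_E card_halfedges in "auto simp: half_edges.valid_def half_edges_axioms unp_def")
 then show "finite (set_pmf R)" "set_pmf R = hcm_pairings Hs n"
  by (simp_all add: hcm_pairing_pmf_def hcm_pairings_Ext)
qed

theorem lower_bound:
 "expect (replicate_pmf L u) ic - 5 * k * \<epsilon> - 2 * \<Lambda> * \<rho>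
   - 2 * C * (68 * K ^ 7 * sqrt \<delta> / \<epsilon> + T * c3 / \<beta>^2 + 2 * T * c1 / \<beta> + real M0 * exp (- (T * x / c2)))
  <= expect R (%m. \<phi> (cs m))"
proof -
 let ?N = "real (total_vertices Hs n)"
 have pos: "a > 0" using a1 by simp
 have C0: "C >= 0" using C[of undefined] by linarith
 have fbig: "finite (big m)" for m by (simp add: big_def community_components_def)
 \<comment> \<open>The number of large components is random. Cutting the family at \<open>M0\<close>
   gives the union bound a fixed number of terms, and by \<open>pointwise\<close> the cut has no
   effect on the good event.\<close>
 have "EX S. S \<subseteq> big m & (card S = M0 \<or> S = big m) & card S <= M0" for m
 proof (cases "card (big m) >= M0")
  case True
  then obtain S where "S \<subseteq> big m" "card S = M0" by (meson obtain_subset_with_card_n)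
  then show ?thesis by auto
 qed auto
 then obtain sel where sel: "!!m. sel m \<subseteq> big m & (card (sel m) = M0 \<or> sel m = big m) & card (sel m) <= M0" by metis
 interpret Q: iid q by unfold_locales (rule finite_q[OF n0])
 define X where "X = expect (replicate_pmf L u) ic - 5 * k * \<epsilon> - 2 * \<Lambda> * \<rho>
   - 2 * C * (68 * K ^ 7 * sqrt \<delta> / \<epsilon> + T * c3 / \<beta>^2)"
 define ub where "ub us = (of_bool (~ (\<Sum>i\<leftarrow>us. d i) < \<beta> * a) :: real)" for us
 define ms where "ms us = expect R (%m. of_bool (EX C:sel m. C \<inter> set us = {}) :: real)" for us
 define Y where "Y = expect R (%m. \<phi> (cs m))"
 have qset: "set_pmf q \<subseteq> {..<n}"
  using finite_vertices vertices_ne[OF n0] by (auto simp: q_def hcm_vertices_def)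
 have us: "X - 2 * C * (ub us + ms us) <= Y" if "us \<in> lists (set_pmf q)" for us
  using us_bound[of us sel] that qset sel unfolding X_def ub_def ms_def Y_def by (force simp: algebra_simps)
 have "Q.Ex J (%us. X - 2 * C * (ub us + ms us)) <= Q.Ex J (%us. Y)" by (rule Q.Ex_mono[OF us])
 then have 1: "X - 2 * C * (Q.Ex J ub + Q.Ex J ms) <= Y" by simp
 have N0: "?N > 0"
  using card_vertices finite_vertices vertices_ne[OF n0] by (metis card_gt_0_iff of_nat_0_less_iff)
 have Jle: "real J <= 2 * T * a" "T * a <= real J"
 proof -
  have "1 * 1 <= T * a" using T a1 by (intro mult_mono) auto
  then show "real J <= 2 * T * a" "T * a <= real J" by linarith+
 qed
 \<comment> \<open>Markov's inequality for the total degree of the starts, whose mean is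
   \<open>J\<close> times the mean degree at a uniform vertex, at most \<open>c1\<close>.\<close>
 have "Q.Ex J ub <= Q.Ex J (%us. Q.ssum d us / (\<beta> * a))"
  by (rule Q.Ex_mono) (use \<beta> pos in "auto simp: ub_def Q.ssum_def pos_le_divide_eq not_less intro!: divide_nonneg_pos sum_list_nonneg")
 also have "... = real J * ((\<Sum>i<n. f i * d i) / ?N) / (\<beta> * a)"
  using Q.ssum_mean[of J d] by (simp add: expectation_q[OF n0])
 also have "... <= (2 * T * a) * c1 / (\<beta> * a)"
  using Jle c1 \<beta> pos T by (intro divide_right_mono mult_mono) (auto intro!: divide_nonneg_nonneg sum_nonneg)
 also have "... = 2 * T * c1 / \<beta>" using pos by simp
 finally have 2: "Q.Ex J ub <= 2 * T * c1 / \<beta>" .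
 \<comment> \<open>A large component has more than \<open>x * a^2\<close> vertices. The cap at 1
   keeps \<open>1 - p\<close> nonnegative when there are fewer vertices than that.\<close>
 define p where "p = min 1 (x * a^2 / ?N)"
 have "Q.Ex J ms <= real M0 * (1 - p) ^ J"
  unfolding ms_def
 proof (rule miss_prob[OF finite_q[OF n0] finite_pairings(1)])
  fix m assume m: "m \<in> set_pmf R"
  then have mp: "m \<in> hcm_pairings Hs n" using finite_pairings(2) by simp
  have "p <= measure_pmf.prob q C" if "C \<in> sel m" for C
  proof -
   have C: "C \<in> community_components m" "(\<Sum>i\<in>C. f i) / a^2 > x" using that sel[of m] by (auto simp: big_def)
   have "p <= x * a^2 / ?N" by (simp add: p_def)
   also have "... <= (\<Sum>i\<in>C. f i) / ?N" using C(2) pos N0 by (intro divide_right_mono) (auto simp: pos_less_divide_eq)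
   also have "... = measure_pmf.prob q C" by (rule prob_q[OF n0 component_lt[OF mp C(1)], symmetric])
   finally show ?thesis .
  qed
  moreover have "finite (sel m)" using sel[of m] fbig finite_subset by blast
  ultimately show "finite (sel m) & card (sel m) <= M0 & (ALL C:sel m. p <= measure_pmf.prob q C)" using sel[of m] by auto
 qed (simp add: p_def)
 also have "(1 - p) ^ J <= exp (- (T * x / c2))"
 proof (cases "x * a^2 / ?N >= 1")
  case True
  then have "1 - p = 0" by (simp add: p_def)
  moreover have "real J > 0" using Jle(2) mult_pos_pos[of T a] T pos by linarith
  ultimately show ?thesis by (simp only: of_nat_0_less_iff zero_power exp_ge_zero)
 next
  case False
  have c20: "c2 > 0"
  proof -
   have "0 < c2 * a ^ 3" using N0 c2 by linarith
   then show ?thesis using pos by (simp add: zero_less_mult_iff)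
  qed
  have "1 - p <= exp (- (x * a^2 / ?N))" using False exp_ge_add_one_self[of "- (x * a^2 / ?N)"] by (simp add: p_def)
  then have "(1 - p) ^ J <= exp (- (x * a^2 / ?N)) ^ J" by (rule power_mono) (simp add: p_def)
  also have "... = exp (- (real J * (x * a^2 / ?N)))" by (simp add: exp_of_nat_mult[symmetric])
  also have "... <= exp (- (T * x / c2))"
  proof -
   have "T * x / c2 = (T * a) * (x * a^2 / (c2 * a ^ 3))" using pos by (simp add: power2_eq_square power3_eq_cube)
   also have "... <= real J * (x * a^2 / ?N)"
   proof (rule mult_mono[OF Jle(2)])
    show "x * a^2 / (c2 * a ^ 3) <= x * a^2 / ?N" using c2 N0 pos x c20 by (intro divide_left_mono) auto
   qed (use pos x c20 in auto)
   finally show ?thesis by simp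
  qed
  finally show ?thesis .
 qed
 finally have 3: "Q.Ex J ms <= real M0 * exp (- (T * x / c2))" by (simp add: mult_left_mono)
 have "2 * C * (Q.Ex J ub + Q.Ex J ms) <= 2 * C * (2 * T * c1 / \<beta> + real M0 * exp (- (T * x / c2)))"
  using 2 3 C0 by (intro mult_left_mono) auto
 then show ?thesis using 1 unfolding X_def Y_def[symmetric] by (simp add: algebra_simps)
qed

end

section \<open>Critical sequences of communities\<close>

lemma emp_mean_add: "emp_mean Hs n (%H. F H + G H) = emp_mean Hs n F + emp_mean Hs n G"
 by (simp add: emp_mean_def sum.distrib add_divide_distrib)

lemma emp_mean_mono: "(!!i. i < n ==> F (Hs i) <= G (Hs i)) ==> emp_mean Hs n F <= emp_mean Hs n G"
 unfolding emp_mean_def by (intro divide_right_mono sum_mono) auto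

lemma emp_mean_abs: "\<bar>emp_mean Hs n F\<bar> <= emp_mean Hs n (%H. \<bar>F H\<bar>)"
 unfolding emp_mean_def abs_divide by (simp add: divide_right_mono sum_abs)

lemma emp_mean_finite:
 assumes "finite A"
 shows "emp_mean Hs n (%H. F H * indicator A H) = (\<Sum>H\<in>A. F H * emp_frac Hs n H)"
proof -
 have "(\<Sum>i<n. F (Hs i) * indicator A (Hs i)) = (\<Sum>i<n. \<Sum>H\<in>A. F H * indicator {H} (Hs i))"
 proof (rule sum.cong[OF refl])
  fix i
  have "(\<Sum>H\<in>A. F H * indicator {H} (Hs i)) = (\<Sum>H\<in>A. if H = Hs i then F H else 0)"
   by (intro sum.cong) auto
  then show "F (Hs i) * indicator A (Hs i) = (\<Sum>H\<in>A. F H * indicator {H} (Hs i))"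
   using assms by (auto simp: sum.delta indicator_def)
 qed
 also have "... = (\<Sum>H\<in>A. F H * real (card {i. i < n & Hs i = H}))"
 proof (subst sum.swap, rule sum.cong[OF refl])
  fix H
  have "(\<Sum>i<n. indicator {H} (Hs i) :: real) = real (card ({..<n} \<inter> {i. Hs i = H}))"
   by (simp add: indicator_def sum.If_cases)
  also have "{..<n} \<inter> {i. Hs i = H} = {i. i < n & Hs i = H}" by auto
  finally show "(\<Sum>i<n. F H * indicator {H} (Hs i)) = F H * real (card {i. i < n & Hs i = H})"
   by (simp add: sum_distrib_left[symmetric])
 qed
 finally show ?thesis by (simp add: emp_mean_def emp_frac_def sum_divide_distrib)
qed

text \<open>The support of \<open>P\<close> is countable, so initial parts of an enumeration exhaust
  it and dominated convergence applies.\<close>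

lemma integrable_finite_tail:
 fixes g :: "'b => real"
 assumes "integrable (measure_pmf P) g" "!!H. g H >= 0" "\<epsilon> > 0"
 obtains A where "finite A" "expect P (%H. g H * indicator (- A) H) < \<epsilon>"
proof -
 define A where "A k = from_nat_into (set_pmf P) ` {..<k}" for k
 have "(%k. expect P (%H. g H * indicator (- A k) H)) \<longlonglongrightarrow> expect P (%H. 0)"
 proof (rule integral_dominated_convergence[where w = g])
  show "AE H in measure_pmf P. (%k. g H * indicator (- A k) H) \<longlonglongrightarrow> 0"
  proof (rule AE_pmfI)
   fix H assume "H \<in> set_pmf P"
   then obtain k where k: "H = from_nat_into (set_pmf P) k"
    using countable_set_pmf[of P] by (metis from_nat_into_surj)
   have "EVTL j. g H * indicator (- A j) H = 0"
    using eventually_gt_at_top[of k] by eventually_elim (auto simp: A_def k)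
   then show "(%k. g H * indicator (- A k) H) \<longlonglongrightarrow> 0" by (rule tendsto_eventually)
  qed
  show "AE H in measure_pmf P. norm (g H * indicator (- A k) H) <= g H" for k
   using assms(2) by (auto simp: indicator_def)
 qed (use assms in auto)
 then have "(%k. expect P (%H. g H * indicator (- A k) H)) \<longlonglongrightarrow> 0" by simp
 then have "EVTL k. expect P (%H. g H * indicator (- A k) H) < \<epsilon>"
  using assms(3) by (rule order_tendstoD(2))
 then obtain k where "expect P (%H. g H * indicator (- A k) H) < \<epsilon>" by (auto simp: eventually_sequentially)
 then show ?thesis using that[of "A k"] by (simp add: A_def)
qed

lemma pmf_integrable_bound:
 fixes F g :: "'b => real"
 assumes "integrable (measure_pmf P) g" "!!H. \<bar>F H\<bar> <= g H"
 shows "integrable (measure_pmf P) F"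
proof (rule Bochner_Integration.integrable_bound[OF assms(1)])
 show "AE H in measure_pmf P. norm (F H) <= norm (g H)"
  by (rule AE_I2) (use assms(2) order_trans[OF _ abs_ge_self] in auto)
qed simp

lemma pmf_integrable_indicator: "integrable (measure_pmf P) (indicator X :: _ => real)"
 by (rule pmf_integrable_bound[where g = "%_. 1"]) (auto simp: indicator_def)

text \<open>Pratt's lemma for the empirical measures.\<close>
lemma emp_mean_dominated:
 fixes F g :: "community => real"
 assumes CR1: "!!H. (%n. emp_frac (Hs n) n H) \<longlonglongrightarrow> pmf P H"
  and g: "integrable (measure_pmf P) g" "!!H. \<bar>F H\<bar> <= g H"
  and lim: "(%n. emp Hs n g) \<longlonglongrightarrow> expect P g"
 shows "(%n. emp Hs n F) \<longlonglongrightarrow> expect P F"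
proof (rule LIMSEQ_I)
 let ?i = "%(G :: community => real) A H. G H * indicator A H :: real"
 fix \<epsilon> :: real assume \<epsilon>: "\<epsilon> > 0"
 have g0: "g H >= 0" for H using g(2)[of H] by linarith
 obtain A where A: "finite A" "expect P (?i g (- A)) < \<epsilon> / 4"
  using integrable_finite_tail[OF g(1) g0, of "\<epsilon>/4"] \<epsilon> by auto
 have intF: "integrable (measure_pmf P) F" by (rule pmf_integrable_bound[OF g])
 have fin: "(%n. emp Hs n (?i G A)) \<longlonglongrightarrow> expect P (?i G A)" for G
 proof -
  have "expect P (?i G A) = (\<Sum>H\<in>A. G H * pmf P H)"
   using A(1) by (subst integral_measure_pmf[of A]) (auto simp: indicator_def mult.commute)
  moreover have "(%n. \<Sum>H\<in>A. G H * emp_frac (Hs n) n H) \<longlonglongrightarrow> (\<Sum>H\<in>A. G H * pmf P H)" by (intro tendsto_intros CR1)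
  ultimately show ?thesis using A(1) by (simp add: emp_mean_finite)
 qed
 have int: "integrable (measure_pmf P) (?i G X)" if "integrable (measure_pmf P) G" for G :: "community => real" and X
 proof (rule pmf_integrable_bound[where g = "%H. \<bar>G H\<bar>"])
  show "integrable (measure_pmf P) (%H. \<bar>G H\<bar>)" using that by simp
 qed (auto simp: indicator_def)
 have split: "G H = G H * indicator A H + G H * indicator (- A) H" for G :: "community => real" and H by (auto simp: indicator_def)
 have E: "expect P G = expect P (?i G A) + expect P (?i G (- A))"
  if "integrable (measure_pmf P) G" for G :: "community => real"
  using int[OF that, of A] int[OF that, of "- A"] by (subst Bochner_Integration.integral_add[symmetric]) (auto simp: split[of G, symmetric])
 have em: "emp Hs n G = emp Hs n (?i G A) + emp Hs n (?i G (- A))" for G n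
  unfolding emp_mean_add[symmetric] split[of G, symmetric] by simp
 have "(%n. emp Hs n g - emp Hs n (?i g A)) \<longlonglongrightarrow> expect P g - expect P (?i g A)"
  by (intro tendsto_diff lim fin)
 then have "(%n. emp Hs n (?i g (- A))) \<longlonglongrightarrow> expect P (?i g (- A))"
  using em[of _ g] E[OF g(1)] by simp
 then have ev1: "EVTL n. emp Hs n (?i g (- A)) < \<epsilon> / 4" using A(2) by (rule order_tendstoD)
 have ev2: "EVTL n. \<bar>emp Hs n (?i F A) - expect P (?i F A)\<bar> < \<epsilon> / 4"
  using tendstoD[OF fin[of F], of "\<epsilon>/4"] \<epsilon> by (simp add: dist_real_def)
 have tail: "\<bar>expect P (?i F (- A))\<bar> <= expect P (?i g (- A))"
 proof (rule order_trans[OF integral_abs_bound integral_mono])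
  show "integrable (measure_pmf P) (%H. \<bar>F H * indicator (- A) H\<bar>)" using int[OF intF] by simp
  show "integrable (measure_pmf P) (?i g (- A))" by (rule int[OF g(1)])
 qed (use g(2) in "auto simp: abs_mult indicator_def")
 have "EVTL n. norm (emp Hs n F - expect P F) < \<epsilon>"
  using ev1 ev2
 proof eventually_elim
  case (elim n)
  have "\<bar>emp Hs n (?i F (- A))\<bar> <= emp Hs n (?i g (- A))"
   by (rule order_trans[OF emp_mean_abs emp_mean_mono]) (use g(2) in "auto simp: abs_mult indicator_def")
  then show ?case unfolding real_norm_def em[of n F] E[OF intF] using elim tail A(2) by linarith
 qed
 then show "EX no. ALL n>=no. norm (emp Hs n F - expect P F) < \<epsilon>" by (simp add: eventually_sequentially)
qed

section \<open>Consequences of the regularity and connectivity conditions\<close>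

locale critical =
 fixes lam :: real and Hs :: "nat => nat => community" and P :: "community pmf"
 assumes valid_seq: "!!n i. i < n ==> valid_community (Hs n i)"
  and valid_P: "!!H. H \<in> set_pmf P ==> valid_community H"
  and even_l: "!!n. even (total_halfedges (Hs n) n)"
  and CR1: "!!H. (%n. emp_frac (Hs n) n H) \<longlonglongrightarrow> pmf P H"
  and CR2_int: "integrable (measure_pmf P) (%H. real (csize H))"
  and CR2: "(%n. emp Hs n (%H. real (csize H))) \<longlonglongrightarrow> expect P (%H. real (csize H))"
  and CR3_int: "integrable (measure_pmf P) (%H. rdeg H * real (csize H))"
  and CR3: "(%n. emp Hs n (%H. rdeg H * real (csize H))) \<longlonglongrightarrow> expect P (%H. rdeg H * real (csize H))"
  and CR4: "(%n. real (max_size (Hs n) n) * ln (real n) / real n powr (2/3)) \<longlonglongrightarrow> 0"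
  and IC1_int: "integrable (measure_pmf P) (%H. rdeg H ^ 3)"
  and IC1: "(%n. emp Hs n (%H. rdeg H ^ 3)) \<longlonglongrightarrow> expect P (%H. rdeg H ^ 3)"
  and IC2b: "0 < measure_pmf.prob P {H. cdegree H = 1}"
  and IC3: "(%n. (emp Hs n (%H. rdeg H * (rdeg H - 1))
           / emp Hs n (%H. rdeg H)
          - 1 - lam * real n powr (-1/3)) * real n powr (1/3)) \<longlonglongrightarrow> 0"
begin

abbreviation lh where "lh n \<equiv> real (total_halfedges (Hs n) n)"
abbreviation hp where "hp n \<equiv> pmf_of_set (hcm_halfedges (Hs n) n)"

definition "ES = expect P (%H. real (csize H))"
definition "ED = expect P (%H. rdeg H)"
definition "EDS = expect P (%H. rdeg H * real (csize H))"
definition "ED2 = expect P (%H. rdeg H ^ 2)"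
definition "ED3 = expect P (%H. rdeg H ^ 3)"

abbreviation d where "d n i \<equiv> rdeg (Hs n i)"
abbreviation s where "s n i \<equiv> real (csize (Hs n i))"

lemma nat_power_le: "m <= 3 ==> m > 0 ==> real k ^ m <= real k ^ 3"
 by (cases "k = 0") (auto intro: power_increasing simp: zero_power)

lemma int_pow: "m <= 3 ==> m > 0 ==> integrable (measure_pmf P) (%H. rdeg H ^ m)"
 by (rule Bochner_Integration.integrable_bound[OF IC1_int]) (use nat_power_le in auto)

lemma emp_pow: "m <= 3 ==> m > 0 ==> (%n. emp Hs n (%H. rdeg H ^ m)) \<longlonglongrightarrow> expect P (%H. rdeg H ^ m)"
 by (rule emp_mean_dominated[OF CR1 IC1_int _ IC1]) (use nat_power_le in auto)

lemma lim1: "(%n. (\<Sum>i<n. d n i) / real n) \<longlonglongrightarrow> ED" using emp_pow[of 1] by (simp add: emp_mean_def ED_def)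
lemma lim2: "(%n. (\<Sum>i<n. d n i ^ 2) / real n) \<longlonglongrightarrow> ED2" using emp_pow[of 2] by (simp add: emp_mean_def ED2_def)
lemma lim3: "(%n. (\<Sum>i<n. d n i ^ 3) / real n) \<longlonglongrightarrow> ED3" using IC1 by (simp add: emp_mean_def ED3_def)
lemma limS: "(%n. (\<Sum>i<n. s n i) / real n) \<longlonglongrightarrow> ES" using CR2 by (simp add: emp_mean_def ES_def)
lemma limDS: "(%n. (\<Sum>i<n. d n i * s n i) / real n) \<longlonglongrightarrow> EDS" using CR3 by (simp add: emp_mean_def EDS_def)

lemma ED_pos: "ED > 0"
proof -
 have "measure_pmf.prob P {H. cdegree H = 1} = expect P (indicator {H. cdegree H = 1})" by simp
 also have "... <= ED" unfolding ED_def
  by (rule integral_mono) (use int_pow[of 1] pmf_integrable_indicator in "auto simp: indicator_def")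
 finally show ?thesis using IC2b by simp
qed

lemma ES_pos: "ES >= 1"
proof -
 have "expect P (%H. 1 :: real) <= ES" unfolding ES_def
  by (rule integral_mono_AE) (use CR2_int valid_P in "auto simp: AE_measure_pmf_iff valid_community_def")
 then show ?thesis by simp
qed

lemma EDS_pos: "EDS > 0"
proof -
 have "ED <= EDS" unfolding ED_def EDS_def
 proof (rule integral_mono_AE)
  show "AE H in measure_pmf P. rdeg H <= rdeg H * real (csize H)"
  proof (rule AE_pmfI)
   fix H assume "H \<in> set_pmf P"
   then have "1 <= real (csize H)" using valid_P[of H] by (simp add: valid_community_def)
   then have "rdeg H * 1 <= rdeg H * real (csize H)" by (intro mult_left_mono) auto
   then show "rdeg H <= rdeg H * real (csize H)" by simp
  qed
 qed (use int_pow[of 1] CR3_int in auto)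
 then show ?thesis using ED_pos by simp
qed

definition a :: "nat => real" where "a n = real n powr (1/3)"

lemma a3: "a n ^ 3 = real n" by (cases "n = 0") (simp_all add: a_def powr_power)

lemma a2: "(a n)^2 = real n powr (2/3)" by (cases "n = 0") (simp_all add: a_def powr_power)

lemma a_at_top: "filterlim a at_top sequentially"
 unfolding filterlim_at_top
proof
 fix Z :: real
 show "EVTL n. Z <= a n"
  using eventually_ge_at_top[of "nat \<lceil>max Z 0 ^ 3\<rceil>"]
 proof eventually_elim
  case (elim n)
  then have "max Z 0 ^ 3 <= a n ^ 3" unfolding a3 by linarith
  then have "max Z 0 <= a n" by (rule power_le_imp_le_base[of _ 2, simplified]) (simp add: a_def)
  then show ?case by simp
 qed
qed

lemma a_inv: "(%n. 1 / a n) \<longlonglongrightarrow> 0"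
 using tendsto_inverse_0_at_top[OF a_at_top] by (simp add: inverse_eq_divide)

definition mean :: "nat => real" where "mean n = (\<Sum>i<n. d n i ^ 2) / lh n"

lemma halfedges: "lh n = (\<Sum>i<n. d n i)" by (simp add: total_halfedges_def)
lemma vertices: "real (total_vertices (Hs n) n) = (\<Sum>i<n. s n i)" by (simp add: total_vertices_def)

lemma ratio_limit:
 assumes "(%n. F n / real n) \<longlonglongrightarrow> l"
 shows "(%n. F n / lh n) \<longlonglongrightarrow> l / ED"
proof (rule Lim_transform_eventually)
 show "(%n. (F n / real n) / ((\<Sum>i<n. d n i) / real n)) \<longlonglongrightarrow> l / ED" using ED_pos by (intro tendsto_divide assms lim1) simp
 show "EVTL n. F n / real n / ((\<Sum>i<n. d n i) / real n) = F n / lh n"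
  using eventually_gt_at_top[of 0] by eventually_elim (simp add: halfedges)
qed

text \<open>\<open>mean n\<close> is the mean degree at a uniform half-edge, which is 1 more than
  the ratio in the connectivity condition. A step to a new community adds its degree minus 2 to the
  walk, hence the comparison with 2.\<close>

lemma drift: "(%n. (mean n - 2) * a n) \<longlonglongrightarrow> lam"
proof -
 let ?r = "%n. emp Hs n (%H. rdeg H * (rdeg H - 1)) / emp Hs n (%H. rdeg H)"
 have eq: "?r n = mean n - 1"
  if n: "n > 0" "(\<Sum>i<n. d n i) > 0" for n
 proof -
  have "(\<Sum>i<n. d n i * (d n i - 1)) = (\<Sum>i<n. d n i ^ 2) - (\<Sum>i<n. d n i)"
   by (simp add: sum_subtractf algebra_simps power2_eq_square)
  then have "?r n
   = ((\<Sum>i<n. d n i ^ 2) - (\<Sum>i<n. d n i)) / (\<Sum>i<n. d n i)" using n by (simp add: emp_mean_def)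
  then show ?thesis using n by (simp add: mean_def halfedges diff_divide_distrib)
 qed
 have ev: "EVTL n. (\<Sum>i<n. d n i) > 0"
  using order_tendstoD(1)[OF lim1 ED_pos] by eventually_elim (auto simp: zero_less_divide_iff)
 have "(%n. (?r n - 1 - lam * real n powr (-1/3)) * real n powr (1/3) + lam) \<longlonglongrightarrow> 0 + lam"
  by (intro tendsto_intros IC3)
 then have "(%n. (?r n - 1 - lam * real n powr (-1/3)) * real n powr (1/3) + lam) \<longlonglongrightarrow> lam" by simp
 then show ?thesis
 proof (rule Lim_transform_eventually)
  show "EVTL n. (?r n - 1 - lam * real n powr (-1/3)) * real n powr (1/3) + lam = (mean n - 2) * a n"
   using ev eventually_gt_at_top[of 0]
  proof eventually_elim
   case (elim n)
   have "real n powr (-1/3) * real n powr (1/3) = 1" using elim by (simp add: powr_add[symmetric])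
   then show ?case unfolding eq[OF elim(2,1)] a_def by (simp add: algebra_simps)
  qed
 qed
qed

text \<open>The critical scaling forces \<open>mean\<close> to 2, while the moments force it to
  \<open>ED2 / ED\<close>; criticality of the limit law follows.\<close>

lemma mean_limit: "mean \<longlonglongrightarrow> 2" "ED2 = 2 * ED"
proof -
 have "(%n. (mean n - 2) * a n * (1 / a n) + 2) \<longlonglongrightarrow> lam * 0 + 2" by (intro tendsto_intros drift a_inv)
 moreover have "EVTL n. (mean n - 2) * a n * (1 / a n) + 2 = mean n"
  using eventually_gt_at_top[of 0] by eventually_elim (simp add: a_def)
 ultimately have "mean \<longlonglongrightarrow> lam * 0 + 2" by (rule Lim_transform_eventually)
 then show m: "mean \<longlonglongrightarrow> 2" by simp
 have "mean \<longlonglongrightarrow> ED2 / ED" unfolding mean_def[abs_def] by (rule ratio_limit[OF lim2])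
 then have "ED2 / ED = 2" using m LIMSEQ_unique by blast
 then show "ED2 = 2 * ED" using ED_pos by (simp add: field_simps)
qed

definition \<eta> where "\<eta> = ED3 * ED - ED2^2"

text \<open>At criticality \<open>\<eta>\<close> is \<open>ED\<close> times the mean of
  \<open>D * (D - 2)^2\<close> for the degree \<open>D\<close> under \<open>P\<close>, and this is
  positive because degree 1 has positive probability.\<close>

lemma \<eta>_pos: "\<eta> > 0"
proof -
 have i: "integrable (measure_pmf P) (%H. rdeg H ^ 3)" "integrable (measure_pmf P) (%H. rdeg H ^ 2)" "integrable (measure_pmf P) (%H. rdeg H)"
  using int_pow[of 3] int_pow[of 2] int_pow[of 1] by auto
 have "measure_pmf.prob P {H. cdegree H = 1} = expect P (indicator {H. cdegree H = 1})" by simp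
 also have "... <= expect P (%H. rdeg H ^ 3 - 4 * rdeg H ^ 2 + 4 * rdeg H)"
 proof (rule integral_mono)
  show "integrable (measure_pmf P) (indicator {H. cdegree H = 1} :: _ => real)" by (rule pmf_integrable_indicator)
  show "indicator {H. cdegree H = 1} H <= rdeg H ^ 3 - 4 * rdeg H ^ 2 + 4 * rdeg H" for H
  proof -
   have "rdeg H ^ 3 - 4 * rdeg H ^ 2 + 4 * rdeg H = rdeg H * (rdeg H - 2)^2"
    by (simp add: power2_eq_square power3_eq_cube algebra_simps)
   then show ?thesis by (auto simp: indicator_def)
  qed
 qed (use i in auto)
 also have "... = ED3 - 4 * ED2 + 4 * ED" using i by (simp add: ED_def ED2_def ED3_def)
 finally have "ED3 - 4 * ED > 0" using IC2b mean_limit(2) by simp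
 then have "ED * (ED3 - 4 * ED) > 0" using ED_pos by simp
 then show ?thesis by (simp add: \<eta>_def mean_limit(2) power2_eq_square algebra_simps)
qed

definition \<sigma> where "\<sigma> = sqrt \<eta> / ED"
lemma \<sigma>_pos: "\<sigma> > 0" using \<eta>_pos ED_pos by (simp add: \<sigma>_def)
lemma \<sigma>2: "\<sigma>^2 = ED3 / ED - 4"
 using \<eta>_pos ED_pos by (simp add: \<sigma>_def power_divide \<eta>_def mean_limit(2)) (simp add: field_simps power2_eq_square)

definition dmax :: "nat => nat" where "dmax n = Max (insert 0 ((%i. cdegree (Hs n i)) ` {..<n}))"

lemma dmax_ge: "i < n ==> cdegree (Hs n i) <= dmax n" unfolding dmax_def by (intro Max_ge) auto

lemma csize_le: "i < n ==> csize (Hs n i) <= max_size (Hs n) n" unfolding max_size_def by (intro Max_ge) auto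

text \<open>Eventually the communities outside a finite set have cubed degrees of total less than
  \<open>\<epsilon> * n / 2\<close>, so no single one exceeds this; inside the finite set degrees
  are bounded. It is convergence of the third moments that excludes a few huge degrees.\<close>

lemma dmax_limit: "(%n. real (dmax n) / a n) \<longlonglongrightarrow> 0"
proof -
 have "(%n. real (dmax n) ^ 3 / real n) \<longlonglongrightarrow> 0"
 proof (rule LIMSEQ_I)
  fix \<epsilon> :: real assume \<epsilon>: "\<epsilon> > 0"
  obtain A where A: "finite A" "expect P (%H. rdeg H ^ 3 * indicator (- A) H) < \<epsilon> / 2"
   using integrable_finite_tail[OF IC1_int, of "\<epsilon>/2"] \<epsilon> by auto
  define b where "b = (\<Sum>H\<in>A. rdeg H ^ 3)"
  have "(%n. emp Hs n (%H. rdeg H ^ 3 * indicator (- A) H)) \<longlonglongrightarrow> expect P (%H. rdeg H ^ 3 * indicator (- A) H)"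
   by (rule emp_mean_dominated[OF CR1 IC1_int _ IC1]) (auto simp: indicator_def)
  then have e1: "EVTL n. emp Hs n (%H. rdeg H ^ 3 * indicator (- A) H) < \<epsilon> / 2" using A(2) by (rule order_tendstoD)
  have "(%n. b / real n) \<longlonglongrightarrow> 0" by (rule lim_const_over_n)
  then have e2: "EVTL n. b / real n < \<epsilon> / 2" using \<epsilon> by (intro order_tendstoD(2)) auto
  have "EVTL n. norm (real (dmax n) ^ 3 / real n - 0) < \<epsilon>"
   using e1 e2 eventually_gt_at_top[of 0]
  proof eventually_elim
   case (elim n)
   have "dmax n \<in> insert 0 ((%i. cdegree (Hs n i)) ` {..<n})" unfolding dmax_def by (rule Max_in) auto
   then consider "dmax n = 0" | i where "i < n" "dmax n = cdegree (Hs n i)" by auto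
   then have "real (dmax n) ^ 3 <= b + (\<Sum>i<n. d n i ^ 3 * indicator (- A) (Hs n i))"
   proof cases
    case 1
    then show ?thesis by (simp add: b_def sum_nonneg)
   next
    case 2
    have s0: "0 <= (\<Sum>i<n. d n i ^ 3 * indicator (- A) (Hs n i))" by (rule sum_nonneg) simp
    show ?thesis
    proof (cases "Hs n i \<in> A")
     case True
     then have "d n i ^ 3 <= b" unfolding b_def using A(1) by (intro member_le_sum) auto
     then show ?thesis using 2 s0 by simp
    next
     case False
     have "d n i ^ 3 * indicator (- A) (Hs n i) <= (\<Sum>i<n. d n i ^ 3 * indicator (- A) (Hs n i))" using 2 by (intro member_le_sum) auto
     moreover have "0 <= b" by (simp add: b_def sum_nonneg)
     ultimately show ?thesis using 2 False by simp
    qed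
   qed
   then have "real (dmax n) ^ 3 / real n <= b / real n + emp Hs n (%H. rdeg H ^ 3 * indicator (- A) H)"
    using elim by (simp add: emp_mean_def add_divide_distrib[symmetric] divide_right_mono)
   moreover have "0 <= real (dmax n) ^ 3 / real n" by simp
   ultimately show ?case unfolding real_norm_def using elim(1,2) by linarith
  qed
  then show "EX no. ALL n>=no. norm (real (dmax n) ^ 3 / real n - 0) < \<epsilon>" by (simp add: eventually_sequentially)
 qed
 then have "(%n. root 3 (real (dmax n) ^ 3 / real n)) \<longlonglongrightarrow> root 3 0" by (intro tendsto_real_root)
 moreover have "root 3 (real (dmax n) ^ 3 / real n) = real (dmax n) / a n" for n
 proof -
  have "real (dmax n) ^ 3 / real n = (real (dmax n) / a n) ^ 3" by (simp add: a3 power_divide)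
  then show ?thesis by (simp add: odd_real_root_power_cancel)
 qed
 ultimately show ?thesis by simp
qed

lemma smax_limit: "(%n. real (max_size (Hs n) n) / (a n)^2) \<longlonglongrightarrow> 0"
proof (rule tendsto_0_le[OF CR4, where K = 1])
 show "EVTL n. norm (real (max_size (Hs n) n) / (a n)^2) <= norm (real (max_size (Hs n) n) * ln (real n) / real n powr (2/3)) * 1"
  using eventually_ge_at_top[of 3]
 proof eventually_elim
  case (elim n)
  have "1 <= ln (real n)"
  proof -
   have "exp 1 <= real n" using exp_le elim by linarith
   then show ?thesis using elim by (subst ln_ge_iff) auto
  qed
  then have "real (max_size (Hs n) n) * 1 <= real (max_size (Hs n) n) * ln (real n)" by (intro mult_left_mono) auto
  then show ?case using \<open>1 <= ln (real n)\<close> by (simp add: a2 divide_right_mono)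
 qed
qed

end

lemma replicate_cover: "exploration_walk (hcm_halfedges Hs n) fst [0..<n]"
 if "!!i. i < n ==> valid_community (Hs i)" "even (total_halfedges Hs n)" "total_halfedges Hs n > 0"
proof -
 interpret hcm Hs n by unfold_locales (rule that(1))
 show ?thesis by unfold_locales (use halfedges_community card_halfedges that in auto)
qed

context critical
begin

definition \<zeta> :: "nat => nat \<times> nat \<times> nat => real" where "\<zeta> n e = d n (fst e) - mean n"

lemma halfedge_mean:
 assumes "total_halfedges (Hs n) n > 0"
 shows "expect (hp n) (%e. F (fst e)) = (\<Sum>i<n. d n i * F i) / lh n"
  and "finite (set_pmf (hp n))"
  and "e \<in> set_pmf (hp n) ==> fst e < n"
proof -
 interpret H: hcm "Hs n" n by unfold_locales (rule valid_seq)
 interpret W: exploration_walk "hcm_halfedges (Hs n) n" fst "[0..<n]" by (rule replicate_cover[OF valid_seq even_l assms])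
 show "expect (hp n) (%e. F (fst e)) = (\<Sum>i<n. d n i * F i) / lh n"
  using W.avg[of F] H.wsum_eq[OF W.exploration_walk_axioms] by (simp add: W.ell_def H.card_halfedges)
 show "finite (set_pmf (hp n))" using H.finE W.E_ne by simp
 show "e \<in> set_pmf (hp n) ==> fst e < n"
  using H.halfedges_community H.finE W.E_ne by auto
qed

lemma eventually_halfedges: "EVTL n. total_halfedges (Hs n) n > 0 & n > 0"
 using order_tendstoD(1)[OF lim1 ED_pos] eventually_gt_at_top[of 0]
 by eventually_elim (auto simp: zero_less_divide_iff halfedges[symmetric])

lemma centred:
 assumes "total_halfedges (Hs n) n > 0"
 shows "expect (hp n) (\<zeta> n) = 0"
  and "expect (hp n) (%e. (\<zeta> n e)^2) = (\<Sum>i<n. d n i ^ 3) / lh n - (mean n)^2"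
  and "e \<in> set_pmf (hp n) ==> \<bar>\<zeta> n e\<bar> <= real (dmax n)"
proof -
 let ?l = "lh n"
 have l: "?l > 0" "?l = (\<Sum>i<n. d n i)" using assms by simp (rule halfedges)
 have s1: "(\<Sum>i<n. d n i * d n i) = mean n * ?l" using l by (simp add: mean_def power2_eq_square)
 have "expect (hp n) (\<zeta> n) = (\<Sum>i<n. d n i * (d n i - mean n)) / ?l"
  using halfedge_mean(1)[OF assms, of "%i. d n i - mean n"] by (simp add: \<zeta>_def[abs_def])
 also have "(\<Sum>i<n. d n i * (d n i - mean n)) = 0"
  using s1 l(2) by (simp add: right_diff_distrib sum_subtractf sum_distrib_left mult.commute)
 finally show "expect (hp n) (\<zeta> n) = 0" by simp
 have "expect (hp n) (%e. (\<zeta> n e)^2) = (\<Sum>i<n. d n i * (d n i - mean n)^2) / ?l"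
  using halfedge_mean(1)[OF assms, of "%i. (d n i - mean n)^2"] by (simp add: \<zeta>_def[abs_def])
 also have "(\<Sum>i<n. d n i * (d n i - mean n)^2) = (\<Sum>i<n. d n i ^ 3 - 2 * mean n * (d n i * d n i) + (mean n)^2 * d n i)"
  by (intro sum.cong refl) (simp add: power2_eq_square power3_eq_cube algebra_simps)
 also have "... = (\<Sum>i<n. d n i ^ 3) - 2 * mean n * (\<Sum>i<n. d n i * d n i) + (mean n)^2 * (\<Sum>i<n. d n i)"
  by (simp add: sum.distrib sum_subtractf sum_distrib_left)
 also have "... = (\<Sum>i<n. d n i ^ 3) - (mean n)^2 * ?l" unfolding s1 l(2)[symmetric] by (simp add: power2_eq_square)
 finally show "expect (hp n) (%e. (\<zeta> n e)^2) = (\<Sum>i<n. d n i ^ 3) / ?l - (mean n)^2"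
  using l(1) by (simp add: diff_divide_distrib)
 assume e: "e \<in> set_pmf (hp n)"
 have "(\<Sum>i<n. d n i * d n i) <= (\<Sum>i<n. real (dmax n) * d n i)" using dmax_ge by (intro sum_mono mult_right_mono) auto
 then have "mean n * ?l <= real (dmax n) * ?l" unfolding s1 l(2) by (simp add: sum_distrib_left)
 then have "mean n <= real (dmax n)" using l(1) by simp
 moreover have "mean n >= 0" unfolding mean_def by (intro divide_nonneg_nonneg sum_nonneg) auto
 moreover have "d n (fst e) <= real (dmax n)" using halfedge_mean(3)[OF assms e] dmax_ge by simp
 moreover have "0 <= d n (fst e)" by simp
 ultimately show "\<bar>\<zeta> n e\<bar> <= real (dmax n)" unfolding \<zeta>_def by linarith
qed

lemma variance_limit: "(%n. (\<Sum>i<n. d n i ^ 3) / lh n - (mean n)^2) \<longlonglongrightarrow> \<sigma>^2"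
proof -
 have "(%n. (\<Sum>i<n. d n i ^ 3) / lh n - (mean n)^2) \<longlonglongrightarrow> ED3 / ED - 2^2"
  by (intro tendsto_intros ratio_limit lim3 mean_limit)
 then show ?thesis by (simp add: \<sigma>2)
qed

lemma donsker_walk:
 fixes \<Phi> :: "(real => real) => real" and B :: "'w => real => real"
 assumes BM: "std_brownian_motion M B" and T: "T > 0"
  and \<Phi>: "!!f. \<bar>\<Phi> f\<bar> <= C" "!!f h \<delta>. \<delta> >= 0 ==> (!!t. t \<in> {0..T} ==> \<bar>f t - h t\<bar> <= \<delta>) ==> \<bar>\<Phi> f - \<Phi> h\<bar> <= \<Lambda> * \<delta>"
 shows "(%n. expect (replicate_pmf (nfl (T * (a n)^2)) (hp n))
   (%xs. \<Phi> (%t. iid.ssum (\<zeta> n) (take (nfl (t * (a n)^2)) xs) / a n))) \<longlonglongrightarrow> integral\<^sup>L M (%\<omega>. \<Phi> (%t. \<sigma> * B \<omega> t))"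
  and "(%\<omega>. \<Phi> (%t. \<sigma> * B \<omega> t)) \<in> borel_measurable M"
proof -
 \<comment> \<open>The array is shifted, since for small \<open>n\<close> there may be no half-edges
   to draw from.\<close>
 obtain n0 where n0: "!!n. n >= n0 ==> total_halfedges (Hs n) n > 0 & n > 0"
  using eventually_halfedges by (auto simp: eventually_sequentially)
 have g: "total_halfedges (Hs (n + n0)) (n + n0) > 0" "n + n0 > 0" for n using n0[of "n + n0"] by auto
 have l: "(%n. F (n + n0)) \<longlonglongrightarrow> x" if "F \<longlonglongrightarrow> x" for F :: "nat => real" and x using that by (rule LIMSEQ_ignore_initial_segment)
 interpret triangular_array "%n. hp (n + n0)" "%n. \<zeta> (n + n0)" "%n. a (n + n0)" "%n. real (dmax (n + n0))" \<sigma>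
 proof
  show "filterlim (%n. a (n + n0)) at_top sequentially"
   using filterlim_compose[OF a_at_top filterlim_add_const_nat_at_top] by simp
  show "(%n. expect (hp (n + n0)) (%e. (\<zeta> (n + n0) e)^2)) \<longlonglongrightarrow> \<sigma>^2"
   unfolding centred(2)[OF g(1)] by (rule l[OF variance_limit])
  show "a (n + n0) > 0" for n using g(2)[of n] by (simp add: a_def del: of_nat_add)
 qed (rule halfedge_mean(2)[OF g(1)] centred(1)[OF g(1)] centred(3)[OF g(1)] l[OF dmax_limit] \<sigma>_pos | assumption)+
 show "(%n. expect (replicate_pmf (nfl (T * (a n)^2)) (hp n))
   (%xs. \<Phi> (%t. iid.ssum (\<zeta> n) (take (nfl (t * (a n)^2)) xs) / a n))) \<longlonglongrightarrow> integral\<^sup>L M (%\<omega>. \<Phi> (%t. \<sigma> * B \<omega> t))"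
  by (rule LIMSEQ_offset[where k = n0]) (rule donsker[OF BM T \<Phi>])
 show "(%\<omega>. \<Phi> (%t. \<sigma> * B \<omega> t)) \<in> borel_measurable M" by (rule donsker_measurable[OF BM T \<Phi>])
qed

definition \<theta> where "\<theta> = \<eta> / (2 * ED ^ 3)"
definition h :: "real => real" where "h t = lam * t - \<theta> * t^2"
definition \<kappa>' where "\<kappa>' = ES powr (-2/3) * (EDS / ED)"
definition cc :: "nat => real" where "cc n = real (total_vertices (Hs n) n) powr (-2/3)"
definition \<delta> :: "nat => real" where "\<delta> n = 1 / a n + real (dmax n) / a n + real (max_size (Hs n) n) / (a n)^2"
text \<open>In units of \<open>a n\<close>, the order \<open>T\<close> of the starts and the order
  \<open>sqrt T\<close> of the fluctuations are both small against \<open>\<beta> T\<close>, which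
  in turn is small against the drift of order \<open>T^2\<close>.\<close>

definition \<beta> :: "real => real" where "\<beta> T = T * sqrt T"
definition M0 :: "real => real => nat" where "M0 T x = nat \<lceil>2 * (EDS / ED + 1) * T / x\<rceil> + 1"
definition KK :: "real => real" where "KK T = 7 + T + 1 / ED + ED3 + EDS + \<bar>lam\<bar>"
text \<open>The error that remains as \<open>n\<close> grows: the centred sum too high at time
  \<open>T\<close>, starts of too large total degree, and a large component that meets no
  start.\<close>

definition bad :: "real => real => real" where
 "bad T x = T * (ED3 / ED + 1) / (\<beta> T)^2 + 2 * T * (EDS / ES + 1) / \<beta> T + real (M0 T x) * exp (- (T * x / (ES + 1)))"

lemma \<theta>_pos: "\<theta> > 0" using \<eta>_pos ED_pos by (simp add: \<theta>_def)
lemma \<kappa>'_pos: "\<kappa>' > 0" using EDS_pos ED_pos ES_pos by (simp add: \<kappa>'_def)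
lemma ED3_nonneg: "ED3 >= 0" unfolding ED3_def by (rule Bochner_Integration.integral_nonneg) simp

lemma \<delta>_limit: "\<delta> \<longlonglongrightarrow> 0"
proof -
 have "(%n. 1 / a n + real (dmax n) / a n + real (max_size (Hs n) n) / (a n)^2) \<longlonglongrightarrow> 0 + 0 + 0"
  by (intro tendsto_add a_inv dmax_limit smax_limit)
 then show ?thesis by (simp add: \<delta>_def[abs_def])
qed

lemma drift_uniform:
 assumes T: "T >= 0" and \<epsilon>: "\<epsilon> > 0"
 shows "EVTL n. ALL t:{0..T}. \<bar>walk_drift (d n) n (lh n) (a n) t - h t\<bar> <= \<epsilon>"
proof -
 define A where "A n = (mean n - 2) * a n" for n
 define W where "W n = (\<Sum>i<n. d n i * (d n i * (d n i - 2))) / lh n" for n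
 define Bn where "Bn n = W n * (real n / lh n) / 2" for n
 have W: "W \<longlonglongrightarrow> (ED3 - 2 * ED2) / ED"
 proof -
  have "(\<Sum>i<n. d n i * (d n i * (d n i - 2))) / real n = (\<Sum>i<n. d n i ^ 3) / real n - 2 * ((\<Sum>i<n. d n i ^ 2) / real n)" for n
  proof -
   have "(\<Sum>i<n. d n i * (d n i * (d n i - 2))) = (\<Sum>i<n. d n i ^ 3) - 2 * (\<Sum>i<n. d n i ^ 2)"
    by (simp add: sum_subtractf[symmetric] sum_distrib_left power2_eq_square power3_eq_cube algebra_simps)
   then show ?thesis by (simp add: diff_divide_distrib)
  qed
  then have "(%n. (\<Sum>i<n. d n i * (d n i * (d n i - 2))) / real n) \<longlonglongrightarrow> ED3 - 2 * ED2"
   using tendsto_diff[OF lim3 tendsto_mult[OF tendsto_const lim2]] by simp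
  then show ?thesis unfolding W_def[abs_def] by (rule ratio_limit)
 qed
 have one: "(%n. real n / real n) \<longlonglongrightarrow> 1"
  by (rule tendsto_eventually) (use eventually_gt_at_top[of 0] in eventually_elim, simp)
 have Bl: "Bn \<longlonglongrightarrow> \<theta>"
 proof -
  have "Bn \<longlonglongrightarrow> (ED3 - 2 * ED2) / ED * (1 / ED) / 2" unfolding Bn_def[abs_def] by (intro tendsto_intros W ratio_limit one) simp
  \<comment> \<open>Criticality, \<open>ED2 = 2 * ED\<close>, turns the limit into the coefficient
    of the parabola.\<close>
  moreover have "(ED3 - 2 * ED2) / ED * (1 / ED) / 2 = \<theta>"
   unfolding \<theta>_def \<eta>_def mean_limit(2) using ED_pos by (simp add: field_simps power2_eq_square power3_eq_cube)
  ultimately show ?thesis by simp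
 qed
 have Al: "A \<longlonglongrightarrow> lam" unfolding A_def[abs_def] by (rule drift)
 define err where "err n = T * \<bar>A n - lam\<bar> + \<bar>lam\<bar> * (1 / a n * (1 / a n)) + T^2 * \<bar>Bn n - \<theta>\<bar> + \<theta> * (2 * T) * (1 / a n * (1 / a n))" for n
 have "err \<longlonglongrightarrow> T * \<bar>lam - lam\<bar> + \<bar>lam\<bar> * (0 * 0) + T^2 * \<bar>\<theta> - \<theta>\<bar> + \<theta> * (2 * T) * (0 * 0)"
  unfolding err_def[abs_def] by (intro tendsto_intros Al Bl a_inv)
 then have "err \<longlonglongrightarrow> 0" by simp
 then have "EVTL n. err n < \<epsilon>" using \<epsilon> by (rule order_tendstoD(2))
 then show ?thesis using eventually_halfedges
 proof eventually_elim
  case (elim n)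
  show ?case
  proof
   fix t assume t: "t \<in> {0..T}"
   define r where "r = real (nfl (t * (a n)^2)) / (a n)^2"
   have an: "a n > 0" using elim by (simp add: a_def)
   have fl: "real (nfl (t * (a n)^2)) <= t * (a n)^2" "t * (a n)^2 < real (nfl (t * (a n)^2)) + 1"
    using t an by (auto simp: of_nat_nat)
   have r: "0 <= r" "r <= t" using fl an by (auto simp: r_def pos_divide_le_eq)
   have "(t - r) * (a n)^2 <= 1" using fl(2) an by (simp add: r_def left_diff_distrib)
   then have "t - r <= 1 / (a n)^2" using an by (simp add: pos_le_divide_eq)
   then have r3: "t - r <= 1 / a n * (1 / a n)" by (simp add: power2_eq_square)
   note r = r r3
   have l: "real (nfl (t * (a n)^2)) = r * (a n)^2" using an by (simp add: r_def)
   have n3: "real n = a n ^ 3" by (simp add: a3)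
   have "(real (nfl (t * (a n)^2)) * (mean n - 2) - W n * (real (nfl (t * (a n)^2)))^2 / (2 * lh n)) / a n = r * A n - r^2 * Bn n"
    unfolding l Bn_def A_def n3 using an elim by (simp add: field_simps power2_eq_square power3_eq_cube)
   moreover have "\<bar>(r * A n - r^2 * Bn n) - h t\<bar> <= err n"
   proof -
    have "(r * A n - r^2 * Bn n) - h t = r * (A n - lam) + lam * (r - t) - r^2 * (Bn n - \<theta>) + \<theta> * ((t + r) * (t - r))"
     by (simp add: h_def algebra_simps power2_eq_square)
    moreover have "\<bar>r * (A n - lam)\<bar> <= T * \<bar>A n - lam\<bar>" using r t by (simp add: abs_mult mult_right_mono)
    moreover have "\<bar>lam * (r - t)\<bar> <= \<bar>lam\<bar> * (1 / a n * (1 / a n))" unfolding abs_mult using r by (intro mult_left_mono) auto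
    moreover have "\<bar>r^2 * (Bn n - \<theta>)\<bar> <= T^2 * \<bar>Bn n - \<theta>\<bar>" unfolding abs_mult using r t by (intro mult_right_mono) (auto intro: power_mono)
    moreover have "\<bar>\<theta> * ((t + r) * (t - r))\<bar> <= \<theta> * (2 * T) * (1 / a n * (1 / a n))"
    proof -
     have "(t + r) * (t - r) <= (2 * T) * (1 / a n * (1 / a n))" using r t T by (intro mult_mono) auto
     moreover have "0 <= (t + r) * (t - r)" using r t by (intro mult_nonneg_nonneg) auto
     ultimately have "\<theta> * ((t + r) * (t - r)) <= \<theta> * ((2 * T) * (1 / a n * (1 / a n)))" "0 <= \<theta> * ((t + r) * (t - r))"
      using \<theta>_pos by (auto intro: mult_left_mono simp del: times_divide_eq_right)
     then show ?thesis by (simp only: abs_of_nonneg mult.assoc)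
    qed
    moreover have "\<bar>x1 + x2 - x3 + x4\<bar> <= y1 + y2 + y3 + y4" if "\<bar>x1\<bar> <= y1" "\<bar>x2\<bar> <= y2" "\<bar>x3\<bar> <= y3" "\<bar>x4\<bar> <= y4"
     for x1 x2 x3 x4 y1 y2 y3 y4 :: real using that by linarith
    ultimately show ?thesis unfolding err_def by simp
   qed
   ultimately show "\<bar>walk_drift (d n) n (lh n) (a n) t - h t\<bar> <= \<epsilon>"
    using elim(1) unfolding W_def[symmetric] mean_def[symmetric] by linarith
  qed
 qed
qed

lemma scaling_limit: "(%n. cc n * (a n)^2) \<longlonglongrightarrow> ES powr (-2/3)"
proof (rule Lim_transform_eventually)
 show "(%n. ((\<Sum>i<n. s n i) / real n) powr (-2/3)) \<longlonglongrightarrow> ES powr (-2/3)"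
  using ES_pos by (intro tendsto_powr limS tendsto_const) simp
 show "EVTL n. ((\<Sum>i<n. s n i) / real n) powr (-2/3) = cc n * (a n)^2"
  using eventually_gt_at_top[of 0]
 proof eventually_elim
  case (elim n)
  have "((\<Sum>i<n. s n i) / real n) powr (-2/3) = (\<Sum>i<n. s n i) powr (-2/3) / real n powr (-2/3)"
   by (rule powr_divide)
  also have "... = cc n * (a n)^2"
   using elim by (simp add: cc_def vertices a2 powr_minus_divide)
  finally show ?case .
 qed
qed

lemma vertex_ratio:
 assumes "(%n. F n / real n) \<longlonglongrightarrow> l"
 shows "(%n. F n / real (total_vertices (Hs n) n)) \<longlonglongrightarrow> l / ES"
proof (rule Lim_transform_eventually)
 show "(%n. (F n / real n) / ((\<Sum>i<n. s n i) / real n)) \<longlonglongrightarrow> l / ES" using ES_pos by (intro tendsto_divide assms limS) simp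
 show "EVTL n. F n / real n / ((\<Sum>i<n. s n i) / real n) = F n / real (total_vertices (Hs n) n)"
  using eventually_gt_at_top[of 0] by eventually_elim (simp add: vertices)
qed

lemma KK: "T >= 0 ==> 1 <= KK T" "T <= KK T" "T >= 0 ==> 1 / ED + 1 <= KK T" "T >= 0 ==> ED3 + 1 <= KK T" "T >= 0 ==> EDS + 1 <= KK T" "T >= 0 ==> \<bar>lam\<bar> + 1 <= KK T"
proof -
 have "1 / ED > 0" "EDS > 0" "ED3 >= 0" "\<bar>lam\<bar> >= 0" using ED_pos EDS_pos ED3_nonneg by auto
 then show "T >= 0 ==> 1 <= KK T" "T <= KK T" "T >= 0 ==> 1 / ED + 1 <= KK T" "T >= 0 ==> ED3 + 1 <= KK T" "T >= 0 ==> EDS + 1 <= KK T" "T >= 0 ==> \<bar>lam\<bar> + 1 <= KK T"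
  unfolding KK_def by linarith+
qed

lemma eventually_estimate:
 fixes \<phi> :: "(nat => real) => real"
 assumes T: "T >= 1" "2 * \<beta> T + h T + 3 * \<epsilon> < 0" and \<epsilon>: "\<epsilon> > 0" "\<epsilon> <= x / 8"
  and C: "!!y. \<bar>\<phi> y\<bar> <= C" and Lip: "!!y z. \<bar>\<phi> y - \<phi> z\<bar> <= \<Lambda> * dist y z" "\<Lambda> >= 0" and k: "k >= 0"
 shows "EVTL n. hcm_estimate (Hs n) n (a n) (KK T) (\<delta> n) T x \<epsilon> C \<Lambda> k (cc n) \<kappa>' (\<beta> T)
  ((ES powr (-2/3) + 1) * (2 * x) + x) (EDS / ES + 1) (ES + 1) (ED3 / ED + 1) (dmax n) (M0 T x) h \<phi>"
proof -
 have x: "x > 0" using \<epsilon> by linarith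
 have K1: "KK T >= 1" using KK(1)[of T] T by simp
 have lt: "EVTL n. F n <= y" if "F \<longlonglongrightarrow> l" "l < y" for F :: "nat => real" and l y
  using order_tendstoD(2)[OF that] by eventually_elim simp
 have gt: "EVTL n. y <= F n" if "F \<longlonglongrightarrow> l" "y < l" for F :: "nat => real" and l y
  using order_tendstoD(1)[OF that] by eventually_elim simp
 have Kinv: "1 / KK T < ED"
 proof -
  have "1 / ED < KK T" using KK(3)[of T] T by simp
  then show ?thesis using ED_pos K1 by (simp add: field_simps)
 qed
 have e1: "EVTL n. a n >= 1" using a_at_top by (auto simp: filterlim_at_top)
 have e2: "EVTL n. \<delta> n <= 1 / (10 * (KK T)^2)" by (rule lt[OF \<delta>_limit]) (use K1 in auto)
 have e3: "EVTL n. 1 / KK T <= (\<Sum>i<n. d n i) / real n" by (rule gt[OF lim1 Kinv])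
 have e4: "EVTL n. (\<Sum>i<n. d n i ^ 3) / real n <= KK T" by (rule lt[OF lim3]) (use KK(4)[of T] T in simp)
 have e5: "EVTL n. (\<Sum>i<n. d n i * s n i) / real n <= KK T" by (rule lt[OF limDS]) (use KK(5)[of T] T in simp)
 have e6: "EVTL n. \<bar>(mean n - 2) * a n\<bar> <= KK T" by (rule lt[OF tendsto_rabs[OF drift]]) (use KK(6)[of T] T in simp)
 have e7: "EVTL n. real (dmax n) / a n <= \<epsilon>" by (rule lt[OF dmax_limit]) (use \<epsilon> in simp)
 have e8: "EVTL n. \<delta> n <= x / 4" by (rule lt[OF \<delta>_limit]) (use x in simp)
 have e9: "EVTL n. cc n * (a n)^2 <= ES powr (-2/3) + 1" by (rule lt[OF scaling_limit]) simp
 have kl: "(%n. (\<Sum>i<n. d n i * s n i) / lh n) \<longlonglongrightarrow> EDS / ED" by (rule ratio_limit[OF limDS])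
 have "(%n. \<bar>cc n * (a n)^2 * ((\<Sum>i<n. d n i * s n i) / lh n) - \<kappa>'\<bar> * T) \<longlonglongrightarrow> \<bar>ES powr (-2/3) * (EDS / ED) - \<kappa>'\<bar> * T"
  by (intro tendsto_intros scaling_limit kl)
 then have e10: "EVTL n. \<bar>cc n * (a n)^2 * ((\<Sum>i<n. d n i * s n i) / lh n) - \<kappa>'\<bar> * T <= x"
  by (rule lt) (use x in "simp add: \<kappa>'_def")
 have e11: "EVTL n. (\<Sum>i<n. d n i * s n i) / lh n <= EDS / ED + 1" by (rule lt[OF kl]) simp
 have e12: "EVTL n. (\<Sum>i<n. s n i * d n i) / real (total_vertices (Hs n) n) <= EDS / ES + 1"
  by (rule lt[OF vertex_ratio]) (use limDS in "auto simp: mult.commute")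
 have e13: "EVTL n. (\<Sum>i<n. s n i) / real n <= ES + 1" by (rule lt[OF limS]) simp
 have e14: "EVTL n. (\<Sum>i<n. d n i ^ 3) / lh n <= ED3 / ED + 1" by (rule lt[OF ratio_limit[OF lim3]]) simp
 have e15: "EVTL n. ALL t:{0..T}. \<bar>walk_drift (d n) n (lh n) (a n) t - h t\<bar> <= \<epsilon>"
  by (rule drift_uniform) (use T \<epsilon> in auto)
 show ?thesis
  using eventually_halfedges e1 e2 e3 e4 e5 e6 e7 e8 e9 e10 e11 e12 e13 e14 e15
 proof eventually_elim
  case (elim n)
  have n: "n > 0" "total_halfedges (Hs n) n > 0" and an: "a n >= 1" using elim by auto
  have an0: "a n > 0" using an by simp
  have nn: "real n > 0" "(a n) ^ 3 = real n" using n a3 by auto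
  have D1: "real (dmax n) / a n <= \<delta> n" and S1: "real (max_size (Hs n) n) / (a n)^2 <= \<delta> n" and A1: "1 / a n <= \<delta> n"
   using an0 by (auto simp: \<delta>_def)
  show ?case
  proof
   show "a n ^ 3 / KK T <= lh n"
    using elim(4) nn K1 unfolding halfedges by (simp add: pos_le_divide_eq)
   show "(\<Sum>i<n. d n i ^ 3) <= KK T * a n ^ 3" "(\<Sum>i<n. d n i * s n i) <= KK T * a n ^ 3"
    using elim(5,6) nn by (simp_all add: pos_divide_le_eq)
   show "real (dmax n) <= \<delta> n * a n" using D1 an0 by (simp add: pos_divide_le_eq)
   show "s n i <= \<delta> n * (a n)^2" if "i < n" for i
   proof -
    have "s n i <= real (max_size (Hs n) n)" using csize_le[OF that] by simp
    then show ?thesis using S1 an0 by (simp add: pos_divide_le_eq)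
   qed
   show "\<bar>(\<Sum>i<n. d n i ^ 2) / lh n - 2\<bar> <= KK T / a n"
    using elim(7) an0 unfolding mean_def[symmetric] by (simp add: abs_mult pos_le_divide_eq)
   show "real (dmax n) <= \<epsilon> * a n" using elim(8) an0 by (simp add: pos_divide_le_eq)
   show "2 * \<epsilon> + \<delta> n <= x / 2" using elim(9) \<epsilon> by linarith
   show "0 <= cc n" by (simp add: cc_def)
   have "cc n * (a n)^2 * (2 * x) <= (ES powr (-2/3) + 1) * (2 * x)" using elim(10) x by (intro mult_right_mono) auto
   then show "cc n * (a n)^2 * (2 * x) + \<bar>cc n * (a n)^2 * ((\<Sum>i<n. d n i * s n i) / lh n) - \<kappa>'\<bar> * T <= (ES powr (-2/3) + 1) * (2 * x) + x"
    using elim(11) by linarith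
   show "0 < \<beta> T" using T by (simp add: \<beta>_def)
   have "2 * ((\<Sum>i<n. d n i * s n i) / lh n) * T / x <= 2 * (EDS / ED + 1) * T / x"
    using elim(12) T x by (intro divide_right_mono mult_right_mono mult_left_mono) auto
   also have "... < real (M0 T x)" unfolding M0_def by linarith
   finally show "2 * ((\<Sum>i<n. d n i * s n i) / lh n) * T / x < real (M0 T x)" .
   show "real (total_vertices (Hs n) n) <= (ES + 1) * a n ^ 3" using elim(14) nn unfolding vertices by (simp add: pos_divide_le_eq)
  qed (use n an K1 A1 elim(3) T KK(2)[of T] C Lip k \<epsilon> x elim(13,15,16) dmax_ge valid_seq even_l \<kappa>'_pos in "auto simp: mult.commute")
 qed
qed

end

section \<open>Passage to the limit\<close>

locale critical_bm = critical lam Hs P for lam Hs P +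
 fixes M :: "'w measure" and B :: "'w => real => real"
 assumes BM: "std_brownian_motion M B"
begin

lemma h_cont: "continuous_on A h" unfolding h_def[abs_def] by (intro continuous_intros)

sublocale D: drifted_bm M B \<sigma> h by unfold_locales (rule BM \<sigma>_pos h_cont)+

abbreviation EY :: "nat => ((nat => real) => real) => real" where
 "EY n \<phi> \<equiv> expect (hcm_pairing_pmf (Hs n) n) (%m. \<phi> (%j. cc n * ordered_comp_sizes (Hs n) n m j))"

definition Y :: "'w => nat => real" where "Y \<omega> j = \<kappa>' * rk (excursions (reflected (D.f \<omega>))) glen j"

definition slack :: "real => real" where "slack x = (ES powr (-2/3) + 1) * (2 * x) + x"

definition IC :: "real => real => ((nat => real) => real) => real => 'w => real" where
 "IC T C \<phi> k \<omega> = infconv T \<kappa>' h C \<phi> k (%t. \<sigma> * B \<omega> t)"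

lemma IC_measurable:
 assumes "!!y. \<bar>\<phi> y\<bar> <= C" "k >= 0" "T > 0"
 shows "IC T C \<phi> k \<in> borel_measurable M"
 unfolding IC_def[abs_def]
 by (rule donsker_walk(2)[OF BM assms(3), where C = C and \<Lambda> = "2 * k"])
  (rule infconv_abs[where \<phi> = \<phi>, OF assms(1,2)], rule infconv_Lipschitz[where \<phi> = \<phi>, OF assms(1,2)], assumption, blast)

lemma main_inequality:
 assumes T: "T >= 1" "2 * \<beta> T + h T + 3 < 0" and x: "x > 0"
  and C: "!!y. \<bar>\<phi> y\<bar> <= C" and Lip: "!!y z. \<bar>\<phi> y - \<phi> z\<bar> <= \<Lambda> * dist y z" "\<Lambda> >= 0" and k: "k >= 0" and \<gamma>: "\<gamma> > 0"
 shows "EVTL n. integral\<^sup>L M (IC T C \<phi> k) - 2 * \<Lambda> * slack x - 2 * C * bad T x - \<gamma> <= EY n \<phi>"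
proof -
 \<comment> \<open>The three bounds serve in turn the sign condition at time \<open>T\<close>, the
   inequality \<open>2 * \<epsilon> + \<delta> n \<le> x / 2\<close> once
   \<open>\<delta> n \<le> x / 4\<close>, and the bound \<open>\<gamma> / 4\<close> on the penalty
   \<open>5 * k * \<epsilon>\<close>.\<close>
 define \<epsilon> where "\<epsilon> = min 1 (min (x / 8) (\<gamma> / (20 * (k + 1))))"
 have \<epsilon>: "\<epsilon> > 0" "\<epsilon> <= 1" "\<epsilon> <= x / 8" "\<epsilon> <= \<gamma> / (20 * (k + 1))"
  using x \<gamma> k unfolding \<epsilon>_def by (auto simp del: distrib_left_numeral divide_le_eq_numeral1 simp: min_le_iff_disj)
 have T': "2 * \<beta> T + h T + 3 * \<epsilon> < 0" using T(2) \<epsilon>(2) by linarith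
 have "(k + 1) * \<epsilon> <= (k + 1) * (\<gamma> / (20 * (k + 1)))" using \<epsilon>(4) k by (intro mult_left_mono) auto
 also have "... = \<gamma> / 20" using k by (simp add: field_simps)
 finally have k\<epsilon>: "5 * k * \<epsilon> <= \<gamma> / 4" using \<epsilon>(1) by (simp add: algebra_simps)
 have "(%n. 2 * C * (68 * KK T ^ 7 * sqrt (\<delta> n) / \<epsilon>)) \<longlonglongrightarrow> 2 * C * (68 * KK T ^ 7 * sqrt 0 / \<epsilon>)"
  by (intro tendsto_intros \<delta>_limit) (use \<epsilon> in simp)
 then have "EVTL n. 2 * C * (68 * KK T ^ 7 * sqrt (\<delta> n) / \<epsilon>) < \<gamma> / 4"
  by (rule order_tendstoD(2)) (use \<gamma> in simp)
 moreover have "(%n. expect (replicate_pmf (nfl (T * (a n)^2)) (hp n))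
   (%xs. infconv T \<kappa>' h C \<phi> k (%t. iid.ssum (\<zeta> n) (take (nfl (t * (a n)^2)) xs) / a n))) \<longlonglongrightarrow> integral\<^sup>L M (IC T C \<phi> k)"
  unfolding IC_def[abs_def]
  by (rule donsker_walk(1)[OF BM _, where C = C and \<Lambda> = "2 * k"])
   (use T in simp, rule infconv_abs[where \<phi> = \<phi>, OF C k], rule infconv_Lipschitz[where \<phi> = \<phi>, OF C k], assumption, blast)
 then have "EVTL n. integral\<^sup>L M (IC T C \<phi> k) - \<gamma> / 4 < expect (replicate_pmf (nfl (T * (a n)^2)) (hp n))
   (%xs. infconv T \<kappa>' h C \<phi> k (%t. iid.ssum (\<zeta> n) (take (nfl (t * (a n)^2)) xs) / a n))"
  by (rule order_tendstoD(1)) (use \<gamma> in simp)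
 moreover note eventually_estimate[where \<phi> = \<phi>, OF T(1) T' \<epsilon>(1,3) C Lip k]
 ultimately show ?thesis
 proof eventually_elim
  case (elim n)
  interpret H: hcm_estimate "Hs n" n "a n" "KK T" "\<delta> n" T x \<epsilon> C \<Lambda> k "cc n" \<kappa>' "\<beta> T"
   "(ES powr (-2/3) + 1) * (2 * x) + x" "EDS / ES + 1" "ES + 1" "ED3 / ED + 1" "dmax n" "M0 T x" h \<phi> by (rule elim(3))
  have G: "H.G xs = (%t. iid.ssum (\<zeta> n) (take (nfl (t * (a n)^2)) xs) / a n)" for xs
  proof
   fix t
   have "H.\<zeta> = \<zeta> n" by (rule ext) (simp add: H.\<zeta>_def \<zeta>_def mean_def)
   then show "H.G xs t = iid.ssum (\<zeta> n) (take (nfl (t * (a n)^2)) xs) / a n" by (simp add: H.G_def)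
  qed
  have "2 * C * (68 * KK T ^ 7 * sqrt (\<delta> n) / \<epsilon> + T * (ED3 / ED + 1) / (\<beta> T)^2 + 2 * T * (EDS / ES + 1) / \<beta> T + real (M0 T x) * exp (- (T * x / (ES + 1))))
   = 2 * C * (68 * KK T ^ 7 * sqrt (\<delta> n) / \<epsilon>) + 2 * C * bad T x" by (simp add: bad_def algebra_simps)
  then show ?case using H.lower_bound elim(1,2) k\<epsilon> \<gamma> unfolding G slack_def by linarith
 qed
qed

text \<open>The infima increase with the penalty, so this is their limit. For paths with distinct
  minima it is at least the test function of the excursion lengths in \<open>[0, T]\<close>, by
  \<open>XT_ge\<close>.\<close>

definition XT :: "nat => real => ((nat => real) => real) => 'w => real" where
 "XT T C \<phi> \<omega> = (SUP k. IC (real T) C \<phi> (real k) \<omega>)"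

context
 fixes \<phi> :: "(nat => real) => real" and C \<Lambda> :: real
 assumes C: "!!y. \<bar>\<phi> y\<bar> <= C" and Lip: "!!y z. \<bar>\<phi> y - \<phi> z\<bar> <= \<Lambda> * dist y z" and \<Lambda>: "\<Lambda> >= 0"
begin

lemma IC_abs: "\<bar>IC T C \<phi> (real k) \<omega>\<bar> <= C" unfolding IC_def by (rule infconv_abs[where \<phi> = \<phi>, OF C]) simp

lemma IC_bdd: "bdd_above (range (%k. IC T C \<phi> (real k) \<omega>))"
 by (rule bdd_aboveI2[where M = C]) (use IC_abs abs_le_D1 in blast)

lemma IC_le_XT: "IC (real T) C \<phi> (real k) \<omega> <= XT T C \<phi> \<omega>" unfolding XT_def by (rule cSUP_upper[OF _ IC_bdd]) simp

lemma XT_abs: "\<bar>XT T C \<phi> \<omega>\<bar> <= C"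
proof -
 have "XT T C \<phi> \<omega> <= C" unfolding XT_def by (rule cSUP_least) (simp, rule abs_le_D1[OF IC_abs])
 moreover have "- C <= XT T C \<phi> \<omega>" using IC_le_XT[of T 0 \<omega>] IC_abs[of "real T" 0 \<omega>] by linarith
 ultimately show ?thesis by linarith
qed

lemma IC_tendsto: "(%k. IC (real T) C \<phi> (real k) \<omega>) \<longlonglongrightarrow> XT T C \<phi> \<omega>"
 unfolding XT_def
proof (rule LIMSEQ_incseq_SUP[OF IC_bdd])
 show "incseq (%k. IC (real T) C \<phi> (real k) \<omega>)"
  unfolding IC_def by (rule incseq_SucI, rule infconv_mono[OF C]) auto
qed

lemma XT_measurable: "T > 0 ==> XT T C \<phi> \<in> borel_measurable M"
 by (rule borel_measurable_LIMSEQ_real[OF IC_tendsto]) (rule IC_measurable[OF C], auto)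

lemma XT_integral: "T > 0 ==> (%k. integral\<^sup>L M (IC (real T) C \<phi> (real k))) \<longlonglongrightarrow> integral\<^sup>L M (XT T C \<phi>)"
proof (rule integral_dominated_convergence[where w = "%_. C"])
 show "IC (real T) C \<phi> (real k) \<in> borel_measurable M" if "T > 0" for k by (rule IC_measurable[OF C]) (use that in auto)
qed (use XT_measurable IC_tendsto IC_abs in auto)

lemma XT_inequality:
 assumes T: "T >= 1" "2 * \<beta> (real T) + h (real T) + 3 < 0" and x: "x > 0" and \<gamma>: "\<gamma> > 0"
 shows "EVTL n. integral\<^sup>L M (XT T C \<phi>) - 2 * \<Lambda> * slack x - 2 * C * bad (real T) x - \<gamma> <= EY n \<phi>"
proof -
 have "EVTL k. integral\<^sup>L M (XT T C \<phi>) - \<gamma> / 2 < integral\<^sup>L M (IC (real T) C \<phi> (real k))"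
  by (rule order_tendstoD(1)[OF XT_integral]) (use T \<gamma> in auto)
 then obtain k where k: "integral\<^sup>L M (XT T C \<phi>) - \<gamma> / 2 < integral\<^sup>L M (IC (real T) C \<phi> (real k))"
  by (auto simp: eventually_sequentially)
 have "EVTL n. integral\<^sup>L M (IC (real T) C \<phi> (real k)) - 2 * \<Lambda> * slack x - 2 * C * bad (real T) x - \<gamma> / 2 <= EY n \<phi>"
  by (rule main_inequality[where \<phi> = \<phi>, OF _ T(2) x C Lip \<Lambda>]) (use T \<gamma> in auto)
 then show ?thesis by eventually_elim (use k in linarith)
qed

lemma XT_ge:
 assumes \<omega>: "\<omega> \<in> space M" and dm: "distinct_minima (D.f \<omega>)"
 shows "\<phi> (%j. \<kappa>' * rk (excT (real T) (D.f \<omega>)) glen j) <= XT T C \<phi> \<omega>"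
proof (rule field_le_epsilon)
 fix e :: real assume e: "e > 0"
 have f: "D.f \<omega> = (%t. \<sigma> * B \<omega> t + h t)" by (rule ext) (simp add: D.f_def)
 obtain k0 where k0: "!!k. k >= k0 ==> infconv (real T) \<kappa>' h C \<phi> k (%t. \<sigma> * B \<omega> t) >= \<phi> (%j. \<kappa>' * rk (excT (real T) (D.f \<omega>)) glen j) - e"
  using infconv_limit[where \<phi> = \<phi> and g = "%t. \<sigma> * B \<omega> t" and h = h and T = "real T", OF C Lip \<Lambda> \<kappa>'_pos D.f_cont[OF \<omega>, unfolded f] dm[unfolded f] _ e]
  unfolding f by auto
 obtain k :: nat where "real k >= k0" using real_arch_simple by blast
 from k0[OF this] IC_le_XT[of T k \<omega>] show "\<phi> (%j. \<kappa>' * rk (excT (real T) (D.f \<omega>)) glen j) <= XT T C \<phi> \<omega> + e" by (simp add: IC_def)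
qed

end

lemma inverse_limits: "(%T. 1 / real T) \<longlonglongrightarrow> 0" "(%T. 1 / sqrt (real T)) \<longlonglongrightarrow> 0"
proof -
 show 1: "(%T. 1 / real T) \<longlonglongrightarrow> 0" by (rule lim_const_over_n)
 have "(%T. sqrt (1 / real T)) \<longlonglongrightarrow> sqrt 0" by (intro tendsto_real_sqrt 1)
 then show "(%T. 1 / sqrt (real T)) \<longlonglongrightarrow> 0" by (simp add: real_sqrt_divide)
qed

lemma bad_limit:
 assumes x: "x > 0"
 shows "(%T. bad (real T) x) \<longlonglongrightarrow> 0"
proof -
 define c3 c1 A b where "c3 = ED3 / ED + 1" and "c1 = EDS / ES + 1" and "A = 2 * (EDS / ED + 1) / x" and "b = x / (ES + 1)"
 have "ED3 / ED >= 0" "EDS / ES > 0" "EDS / ED > 0" using ED3_nonneg ED_pos ES_pos EDS_pos by auto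
 then have pos: "c3 > 0" "c1 > 0" "A > 0" "b > 0" using ES_pos x by (simp_all add: c3_def c1_def A_def b_def)
 have le: "\<bar>bad (real T) x\<bar> <= (c3 + 2 * (A + 2) / b^2) * (1 / real T) + 2 * c1 * (1 / sqrt (real T))" if T: "T >= 1" for T
 proof -
  have T1: "real T >= 1" using T by simp
  have "real T * c3 / (\<beta> (real T))^2 = c3 / (real T * real T)"
   using T1 by (simp add: \<beta>_def power_mult_distrib power2_eq_square)
  also have "... <= c3 / (real T * 1)" using T1 pos by (intro divide_left_mono mult_left_mono) auto
  finally have 1: "real T * c3 / (\<beta> (real T))^2 <= c3 * (1 / real T)" by simp
  have 2: "2 * real T * c1 / \<beta> (real T) = 2 * c1 * (1 / sqrt (real T))" using T1 by (simp add: \<beta>_def)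
  have "real (M0 (real T) x) <= A * real T + 2"
  proof -
   have "0 <= 2 * (EDS / ED + 1) * real T / x" using EDS_pos ED_pos x by (intro divide_nonneg_pos mult_nonneg_nonneg add_nonneg_nonneg) auto
   then have "real (M0 (real T) x) <= 2 * (EDS / ED + 1) * real T / x + 2" unfolding M0_def by linarith
   then show ?thesis by (simp add: A_def)
  qed
  also have "... <= (A + 2) * real T" using T1 by (simp add: algebra_simps)
  finally have m: "real (M0 (real T) x) <= (A + 2) * real T" .
  \<comment> \<open>\<open>M0\<close> grows linearly in \<open>T\<close>, so a quadratic lower bound
    for the exponential is enough.\<close>
  have "(b * real T)^2 / 2 <= exp (b * real T)"
  proof -
   have "1 + b * real T + (b * real T)^2 / 2 <= exp (b * real T)" by (rule exp_lower_Taylor_quadratic) (use pos in simp)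
   then show ?thesis using pos by (smt (verit) mult_nonneg_nonneg of_nat_0_le_iff)
  qed
  then have "1 / exp (b * real T) <= 1 / ((b * real T)^2 / 2)" using T1 pos by (intro divide_left_mono) auto
  then have "exp (- (b * real T)) <= 2 / (b * real T)^2" by (simp add: exp_minus inverse_eq_divide)
  then have "real (M0 (real T) x) * exp (- (b * real T)) <= ((A + 2) * real T) * (2 / (b * real T)^2)" using m pos by (intro mult_mono) auto
  also have "... = 2 * (A + 2) / b^2 * (1 / real T)" using T1 pos by (simp add: field_simps power2_eq_square)
  finally have 3: "real (M0 (real T) x) * exp (- (real T * x / (ES + 1))) <= 2 * (A + 2) / b^2 * (1 / real T)" by (simp add: b_def mult.commute)
  have "bad (real T) x >= 0" unfolding bad_def c3_def[symmetric] c1_def[symmetric] using pos T1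
   by (intro add_nonneg_nonneg divide_nonneg_nonneg mult_nonneg_nonneg) (auto simp: \<beta>_def)
  moreover have "bad (real T) x <= c3 * (1 / real T) + 2 * c1 * (1 / sqrt (real T)) + 2 * (A + 2) / b^2 * (1 / real T)"
   unfolding bad_def c3_def[symmetric] c1_def[symmetric] using 1 2 3 by linarith
  ultimately show ?thesis unfolding distrib_right by linarith
 qed
 have "(%T. (c3 + 2 * (A + 2) / b^2) * (1 / real T) + 2 * c1 * (1 / sqrt (real T))) \<longlonglongrightarrow> (c3 + 2 * (A + 2) / b^2) * 0 + 2 * c1 * 0"
  by (intro tendsto_intros inverse_limits)
 then have z: "(%T. (c3 + 2 * (A + 2) / b^2) * (1 / real T) + 2 * c1 * (1 / sqrt (real T))) \<longlonglongrightarrow> 0" by simp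
 show ?thesis
 proof (rule Lim_null_comparison[OF _ z])
  show "EVTL T. norm (bad (real T) x) <= (c3 + 2 * (A + 2) / b^2) * (1 / real T) + 2 * c1 * (1 / sqrt (real T))"
   using eventually_ge_at_top[of 1] by eventually_elim (use le in simp)
 qed
qed

text \<open>The parabola \<open>- \<theta> * T^2\<close> outweighs both \<open>T * sqrt T\<close>
  and \<open>lam * T\<close>.\<close>

lemma eventually_T: "EVTL T. T >= 1 & 2 * \<beta> (real T) + h (real T) + 3 < 0"
proof -
 have "(%T. 2 * (1 / sqrt (real T)) + lam * (1 / real T) + 3 * ((1 / real T) * (1 / real T))) \<longlonglongrightarrow> 2 * 0 + lam * 0 + 3 * (0 * 0)"
  by (intro tendsto_intros inverse_limits)
 then have "EVTL T. 2 * (1 / sqrt (real T)) + lam * (1 / real T) + 3 * ((1 / real T) * (1 / real T)) < \<theta>"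
  using \<theta>_pos by (intro order_tendstoD(2)) auto
 then show ?thesis using eventually_ge_at_top[of 1]
 proof eventually_elim
  case (elim T)
  have T1: "real T >= 1" using elim by simp
  have sq: "sqrt (real T) * sqrt (real T) = real T" "sqrt (real T) > 0" using T1 by auto
  have "(2 * (1 / sqrt (real T)) + lam * (1 / real T) + 3 * ((1 / real T) * (1 / real T))) * (real T)^2 < \<theta> * (real T)^2"
   using elim T1 by (intro mult_strict_right_mono) auto
  moreover have "1 / sqrt (real T) * (real T)^2 = real T * sqrt (real T)"
  proof -
   have "(real T)^2 = (real T * sqrt (real T)) * sqrt (real T)" using sq(1) by (simp add: power2_eq_square mult.assoc)
   then show ?thesis using sq(2) by simp
  qed
  then have "(2 * (1 / sqrt (real T)) + lam * (1 / real T) + 3 * ((1 / real T) * (1 / real T))) * (real T)^2 = 2 * \<beta> (real T) + lam * real T + 3"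
   using T1 by (simp add: \<beta>_def distrib_right power2_eq_square)
  ultimately have "2 * \<beta> (real T) + lam * real T + 3 < \<theta> * (real T)^2" by linarith
  then show ?case using elim(2) by (simp add: h_def)
 qed
qed

lemma slack_limit:
 assumes "\<gamma> > 0" "c >= 0"
 shows "\<exists>x>0. c * slack x <= \<gamma>"
proof -
 define c0 where "c0 = (ES powr (-2/3) + 1) * 2 + 1"
 have c0: "c0 > 0" unfolding c0_def by (rule add_nonneg_pos) (auto intro: add_nonneg_nonneg)
 have s: "slack x = c0 * x" for x by (simp add: slack_def c0_def algebra_simps)
 have "c * slack (\<gamma> / (c * c0 + 1)) = (c * c0 / (c * c0 + 1)) * \<gamma>" by (simp add: s)
 also have "... <= 1 * \<gamma>" using assms c0 by (intro mult_right_mono) (auto simp: divide_le_eq_1 add_nonneg_pos)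
 finally have "c * slack (\<gamma> / (c * c0 + 1)) <= \<gamma>" by simp
 moreover have "\<gamma> / (c * c0 + 1) > 0" using assms c0 by (intro divide_pos_pos add_nonneg_pos mult_nonneg_nonneg) auto
 ultimately show ?thesis by blast
qed

end

lemma dist_fun_coordinate:
 fixes y z :: "nat => real"
 shows "min \<bar>y j - z j\<bar> 1 <= 2 ^ to_nat j * dist y z"
proof -
 let ?F = "%n. (1/2) ^ n * min (dist (y (from_nat n)) (z (from_nat n))) (1::real)"
 have "summable ?F" by (rule summable_comparison_test'[of "%n. (1/2::real) ^ n"]) (auto simp: summable_geometric_iff mult_left_le)
 then have "sum ?F {to_nat j} <= suminf ?F" by (rule sum_le_suminf) auto
 then have "(1/2) ^ to_nat j * min \<bar>y j - z j\<bar> 1 <= dist y z" by (simp add: dist_fun_def dist_real_def)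
 then have "2 ^ to_nat j * ((1/2) ^ to_nat j * min \<bar>y j - z j\<bar> 1) <= 2 ^ to_nat j * dist y z" by (rule mult_left_mono) simp
 then show ?thesis by (simp add: power_one_over)
qed

lemma tendsto_fun_coordinates:
 fixes y :: "nat => nat => real"
 assumes "!!j. (%T. y T j) \<longlonglongrightarrow> z j"
 shows "y \<longlonglongrightarrow> z"
proof (rule tendstoI)
 fix e :: real assume "e > 0"
 then obtain J :: nat and r where r: "r > 0" and J: "!!y z :: nat => real. (!!j. j <= J ==> \<bar>y j - z j\<bar> <= r) ==> dist y z <= e / 2"
  using dist_fun_finite_coordinates[of "e/2"] by (metis half_gt_zero)
 have "EVTL T. ALL j:{..J}. dist (y T j) (z j) < r"
  by (rule eventually_ball_finite) (use tendstoD[OF assms r] in auto)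
 then show "EVTL T. dist (y T) z < e"
 proof eventually_elim
  case (elim T)
  have "dist (y T) z <= e / 2" by (rule J) (use elim in "force simp: dist_real_def")
  then show ?case using \<open>e > 0\<close> by linarith
 qed
qed

text \<open>\<open>\<psi> k\<close> is the infimal convolution of \<open>\<phi>\<close> with
  \<open>k\<close> times the distance, the largest minorant with Lipschitz constant
  \<open>k\<close>. Approximation from below is what lower bounds can use.\<close>

lemma Lipschitz_regularisation:
 fixes \<phi> :: "'b::metric_space => real"
 assumes C: "!!y. \<bar>\<phi> y\<bar> <= C" and cont: "continuous_on UNIV \<phi>"
 obtains \<psi> :: "nat => 'b => real" where "!!k y. \<bar>\<psi> k y\<bar> <= C" "!!k y. \<psi> k y <= \<phi> y"
  "!!k y z. \<bar>\<psi> k y - \<psi> k z\<bar> <= real k * dist y z" "!!y. (%k. \<psi> k y) \<longlonglongrightarrow> \<phi> y"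
proof -
 define \<psi> where "\<psi> k y = (INF z. \<phi> z + real k * dist y z)" for k y
 have C': "- C <= \<phi> z" "\<phi> z <= C" for z using C[of z] by (auto simp: abs_le_iff)
 have lb: "- C <= \<phi> z + real k * dist y z" for k y z using C'(1)[of z] by (simp add: add_increasing2)
 have bdd: "bdd_below (range (%z. \<phi> z + real k * dist y z))" for k y using lb by (rule bdd_belowI2)
 have low: "- C <= \<psi> k y" for k y unfolding \<psi>_def by (rule cINF_greatest) (auto intro: lb)
 have up: "\<psi> k y <= \<phi> z + real k * dist y z" for k y z unfolding \<psi>_def by (rule cINF_lower[OF bdd]) simp
 have le: "\<psi> k y <= \<phi> y" for k y using up[of k y y] by simp
 have L: "\<psi> k y - real k * dist y z <= \<psi> k z" for k y z
  unfolding \<psi>_def[of k z]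
 proof (rule cINF_greatest)
  fix w
  have "real k * dist y w <= real k * (dist y z + dist z w)" by (intro mult_left_mono dist_triangle) auto
  then show "\<psi> k y - real k * dist y z <= \<phi> w + real k * dist z w" using up[of k y w] by (simp add: algebra_simps)
 qed simp
 have lim: "(%k. \<psi> k y) \<longlonglongrightarrow> \<phi> y" for y
 proof (rule LIMSEQ_I)
  fix e :: real assume e: "e > 0"
  obtain r where r: "r > 0" "!!z. dist z y < r ==> dist (\<phi> z) (\<phi> y) < e / 2"
   using cont e unfolding continuous_on_iff by (metis UNIV_I half_gt_zero)
  obtain k0 :: nat where k0: "2 * C / r <= real k0" using real_arch_simple by blast
  have "norm (\<psi> k y - \<phi> y) < e" if k: "k >= k0" for k
  proof -
   have "\<phi> y - e / 2 <= \<psi> k y"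
    unfolding \<psi>_def
   proof (rule cINF_greatest)
    fix z
    show "\<phi> y - e / 2 <= \<phi> z + real k * dist y z"
    proof (cases "dist y z < r")
     case True
     then have "dist (\<phi> z) (\<phi> y) < e / 2" by (intro r(2)) (simp add: dist_commute)
     moreover have "0 <= real k * dist y z" by simp
     ultimately show ?thesis unfolding dist_real_def by linarith
    next
     case False
     have "2 * C <= real k0 * r" using k0 r(1) by (simp add: pos_divide_le_eq)
     also have "... <= real k * dist y z" using False k r(1) by (intro mult_mono) auto
     finally show ?thesis using C'(1)[of z] C'(2)[of y] e by linarith
    qed
   qed simp
   then show ?thesis using le[of k y] e by simp
  qed
  then show "EX no. ALL k>=no. norm (\<psi> k y - \<phi> y) < e" by blast
 qed
 show ?thesis
 proof (rule that[of \<psi>])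
  show "\<bar>\<psi> k y\<bar> <= C" for k y using low[of k y] le[of k y] C'(2)[of y] by linarith
  show "\<bar>\<psi> k y - \<psi> k z\<bar> <= real k * dist y z" for k y z using L[of k y z] L[of k z y] by (simp add: dist_commute)
 qed (rule le lim)+
qed

context critical_bm
begin

abbreviation unbounded :: "'w => bool" where
 "unbounded \<omega> \<equiv> ~ (EX b. ALL e:excursions (reflected (D.f \<omega>)). glen e <= b)"

text \<open>The test function \<open>\<phi>\<close> detects a largest length beyond
  \<open>R\<close>. The lower bound for \<open>- \<phi>\<close> in the window \<open>T0\<close>
  shows that \<open>\<phi>\<close> has small mean for large \<open>n\<close>. The lower bounds for
  \<open>\<phi>\<close> in longer windows carry this to the limit path, uniformly in the window,
  whereas excursions of unbounded length would make \<open>\<phi>\<close> equal to 1 in all long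
  windows.\<close>

lemma unbounded_rare:
 assumes \<gamma>: "\<gamma> > 0"
 shows "EX A:sets M. D.prob A <= 6 * \<gamma> & (ALL \<omega>:space M. distinct_minima (D.f \<omega>) & unbounded \<omega> --> \<omega> \<in> A)"
proof -
 define \<Lambda> :: real where "\<Lambda> = 2 ^ to_nat (0::nat)"
 have \<Lambda>: "\<Lambda> >= 0" by (simp add: \<Lambda>_def)
 obtain x where x: "x > 0" "2 * \<Lambda> * slack x <= \<gamma>" using slack_limit[OF \<gamma>, of "2 * \<Lambda>"] \<Lambda> by auto
 have "(%T. 2 * 1 * bad (real T) x) \<longlonglongrightarrow> 2 * 1 * 0" by (intro tendsto_intros bad_limit x(1))
 then have "EVTL T. 2 * 1 * bad (real T) x < \<gamma>" by (rule order_tendstoD(2)) (use \<gamma> in simp)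
 then have "EVTL T. 2 * 1 * bad (real T) x < \<gamma> & T >= 1 & 2 * \<beta> (real T) + h (real T) + 3 < 0"
  using eventually_T by (rule eventually_conj)
 then obtain T0 where T0: "!!T. T >= T0 ==> 2 * 1 * bad (real T) x < \<gamma> & T >= 1 & 2 * \<beta> (real T) + h (real T) + 3 < 0"
  unfolding eventually_sequentially by blast
 define R where "R = \<kappa>' * real T0"
 define \<phi> :: "(nat => real) => real" where "\<phi> y = min 1 (max 0 (y 0 - R))" for y
 have C: "\<bar>\<phi> y\<bar> <= 1" "\<bar>- \<phi> y\<bar> <= 1" and \<phi>0: "\<phi> y >= 0" for y by (auto simp: \<phi>_def)
 have Lip: "\<bar>\<phi> y - \<phi> z\<bar> <= \<Lambda> * dist y z" for y z
 proof -
  have "\<bar>\<phi> y - \<phi> z\<bar> <= min \<bar>y 0 - z 0\<bar> 1" by (auto simp: \<phi>_def min_def max_def)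
  also have "... <= \<Lambda> * dist y z" using dist_fun_coordinate[of y 0 z] by (simp add: \<Lambda>_def)
  finally show ?thesis .
 qed
 have Lip': "\<bar>- \<phi> y - - \<phi> z\<bar> <= \<Lambda> * dist y z" for y z using Lip[of z y] by (simp add: dist_commute)
 have up: "EVTL n. EY n \<phi> <= 3 * \<gamma>"
 proof -
  \<comment> \<open>No gap is longer than the window, so \<open>\<phi>\<close> vanishes on gap
    lengths, and already the penalty 0 gives a nonnegative infimum.\<close>
  have "IC (real T0) 1 (%y. - \<phi> y) 0 \<omega> >= 0" for \<omega>
   unfolding IC_def infconv_def
  proof (rule cInf_greatest)
   fix v assume "v \<in> insert 1 {- \<phi> (%j. \<kappa>' * rk (gaps Z) glen j) + 0 * \<epsilon> |\<epsilon> Z. edec (real T0) \<epsilon> (%t. \<sigma> * B \<omega> t + h t) Z}"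
   moreover have "\<phi> (%j. \<kappa>' * rk (gaps Z) glen j) = 0" if "edec (real T0) \<epsilon> (%t. \<sigma> * B \<omega> t + h t) Z" for \<epsilon> Z
   proof -
    have "rk (gaps Z) glen 0 <= real T0" by (rule rk_upper[OF gaps_glen[OF that]]) auto
    then have "\<kappa>' * rk (gaps Z) glen 0 <= R" unfolding R_def using \<kappa>'_pos by (intro mult_left_mono) auto
    then show ?thesis by (simp add: \<phi>_def)
   qed
   ultimately show "0 <= v" by auto
  qed simp
  then have I0: "0 <= integral\<^sup>L M (IC (real T0) 1 (%y. - \<phi> y) 0)" by (intro Bochner_Integration.integral_nonneg)
  have "EVTL n. integral\<^sup>L M (IC (real T0) 1 (%y. - \<phi> y) 0) - 2 * \<Lambda> * slack x - 2 * 1 * bad (real T0) x - \<gamma> <= EY n (%y. - \<phi> y)"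
   by (rule main_inequality[OF _ _ x(1) C(2) Lip' \<Lambda> _ \<gamma>]) (use T0[of T0] in auto)
  then show ?thesis
  proof eventually_elim
   case (elim n)
   have "EY n (%y. - \<phi> y) = - EY n \<phi>" by simp
   then show ?case using elim I0 x(2) T0[of T0] by linarith
  qed
 qed
 define X where "X T = XT (Suc (T0 + T)) 1 \<phi>" for T
 have Xm: "X T \<in> borel_measurable M" for T unfolding X_def by (rule XT_measurable[OF C(1) Lip \<Lambda>]) simp
 have X1: "\<bar>X T \<omega>\<bar> <= 1" for T \<omega> unfolding X_def by (rule XT_abs[OF C(1) Lip \<Lambda>])
 have X0: "0 <= X T \<omega>" for T \<omega>
 proof -
  have "0 <= IC (real (Suc (T0 + T))) 1 \<phi> (real 0) \<omega>"
   unfolding IC_def infconv_def by (rule cInf_greatest) (use \<phi>0 in auto)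
  also have "... <= X T \<omega>" unfolding X_def by (rule IC_le_XT[OF C(1) Lip \<Lambda>])
  finally show ?thesis .
 qed
 have Xint: "integral\<^sup>L M (X T) <= 6 * \<gamma>" for T
 proof -
  have T: "2 * 1 * bad (real (Suc (T0 + T))) x < \<gamma>" "Suc (T0 + T) >= 1" "2 * \<beta> (real (Suc (T0 + T))) + h (real (Suc (T0 + T))) + 3 < 0"
   using T0[of "Suc (T0 + T)"] by auto
  have "EVTL n. integral\<^sup>L M (X T) - 2 * \<Lambda> * slack x - 2 * 1 * bad (real (Suc (T0 + T))) x - \<gamma> <= EY n \<phi>"
   unfolding X_def by (rule XT_inequality[OF C(1) Lip \<Lambda> T(2,3) x(1) \<gamma>])
  then have "EVTL n. integral\<^sup>L M (X T) <= 6 * \<gamma>" using up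
   by eventually_elim (use T(1) x(2) in linarith)
  then show ?thesis by simp
 qed
 \<comment> \<open>The event asks for all windows from \<open>m\<close> on, which makes it increase
   with \<open>m\<close>; its measure is bounded by that for the single window
   \<open>m\<close>.\<close>
 define Am where "Am m = (\<Inter>T\<in>{m..}. {\<omega> \<in> space M. X T \<omega> >= 1})" for m :: nat
 have Ams: "Am m \<in> sets M" for m unfolding Am_def by (rule sets.countable_INT') (use Xm in auto)
 have Amp: "D.prob (Am m) <= 6 * \<gamma>" for m
 proof -
  have "D.prob (Am m) <= D.prob {\<omega> \<in> space M. X m \<omega> >= 1}" unfolding Am_def using Xm by (intro D.finite_measure_mono) auto
  also have "... <= integral\<^sup>L M (X m) / 1"
  proof (rule integral_Markov_inequality_measure[where A = "{}"])
   show "integrable M (X m)" by (rule D.integrable_const_bound[where B = 1]) (use X1 Xm in auto)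
  qed (use X0 in auto)
  finally show ?thesis using Xint[of m] by simp
 qed
 define A where "A = (\<Union>m. Am m)"
 have As: "A \<in> sets M" unfolding A_def using Ams by auto
 have "incseq Am" unfolding Am_def by (intro incseq_SucI) auto
 then have "(%m. D.prob (Am m)) \<longlonglongrightarrow> D.prob A" unfolding A_def using Ams by (intro D.finite_Lim_measure_incseq) auto
 then have Ap: "D.prob A <= 6 * \<gamma>" by (rule LIMSEQ_le_const2) (use Amp in auto)
 have "\<omega> \<in> A" if \<omega>: "\<omega> \<in> space M" and dm: "distinct_minima (D.f \<omega>)" and ub: "unbounded \<omega>" for \<omega>
 proof -
  obtain e where e: "e \<in> excursions (reflected (D.f \<omega>))" "glen e > (R + 1) / \<kappa>'" using ub by (metis not_le)
  obtain m :: nat where m: "snd e <= real m" using real_arch_simple by blast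
  have "X T \<omega> >= 1" if T: "T >= m" for T
  proof -
   let ?T = "real (Suc (T0 + T))"
   have eT: "e \<in> excT ?T (D.f \<omega>)" using e(1) m T by (auto simp: excT_def)
   have R0: "(R + 1) / \<kappa>' >= 0" using \<kappa>'_pos by (simp add: R_def)
   have "rk (excT ?T (D.f \<omega>)) glen 0 > (R + 1) / \<kappa>'"
    by (rule rk_gtI[of "{e}", OF _ _ _ _ R0 excT_glen]) (use eT e(2) in auto)
   then have "\<kappa>' * rk (excT ?T (D.f \<omega>)) glen 0 > R + 1" using \<kappa>'_pos by (simp add: pos_divide_less_eq mult.commute)
   then have "\<phi> (%j. \<kappa>' * rk (excT ?T (D.f \<omega>)) glen j) = 1" by (simp add: \<phi>_def)
   then show ?thesis using XT_ge[OF C(1) Lip \<Lambda> \<omega> dm, of "Suc (T0 + T)"] by (simp add: X_def)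
  qed
  then show ?thesis using \<omega> unfolding A_def Am_def by blast
 qed
 then show ?thesis using As Ap by blast
qed

text \<open>Boundedness makes the suprema in \<open>rk\<close> genuine, so that the lengths in
  \<open>[0, T]\<close> converge to those on the half line.\<close>

lemma excursions_bounded_AE: "AE \<omega> in M. EX b. ALL e:excursions (reflected (D.f \<omega>)). glen e <= b"
proof -
 have "EX A:sets M. D.prob A <= 6 * (1 / real (Suc i)) & (ALL \<omega>:space M. distinct_minima (D.f \<omega>) & unbounded \<omega> --> \<omega> \<in> A)" for i
  by (rule unbounded_rare) simp
 then obtain A where A: "!!i. A i \<in> sets M" "!!i. D.prob (A i) <= 6 * (1 / real (Suc i))"
  "!!i \<omega>. \<omega> \<in> space M ==> distinct_minima (D.f \<omega>) ==> unbounded \<omega> ==> \<omega> \<in> A i" by metis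
 have N: "(\<Inter>i. A i) \<in> sets M" using A(1) by auto
 have "D.prob (\<Inter>i. A i) <= 6 * (1 / real (Suc i))" for i
 proof -
  have "D.prob (\<Inter>i. A i) <= D.prob (A i)" using A(1) by (intro D.finite_measure_mono) auto
  then show ?thesis using A(2)[of i] by linarith
 qed
 moreover have "(%i. 6 * (1 / real (Suc i))) \<longlonglongrightarrow> 6 * 0"
  using LIMSEQ_inverse_real_of_nat by (intro tendsto_intros) (simp add: inverse_eq_divide)
 ultimately have "D.prob (\<Inter>i. A i) <= 6 * 0" by (intro LIMSEQ_le_const[of "%i. 6 * (1 / real (Suc i))"]) auto
 then have "D.prob (\<Inter>i. A i) = 0" using measure_nonneg[of M "\<Inter>i. A i"] by linarith
 then have "(\<Inter>i. A i) \<in> null_sets M" using N by (simp add: null_sets_def D.emeasure_eq_measure)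
 then have "AE \<omega> in M. \<omega> \<notin> (\<Inter>i. A i)" by (rule AE_not_in)
 then show ?thesis using D.distinct_minima_AE AE_space
 proof eventually_elim
  case (elim \<omega>)
  then show ?case using A(3)[of \<omega>] by blast
 qed
qed

lemma Y_measurable: "Y \<in> borel_measurable M"
proof -
 have "continuous_on UNIV (%y :: nat => real. %j. \<kappa>' * y j)"
  by (rule continuous_on_coordinatewise_then_product) (intro continuous_intros continuous_on_product_coordinates)
 then have "(%y :: nat => real. %j. \<kappa>' * y j) \<in> borel_measurable borel" by (rule borel_measurable_continuous_onI)
 from measurable_compose[OF D.excursion_lengths_measurable this] show ?thesis by (simp add: Y_def[abs_def])
qed

lemma Lipschitz_lower_bound:
 assumes C: "!!y. \<bar>\<phi> y\<bar> <= C" and Lip: "!!y z. \<bar>\<phi> y - \<phi> z\<bar> <= \<Lambda> * dist y z" and \<Lambda>: "\<Lambda> >= 0" and \<gamma>: "\<gamma> > 0"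
 shows "EVTL n. integral\<^sup>L M (%\<omega>. \<phi> (Y \<omega>)) - \<gamma> <= EY n \<phi>"
proof -
 have cont: "continuous_on UNIV \<phi>"
  unfolding continuous_on_iff
 proof (intro ballI allI impI)
  fix y :: "nat => real" and e :: real assume e: "e > 0"
  have "dist (\<phi> z) (\<phi> y) < e" if "dist z y < e / (\<Lambda> + 1)" for z
  proof -
   have "\<Lambda> * dist z y <= (\<Lambda> + 1) * dist z y" by (intro mult_right_mono) auto
   also have "... < (\<Lambda> + 1) * (e / (\<Lambda> + 1))" using that \<Lambda> by (intro mult_strict_left_mono) auto
   also have "... = e" using \<Lambda> by simp
   finally show ?thesis using Lip[of z y] by (simp add: dist_real_def)
  qed
  then show "\<exists>d>0. ALL z:UNIV. dist z y < d --> dist (\<phi> z) (\<phi> y) < e" using e \<Lambda> by (intro exI[of _ "e / (\<Lambda> + 1)"]) auto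
 qed
 have m\<phi>: "(%\<omega>. \<phi> (Y \<omega>)) \<in> borel_measurable M"
  by (rule measurable_compose[OF Y_measurable borel_measurable_continuous_onI[OF cont]])
 have mX: "XT (Suc T) C \<phi> \<in> borel_measurable M" for T by (rule XT_measurable[OF C Lip \<Lambda>]) simp
 \<comment> \<open>\<open>XT\<close> is controlled only from below, so it is cut off at the target.
   The cut-off converges almost surely by squeezing, and its integral is at most that of
   \<open>XT\<close>.\<close>
 define V where "V T \<omega> = min (XT (Suc T) C \<phi> \<omega>) (\<phi> (Y \<omega>))" for T \<omega>
 have lim: "AE \<omega> in M. (%T. V T \<omega>) \<longlonglongrightarrow> \<phi> (Y \<omega>)"
  using excursions_bounded_AE D.distinct_minima_AE AE_space
 proof eventually_elim
  case (elim \<omega>)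
  obtain b where b: "!!e. e \<in> excursions (reflected (D.f \<omega>)) ==> glen e <= b" using elim(1) by blast
  define y where "y T = (%j. \<kappa>' * rk (excT (real T) (D.f \<omega>)) glen j)" for T
  have "(%T. y T j) \<longlonglongrightarrow> Y \<omega> j" for j
   unfolding y_def Y_def by (intro tendsto_intros rk_excT_tendsto[OF b])
  then have "y \<longlonglongrightarrow> Y \<omega>" by (rule tendsto_fun_coordinates)
  then have "(%T. \<phi> (y T)) \<longlonglongrightarrow> \<phi> (Y \<omega>)"
   using cont by (intro isCont_tendsto_compose[of _ \<phi>]) (auto simp: continuous_on_eq_continuous_at)
  then have "(%T. \<phi> (y (Suc T))) \<longlonglongrightarrow> \<phi> (Y \<omega>)" by (rule LIMSEQ_Suc)
  then have "(%T. min (\<phi> (y (Suc T))) (\<phi> (Y \<omega>))) \<longlonglongrightarrow> min (\<phi> (Y \<omega>)) (\<phi> (Y \<omega>))" by (intro tendsto_min tendsto_const)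
  then have l: "(%T. min (\<phi> (y (Suc T))) (\<phi> (Y \<omega>))) \<longlonglongrightarrow> \<phi> (Y \<omega>)" by simp
  have "\<phi> (y (Suc T)) <= XT (Suc T) C \<phi> \<omega>" for T
   unfolding y_def by (rule XT_ge[OF C Lip \<Lambda> elim(3,2)])
  then have lo: "min (\<phi> (y (Suc T))) (\<phi> (Y \<omega>)) <= V T \<omega>" for T unfolding V_def by (rule min.mono) simp
  show ?case
   by (rule tendsto_sandwich[OF _ _ l tendsto_const]) (use lo in "auto simp: V_def")
 qed
 have Vb: "\<bar>V T \<omega>\<bar> <= C" for T \<omega> using XT_abs[OF C Lip \<Lambda>, of "Suc T" \<omega>] C[of "Y \<omega>"] unfolding V_def by (auto simp: min_def)
 have Vm: "V T \<in> borel_measurable M" for T unfolding V_def[abs_def] using mX m\<phi> by (intro borel_measurable_min)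
 have "(%T. integral\<^sup>L M (V T)) \<longlonglongrightarrow> integral\<^sup>L M (%\<omega>. \<phi> (Y \<omega>))"
  by (rule integral_dominated_convergence[where w = "%_. C"]) (use Vm m\<phi> lim Vb in auto)
 then have e1: "EVTL T. integral\<^sup>L M (%\<omega>. \<phi> (Y \<omega>)) - \<gamma> / 4 < integral\<^sup>L M (V T)"
  by (rule order_tendstoD(1)) (use \<gamma> in simp)
 obtain x where x: "x > 0" "2 * \<Lambda> * slack x <= \<gamma> / 4" using slack_limit[of "\<gamma>/4" "2 * \<Lambda>"] \<Lambda> \<gamma> by auto
 have "(%T. 2 * C * bad (real (Suc T)) x) \<longlonglongrightarrow> 2 * C * 0" by (intro tendsto_intros LIMSEQ_Suc[OF bad_limit] x(1))
 then have e2: "EVTL T. 2 * C * bad (real (Suc T)) x < \<gamma> / 4" by (rule order_tendstoD(2)) (use \<gamma> in simp)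
 have e3: "EVTL T. Suc T >= 1 & 2 * \<beta> (real (Suc T)) + h (real (Suc T)) + 3 < 0"
  using eventually_T by (subst eventually_sequentially_Suc)
 obtain T where T: "integral\<^sup>L M (%\<omega>. \<phi> (Y \<omega>)) - \<gamma> / 4 < integral\<^sup>L M (V T)" "2 * C * bad (real (Suc T)) x < \<gamma> / 4"
  "Suc T >= 1" "2 * \<beta> (real (Suc T)) + h (real (Suc T)) + 3 < 0"
  using eventually_happens[OF eventually_conj[OF e1 eventually_conj[OF e2 e3]]] by auto
 have "integral\<^sup>L M (V T) <= integral\<^sup>L M (XT (Suc T) C \<phi>)"
 proof (rule integral_mono)
  show "integrable M (V T)" by (rule D.integrable_const_bound[where B = C]) (use Vb Vm in auto)
  show "integrable M (XT (Suc T) C \<phi>)" by (rule D.integrable_const_bound[where B = C]) (use XT_abs[OF C Lip \<Lambda>] mX in auto)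
 qed (simp add: V_def)
 moreover have "EVTL n. integral\<^sup>L M (XT (Suc T) C \<phi>) - 2 * \<Lambda> * slack x - 2 * C * bad (real (Suc T)) x - \<gamma> / 4 <= EY n \<phi>"
  by (rule XT_inequality[OF C Lip \<Lambda> T(3,4) x(1)]) (use \<gamma> in simp)
 ultimately show ?thesis using T(1,2) x(2) by (auto elim!: eventually_mono)
qed

lemma lower_semicontinuity:
 assumes C: "!!y. \<bar>\<phi> y\<bar> <= C" and cont: "continuous_on UNIV \<phi>" and \<gamma>: "\<gamma> > 0"
 shows "EVTL n. integral\<^sup>L M (%\<omega>. \<phi> (Y \<omega>)) - \<gamma> <= EY n \<phi>"
proof -
 let ?I = "integral\<^sup>L M (%\<omega>. \<phi> (Y \<omega>))"
 obtain \<psi> where \<psi>: "!!k y. \<bar>\<psi> k y\<bar> <= C" "!!k y. \<psi> k y <= \<phi> y" "!!k y z. \<bar>\<psi> k y - \<psi> k z\<bar> <= real k * dist y z" "!!y. (%k. \<psi> k y) \<longlonglongrightarrow> \<phi> y"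
  using Lipschitz_regularisation[OF C cont] by metis
 let ?J = "%k. integral\<^sup>L M (%\<omega>. \<psi> k (Y \<omega>))"
 have m: "(%\<omega>. \<phi> (Y \<omega>)) \<in> borel_measurable M" by (rule measurable_compose[OF Y_measurable borel_measurable_continuous_onI[OF cont]])
 have "continuous_on UNIV (\<psi> k)" for k
 proof (rule lipschitz_on_continuous_on)
  show "(real k)-lipschitz_on UNIV (\<psi> k)" by (rule lipschitz_onI) (use \<psi>(3) in "auto simp: dist_real_def")
 qed
 then have mk: "(%\<omega>. \<psi> k (Y \<omega>)) \<in> borel_measurable M" for k by (rule measurable_compose[OF Y_measurable borel_measurable_continuous_onI])
 have "?J \<longlonglongrightarrow> ?I"
  by (rule integral_dominated_convergence[where w = "%_. C"]) (use m mk \<psi> in auto)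
 then have "EVTL k. ?I - \<gamma> / 2 < ?J k" by (rule order_tendstoD(1)) (use \<gamma> in simp)
 then obtain k where k: "?I - \<gamma> / 2 < ?J k" by (auto simp: eventually_sequentially)
 have "EVTL n. ?J k - \<gamma> / 2 <= EY n (\<psi> k)"
  by (rule Lipschitz_lower_bound[OF \<psi>(1,3)]) (use \<gamma> in auto)
 then show ?thesis
 proof eventually_elim
  case (elim n)
  have "integrable (measure_pmf p) F" if "!!y. \<bar>F y\<bar> <= C" for p :: "(nat \<times> nat \<times> nat => nat \<times> nat \<times> nat) pmf" and F
   by (rule measure_pmf.integrable_const_bound[where B = C]) (use that in auto)
  then have "EY n (\<psi> k) <= EY n \<phi>" by (intro integral_mono) (use C \<psi> in auto)
  then show ?case using elim k by linarith
 qed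
qed

theorem convergence:
 assumes cont: "continuous_on UNIV \<phi>" and bdd: "bounded (range \<phi>)"
 shows "(%n. EY n \<phi>) \<longlonglongrightarrow> integral\<^sup>L M (%\<omega>. \<phi> (Y \<omega>))"
proof -
 obtain C where C: "!!y. \<bar>\<phi> y\<bar> <= C" using bdd unfolding bounded_iff by auto
 show ?thesis
 proof (rule LIMSEQ_I)
  fix \<gamma> :: real assume \<gamma>: "\<gamma> > 0"
  have "EVTL n. integral\<^sup>L M (%\<omega>. \<phi> (Y \<omega>)) - \<gamma> / 2 <= EY n \<phi>"
   by (rule lower_semicontinuity[OF C cont]) (use \<gamma> in simp)
  moreover have "EVTL n. integral\<^sup>L M (%\<omega>. - \<phi> (Y \<omega>)) - \<gamma> / 2 <= EY n (%y. - \<phi> y)"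
   by (rule lower_semicontinuity[where C = C]) (use \<gamma> C cont in "auto intro: continuous_intros")
  ultimately have "EVTL n. norm (EY n \<phi> - integral\<^sup>L M (%\<omega>. \<phi> (Y \<omega>))) < \<gamma>"
  proof eventually_elim
   case (elim n)
   have "EY n (%y. - \<phi> y) = - EY n \<phi>" "integral\<^sup>L M (%\<omega>. - \<phi> (Y \<omega>)) = - integral\<^sup>L M (%\<omega>. \<phi> (Y \<omega>))" by simp_all
   then show ?case using elim \<gamma> unfolding real_norm_def by linarith
  qed
  then show "EX no. ALL n>=no. norm (EY n \<phi> - integral\<^sup>L M (%\<omega>. \<phi> (Y \<omega>))) < \<gamma>" by (simp add: eventually_sequentially)
 qed
qed

end

theorem theorem1p1:
  fixes lam :: real
    and Hs :: "nat \<Rightarrow> nat \<Rightarrow> community"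
    and P :: "community pmf"
    and M :: "'a measure"
    and B :: "'a \<Rightarrow> real \<Rightarrow> real"
  defines "ES \<equiv> measure_pmf.expectation P (\<lambda>H. real (csize H))"
    and "ED \<equiv> measure_pmf.expectation P (\<lambda>H. real (cdegree H))"
    and "EDS \<equiv> measure_pmf.expectation P (\<lambda>H. real (cdegree H) * real (csize H))"
    and "ED2 \<equiv> measure_pmf.expectation P (\<lambda>H. real (cdegree H) ^ 2)"
    and "ED3 \<equiv> measure_pmf.expectation P (\<lambda>H. real (cdegree H) ^ 3)"
  assumes valid_seq: "\<And>n i. i < n \<Longrightarrow> valid_community (Hs n i)"
    and valid_P: "\<And>H. H \<in> set_pmf P \<Longrightarrow> valid_community H"
    and even_l: "\<And>n. even (total_halfedges (Hs n) n)"
    \<comment> \<open>Community regularity condition\<close>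
    and CR1: "\<And>H. (\<lambda>n. emp_frac (Hs n) n H) \<longlonglongrightarrow> pmf P H"
    and CR2_int: "integrable (measure_pmf P) (\<lambda>H. real (csize H))"
    and CR2: "(\<lambda>n. emp_mean (Hs n) n (\<lambda>H. real (csize H))) \<longlonglongrightarrow> ES"
    and CR3_int: "integrable (measure_pmf P) (\<lambda>H. real (cdegree H) * real (csize H))"
    and CR3: "(\<lambda>n. emp_mean (Hs n) n (\<lambda>H. real (cdegree H) * real (csize H))) \<longlonglongrightarrow> EDS"
    and CR4: "(\<lambda>n. real (max_size (Hs n) n) * ln (real n) / real n powr (2/3)) \<longlonglongrightarrow> 0"
    \<comment> \<open>Inter-community connectivity condition\<close>
    and IC1_int: "integrable (measure_pmf P) (\<lambda>H. real (cdegree H) ^ 3)"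
    and IC1: "(\<lambda>n. emp_mean (Hs n) n (\<lambda>H. real (cdegree H) ^ 3)) \<longlonglongrightarrow> ED3"
    and IC2a: "measure_pmf.prob P {H. cdegree H = 0} < 1"
    and IC2b: "0 < measure_pmf.prob P {H. cdegree H = 1}"
    and IC2c: "measure_pmf.prob P {H. cdegree H = 1} < 1"
    and IC3: "(\<lambda>n. (emp_mean (Hs n) n (\<lambda>H. real (cdegree H) * (real (cdegree H) - 1))
                      / emp_mean (Hs n) n (\<lambda>H. real (cdegree H))
                    - 1 - lam * real n powr (-1/3)) * real n powr (1/3)) \<longlonglongrightarrow> 0"
    \<comment> \<open>a standard Brownian motion\<close>
    and BM: "std_brownian_motion M B"
  shows "conv_in_dist_pmf
           (\<lambda>n. hcm_pairing_pmf (Hs n) n)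
           (\<lambda>n m j. real (total_vertices (Hs n) n) powr (-2/3) * ordered_comp_sizes (Hs n) n m j)
           M
           (\<lambda>\<omega> j. ES powr (-2/3) * (EDS / ED) *
              ordered_excursion_lengths
                (reflected (bm_parabolic ED lam (ED3 * ED - ED2\<^sup>2) (B \<omega>))) j)"
proof -
 interpret X: critical_bm lam Hs P M B
  by unfold_locales (use valid_seq valid_P even_l CR1 CR2_int CR2 CR3_int CR3 CR4 IC1_int IC1 IC2b IC3 BM in "simp_all add: ES_def EDS_def ED3_def")
 have constants: "ES = X.ES" "ED = X.ED" "EDS = X.EDS" "ED2 = X.ED2" "ED3 = X.ED3"
  by (simp_all add: ES_def ED_def EDS_def ED2_def ED3_def X.ES_def X.ED_def X.EDS_def X.ED2_def X.ED3_def)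
 have f: "bm_parabolic ED lam (ED3 * ED - ED2^2) (B \<omega>) = X.D.f \<omega>" for \<omega>
  unfolding X.D.f_def[abs_def] by (rule ext) (simp add: bm_parabolic_def X.\<sigma>_def X.h_def X.\<theta>_def X.\<eta>_def constants)
 have Y: "(%\<omega> j. ES powr (-2/3) * (EDS / ED) * ordered_excursion_lengths (reflected (bm_parabolic ED lam (ED3 * ED - ED2^2) (B \<omega>))) j) = X.Y"
  unfolding f by (intro ext) (simp add: X.Y_def X.\<kappa>'_def constants ordered_excursion_lengths_def rk_def glen_def)
 show ?thesis
  unfolding conv_in_dist_pmf_def Y
  using X.Y_measurable X.convergence by (simp add: X.cc_def)
qed

end
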